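(* Let $A=\mathbb{C}\{t,q,q^{-1},p\}$, regarded as a Poisson algebra over $\mathbb{C}\{t\}$, and let $I=(p_1,\dots,p_n)\subset A$. Let $H\in A$ be an analytic function of the $p$-variables of the form $$H=\sum_{i=1}^n \omega_i p_i+\sum_{i,j=1}^n a_{ij}p_ip_j+\dots$$ where the dots denote terms of order at least $3$ in $p$ and $(a_{ij})$ is a symmetric matrix. Assume that (D) the vector $\omega=(\omega_1,\dots,\omega_n)$ satisfies Kolmogorov's Diophantine condition; (K) the matrix $(a_{ij})$ is invertible. Then for any $R\in A$ there exists a Poisson automorphism $\varphi$ of $A$ (over $\mathbb{C}\{t\}$) such that $$\varphi(H+tR)-H\in t\,I^2\oplus \mathbb{C}\{t\}.$$ In particular, $H+tR$ admits an invariant ideal isomorphic to $I$, i.e. there is an ideal $J\subset A$ which is the image of $I$ under a Poisson automorphism of $A$ and satisfies $\{H+tR,J\}\subset J$.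
   Context: $\mathbb{C}\{t,q,q^{-1},p\}$, with $q=(q_1,\dots,q_n)$, $p=(p_1,\dots,p_n)$, denotes the algebra of germs of holomorphic functions in $(q,p,t)\in(\mathbb{C}^* )^n\times\mathbb{C}^n\times\mathbb{C}$ along the real torus $\{|q_1|=\dots=|q_n|=1,\ p=0,\ t=0\}$; equivalently, functions holomorphic on some set $\{1-s<|q_i|<1+s,\ |p_i|<s,\ |t|<s\}$ with $s>0$. The Poisson bracket is the $\mathbb{C}\{t\}$-bilinear one (so $t$ is central) determined by $\{p_i,q_j\}=\delta_{ij}q_j$, $\{q_i,q_j\}=\{p_i,p_j\}=0$; thus $\{\sum_i\omega_ip_i,\,q^Mp^J\}=(\omega,M)q^Mp^J$ for $M\in\mathbb{Z}^n$, $J\in\mathbb{N}^n$, where $(\omega,M)=\sum_i\omega_iM_i$. A Poisson automorphism of $A$ over $\mathbb{C}\{t\}$ is a $\mathbb{C}\{t\}$-algebra automorphism preserving the bracket. Kolmogorov's Diophantine condition on $\omega\in\mathbb{C}^n$: there exist constants $C>0$ and $k\geq 0$ such that $|(\omega,M)|\ge C/|M|^k$ for all $M\in\mathbb{Z}^n\setminus\{0\}$, where $|M|=\sum_i|M_i|$. *)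

theory Defs
  imports "HOL-Complex_Analysis.Complex_Analysis"
begin

text \<open>A point $(q, p, t)$ of $\mathbb{C}^n \times \mathbb{C}^n \times \mathbb{C}$, where $n$ is the
  cardinality of the index type.\<close>

type_synonym 'n phase = "(complex ^ 'n) \<times> (complex ^ 'n) \<times> complex"

definition cscale :: "complex \<Rightarrow> 'n phase \<Rightarrow> 'n::finite phase" where
  "cscale c = (\<lambda>(q, p, t). (c *s q, c *s p, c * t))"

text \<open>Holomorphy in several variables: Frechet differentiability with a complex-linear derivative
  (used on open sets only).\<close>

definition holo_on :: "('n::finite phase \<Rightarrow> complex) \<Rightarrow> 'n phase set \<Rightarrow> bool" where
  "holo_on f S \<longleftrightarrow> (\<forall>x\<in>S. \<exists>D. (f has_derivative D) (at x) \<and> (\<forall>c v. D (cscale c v) = c * D v))"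

abbreviation fder :: "('n::finite phase \<Rightarrow> complex) \<Rightarrow> 'n phase \<Rightarrow> 'n phase \<Rightarrow> complex" where
  "fder f v x \<equiv> frechet_derivative f (at x) v"

lemma norm_cscale: "norm (cscale c v) = cmod c * norm v"
proof -
  have 1: "norm (c *s q) = cmod c * norm q" for q :: "complex ^ 'n"
    by (simp add: norm_vec_def L2_set_right_distrib norm_mult)
  obtain q p t where v: "v = (q, p, t)" by (cases v)
  show ?thesis
    by (simp add: v cscale_def norm_Pair 1 norm_mult power_mult_distrib
        flip: distrib_left) (simp add: real_sqrt_mult)
qed

lemma cscale_bl: "bounded_linear (\<lambda>z. cscale z v)"
proof (rule bounded_linear_intro[where K = "norm v"])
  show "cscale (x + y) v = cscale x v + cscale y v" for x y
    by (auto simp: cscale_def split: prod.splits) (auto simp: vec_eq_iff algebra_simps)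
  show "cscale (r *\<^sub>R x) v = r *\<^sub>R cscale x v" for r x
    by (auto simp: cscale_def vec_eq_iff split: prod.splits)
qed (simp add: norm_cscale)

lemma cscale_0[simp]: "cscale 0 v = 0" and cscale_1[simp]: "cscale 1 v = v"
  by (auto simp: cscale_def zero_prod_def vec_eq_iff split: prod.splits)

lemma holo_onD:
  assumes "holo_on f S" "x \<in> S"
  shows "(f has_derivative (\<lambda>v. fder f v x)) (at x)" "fder f (cscale c v) x = c * fder f v x"
proof -
  obtain D where D: "(f has_derivative D) (at x)" "\<And>c v. D (cscale c v) = c * D v"
    using assms unfolding holo_on_def by blast
  have "frechet_derivative f (at x) = D"
    using frechet_derivative_at[OF D(1)] by simp
  with D show "(f has_derivative (\<lambda>v. fder f v x)) (at x)" "fder f (cscale c v) x = c * fder f v x"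
    by auto
qed

lemma holo_on_line:
  assumes "holo_on f S" "x + cscale z v \<in> S"
  shows "((\<lambda>z. f (x + cscale z v)) has_field_derivative fder f v (x + cscale z v)) (at z)"
proof -
  have "((\<lambda>z. x + cscale z v) has_derivative (\<lambda>z. 0 + cscale z v)) (at z)"
    by (intro has_derivative_add has_derivative_const bounded_linear_imp_has_derivative cscale_bl)
  from diff_chain_at[OF this holo_onD(1)[OF assms]] holo_onD(2)[OF assms]
  show ?thesis
    by (simp add: has_field_derivative_def o_def mult.commute[of _ "fder f v (x + cscale z v)"])
qed

lemma holo_on_line_holomorphic:
  assumes "holo_on f S" "ball x r \<subseteq> S" "norm v * s \<le> r" "0 < r"
  shows "(\<lambda>z. f (x + cscale z v)) holomorphic_on ball 0 s" (is ?A)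
    and "cmod z < s \<Longrightarrow> x + cscale z v \<in> ball x r"
proof -
  have *: "x + cscale z v \<in> ball x r" if "cmod z < s" for z
  proof (cases "v = 0")
    case False
    then have "cmod z * norm v < s * norm v" using that by simp
    then show ?thesis using assms(3) by (simp add: dist_norm norm_cscale mult.commute)
  qed (use assms norm_cscale[of z v] in \<open>simp\<close>)
  then show "cmod z < s \<Longrightarrow> x + cscale z v \<in> ball x r" by blast
  show ?A
    unfolding holomorphic_on_open[OF open_ball]
  proof
    fix z assume "z \<in> ball (0::complex) s"
    then have "x + cscale z v \<in> S" using * assms(2) by auto
    from holo_on_line[OF assms(1) this]
    show "\<exists>f'. ((\<lambda>z. f (x + cscale z v)) has_field_derivative f') (at z)" by blast
  qed
qed

lemma fder_bound:
  assumes f: "holo_on f S" and S: "ball x r \<subseteq> S" and r: "0 < r"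
    and B: "\<And>y. y \<in> ball x r \<Longrightarrow> cmod (f y) \<le> B"
  shows "cmod (fder f v x) \<le> 2 * B / r * norm v"
proof (cases "v = 0")
  case True
  have "x \<in> S" using S r by auto
  have "fder f v x = 0" 
    using holo_onD(2)[OF f \<open>x \<in> S\<close>, of 0 v] True by simp
  then show ?thesis using True by simp
next
  case False
  define s where "s = r / norm v"
  have s: "0 < s" "norm v * s \<le> r" using r False by (auto simp: s_def)
  let ?g = "\<lambda>z. f (x + cscale z v)"
  note H = holo_on_line_holomorphic[OF f S s(2) r]
  have h: "?g holomorphic_on ball 0 s" by (rule H)
  have "cmod ((deriv ^^ 1) ?g 0) \<le> fact 1 * B / (s/2) ^ 1"
  proof (rule Cauchy_inequality)
    show "?g holomorphic_on ball 0 (s/2)" by (rule holomorphic_on_subset[OF h]) (use s in auto)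
    show "continuous_on (cball 0 (s/2)) ?g"
      by (rule continuous_on_subset[OF holomorphic_on_imp_continuous_on[OF h]]) (use s in auto)
    show "0 < s/2" using s by simp
    fix z assume "cmod (0 - z) = s/2"
    then have "cmod z < s" using s unfolding diff_0 norm_minus_cancel by simp
    then show "cmod (f (x + cscale z v)) \<le> B" using B H(2) by blast
  qed
  moreover have "deriv ?g 0 = fder f v x"
  proof -
    have "x \<in> S" using S r by auto
    then show ?thesis using DERIV_imp_deriv[OF holo_on_line[OF f, of x 0 v]] by simp
  qed
  ultimately show ?thesis using False r by (simp add: s_def field_simps)
qed

lemma fder_quotient:
  assumes f: "holo_on f S" and S: "ball x r \<subseteq> S" and r: "0 < r" and v: "norm v \<le> 1"
    and B: "\<And>y. y \<in> ball x r \<Longrightarrow> cmod (f y) \<le> B"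
    and h: "h \<noteq> 0" "cmod h < r / 2"
  shows "cmod ((f (x + cscale h v) - f x) / h - fder f v x) \<le> 32 * B / r\<^sup>2 * cmod h"
proof -
  let ?g = "\<lambda>z. f (x + cscale z v)"
  have rr: "norm v * r \<le> r" using v r by (simp add: mult_left_le_one_le)
  note H = holo_on_line_holomorphic[OF f S rr r]
  have hol: "?g holomorphic_on ball 0 r" by (rule H)
  have bd: "cmod ((deriv ^^ 2) ?g z) \<le> 32 * B / r\<^sup>2" if z: "z \<in> ball 0 (r/2)" for z
  proof -
    have sub: "cball z (r/4) \<subseteq> ball 0 r"
    proof
      fix w assume "w \<in> cball z (r/4)"
      with z have "dist z w \<le> r/4" "dist 0 z < r/2" by auto
      with dist_triangle[of 0 w z] r show "w \<in> ball 0 r" by auto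
    qed
    have "cmod ((deriv ^^ 2) ?g z) \<le> fact 2 * B / (r/4) ^ 2"
    proof (rule Cauchy_inequality)
      show "?g holomorphic_on ball z (r/4)" by (rule holomorphic_on_subset[OF hol]) (use sub ball_subset_cball in blast)
      show "continuous_on (cball z (r/4)) ?g"
        by (rule continuous_on_subset[OF holomorphic_on_imp_continuous_on[OF hol] sub])
      show "0 < r/4" using r by simp
      fix w assume "cmod (z - w) = r/4"
      then have "w \<in> cball z (r/4)" by (simp add: dist_norm)
      then have "cmod w < r" using sub by auto
      then show "cmod (f (x + cscale w v)) \<le> B" using B H(2) by blast
    qed
    then show ?thesis by (simp add: field_simps)
  qed
  have "cmod ((deriv ^^ 0) ?g h - (\<Sum>i\<le>1. (deriv ^^ i) ?g 0 * (h - 0) ^ i / fact i))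
      \<le> 32 * B / r\<^sup>2 * cmod (h - 0) ^ Suc 1 / fact 1"
  proof (rule complex_Taylor)
    show "convex (ball (0::complex) (r/2))" by simp
    show "((deriv ^^ i) ?g has_field_derivative (deriv ^^ Suc i) ?g x) (at x within ball 0 (r/2))"
      if "x \<in> ball 0 (r/2)" for i x
    proof -
      have "(deriv ^^ i) ?g holomorphic_on ball 0 r"
        by (rule holomorphic_higher_deriv[OF hol]) simp
      then have "((deriv ^^ i) ?g has_field_derivative (deriv ^^ Suc i) ?g x) (at x)"
        using holomorphic_derivI[of "(deriv ^^ i) ?g" "ball 0 r" x UNIV] that r by simp
      then show ?thesis using has_field_derivative_at_within by blast
    qed
    show "cmod ((deriv ^^ Suc 1) ?g z) \<le> 32 * B / r\<^sup>2" if "z \<in> ball 0 (r/2)" for z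
      using bd[OF that] by (simp add: numeral_2_eq_2)
  qed (use r h in auto)
  moreover have "deriv ?g 0 = fder f v x"
  proof -
    have "x \<in> S" using S r by auto
    then show ?thesis using DERIV_imp_deriv[OF holo_on_line[OF f, of x 0 v]] by simp
  qed
  ultimately have *: "cmod (f (x + cscale h v) - (f x + fder f v x * h)) \<le> 32 * B / r\<^sup>2 * (cmod h)\<^sup>2"
    by (simp add: power2_eq_square)
  have "(f (x + cscale h v) - f x) / h - fder f v x = (f (x + cscale h v) - (f x + fder f v x * h)) / h"
    using h by (simp add: field_simps)
  also have "cmod \<dots> \<le> 32 * B / r\<^sup>2 * (cmod h)\<^sup>2 / cmod h"
    unfolding norm_divide by (rule divide_right_mono[OF *]) simp
  finally show ?thesis using h by (simp add: power2_eq_square)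
qed

lemma holo_on_add: "holo_on f S \<Longrightarrow> holo_on g S \<Longrightarrow> holo_on (\<lambda>x. f x + g x) S"
  and holo_on_diff: "holo_on f S \<Longrightarrow> holo_on g S \<Longrightarrow> holo_on (\<lambda>x. f x - g x) S"
  and holo_on_minus: "holo_on f S \<Longrightarrow> holo_on (\<lambda>x. - f x) S"
  and holo_on_mult: "holo_on f S \<Longrightarrow> holo_on g S \<Longrightarrow> holo_on (\<lambda>x. f x * g x) S"
  unfolding holo_on_def
  by (intro ballI, drule (1) bspec, drule (1) bspec, elim exE conjE, intro exI conjI,
      rule has_derivative_add has_derivative_mult has_derivative_diff, assumption, assumption, simp add: algebra_simps)
     (intro ballI, drule (1) bspec, drule (1) bspec, elim exE conjE, intro exI conjI,
      rule has_derivative_add has_derivative_mult has_derivative_diff, assumption, assumption, simp add: algebra_simps,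
      intro ballI, drule (1) bspec, elim exE conjE, intro exI conjI,
      rule has_derivative_minus, assumption, simp add: algebra_simps,
      intro ballI, drule (1) bspec, drule (1) bspec, elim exE conjE, intro exI conjI,
      rule has_derivative_mult, assumption, assumption, simp add: algebra_simps)

lemma holo_on_const: "holo_on (\<lambda>_. c) S"
  unfolding holo_on_def by (auto intro!: exI[of _ "\<lambda>_. 0"])

lemma holo_on_subset: "holo_on f S \<Longrightarrow> T \<subseteq> S \<Longrightarrow> holo_on f T"
  unfolding holo_on_def by blast

lemma holo_on_sum: "(\<And>i. i \<in> I \<Longrightarrow> holo_on (f i) S) \<Longrightarrow> holo_on (\<lambda>x. \<Sum>i\<in>I. f i x) S"
  by (induction I rule: infinite_finite_induct) (auto intro: holo_on_const holo_on_add)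

lemma holo_on_linear:
  assumes "bounded_linear L" "\<And>c v. L (cscale c v) = c * L v"
  shows "holo_on L S"
  unfolding holo_on_def using assms bounded_linear_imp_has_derivative by blast

lemma holo_on_cong:
  assumes "open S" "\<And>x. x \<in> S \<Longrightarrow> f x = g x" "holo_on f S"
  shows "holo_on g S"
  unfolding holo_on_def
proof
  fix x assume x: "x \<in> S"
  then obtain D where D: "(f has_derivative D) (at x)" "\<forall>c v. D (cscale c v) = c * D v"
    using assms(3) unfolding holo_on_def by blast
  have "(g has_derivative D) (at x)"
    by (rule has_derivative_transform_within_open[OF D(1) assms(1) x]) (use assms(2) in auto)
  with D(2) show "\<exists>D. (g has_derivative D) (at x) \<and> (\<forall>c v. D (cscale c v) = c * D v)" by blast
qed

lemma fder_cong:
  assumes "open S" "\<And>x. x \<in> S \<Longrightarrow> f x = g x" "x \<in> S"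
  shows "fder f v x = fder g v x"
proof -
  have "(f has_derivative D) (at x) \<longleftrightarrow> (g has_derivative D) (at x)" for D
    using has_derivative_transform_within_open[of f D x UNIV S g]
      has_derivative_transform_within_open[of g D x UNIV S f] assms by auto
  then show ?thesis unfolding frechet_derivative_def by simp
qed

lemma holo_on_shift:
  assumes "holo_on f S" "\<And>x. x \<in> T \<Longrightarrow> x + a \<in> S"
  shows "holo_on (\<lambda>x. f (x + a)) T"
  unfolding holo_on_def
proof
  fix x assume "x \<in> T"
  then have x: "x + a \<in> S" using assms by blast
  have "((\<lambda>x. x + a) has_derivative (\<lambda>h. h)) (at x)"
    by (auto intro!: derivative_eq_intros)
  from diff_chain_at[OF this holo_onD(1)[OF assms(1) x]] holo_onD(2)[OF assms(1) x]
  show "\<exists>D. ((\<lambda>x. f (x + a)) has_derivative D) (at x) \<and> (\<forall>c v. D (cscale c v) = c * D v)"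
    by (auto simp: o_def)
qed

text \<open>Directional derivatives of holomorphic functions are holomorphic, as locally uniform limits of
  difference quotients. This makes the Poisson bracket below an operation on germs.\<close>

lemma holo_on_fder:
  assumes f: "holo_on f S" and S: "open S" and v: "norm v \<le> 1"
  shows "holo_on (fder f v) S"
  unfolding holo_on_def
proof
  fix x0 assume x0: "x0 \<in> S"
  obtain r0 where r0: "0 < r0" "cball x0 r0 \<subseteq> S"
    using S x0 open_contains_cball by blast
  define r where "r = r0 / 2"
  have r: "0 < r" "cball x0 (2 * r) \<subseteq> S" using r0 by (auto simp: r_def)
  have "continuous_on (cball x0 (2 * r)) f"
  proof (intro continuous_at_imp_continuous_on ballI)
    fix y assume "y \<in> cball x0 (2 * r)"
    with r(2) have "y \<in> S" by blast
    from has_derivative_continuous[OF holo_onD(1)[OF f this]] show "isCont f y" .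
  qed
  then have "bounded (f ` cball x0 (2 * r))"
    by (intro compact_imp_bounded compact_continuous_image) simp_all
  then obtain B where B: "\<And>y. y \<in> cball x0 (2 * r) \<Longrightarrow> cmod (f y) \<le> B"
    unfolding bounded_iff by blast
  have sub: "ball x r \<subseteq> cball x0 (2 * r)" if "x \<in> ball x0 r" for x
  proof
    fix y assume "y \<in> ball x r"
    with that dist_triangle[of x0 y x] show "y \<in> cball x0 (2 * r)" by auto
  qed
  define h :: "nat \<Rightarrow> complex" where "h n = of_real (r / 4 / real (Suc n))" for n
  have hn: "cmod (h n) = r / 4 / real (Suc n)" for n
    using r by (simp add: h_def del: of_nat_Suc of_real_divide)
  have hpos: "h n \<noteq> 0" for n
    using hn[of n] r by auto
  have hlt: "cmod (h n) < r / 2" for n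
  proof -
    have "r / 4 / real (Suc n) \<le> r / 4 / 1"
      by (rule divide_left_mono) (use r in auto)
    then show ?thesis using r hn[of n] by simp
  qed
  define K where "K = 32 * B / r\<^sup>2"
  define g where "g n x = (f (x + cscale (h n) v) - f x) * inverse (h n)" for n x
  have hlim: "(\<lambda>n. cmod (h n)) \<longlonglongrightarrow> 0"
    unfolding hn by (rule real_tendsto_divide_at_top[OF tendsto_const]) (rule filterlim_compose[OF filterlim_real_sequentially filterlim_Suc])
  have gest: "cmod (g n x - fder f v x) \<le> K * cmod (h n)" if "x \<in> ball x0 r" for n x
  proof -
    have "ball x r \<subseteq> S" "\<And>y. y \<in> ball x r \<Longrightarrow> cmod (f y) \<le> B"
      using sub[OF that] r(2) B by blast+
    from fder_quotient[OF f this(1) r(1) v this(2) hpos hlt]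
    show ?thesis unfolding g_def K_def by (simp only: divide_inverse)
  qed
  have ghol: "holo_on (g n) (ball x0 r)" for n
    unfolding g_def
  proof (intro holo_on_mult holo_on_diff holo_on_const holo_on_shift[OF f] holo_on_subset[OF f])
    fix x assume x: "x \<in> ball x0 r"
    have "cmod (h n) * norm v \<le> cmod (h n) * 1"
      by (rule mult_left_mono[OF v]) simp
    then have "norm (cscale (h n) v) < r" using hlt[of n] r by (simp add: norm_cscale)
    then have "x + cscale (h n) v \<in> ball x r" by (simp add: dist_norm)
    then show "x + cscale (h n) v \<in> S" using sub[OF x] r(2) by blast
  qed (use r in auto)
  have K0: "0 \<le> K * cmod (h n)" for n
    using gest[of x0 n] r(1) norm_ge_zero order_trans by (metis centre_in_ball)
  have cauchy: "cmod (fder (g m) w y - fder (g n) w y) \<le> 4 * (K * cmod (h m) + K * cmod (h n)) / r * norm w"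
    if y: "y \<in> ball x0 (r/2)" for m n w y
  proof -
    have sub2: "ball y (r/2) \<subseteq> ball x0 r"
    proof
      fix z assume "z \<in> ball y (r/2)"
      with y dist_triangle[of x0 z y] show "z \<in> ball x0 r" by auto
    qed
    have yr: "y \<in> ball x0 r" using y r(1) by auto
    have "cmod (fder (\<lambda>x. g m x - g n x) w y) \<le> 2 * (K * cmod (h m) + K * cmod (h n)) / (r/2) * norm w"
    proof (rule fder_bound[OF holo_on_diff[OF ghol ghol] sub2])
      fix z assume "z \<in> ball y (r/2)"
      then have z: "z \<in> ball x0 r" using sub2 by blast
      show "cmod (g m z - g n z) \<le> K * cmod (h m) + K * cmod (h n)"
        using norm_triangle_ineq4[of "g m z - fder f v z" "g n z - fder f v z"] gest[OF z, of m] gest[OF z, of n]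
        by simp
    qed (use r in auto)
    moreover have "fder (\<lambda>x. g m x - g n x) w y = fder (g m) w y - fder (g n) w y"
      using fun_cong[OF frechet_derivative_at[OF has_derivative_diff[OF holo_onD(1)[OF ghol[of m] yr] holo_onD(1)[OF ghol[of n] yr]]], of w]
      by (rule sym)
    ultimately show ?thesis by simp
  qed
  have cauchy': "cmod (fder (g m) w y - fder (g n) w y)
      \<le> 4 * K * norm w / r * cmod (h m) + 4 * K * norm w / r * cmod (h n)"
    if "y \<in> ball x0 (r/2)" for m n w y
    using cauchy[OF that, of m w n] by (simp add: algebra_simps add_divide_distrib)
  have lim0: "(\<lambda>n. c * cmod (h n)) \<longlonglongrightarrow> 0" for c :: real
    using tendsto_mult_left[OF hlim, of c] by simp
  define D where "D y w = lim (\<lambda>n. fder (g n) w y)" for y w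
  have Dlim: "(\<lambda>n. fder (g n) w y) \<longlonglongrightarrow> D y w" if y: "y \<in> ball x0 (r/2)" for w y
  proof -
    have "Cauchy (\<lambda>n. fder (g n) w y)"
    proof (rule metric_CauchyI)
      fix e :: real assume e: "0 < e"
      have "eventually (\<lambda>n. 4 * K * norm w / r * cmod (h n) < e / 2) sequentially"
        by (rule order_tendstoD(2)[OF lim0]) (use e in simp)
      then obtain N where N: "\<And>n. N \<le> n \<Longrightarrow> 4 * K * norm w / r * cmod (h n) < e / 2"
        by (auto simp: eventually_sequentially)
      show "\<exists>N. \<forall>m\<ge>N. \<forall>n\<ge>N. dist (fder (g m) w y) (fder (g n) w y) < e"
      proof (intro exI[of _ N] allI impI)
        fix m n assume "N \<le> m" "N \<le> n"
        from N[OF this(1)] N[OF this(2)] cauchy'[OF y, of m w n]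
        show "dist (fder (g m) w y) (fder (g n) w y) < e"
          unfolding dist_norm by linarith
      qed
    qed
    then show ?thesis unfolding D_def
      by (simp add: Cauchy_convergent_iff convergent_LIMSEQ_iff)
  qed
  have Dest: "cmod (fder (g n) w y - D y w) \<le> 4 * K / r * cmod (h n) * norm w" if y: "y \<in> ball x0 (r/2)" for n w y
  proof (rule LIMSEQ_le)
    show "(\<lambda>m. cmod (fder (g n) w y - fder (g m) w y)) \<longlonglongrightarrow> cmod (fder (g n) w y - D y w)"
      by (intro tendsto_intros Dlim y)
    show "(\<lambda>m. 4 * K / r * cmod (h n) * norm w + 4 * K * norm w / r * cmod (h m)) \<longlonglongrightarrow> 4 * K / r * cmod (h n) * norm w"
      using tendsto_add[OF tendsto_const lim0[of "4 * K * norm w / r"]] unfolding add_0_right .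
    show "\<exists>N. \<forall>m\<ge>N. cmod (fder (g n) w y - fder (g m) w y) \<le> 4 * K / r * cmod (h n) * norm w + 4 * K * norm w / r * cmod (h m)"
      using cauchy'[OF y, of n w] by (simp add: mult_ac)
  qed
  have "\<exists>G. \<forall>x\<in>ball x0 (r/2). (\<lambda>n. g n x) \<longlonglongrightarrow> G x \<and> (G has_derivative D x) (at x within ball x0 (r/2))"
  proof (rule has_derivative_sequence)
    show "(g n has_derivative (\<lambda>w. fder (g n) w x)) (at x within ball x0 (r/2))" if "x \<in> ball x0 (r/2)" for n x
      using holo_onD(1)[OF ghol, of x n] that r by (auto intro: has_derivative_at_withinI)
    show "\<forall>\<^sub>F n in sequentially. \<forall>x\<in>ball x0 (r/2). \<forall>w. cmod (fder (g n) w x - D x w) \<le> e * norm w"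
      if e: "0 < e" for e
    proof -
      have "eventually (\<lambda>n. 4 * K / r * cmod (h n) < e) sequentially"
        by (rule order_tendstoD(2)[OF lim0]) (use e in simp)
      then show ?thesis
      proof eventually_elim
        case (elim n)
        show ?case
        proof (intro ballI allI)
          fix y w assume "y \<in> ball x0 (r/2)"
          from order_trans[OF Dest[OF this, of n w] mult_right_mono[OF less_imp_le[OF elim] norm_ge_zero[of w]]]
          show "cmod (fder (g n) w y - D y w) \<le> e * norm w" .
        qed
      qed
    qed
    have "(\<lambda>n. g n x0 - fder f v x0) \<longlonglongrightarrow> 0"
      by (rule Lim_null_comparison[OF _ lim0[of K]]) (use gest[of x0] r in auto)
    then show "(\<lambda>n. g n x0) \<longlonglongrightarrow> fder f v x0" by (simp add: LIM_zero_iff)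
  qed (use r in auto)
  then obtain G where G: "\<And>x. x \<in> ball x0 (r/2) \<Longrightarrow> (\<lambda>n. g n x) \<longlonglongrightarrow> G x"
    "\<And>x. x \<in> ball x0 (r/2) \<Longrightarrow> (G has_derivative D x) (at x within ball x0 (r/2))" by blast
  have GG: "G x = fder f v x" if x: "x \<in> ball x0 (r/2)" for x
  proof -
    have "(\<lambda>n. g n x - fder f v x) \<longlonglongrightarrow> 0"
      by (rule Lim_null_comparison[OF _ lim0[of K]]) (use gest[of x] x r in auto)
    then show ?thesis using LIMSEQ_unique[OF G(1)[OF x]] by (simp add: LIM_zero_iff)
  qed
  have x0b: "x0 \<in> ball x0 (r/2)" using r by simp
  have "(G has_derivative D x0) (at x0)"
    using G(2)[OF x0b] at_within_open[OF x0b] by simp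
  then have "(fder f v has_derivative D x0) (at x0)"
    by (rule has_derivative_transform_within_open[of _ _ _ _ "ball x0 (r/2)"]) (use r GG in auto)
  moreover have "D x0 (cscale c w) = c * D x0 w" for c w
  proof -
    have "(\<lambda>n. c * fder (g n) w x0) \<longlonglongrightarrow> c * D x0 w"
      by (intro tendsto_intros Dlim x0b)
    moreover have "fder (g n) (cscale c w) x0 = c * fder (g n) w x0" for n
      using holo_onD(2)[OF ghol] r by simp
    ultimately show ?thesis using LIMSEQ_unique[OF Dlim[OF x0b]] by simp
  qed
  ultimately show "\<exists>D. (fder f v has_derivative D) (at x0) \<and> (\<forall>c w. D (cscale c w) = c * D w)" by blast
qed

no_notation fps_nth (infixl "$" 75)

subsection \<open>Germs along the real torus\<close>

text \<open>A basis of neighbourhoods, as \<open>s\<close> tends to $0$, of the torus $|q_i| = 1$, $p = 0$, $t = 0$; for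
  $s \le 1$ they lie in $(\mathbb{C}^*)^n \times \mathbb{C}^n \times \mathbb{C}$.\<close>

definition toric_nhd :: "real \<Rightarrow> 'n::finite phase set" where
  "toric_nhd s = {(q, p, t). (\<forall>i. 1 - s < cmod (q $ i) \<and> cmod (q $ i) < 1 + s) \<and>
     (\<forall>i. cmod (p $ i) < s) \<and> cmod t < s}"

definition germ_eq :: "('n::finite phase \<Rightarrow> complex) \<Rightarrow> ('n phase \<Rightarrow> complex) \<Rightarrow> bool" where
  "germ_eq f g \<longleftrightarrow> (\<exists>s>0. holo_on f (toric_nhd s) \<and> holo_on g (toric_nhd s) \<and>
     (\<forall>x\<in>toric_nhd s. f x = g x))"

lemma open_toric_nhd: "open (toric_nhd s)"
proof -
  have "toric_nhd s = {x. (\<forall>i. 1 - s < cmod (fst x $ i) \<and> cmod (fst x $ i) < 1 + s) \<and>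
     (\<forall>i. cmod (fst (snd x) $ i) < s) \<and> cmod (snd (snd x)) < s}"
    by (auto simp: toric_nhd_def)
  also have "open \<dots>"
    unfolding Collect_conj_eq Collect_all_eq
    by (intro open_Int open_INT finite ballI open_Collect_less continuous_intros)
  finally show ?thesis .
qed

lemma toric_nhd_mono: "s \<le> s' \<Longrightarrow> toric_nhd s \<subseteq> toric_nhd s'"
  unfolding toric_nhd_def
proof (clarify, intro conjI allI)
  fix q p :: "complex ^ 'a" and t i
  assume "s \<le> s'" "\<forall>i. 1 - s < cmod (q $ i) \<and> cmod (q $ i) < 1 + s"
    "\<forall>i. cmod (p $ i) < s" "cmod t < s"
  then have "1 - s < cmod (q $ i)" "cmod (q $ i) < 1 + s" "cmod (p $ i) < s" "cmod t < s" "s \<le> s'"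
    by auto
  then show "1 - s' < cmod (q $ i)" "cmod (q $ i) < 1 + s'" "cmod (p $ i) < s'" "cmod t < s'"
    by linarith+
qed

lemma toric_nhd_base: "0 < s \<Longrightarrow> (1, 0, 0) \<in> toric_nhd s"
  by (simp add: toric_nhd_def)

lemma germ_eq_lift1:
  assumes "germ_eq f g"
    and "\<And>f S. open S \<Longrightarrow> holo_on f S \<Longrightarrow> holo_on (F f) S"
    and "\<And>f g S x. open S \<Longrightarrow> (\<And>x. x \<in> S \<Longrightarrow> f x = g x) \<Longrightarrow> x \<in> S \<Longrightarrow> F f x = F g x"
  shows "germ_eq (F f) (F g)"
proof -
  obtain s where s: "0 < s" "holo_on f (toric_nhd s)" "holo_on g (toric_nhd s)"
    "\<And>x. x \<in> toric_nhd s \<Longrightarrow> f x = g x"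
    using assms(1) unfolding germ_eq_def by blast
  show ?thesis unfolding germ_eq_def
    by (intro exI[of _ s] conjI ballI s assms(2)[OF open_toric_nhd] assms(3)[OF open_toric_nhd s(4)])
qed

lemma germ_eq_lift2:
  fixes f f' g g' :: "'n::finite phase \<Rightarrow> complex"
  assumes "germ_eq f g" "germ_eq f' g'"
    and "\<And>f f' S. open S \<Longrightarrow> holo_on f S \<Longrightarrow> holo_on f' S \<Longrightarrow> holo_on (F f f') S"
    and "\<And>f g f' g' S x. open S \<Longrightarrow> (\<And>x. x \<in> S \<Longrightarrow> f x = g x) \<Longrightarrow>
      (\<And>x. x \<in> S \<Longrightarrow> f' x = g' x) \<Longrightarrow> x \<in> S \<Longrightarrow> F f f' x = F g g' x"
  shows "germ_eq (F f f') (F g g')"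
proof -
  obtain s where s: "0 < s" "holo_on f (toric_nhd s)" "holo_on g (toric_nhd s)"
    "\<And>x. x \<in> toric_nhd s \<Longrightarrow> f x = g x"
    using assms(1) unfolding germ_eq_def by blast
  obtain s' where s': "0 < s'" "holo_on f' (toric_nhd s')" "holo_on g' (toric_nhd s')"
    "\<And>x. x \<in> toric_nhd s' \<Longrightarrow> f' x = g' x"
    using assms(2) unfolding germ_eq_def by blast
  let ?U = "toric_nhd (min s s') :: 'n phase set"
  have sub: "?U \<subseteq> toric_nhd s" "?U \<subseteq> toric_nhd s'"
    by (auto intro!: toric_nhd_mono)
  have eq: "f x = g x" "f' x = g' x" if "x \<in> ?U" for x
    using that sub s(4) s'(4) by blast+
  have "holo_on (F f f') ?U" "holo_on (F g g') ?U"
    by (intro assms(3) open_toric_nhd holo_on_subset[OF _ sub(1)] holo_on_subset[OF _ sub(2)] s s')+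
  moreover have "F f f' x = F g g' x" if "x \<in> ?U" for x
    using assms(4)[OF open_toric_nhd eq that] .
  ultimately show ?thesis
    unfolding germ_eq_def using s(1) s'(1) by (intro exI[of _ "min s s'"]) auto
qed

lemma germ_eq_sym: "germ_eq f g \<Longrightarrow> germ_eq g f"
  by (auto simp: germ_eq_def)

lemma germ_eq_refl: "(\<And>S. holo_on f S) \<Longrightarrow> germ_eq f f"
  unfolding germ_eq_def by (auto intro: exI[of _ 1])

lemma part_equivp_germ_eq: "part_equivp (germ_eq :: ('n::finite phase \<Rightarrow> complex) \<Rightarrow> _)"
proof (rule part_equivpI)
  show "\<exists>f :: 'n phase \<Rightarrow> complex. germ_eq f f" using germ_eq_refl[OF holo_on_const] by blast
  show "symp (germ_eq :: ('n phase \<Rightarrow> complex) \<Rightarrow> _)" by (rule sympI) (auto simp: germ_eq_def)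
  show "transp (germ_eq :: ('n phase \<Rightarrow> complex) \<Rightarrow> _)"
  proof (rule transpI)
    fix f g h :: "'n phase \<Rightarrow> complex"
    assume a: "germ_eq f g" "germ_eq g h"
    then obtain s s' where s: "0 < s" "holo_on f (toric_nhd s)" "\<And>x. x \<in> toric_nhd s \<Longrightarrow> f x = g x"
      and s': "0 < s'" "holo_on h (toric_nhd s')" "\<And>x. x \<in> toric_nhd s' \<Longrightarrow> g x = h x"
      unfolding germ_eq_def by blast
    have sub: "toric_nhd (min s s') \<subseteq> (toric_nhd s :: 'n phase set)"
      "toric_nhd (min s s') \<subseteq> (toric_nhd s' :: 'n phase set)"
      by (auto intro!: toric_nhd_mono)
    show "germ_eq f h" unfolding germ_eq_def
    proof (intro exI[of _ "min s s'"] conjI ballI)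
      show "holo_on f (toric_nhd (min s s'))" "holo_on h (toric_nhd (min s s'))"
        using holo_on_subset s s' sub by blast+
      fix x :: "'n phase" assume "x \<in> toric_nhd (min s s')"
      with sub have "x \<in> toric_nhd s" "x \<in> toric_nhd s'" by blast+
      with s(3) s'(3) show "f x = h x" by simp
    qed (use s s' in auto)
  qed
qed

text \<open>The algebra $\mathbb{C}\{t, q, q^{-1}, p\}$: only functions holomorphic on some
  neighbourhood \<^const>\<open>toric_nhd\<close> of the torus lie in the field of the partial equivalence.\<close>

quotient_type (overloaded) 'n germ = "'n::finite phase \<Rightarrow> complex" / partial: germ_eq
  by (rule part_equivp_germ_eq)

instantiation germ :: (finite) comm_ring_1
begin

lift_definition zero_germ :: "'a germ" is "\<lambda>_. 0"
  by (rule germ_eq_refl[OF holo_on_const])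

lift_definition one_germ :: "'a germ" is "\<lambda>_. 1"
  by (rule germ_eq_refl[OF holo_on_const])

lift_definition plus_germ :: "'a germ \<Rightarrow> 'a germ \<Rightarrow> 'a germ" is "\<lambda>f g x. f x + g x"
  by (erule (1) germ_eq_lift2) (auto intro: holo_on_add)

lift_definition minus_germ :: "'a germ \<Rightarrow> 'a germ \<Rightarrow> 'a germ" is "\<lambda>f g x. f x - g x"
  by (erule (1) germ_eq_lift2) (auto intro: holo_on_diff)

lift_definition uminus_germ :: "'a germ \<Rightarrow> 'a germ" is "\<lambda>f x. - f x"
  by (erule germ_eq_lift1) (auto intro: holo_on_minus)

lift_definition times_germ :: "'a germ \<Rightarrow> 'a germ \<Rightarrow> 'a germ" is "\<lambda>f g x. f x * g x"
  by (erule (1) germ_eq_lift2) (auto intro: holo_on_mult)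

lemma germ_cases:
  obtains f :: "'a phase \<Rightarrow> complex" where "germ_eq f f" "G = abs_germ f"
  by (metis Quotient3_germ Quotient3_def)

lemma germ_eq_closed:
  "germ_eq f f \<Longrightarrow> germ_eq g g \<Longrightarrow> germ_eq (\<lambda>x. f x + g x) (\<lambda>x. f x + g x)"
  "germ_eq f f \<Longrightarrow> germ_eq g g \<Longrightarrow> germ_eq (\<lambda>x. f x - g x) (\<lambda>x. f x - g x)"
  "germ_eq f f \<Longrightarrow> germ_eq g g \<Longrightarrow> germ_eq (\<lambda>x. f x * g x) (\<lambda>x. f x * g x)"
  "germ_eq f f \<Longrightarrow> germ_eq (\<lambda>x. - f x) (\<lambda>x. - f x)"
  "germ_eq (\<lambda>_. c) (\<lambda>_. c)"
  by (erule (1) germ_eq_lift2, auto intro: holo_on_add)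
     (erule (1) germ_eq_lift2, auto intro: holo_on_diff,
      erule (1) germ_eq_lift2, auto intro: holo_on_mult,
      erule germ_eq_lift1, auto intro: holo_on_minus germ_eq_refl holo_on_const)

instance
proof
  fix a b c :: "'a germ"
  note simps = zero_germ.abs_eq one_germ.abs_eq plus_germ.abs_eq minus_germ.abs_eq
    uminus_germ.abs_eq times_germ.abs_eq germ_eq_closed
  obtain f where f: "germ_eq f f" "a = abs_germ f" by (rule germ_cases)
  obtain g where g: "germ_eq g g" "b = abs_germ g" by (rule germ_cases)
  obtain h where h: "germ_eq h h" "c = abs_germ h" by (rule germ_cases)
  show "a * b * c = a * (b * c)" "a * b = b * a" "1 * a = a" "a + b + c = a + (b + c)"
    "a + b = b + a" "0 + a = a" "- a + a = 0" "a - b = a + - b" "(a + b) * c = a * c + b * c"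
    using f g h by (simp_all add: simps zero_germ_def one_germ_def algebra_simps)
  have "\<not> germ_eq (\<lambda>_::'a phase. 0) (\<lambda>_. 1)"
    unfolding germ_eq_def using toric_nhd_base by (metis zero_neq_one)
  then show "(0::'a germ) \<noteq> 1" by transfer
qed

end

subsection \<open>The Poisson algebra\<close>

text \<open>Differentiating in the direction of the coordinate vector for $q_i$ or $p_i$ gives the complex
  partial derivative, by complex linearity of the derivative.\<close>

abbreviation dq :: "'n::finite \<Rightarrow> ('n phase \<Rightarrow> complex) \<Rightarrow> 'n phase \<Rightarrow> complex" where
  "dq i f x \<equiv> fder f (axis i 1, 0, 0) x"

abbreviation dp :: "'n::finite \<Rightarrow> ('n phase \<Rightarrow> complex) \<Rightarrow> 'n phase \<Rightarrow> complex" where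
  "dp i f x \<equiv> fder f (0, axis i 1, 0) x"

lemma holo_on_coord:
  fixes i :: "'n::finite"
  shows "holo_on (\<lambda>(q, p, t). q $ i) S" "holo_on (\<lambda>(q, p, t). p $ i) S" "holo_on (\<lambda>(q, p, t). t) S"
proof -
  have "bounded_linear (\<lambda>x::'n phase. fst x $ i)"
    by (rule bounded_linear_compose[OF bounded_linear_vec_nth bounded_linear_fst])
  then show "holo_on (\<lambda>(q, p, t). q $ i) S"
    by (intro holo_on_linear) (auto simp: case_prod_beta' cscale_def)
  have "bounded_linear (\<lambda>x::'n phase. fst (snd x) $ i)"
    by (rule bounded_linear_compose[OF bounded_linear_vec_nth
          bounded_linear_compose[OF bounded_linear_fst bounded_linear_snd]])
  then show "holo_on (\<lambda>(q, p, t). p $ i) S"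
    by (intro holo_on_linear) (auto simp: case_prod_beta' cscale_def)
  have "bounded_linear (\<lambda>x::'n phase. snd (snd x))"
    by (rule bounded_linear_compose[OF bounded_linear_snd bounded_linear_snd])
  then show "holo_on (\<lambda>(q, p, t). t) S"
    by (intro holo_on_linear) (auto simp: case_prod_beta' cscale_def)
qed

lift_definition const_germ :: "complex \<Rightarrow> 'n::finite germ" is "\<lambda>c _. c"
  by (rule germ_eq_refl[OF holo_on_const])

lift_definition qvar :: "'n::finite \<Rightarrow> 'n germ" is "\<lambda>i (q, p, t). q $ i"
  by (rule germ_eq_refl[OF holo_on_coord(1)])

lift_definition pvar :: "'n::finite \<Rightarrow> 'n germ" is "\<lambda>i (q, p, t). p $ i"
  by (rule germ_eq_refl[OF holo_on_coord(2)])

lift_definition tvar :: "'n::finite germ" is "\<lambda>(q, p, t). t"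
  by (rule germ_eq_refl[OF holo_on_coord(3)])

text \<open>$\{f, g\} = \sum_i q_i \bigl(\frac{\partial f}{\partial p_i} \frac{\partial g}{\partial q_i}
    - \frac{\partial f}{\partial q_i} \frac{\partial g}{\partial p_i}\bigr)$, the bracket with
  $\{p_i, q_j\} = \delta_{ij} q_j$ and $t$ central.\<close>

lift_definition bracket :: "'n::finite germ \<Rightarrow> 'n germ \<Rightarrow> 'n germ" is
  "\<lambda>f g x. \<Sum>i\<in>UNIV. (case x of (q, p, t) \<Rightarrow> q $ i) * (dp i f x * dq i g x - dq i f x * dp i g x)"
proof (erule (1) germ_eq_lift2)
  fix f g :: "'n phase \<Rightarrow> complex" and S
  assume "open S" "holo_on f S" "holo_on g S"
  then show "holo_on (\<lambda>x. \<Sum>i\<in>UNIV. (case x of (q, p, t) \<Rightarrow> q $ i) *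
      (dp i f x * dq i g x - dq i f x * dp i g x)) S"
    by (intro holo_on_sum holo_on_mult holo_on_diff holo_on_coord holo_on_fder)
      (simp_all add: norm_Pair)
next
  fix f g f' g' :: "'n phase \<Rightarrow> complex" and S x
  assume S: "open S" "\<And>x. x \<in> S \<Longrightarrow> f x = g x" "\<And>x. x \<in> S \<Longrightarrow> f' x = g' x" "x \<in> S"
  show "(\<Sum>i\<in>UNIV. (case x of (q, p, t) \<Rightarrow> q $ i) * (dp i f x * dq i f' x - dq i f x * dp i f' x)) =
    (\<Sum>i\<in>UNIV. (case x of (q, p, t) \<Rightarrow> q $ i) * (dp i g x * dq i g' x - dq i g x * dp i g' x))"
    using fder_cong[OF S(1) S(2) S(4)] fder_cong[OF S(1) S(3) S(4)] by simp
qed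

definition represents :: "('n::finite phase \<Rightarrow> complex) \<Rightarrow> 'n germ \<Rightarrow> bool" where
  "represents f G \<longleftrightarrow> germ_eq f f \<and> abs_germ f = G"

text \<open>The subalgebra $\mathbb{C}\{t\}$.\<close>

definition Ct :: "'n::finite germ set" where
  "Ct = {G. \<exists>c. represents (\<lambda>(q, p, t). c t) G}"

lemma fder_linear: "bounded_linear L \<Longrightarrow> fder L v x = L v"
  by (metis bounded_linear_imp_has_derivative frechet_derivative_at)

lemma fder_coord:
  fixes i :: "'n::finite"
  shows "fder (\<lambda>(q, p, t). q $ i) (a, b, c) x = a $ i"
  "fder (\<lambda>(q, p, t). p $ i) (a, b, c) x = b $ i"
proof -
  have "bounded_linear (\<lambda>x::'n phase. fst x $ i)"
    by (rule bounded_linear_compose[OF bounded_linear_vec_nth bounded_linear_fst])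
  from fder_linear[OF this] show "fder (\<lambda>(q, p, t). q $ i) (a, b, c) x = a $ i"
    by (simp add: case_prod_beta')
  have "bounded_linear (\<lambda>x::'n phase. fst (snd x) $ i)"
    by (rule bounded_linear_compose[OF bounded_linear_vec_nth
          bounded_linear_compose[OF bounded_linear_fst bounded_linear_snd]])
  from fder_linear[OF this] show "fder (\<lambda>(q, p, t). p $ i) (a, b, c) x = b $ i"
    by (simp add: case_prod_beta')
qed

lemma bracket_coords:
  fixes i j :: "'n::finite"
  shows "bracket (pvar i) (qvar j) = (if i = j then qvar j else 0)"
  "bracket (pvar i) (pvar j) = 0" "bracket (qvar i) (qvar j) = 0"
proof -
  have *: "(\<Sum>k\<in>UNIV. u k * (axis k 1 $ i * axis k 1 $ j)) = (if i = j then u j else (0::complex))"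
    for u and i j :: 'n
  proof -
    have "(\<Sum>k\<in>UNIV. u k * (axis k 1 $ i * axis k 1 $ j)) =
      (\<Sum>k\<in>UNIV. if k = i then if i = j then u j else 0 else 0)"
      by (rule sum.cong) (auto simp: axis_def)
    then show ?thesis by simp
  qed
  have r: "germ_eq (\<lambda>(q, p, t). q $ i) (\<lambda>(q, p, t). q $ i)"
    "germ_eq (\<lambda>(q, p, t). p $ i) (\<lambda>(q, p, t). p $ i)" for i :: 'n
    by (rule germ_eq_refl holo_on_coord)+
  show "bracket (pvar i) (qvar j) = (if i = j then qvar j else 0)"
    unfolding qvar_def pvar_def zero_germ_def
    by (auto simp: bracket.abs_eq r fder_coord * intro!: arg_cong[of _ _ abs_germ])
  show "bracket (pvar i) (pvar j) = 0" "bracket (qvar i) (qvar j) = 0"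
    unfolding qvar_def pvar_def zero_germ_def
    by (auto simp: bracket.abs_eq r fder_coord intro!: arg_cong[of _ _ abs_germ])
qed

definition poisson_automorphism :: "('n::finite germ \<Rightarrow> 'n germ) \<Rightarrow> bool" where
  "poisson_automorphism \<phi> \<longleftrightarrow> bij \<phi> \<and> \<phi> 1 = 1 \<and>
     (\<forall>f g. \<phi> (f + g) = \<phi> f + \<phi> g) \<and>
     (\<forall>f g. \<phi> (f * g) = \<phi> f * \<phi> g) \<and>
     (\<forall>c\<in>Ct. \<forall>f. \<phi> (c * f) = c * \<phi> f) \<and>
     (\<forall>f g. \<phi> (bracket f g) = bracket (\<phi> f) (\<phi> g))"

subsection \<open>Ideals\<close>

text \<open>Ideals are the submodules of the algebra over itself.\<close>

abbreviation is_ideal :: "'n::finite germ set \<Rightarrow> bool" where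
  "is_ideal \<equiv> module.subspace (*)"

abbreviation ideal_gen :: "'n::finite germ set \<Rightarrow> 'n germ set" where
  "ideal_gen \<equiv> module.span (*)"

lemma module_germ: "module ((*) :: 'n::finite germ \<Rightarrow> 'n germ \<Rightarrow> 'n germ)"
  by unfold_locales (simp_all add: algebra_simps)

definition ideal_square :: "'n::finite germ set \<Rightarrow> 'n germ set" where
  "ideal_square I = ideal_gen {x * y | x y. x \<in> I \<and> y \<in> I}"

definition ideal_p :: "'n::finite germ set" where
  "ideal_p = ideal_gen (range pvar)"

lift_definition vanishes_at_p0 :: "'n::finite germ \<Rightarrow> bool" is
  "\<lambda>f. \<exists>s>0. \<forall>q t. (q, 0, t) \<in> toric_nhd s \<longrightarrow> f (q, 0, t) = 0"
proof -
  have *: "\<exists>s>0. \<forall>q t. (q, 0, t) \<in> toric_nhd s \<longrightarrow> g (q, 0, t) = 0"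
    if fg: "germ_eq f g" and f: "\<exists>s>0. \<forall>q t. (q, 0, t) \<in> toric_nhd s \<longrightarrow> f (q, 0, t) = 0"
    for f g :: "'n phase \<Rightarrow> complex"
  proof -
    obtain s s' where s: "0 < s" "\<And>x. x \<in> toric_nhd s \<Longrightarrow> f x = g x"
      and s': "0 < s'" "\<And>q t. (q, 0, t) \<in> toric_nhd s' \<Longrightarrow> f (q, 0, t) = 0"
      using fg f unfolding germ_eq_def by blast
    have "g (q, 0, t) = 0" if "(q, 0, t) \<in> toric_nhd (min s s')" for q t
    proof -
      have "(q, 0, t) \<in> toric_nhd s" "(q, 0, t) \<in> toric_nhd s'"
        using that toric_nhd_mono[of "min s s'" s] toric_nhd_mono[of "min s s'" s'] by auto
      then show ?thesis using s(2) s'(2) by metis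
    qed
    then show ?thesis using s(1) s'(1) by (intro exI[of _ "min s s'"]) auto
  qed
  fix f g :: "'n phase \<Rightarrow> complex"
  assume "germ_eq f g"
  then show "(\<exists>s>0. \<forall>q t. (q, 0, t) \<in> toric_nhd s \<longrightarrow> f (q, 0, t) = 0) =
    (\<exists>s>0. \<forall>q t. (q, 0, t) \<in> toric_nhd s \<longrightarrow> g (q, 0, t) = 0)"
    using *[of f g] *[of g f] germ_eq_sym[of f g] by blast
qed

lemma subspace_vanishes_at_p0: "is_ideal {G :: 'n::finite germ. vanishes_at_p0 G}"
proof -
  interpret module "(*) :: 'n germ \<Rightarrow> 'n germ \<Rightarrow> 'n germ" by (rule module_germ)
  show ?thesis
  proof (rule subspaceI; clarsimp)
    show "vanishes_at_p0 (0 :: 'n germ)" by transfer (auto intro: exI[of _ 1])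
  next
    fix F G :: "'n germ"
    assume FG: "vanishes_at_p0 F" "vanishes_at_p0 G"
    obtain f where f: "germ_eq f f" "F = abs_germ f" by (rule germ_cases)
    obtain g where g: "germ_eq g g" "G = abs_germ g" by (rule germ_cases)
    obtain s s' where s: "0 < s" "\<And>q t. (q, 0, t) \<in> toric_nhd s \<Longrightarrow> f (q, 0, t) = 0"
      and s': "0 < s'" "\<And>q t. (q, 0, t) \<in> toric_nhd s' \<Longrightarrow> g (q, 0, t) = 0"
      using FG f g by (auto simp: vanishes_at_p0.abs_eq)
    have "f (q, 0, t) + g (q, 0, t) = 0" if "(q, 0, t) \<in> toric_nhd (min s s')" for q t
    proof -
      have "(q, 0, t) \<in> toric_nhd s" "(q, 0, t) \<in> toric_nhd s'"
        using that toric_nhd_mono[of "min s s'" s] toric_nhd_mono[of "min s s'" s'] by auto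
      then show ?thesis using s(2) s'(2) by simp
    qed
    then show "vanishes_at_p0 (F + G)" using s(1) s'(1)
      by (simp add: f g plus_germ.abs_eq vanishes_at_p0.abs_eq germ_eq_closed) (rule exI[of _ "min s s'"], auto)
  next
    fix c F :: "'n germ"
    assume F: "vanishes_at_p0 F"
    obtain f where f: "germ_eq f f" "F = abs_germ f" by (rule germ_cases)
    obtain g where g: "germ_eq g g" "c = abs_germ g" by (rule germ_cases)
    show "vanishes_at_p0 (c * F)" using F
      by (auto simp: f g times_germ.abs_eq vanishes_at_p0.abs_eq germ_eq_closed)
  qed
qed

lemma vanishes_at_p0_tI2:
  fixes x :: "'n::finite germ"
  assumes "x \<in> ideal_square ideal_p"
  shows "vanishes_at_p0 (tvar * x)"
proof -
  interpret module "(*) :: 'n germ \<Rightarrow> 'n germ \<Rightarrow> 'n germ" by (rule module_germ)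
  have p: "vanishes_at_p0 (pvar i :: 'n germ)" for i
    by transfer (auto intro: exI[of _ 1])
  have I: "ideal_p \<subseteq> {G :: 'n germ. vanishes_at_p0 G}"
    unfolding ideal_p_def using p by (intro span_minimal subspace_vanishes_at_p0) auto
  have "ideal_square ideal_p \<subseteq> {G :: 'n germ. vanishes_at_p0 G}"
    unfolding ideal_square_def
    using I subspace_scale[OF subspace_vanishes_at_p0]
    by (intro span_minimal subspace_vanishes_at_p0) auto
  with assms show ?thesis using subspace_scale[OF subspace_vanishes_at_p0] by blast
qed

lemma tI2_Ct_direct:
  fixes c :: "'n::finite germ"
  assumes "x \<in> ideal_square ideal_p" "c \<in> Ct" "tvar * x = c"
  shows "c = 0"
proof -
  obtain k where "represents (\<lambda>(q, p, t). k t) c"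
    using assms(2) unfolding Ct_def by blast
  then have k: "germ_eq (\<lambda>(q :: complex ^ 'n, p :: complex ^ 'n, t). k t) (\<lambda>(q, p, t). k t)"
    "c = abs_germ (\<lambda>(q, p, t). k t)"
    by (simp_all add: represents_def)
  have "vanishes_at_p0 c" using vanishes_at_p0_tI2[OF assms(1)] assms(3) by simp
  then obtain s where s: "0 < s" "\<And>q t. (q :: complex ^ 'n, 0 :: complex ^ 'n, t) \<in> toric_nhd s \<Longrightarrow> k t = 0"
    using k by (auto simp: vanishes_at_p0.abs_eq)
  have k0: "k t = 0" if "cmod t < s" for t
    by (rule s(2)[of 1]) (use that s(1) in \<open>simp add: toric_nhd_def\<close>)
  have eq: "(\<lambda>(q, p, t). k t) x = 0" if "x \<in> toric_nhd s" for x :: "'n phase"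
    using that k0 by (auto simp: toric_nhd_def)
  have "germ_eq (\<lambda>(q :: complex ^ 'n, p :: complex ^ 'n, t). k t) (\<lambda>_. 0)"
    unfolding germ_eq_def
    by (intro exI[of _ s] conjI ballI s(1) eq holo_on_const
        holo_on_cong[OF open_toric_nhd _ holo_on_const[of 0]]) (rule eq[symmetric])
  then show ?thesis unfolding k(2) zero_germ_def by (rule Quotient3_rel_abs[OF Quotient3_germ])
qed

text \<open>The sum $t I^2 + \mathbb{C}\{t\}$; it is direct by \<open>tI2_Ct_direct\<close>.\<close>

definition t_square_plus_Ct :: "'n::finite germ set" where
  "t_square_plus_Ct = {tvar * x + c | x c. x \<in> ideal_square ideal_p \<and> c \<in> Ct}"

subsection \<open>Hypotheses on the Hamiltonian\<close>

text \<open>Germs of convergent power series in $p$ alone, all of whose terms have order at least \<open>k\<close>;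
  multi-indices are functions \<open>J\<close>.\<close>

definition p_series_ge :: "nat \<Rightarrow> 'n::finite germ set" where
  "p_series_ge k = {G. \<exists>h c s. represents (\<lambda>(q, p, t). h p) G \<and> 0 < s \<and>
     (\<forall>p. (\<forall>i. cmod (p $ i) < s) \<longrightarrow>
       ((\<lambda>J :: 'n \<Rightarrow> nat. c J * (\<Prod>i\<in>UNIV. (p $ i) ^ J i)) has_sum h p) {J. k \<le> (\<Sum>i\<in>UNIV. J i)})}"

definition kolmogorov_diophantine :: "complex ^ 'n::finite \<Rightarrow> bool" where
  "kolmogorov_diophantine \<omega> \<longleftrightarrow> (\<exists>C>0. \<exists>k\<ge>0. \<forall>M :: int ^ 'n. M \<noteq> 0 \<longrightarrow>
     C / real_of_int (\<Sum>i\<in>UNIV. \<bar>M $ i\<bar>) powr k \<le> cmod (\<Sum>i\<in>UNIV. \<omega> $ i * of_int (M $ i)))"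

end

theory Submission
  imports Defs
begin

text \<open>Kolmogorov's iteration. A Hamiltonian \<open>P\<close> that misses the normal form at $p = 0$ by \<open>\<epsilon>\<close> is composed
  with an exactly symplectic lift $q' = q\,e^{w(q)}$, $(1 + N) p' = p + \eta(q)$ of a torus map. To first order
  the error disappears if $w$ and $\eta$ solve equations $\sum_i \omega_i q_i \partial_{q_i} u = h - \bar h$
  with $\bar h$ the torus average: (K) adjusts the average of $\eta$ so that the right-hand sides have mean
  zero, and (D) makes the Fourier series of the solutions converge, at the price of a power of the loss
  $\sigma$ of domain. The new error is therefore $O(\epsilon^2 \sigma^{-\mu})$, which is summable along shrinking
  domains, and the composed maps converge to a symplectic $\Theta$ with $\Theta = \mathrm{id}$ at $t = 0$. By the
  Schwarz lemma $\Theta - \mathrm{id} = O(t)$, so $\Theta$ is invertible near the torus and pulling back along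
  $\Theta$ is a Poisson automorphism of germs. Hadamard's lemma turns the vanishing of
  $P \circ \Theta - H$, up to a function of $t$, to second order at $p = 0$ and to first order at $t = 0$ into
  membership in $t I^2$.\<close>

text \<open>A lift of a torus map is used instead of the time-one flow of a Hamiltonian: it is given
  in closed form, so symplecticity reduces to linear algebra and no flow has to be constructed. The
  parameter \<open>t\<close> is one more coordinate, fixed by every map. Analyticity in
  \<open>t\<close> is thus built in, and only the radius in \<open>q\<close> and \<open>p\<close>
  shrinks during the iteration, while the radius \<tau> is chosen once, so small that the
  perturbation \<open>t R\<close> can start the scheme. The iteration corrects only the value and
  the first p-derivatives at \<open>p = 0\<close>. The Hessian at \<open>p = 0\<close> is left to
  drift, and this is the obstacle, as (K) has to be available at every step. It stays available
  because the sup-distance to the unperturbed Hamiltonian never exceeds a fixed budget, and at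
  \<open>p = 0\<close> a Cauchy estimate turns this into a bound for the Hessian without loss of
  domain. Two further points are carried along: each map is the identity at \<open>t = 0\<close>,
  and constants depending on \<open>t\<close> are split off throughout, which is where the summand
  of functions of \<open>t\<close> alone in the conclusion comes from.\<close>

lemma fder_eqI: "(f has_derivative D) (at x) \<Longrightarrow> fder f v x = D v"
  using frechet_derivative_at by metis

lemma fder_linear_vec:
  assumes "holo_on f S" "x \<in> S"
  shows "fder f (v + w) x = fder f v x + fder f w x" "fder f 0 x = 0"
    "fder f (\<Sum>i\<in>I. u i) x = (\<Sum>i\<in>I. fder f (u i) x)"
    "fder f (v - w) x = fder f v x - fder f w x"
proof -
  have l: "linear (\<lambda>v. fder f v x)"
    using has_derivative_linear[OF holo_onD(1)[OF assms]] .
  show "fder f (v + w) x = fder f v x + fder f w x" "fder f 0 x = 0"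
    "fder f (\<Sum>i\<in>I. u i) x = (\<Sum>i\<in>I. fder f (u i) x)"
    "fder f (v - w) x = fder f v x - fder f w x"
    using linear_add[OF l] linear_0[OF l] linear_sum[OF l] linear_diff[OF l] by (auto simp: o_def)
qed

lemma phase_decomp:
  fixes a b :: "complex ^ 'n::finite"
  shows "(a, b, c) = (\<Sum>i\<in>UNIV. cscale (a $ i) (axis i 1, 0, 0)) +
     (\<Sum>i\<in>UNIV. cscale (b $ i) (0, axis i 1, 0)) + cscale c (0, 0, 1)"
proof -
  have "(\<Sum>i\<in>UNIV. a $ i *s axis i 1) = a" for a :: "complex ^ 'n"
    by (rule basis_expansion)
  then show ?thesis
    by (simp add: prod_eq_iff fst_sum snd_sum cscale_def)
qed

lemma fder_decomp:
  assumes "holo_on f S" "x \<in> S"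
  shows "fder f (a, b, c) x = (\<Sum>i\<in>UNIV. a $ i * dq i f x) + (\<Sum>i\<in>UNIV. b $ i * dp i f x)
     + c * fder f (0, 0, 1) x"
  unfolding phase_decomp[of a b c]
  by (simp add: fder_linear_vec[OF assms] holo_onD(2)[OF assms])

section \<open>Rules of calculus for directional derivatives of holomorphic functions\<close>

lemma fder_const [simp]: "fder (\<lambda>_. c) v x = 0"
  by (rule fder_eqI[where D="\<lambda>_. 0"]) simp

lemma
  assumes f: "holo_on f S" and g: "holo_on g S" and x: "x \<in> S"
  shows fder_add: "fder (\<lambda>x. f x + g x) v x = fder f v x + fder g v x"
    and fder_diff: "fder (\<lambda>x. f x - g x) v x = fder f v x - fder g v x"
    and fder_mult: "fder (\<lambda>x. f x * g x) v x = f x * fder g v x + fder f v x * g x"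
  by (rule fder_eqI has_derivative_add has_derivative_diff has_derivative_mult holo_onD f g x)+

lemma fder_sum:
  assumes "\<And>i. i \<in> I \<Longrightarrow> holo_on (f i) S" and x: "x \<in> S"
  shows "fder (\<lambda>x. \<Sum>i\<in>I. f i x) v x = (\<Sum>i\<in>I. fder (f i) v x)"
  by (rule fder_eqI has_derivative_sum holo_onD assms | assumption)+

lemma fder_cmult:
  assumes "holo_on f S" "x \<in> S"
  shows "fder (\<lambda>x. c * f x) v x = c * fder f v x"
  using fder_mult[OF holo_on_const assms, of c v] by simp

lemma holo_on_imp_continuous: "holo_on f S \<Longrightarrow> x \<in> S \<Longrightarrow> isCont f x"
  using has_derivative_continuous[OF holo_onD(1)] by blast

lemma holo_on_imp_continuous_on: "holo_on f S \<Longrightarrow> continuous_on S f"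
  by (intro continuous_at_imp_continuous_on ballI holo_on_imp_continuous)

text \<open>Differentiability of \<open>h\<close> is asked only at the values that \<open>f\<close>
  takes on \<open>S\<close>, so that the rule also covers reciprocals and negative integer
  powers.\<close>

lemma holo_on_chain1:
  assumes f: "holo_on f S" and h: "\<And>x. x \<in> S \<Longrightarrow> (h has_field_derivative h' (f x)) (at (f x))"
  shows "holo_on (\<lambda>x. h (f x)) S" "x \<in> S \<Longrightarrow> fder (\<lambda>x. h (f x)) v x = h' (f x) * fder f v x"
proof -
  have d: "((\<lambda>x. h (f x)) has_derivative (\<lambda>v. h' (f x) * fder f v x)) (at x)" if "x \<in> S" for x
    using diff_chain_at[OF holo_onD(1)[OF f that]] h[OF that]
    by (force simp: has_field_derivative_def o_def)
  show "holo_on (\<lambda>x. h (f x)) S"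
    unfolding holo_on_def
  proof (intro ballI exI conjI allI)
    fix x c v assume x: "x \<in> S"
    show "((\<lambda>x. h (f x)) has_derivative (\<lambda>v. h' (f x) * fder f v x)) (at x)" by (rule d[OF x])
    show "h' (f x) * fder f (cscale c v) x = c * (h' (f x) * fder f v x)"
      by (simp add: holo_onD(2)[OF f x])
  qed
  show "x \<in> S \<Longrightarrow> fder (\<lambda>x. h (f x)) v x = h' (f x) * fder f v x"
    by (rule fder_eqI[OF d])
qed

lemma holo_on_exp:
  assumes f: "holo_on f S"
  shows "holo_on (\<lambda>x. exp (f x)) S" "x \<in> S \<Longrightarrow> fder (\<lambda>x. exp (f x)) v x = exp (f x) * fder f v x"
  using holo_on_chain1[OF f, of exp exp] DERIV_exp by auto

lemma holo_on_divide:
  assumes f: "holo_on f S" and g: "holo_on g S" and nz: "\<And>x. x \<in> S \<Longrightarrow> g x \<noteq> 0"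
  shows "holo_on (\<lambda>x. f x / g x) S"
proof -
  have "holo_on (\<lambda>x. inverse (g x)) S"
    by (rule holo_on_chain1[OF g, where h'="\<lambda>z. - inverse (z ^ 2)"])
      (use nz in \<open>auto intro!: derivative_eq_intros simp: power2_eq_square\<close>)
  from holo_on_mult[OF f this] show ?thesis by (simp add: field_simps)
qed

lemma holo_on_prod: "(\<And>i. i \<in> I \<Longrightarrow> holo_on (f i) S) \<Longrightarrow> holo_on (\<lambda>x. \<Prod>i\<in>I. f i x) S"
  by (induction I rule: infinite_finite_induct) (auto intro: holo_on_const holo_on_mult)

lemma holo_on_coords:
  "holo_on (\<lambda>x. fst x $ i) S" "holo_on (\<lambda>x. fst (snd x) $ i) S" "holo_on (\<lambda>x. snd (snd x)) S"
  using holo_on_coord(1)[of i S] holo_on_coord(2)[of i S] holo_on_coord(3)[of S] by (simp_all add: case_prod_beta')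

lemma fder_coords [simp]:
  "fder (\<lambda>x. fst x $ i) v x = fst v $ i" "fder (\<lambda>x. fst (snd x) $ i) v x = fst (snd v) $ i"
  "fder (\<lambda>x. snd (snd x)) v x = snd (snd v)"
  by (rule fder_eqI, auto intro!: bounded_linear_imp_has_derivative
      bounded_linear_compose[OF bounded_linear_vec_nth] bounded_linear_fst bounded_linear_snd
      bounded_linear_compose[OF bounded_linear_fst] bounded_linear_compose[OF bounded_linear_snd])+

subsection \<open>Limits and integrals of holomorphic functions\<close>

text \<open>By the Cauchy estimate, uniform convergence on a ball makes the derivatives uniformly
  Cauchy on the ball of half the radius, so limit and derivative may be interchanged; complex
  linearity of the derivative survives pointwise limits.\<close>

lemma holo_on_limit:
  fixes g :: "nat \<Rightarrow> 'n::finite phase \<Rightarrow> complex"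
  assumes g: "\<And>n. holo_on (g n) S"
    and lim: "\<And>x. x \<in> S \<Longrightarrow> \<exists>r>0. ball x r \<subseteq> S \<and> uniform_limit (ball x r) g f sequentially"
  shows "holo_on f S" "x \<in> S \<Longrightarrow> (\<lambda>n. fder (g n) v x) \<longlonglongrightarrow> fder f v x"
proof -
  have *: "\<exists>D. (f has_derivative D) (at x0) \<and> (\<forall>c v. D (cscale c v) = c * D v) \<and>
     (\<forall>v. (\<lambda>n. fder (g n) v x0) \<longlonglongrightarrow> D v)" if x0: "x0 \<in> S" for x0
  proof -
    obtain r where r: "0 < r" "ball x0 r \<subseteq> S" "uniform_limit (ball x0 r) g f sequentially"
      using lim[OF x0] by blast
    let ?U = "ball x0 (r/2)"
    have US: "y \<in> S" if "y \<in> ?U" for y using that r by auto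
    have cauchy: "\<exists>N. \<forall>m\<ge>N. \<forall>n\<ge>N. \<forall>y\<in>?U. \<forall>w. cmod (fder (g m) w y - fder (g n) w y) \<le> e * norm w"
      if e: "0 < e" for e
    proof -
      have "\<forall>\<^sub>F n in sequentially. \<forall>y\<in>ball x0 r. dist (g n y) (f y) < e * r / 8"
        by (rule uniform_limitD[OF r(3)]) (use e r in simp)
      then obtain N where N: "\<And>n y. N \<le> n \<Longrightarrow> y \<in> ball x0 r \<Longrightarrow> dist (g n y) (f y) < e * r / 8"
        unfolding eventually_sequentially by blast
      show ?thesis
      proof (intro exI[of _ N] allI impI ballI)
        fix m n y w assume mn: "N \<le> m" "N \<le> n" and y: "y \<in> ?U"
        have sub: "ball y (r/2) \<subseteq> ball x0 r"
        proof
          fix z assume "z \<in> ball y (r/2)"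
          with y dist_triangle[of x0 z y] show "z \<in> ball x0 r" by auto
        qed
        have "cmod (fder (\<lambda>x. g m x - g n x) w y) \<le> 2 * (e * r / 4) / (r/2) * norm w"
        proof (rule fder_bound[OF holo_on_diff[OF g g]])
          show "ball y (r/2) \<subseteq> S" using sub r by blast
          fix z assume "z \<in> ball y (r/2)"
          then have "dist (g m z) (f z) < e * r / 8" "dist (g n z) (f z) < e * r / 8"
            using N mn sub by blast+
          then show "cmod (g m z - g n z) \<le> e * r / 4"
            using dist_triangle2[of "g m z" "g n z" "f z"] by (simp add: dist_norm)
        qed (use r in auto)
        then show "cmod (fder (g m) w y - fder (g n) w y) \<le> e * norm w"
          using r by (simp add: fder_diff[OF g g US[OF y]])
      qed
    qed
    define D where "D y w = lim (\<lambda>n. fder (g n) w y)" for y w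
    have Dlim: "(\<lambda>n. fder (g n) w y) \<longlonglongrightarrow> D y w" if y: "y \<in> ?U" for w y
    proof -
      have "Cauchy (\<lambda>n. fder (g n) w y)"
      proof (rule metric_CauchyI)
        fix e :: real assume e: "0 < e"
        \<comment> \<open>Adding 1 keeps the divisor positive when \<open>w = 0\<close>.\<close>
        define e' where "e' = e / (2 * (norm w + 1))"
        have w: "0 < norm w + 1" by (simp add: add_nonneg_pos)
        have e': "0 < e'" using e w by (auto simp: e'_def intro!: divide_pos_pos)
        have "e' * norm w \<le> e' * (norm w + 1)" using e' by simp
        also have "\<dots> = e / 2" using w by (simp add: e'_def field_simps)
        finally have "e' * norm w < e" using e by simp
        with cauchy[OF e'] y show "\<exists>N. \<forall>m\<ge>N. \<forall>n\<ge>N. dist (fder (g m) w y) (fder (g n) w y) < e"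
          unfolding dist_norm by (meson order_le_less_trans)
      qed
      then show ?thesis unfolding D_def
        by (simp add: Cauchy_convergent_iff convergent_LIMSEQ_iff)
    qed
    have x0U: "x0 \<in> ?U" using r by simp
    have flim: "(\<lambda>n. g n y) \<longlonglongrightarrow> f y" if "y \<in> ball x0 r" for y
      using tendsto_uniform_limitI[OF r(3) that] .
    have "\<exists>G. \<forall>x\<in>?U. (\<lambda>n. g n x) \<longlonglongrightarrow> G x \<and> (G has_derivative D x) (at x within ?U)"
    proof (rule has_derivative_sequence)
      show "(g n has_derivative (\<lambda>w. fder (g n) w x)) (at x within ?U)" if "x \<in> ?U" for n x
        using holo_onD(1)[OF g US[OF that]] has_derivative_at_withinI by blast
      show "\<forall>\<^sub>F n in sequentially. \<forall>x\<in>?U. \<forall>w. cmod (fder (g n) w x - D x w) \<le> e * norm w"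
        if e: "0 < e" for e
      proof -
        obtain N where N: "\<And>m n y w. N \<le> m \<Longrightarrow> N \<le> n \<Longrightarrow> y \<in> ?U \<Longrightarrow>
            cmod (fder (g m) w y - fder (g n) w y) \<le> e * norm w"
          using cauchy[OF e] by blast
        have "cmod (fder (g m) w y - D y w) \<le> e * norm w" if m: "N \<le> m" and y: "y \<in> ?U" for m y w
        proof (rule LIMSEQ_le_const2)
          show "(\<lambda>n. cmod (fder (g m) w y - fder (g n) w y)) \<longlonglongrightarrow> cmod (fder (g m) w y - D y w)"
            by (intro tendsto_intros Dlim y)
          show "\<exists>M. \<forall>n\<ge>M. cmod (fder (g m) w y - fder (g n) w y) \<le> e * norm w"
            using N[OF m _ y] by blast
        qed
        then show ?thesis unfolding eventually_sequentially by blast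
      qed
      show "(\<lambda>n. g n x0) \<longlonglongrightarrow> f x0" by (rule flim) (use r in simp)
    qed (use r in auto)
    then obtain G where G: "\<And>x. x \<in> ?U \<Longrightarrow> (\<lambda>n. g n x) \<longlonglongrightarrow> G x"
      "\<And>x. x \<in> ?U \<Longrightarrow> (G has_derivative D x) (at x within ?U)" by blast
    have "G y = f y" if "y \<in> ?U" for y
      using LIMSEQ_unique[OF G(1)[OF that] flim] that r by auto
    moreover have "(G has_derivative D x0) (at x0)"
      using G(2)[OF x0U] at_within_open[OF x0U] by simp
    ultimately have "(f has_derivative D x0) (at x0)"
      using has_derivative_transform_within_open[of G "D x0" x0 UNIV ?U f] x0U by auto
    moreover have "D x0 (cscale c w) = c * D x0 w" for c w
    proof -
      have "(\<lambda>n. c * fder (g n) w x0) \<longlonglongrightarrow> c * D x0 w"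
        by (intro tendsto_intros Dlim x0U)
      then show ?thesis using LIMSEQ_unique[OF Dlim[OF x0U]] by (simp add: holo_onD(2)[OF g x0])
    qed
    ultimately show ?thesis using Dlim[OF x0U] by blast
  qed
  show "holo_on f S" unfolding holo_on_def using * by blast
  show "x \<in> S \<Longrightarrow> (\<lambda>n. fder (g n) v x) \<longlonglongrightarrow> fder f v x"
    using *[of x] fder_eqI by metis
qed

lemma holo_on_limit_uniform:
  fixes g :: "nat \<Rightarrow> 'n::finite phase \<Rightarrow> complex"
  assumes "open S" "\<And>n. holo_on (g n) S" "uniform_limit S g f sequentially"
  shows "holo_on f S" "x \<in> S \<Longrightarrow> (\<lambda>n. fder (g n) v x) \<longlonglongrightarrow> fder f v x"
proof -
  have "\<exists>r>0. ball x r \<subseteq> S \<and> uniform_limit (ball x r) g f sequentially" if x: "x \<in> S" for x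
    using open_contains_ball assms(1) x uniform_limit_on_subset[OF assms(3)] by metis
  from holo_on_limit[OF assms(2) this]
  show "holo_on f S" "x \<in> S \<Longrightarrow> (\<lambda>n. fder (g n) v x) \<longlonglongrightarrow> fder f v x" by blast+
qed

section \<open>Cauchy and Taylor estimates along complex lines\<close>

lemma holo_on_line_holomorphic':
  assumes "holo_on f S" "\<And>z. cmod z < \<rho> \<Longrightarrow> x + cscale z v \<in> S"
  shows "(\<lambda>z. f (x + cscale z v)) holomorphic_on ball 0 \<rho>"
  unfolding holomorphic_on_open[OF open_ball]
proof
  fix z assume "z \<in> ball (0::complex) \<rho>"
  then have "cmod z < \<rho>" by simp
  from holo_on_line[OF assms(1) assms(2)[OF this]]
  show "\<exists>f'. ((\<lambda>z. f (x + cscale z v)) has_field_derivative f') (at z)" by blast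
qed

text \<open>Cauchy's inequality on discs inside the disc of radius \<rho>. The second estimate is a
  first-order Taylor expansion from 0 to 1; the second derivative is controlled on the open disc of
  radius \<rho>/2, which contains the point 1 exactly when 2 < \<rho>.\<close>

lemma line_second_deriv_bound:
  assumes g: "g holomorphic_on ball 0 \<rho>" and B: "\<And>z. cmod z < \<rho> \<Longrightarrow> cmod (g z) \<le> B"
  shows "0 < \<rho> \<Longrightarrow> cmod (deriv g 0) \<le> 2 * B / \<rho>"
    and "2 < \<rho> \<Longrightarrow> cmod (g 1 - g 0 - deriv g 0) \<le> 32 * B / \<rho>\<^sup>2"
proof -
  have bd: "cmod ((deriv ^^ n) g z) \<le> fact n * B / (\<rho>/4) ^ n" if z: "z \<in> ball 0 (\<rho>/2)" and \<rho>: "0 < \<rho>" for z n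
  proof (rule Cauchy_inequality)
    have sub: "cball z (\<rho>/4) \<subseteq> ball 0 \<rho>"
    proof
      fix w assume "w \<in> cball z (\<rho>/4)"
      with z have "dist z w \<le> \<rho>/4" "dist 0 z < \<rho>/2" by auto
      with dist_triangle[of 0 w z] \<rho> show "w \<in> ball 0 \<rho>" by auto
    qed
    show "g holomorphic_on ball z (\<rho>/4)" using holomorphic_on_subset[OF g] sub ball_subset_cball by blast
    show "continuous_on (cball z (\<rho>/4)) g"
      by (rule continuous_on_subset[OF holomorphic_on_imp_continuous_on[OF g] sub])
    fix w assume "cmod (z - w) = \<rho>/4"
    then have "w \<in> cball z (\<rho>/4)" by (simp add: dist_norm)
    then show "cmod (g w) \<le> B" using sub B by auto
  qed (use \<rho> in auto)
  show "cmod (deriv g 0) \<le> 2 * B / \<rho>" if \<rho>: "0 < \<rho>"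
  proof -
    have "cmod ((deriv ^^ 1) g 0) \<le> fact 1 * B / (\<rho>/2) ^ 1"
    proof (rule Cauchy_inequality)
      show "g holomorphic_on ball 0 (\<rho>/2)" by (rule holomorphic_on_subset[OF g]) (use \<rho> in auto)
      show "continuous_on (cball 0 (\<rho>/2)) g"
        by (rule continuous_on_subset[OF holomorphic_on_imp_continuous_on[OF g]]) (use \<rho> in auto)
      fix w :: complex assume "cmod (0 - w) = \<rho>/2"
      then show "cmod (g w) \<le> B" using B \<rho> unfolding diff_0 norm_minus_cancel by simp
    qed (use \<rho> in auto)
    then show ?thesis by (simp add: mult.commute)
  qed
  show "cmod (g 1 - g 0 - deriv g 0) \<le> 32 * B / \<rho>\<^sup>2" if \<rho>: "2 < \<rho>"
  proof -
    have "cmod ((deriv ^^ 0) g 1 - (\<Sum>i\<le>1. (deriv ^^ i) g 0 * (1 - 0) ^ i / fact i))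
      \<le> 32 * B / \<rho>\<^sup>2 * cmod (1 - 0) ^ Suc 1 / fact 1"
    proof (rule complex_Taylor)
      show "((deriv ^^ i) g has_field_derivative (deriv ^^ Suc i) g x) (at x within ball 0 (\<rho>/2))"
        if "x \<in> ball 0 (\<rho>/2)" for i x
      proof -
        have "(deriv ^^ i) g holomorphic_on ball 0 \<rho>"
          by (rule holomorphic_higher_deriv[OF g]) simp
        then show ?thesis
          using holomorphic_derivI[of "(deriv ^^ i) g" "ball 0 \<rho>" x "ball 0 (\<rho>/2)"] that \<rho> by simp
      qed
      show "cmod ((deriv ^^ Suc 1) g z) \<le> 32 * B / \<rho>\<^sup>2" if "z \<in> ball 0 (\<rho>/2)" for z
        using bd[OF that, of 2] \<rho> by (simp add: numeral_2_eq_2 field_simps)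
    qed (use \<rho> in auto)
    then show ?thesis by (simp add: algebra_simps)
  qed
qed

text \<open>The radius \<rho> measures how far the complex line in direction \<open>v\<close> stays
  inside the domain, so that a short \<open>v\<close> shows up as a large \<rho>. This form fits
  product domains, where different directions leave different room.\<close>

lemma
  assumes f: "holo_on f S" and L: "\<And>z. cmod z < \<rho> \<Longrightarrow> x + cscale z v \<in> S"
    and B: "\<And>z. cmod z < \<rho> \<Longrightarrow> cmod (f (x + cscale z v)) \<le> B"
  shows fder_bound_line: "0 < \<rho> \<Longrightarrow> cmod (fder f v x) \<le> 2 * B / \<rho>"
    and taylor_bound_line: "2 < \<rho> \<Longrightarrow> cmod (f (x + v) - f x - fder f v x) \<le> 32 * B / \<rho>\<^sup>2"
proof -
  have *: "deriv (\<lambda>z. f (x + cscale z v)) 0 = fder f v x" if "0 < \<rho>"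
    using DERIV_imp_deriv[OF holo_on_line[OF f L, of 0]] that by simp
  note b = line_second_deriv_bound[OF holo_on_line_holomorphic'[OF f L] B]
  show "0 < \<rho> \<Longrightarrow> cmod (fder f v x) \<le> 2 * B / \<rho>"
    using b(1) * by simp
  show "2 < \<rho> \<Longrightarrow> cmod (f (x + v) - f x - fder f v x) \<le> 32 * B / \<rho>\<^sup>2"
    using b(2) * by simp
qed

text \<open>The difference quotients in direction \<open>v\<close> converge uniformly near
  \<open>x\<close> to the derivative, hence their derivatives in direction \<open>w\<close> converge
  too; these are in turn difference quotients of the derivative in direction \<open>w\<close>. So
  both mixed derivatives are the same limit.\<close>

lemma fder_commute:
  assumes f: "holo_on f S" and S: "open S" and v: "norm v \<le> 1" and w: "norm w \<le> 1" and x: "x \<in> S"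
  shows "fder (fder f v) w x = fder (fder f w) v x"
proof -
  obtain r0 where r0: "0 < r0" "cball x r0 \<subseteq> S"
    using S x open_contains_cball by blast
  have "bounded (f ` cball x r0)"
    by (intro compact_imp_bounded compact_continuous_image
        continuous_on_subset[OF holo_on_imp_continuous_on[OF f] r0(2)]) simp
  then obtain B where B: "\<And>y. y \<in> cball x r0 \<Longrightarrow> cmod (f y) \<le> B"
    unfolding bounded_iff by blast
  define r where "r = r0 / 2"
  have r: "0 < r" using r0 by (simp add: r_def)
  have sub: "ball y r \<subseteq> cball x r0" if "y \<in> ball x r" for y
  proof
    fix z assume "z \<in> ball y r"
    with that dist_triangle[of x z y] show "z \<in> cball x r0" by (auto simp: r_def)
  qed
  define h :: "nat \<Rightarrow> complex" where "h n = of_real (r / 4 / real (Suc n))" for n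
  have hn: "cmod (h n) = r / 4 / real (Suc n)" for n
    using r by (simp add: h_def del: of_nat_Suc of_real_divide)
  have hpos: "h n \<noteq> 0" for n
    using hn[of n] r by auto
  have hlt: "cmod (h n) < r / 2" for n
  proof -
    have "r / 4 / real (Suc n) \<le> r / 4 / 1"
      by (rule divide_left_mono) (use r in auto)
    then show ?thesis using r hn[of n] by simp
  qed
  have hlim: "(\<lambda>n. cmod (h n)) \<longlonglongrightarrow> 0"
    unfolding hn by (rule real_tendsto_divide_at_top[OF tendsto_const])
      (rule filterlim_compose[OF filterlim_real_sequentially filterlim_Suc])
  have h0: "h \<longlonglongrightarrow> 0" using hlim tendsto_norm_zero_iff by blast
  define g where "g n y = inverse (h n) * (f (y + cscale (h n) v) - f y)" for n y
  have shift: "y + cscale (h n) v \<in> S" if "y \<in> ball x r" for n y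
  proof -
    have "cmod (h n) * norm v \<le> cmod (h n) * 1" by (rule mult_left_mono[OF v]) simp
    then have "norm (cscale (h n) v) < r" using hlt[of n] r by (simp add: norm_cscale)
    then have "y + cscale (h n) v \<in> ball y r" by (simp add: dist_norm)
    then show ?thesis using sub[OF that] r0 by blast
  qed
  have bS: "y \<in> S" if "y \<in> ball x r" for y using that r0 by (auto simp: r_def)
  have hs: "holo_on (\<lambda>y. f (y + cscale (h n) v)) (ball x r)" for n
    by (rule holo_on_shift[OF f shift])
  have fb: "holo_on f (ball x r)" using holo_on_subset[OF f] bS by blast
  have g_holo: "holo_on (g n) (ball x r)" for n
    unfolding g_def by (intro holo_on_mult holo_on_diff holo_on_const hs fb)
  have ul: "uniform_limit (ball x r) g (fder f v) sequentially"
  proof (rule uniform_limitI)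
    fix e :: real assume e: "0 < e"
    have "(\<lambda>n. 32 * B / r\<^sup>2 * cmod (h n)) \<longlonglongrightarrow> 0"
      using tendsto_mult_right_zero[OF hlim] .
    then have "\<forall>\<^sub>F n in sequentially. 32 * B / r\<^sup>2 * cmod (h n) < e"
      using order_tendstoD(2) e by blast
    then show "\<forall>\<^sub>F n in sequentially. \<forall>y\<in>ball x r. dist (g n y) (fder f v y) < e"
    proof eventually_elim
      case (elim n)
      show ?case
      proof
        fix y assume y: "y \<in> ball x r"
        have "cmod ((f (y + cscale (h n) v) - f y) / h n - fder f v y) \<le> 32 * B / r\<^sup>2 * cmod (h n)"
          by (rule fder_quotient[OF f _ r v _ hpos hlt]) (use sub[OF y] r0 B in blast)+
        then show "dist (g n y) (fder f v y) < e" using elim by (simp add: g_def dist_norm field_simps)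
      qed
    qed
  qed
  have xb: "x \<in> ball x r" using r by simp
  have "(\<lambda>n. fder (g n) w x) \<longlonglongrightarrow> fder (fder f v) w x"
    by (rule holo_on_limit_uniform(2)[OF open_ball g_holo ul xb])
  moreover have "fder (g n) w x = inverse (h n) * (fder f w (x + cscale (h n) v) - fder f w x)" for n
  proof -
    have "((\<lambda>y. y + cscale (h n) v) has_derivative (\<lambda>k. k)) (at x)"
      by (auto intro!: derivative_eq_intros)
    from diff_chain_at[OF this holo_onD(1)[OF f shift[OF xb]]]
    have "fder (\<lambda>y. f (y + cscale (h n) v)) w x = fder f w (x + cscale (h n) v)"
      by (intro fder_eqI) (simp add: o_def)
    then show ?thesis unfolding g_def
      by (subst fder_cmult[OF holo_on_diff[OF hs fb] xb], subst fder_diff[OF hs fb xb]) simp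
  qed
  moreover have "(\<lambda>n. inverse (h n) * (fder f w (x + cscale (h n) v) - fder f w x)) \<longlonglongrightarrow> fder (fder f w) v x"
  proof -
    have "((\<lambda>z. fder f w (x + cscale z v)) has_field_derivative fder (fder f w) v (x + cscale 0 v)) (at 0)"
      by (rule holo_on_line[OF holo_on_fder[OF f S w]]) (simp add: x)
    then have "((\<lambda>z. (fder f w (x + cscale z v) - fder f w x) / z) \<longlongrightarrow> fder (fder f w) v x) (at 0)"
      by (simp add: has_field_derivative_iff)
    moreover have "filterlim h (at 0) sequentially"
      using h0 hpos by (auto simp: filterlim_at)
    ultimately have "(\<lambda>n. (fder f w (x + cscale (h n) v) - fder f w x) / h n) \<longlonglongrightarrow> fder (fder f w) v x"
      by (rule filterlim_compose)
    then show ?thesis unfolding divide_inverse by (subst mult.commute)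
  qed
  ultimately show ?thesis using LIMSEQ_unique by simp
qed

lemma taylor_bound_ball:
  assumes f: "holo_on f S" and S: "ball x r \<subseteq> S"
    and B: "\<And>y. y \<in> ball x r \<Longrightarrow> cmod (f y) \<le> B" and v: "norm v < r / 2"
  shows "cmod (f (x + v) - f x - fder f v x) \<le> 32 * B / r\<^sup>2 * (norm v)\<^sup>2"
proof (cases "v = 0")
  case True
  have "x \<in> S" using S v True by auto
  then show ?thesis using True fder_linear_vec(2)[OF f] by simp
next
  case False
  have *: "x + cscale z v \<in> ball x r" if "cmod z < r / norm v" for z
    using that False by (simp add: dist_norm norm_cscale field_simps)
  have "cmod (f (x + v) - f x - fder f v x) \<le> 32 * B / (r / norm v)\<^sup>2"
    by (rule taylor_bound_line[OF f]) (use * S B v False in \<open>auto simp: field_simps\<close>)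
  then show ?thesis by (simp add: power_divide)
qed

text \<open>Differentiation under the integral sign. A bound for \<open>F\<close> on the compact
  product of the unit interval and a closed ball gives a Taylor remainder uniform in \<theta>;
  integrating it shows that the integrated derivative is the derivative of the integral.\<close>

lemma holo_on_integral:
  fixes F :: "real \<Rightarrow> 'n::finite phase \<Rightarrow> complex"
  assumes S: "open S" and F: "\<And>\<theta>. \<theta> \<in> {0..1} \<Longrightarrow> holo_on (F \<theta>) S"
    and C: "continuous_on ({0..1} \<times> S) (\<lambda>(\<theta>, x). F \<theta> x)"
  shows "holo_on (\<lambda>x. integral {0..1} (\<lambda>\<theta>. F \<theta> x)) S" (is "holo_on ?G S")
    and "x \<in> S \<Longrightarrow> fder (\<lambda>x. integral {0..1} (\<lambda>\<theta>. F \<theta> x)) v x = integral {0..1} (\<lambda>\<theta>. fder (F \<theta>) v x)"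
proof -
  have *: "(?G has_derivative (\<lambda>v. integral {0..1} (\<lambda>\<theta>. fder (F \<theta>) v x0))) (at x0)
      \<and> (\<forall>v. continuous_on {0..1} (\<lambda>\<theta>. fder (F \<theta>) v x0))" if x0: "x0 \<in> S" for x0
  proof
    obtain r where r: "0 < r" "cball x0 r \<subseteq> S"
      using S x0 open_contains_cball by blast
    have "bounded ((\<lambda>(\<theta>, x). F \<theta> x) ` ({0..1} \<times> cball x0 r))"
      by (intro compact_imp_bounded compact_continuous_image compact_Times continuous_on_subset[OF C])
        (use r in auto)
    then obtain B where B: "\<And>\<theta> y. \<theta> \<in> {0..1} \<Longrightarrow> y \<in> cball x0 r \<Longrightarrow> cmod (F \<theta> y) \<le> B"
      unfolding bounded_iff by fastforce
    have bS: "ball x0 r \<subseteq> S" using r ball_subset_cball by blast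
    have taylor: "cmod (F \<theta> (x0 + v) - F \<theta> x0 - fder (F \<theta>) v x0) \<le> 32 * B / r\<^sup>2 * (norm v)\<^sup>2"
      if "\<theta> \<in> {0..1}" "norm v < r / 2" for \<theta> v
      by (rule taylor_bound_ball[OF F[OF that(1)] bS _ that(2)]) (use B[OF that(1)] in auto)
    have cF: "continuous_on {0..1} (\<lambda>\<theta>. F \<theta> x)" if "x \<in> S" for x
    proof -
      have "continuous_on {0..1} ((\<lambda>(\<theta>, x). F \<theta> x) \<circ> (\<lambda>\<theta>. (\<theta>, x)))"
        by (intro continuous_on_compose continuous_intros continuous_on_subset[OF C]) (use that in auto)
      then show ?thesis by (simp add: o_def)
    qed
    \<comment> \<open>Joint continuity is assumed of \<open>F\<close> only. The derivative inherits
      continuity in \<theta> as a uniform limit of difference quotients, which makes it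
      integrable.\<close>
    have cd: "continuous_on {0..1} (\<lambda>\<theta>. fder (F \<theta>) v x0)" for v
    proof -
      \<comment> \<open>The step lengths are scaled so that \<open>x0 + cscale (h n) v\<close> stays
        within \<open>r / 2\<close> of \<open>x0\<close>, where the Taylor bound applies.\<close>
      define d where "d = r / (2 * (norm v + 1))"
      have nv: "0 < norm v + 1" by (simp add: add_nonneg_pos)
      have d: "0 < d" using r nv by (simp add: d_def)
      define h :: "nat \<Rightarrow> complex" where "h n = of_real (d / real (Suc n))" for n
      have hn: "cmod (h n) = d / real (Suc n)" for n
        using d by (simp add: h_def del: of_nat_Suc of_real_divide)
      have h0: "h n \<noteq> 0" for n using hn[of n] d by auto
      have hd: "cmod (h n) \<le> d" for n
        unfolding hn using d by (simp add: divide_le_eq)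
      have hv: "norm (cscale (h n) v) < r / 2" for n
      proof -
        have "cmod (h n) * norm v \<le> d * norm v" by (rule mult_right_mono[OF hd]) simp
        also have "\<dots> < d * (norm v + 1)" using d by simp
        also have "\<dots> = r / 2" using nv by (simp add: d_def field_simps)
        finally show ?thesis by (simp add: norm_cscale)
      qed
      have hlim: "(\<lambda>n. cmod (h n)) \<longlonglongrightarrow> 0"
        unfolding hn by (rule real_tendsto_divide_at_top[OF tendsto_const])
          (rule filterlim_compose[OF filterlim_real_sequentially filterlim_Suc])
      let ?q = "\<lambda>n \<theta>. inverse (h n) * (F \<theta> (x0 + cscale (h n) v) - F \<theta> x0)"
      have inS: "x0 + cscale (h n) v \<in> S" for n
        using hv[of n] bS r by (auto simp: dist_norm)
      have est: "cmod (?q n \<theta> - fder (F \<theta>) v x0) \<le> 32 * B / r\<^sup>2 * (norm v)\<^sup>2 * cmod (h n)"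
        if "\<theta> \<in> {0..1}" for n \<theta>
      proof -
        have "?q n \<theta> - fder (F \<theta>) v x0 =
          inverse (h n) * (F \<theta> (x0 + cscale (h n) v) - F \<theta> x0 - fder (F \<theta>) (cscale (h n) v) x0)"
          using h0[of n] by (simp add: holo_onD(2)[OF F[OF that] x0] field_simps)
        also have "cmod \<dots> \<le> inverse (cmod (h n)) * (32 * B / r\<^sup>2 * (norm (cscale (h n) v))\<^sup>2)"
          unfolding norm_mult norm_inverse by (intro mult_left_mono taylor that hv) simp
        also have "\<dots> = 32 * B / r\<^sup>2 * (norm v)\<^sup>2 * cmod (h n)"
          using h0[of n] by (simp add: norm_cscale power2_eq_square)
        finally show ?thesis .
      qed
      show ?thesis
      proof (rule uniform_limit_theorem)
        show "\<forall>\<^sub>F n in sequentially. continuous_on {0..1} (?q n)"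
          by (intro always_eventually allI continuous_intros cF inS x0)
        show "uniform_limit {0..1} ?q (\<lambda>\<theta>. fder (F \<theta>) v x0) sequentially"
        proof (rule uniform_limitI)
          fix e :: real assume e: "0 < e"
          have "(\<lambda>n. 32 * B / r\<^sup>2 * (norm v)\<^sup>2 * cmod (h n)) \<longlonglongrightarrow> 0"
            using tendsto_mult_right_zero[OF hlim] .
          then have "\<forall>\<^sub>F n in sequentially. 32 * B / r\<^sup>2 * (norm v)\<^sup>2 * cmod (h n) < e"
            using order_tendstoD(2) e by blast
          then show "\<forall>\<^sub>F n in sequentially. \<forall>\<theta>\<in>{0..1}. dist (?q n \<theta>) (fder (F \<theta>) v x0) < e"
          proof eventually_elim
            case (elim n)
            then show ?case using est[of _ n] unfolding dist_norm by (meson order_le_less_trans)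
          qed
        qed
      qed simp
    qed
    then show "\<forall>v. continuous_on {0..1} (\<lambda>\<theta>. fder (F \<theta>) v x0)" by blast
    have int: "(\<lambda>\<theta>. fder (F \<theta>) v x0) integrable_on {0..1}" for v
      by (rule integrable_continuous_real[OF cd])
    let ?D = "\<lambda>v. integral {0..1} (\<lambda>\<theta>. fder (F \<theta>) v x0)"
    have "linear ?D"
    proof (rule linearI)
      fix v w :: "'n phase" and c :: real
      have "?D (v + w) = integral {0..1} (\<lambda>\<theta>. fder (F \<theta>) v x0 + fder (F \<theta>) w x0)"
        by (rule integral_cong) (simp add: fder_linear_vec[OF F x0])
      then show "?D (v + w) = ?D v + ?D w" by (simp add: integral_add[OF int int])
      have "?D (c *\<^sub>R v) = integral {0..1} (\<lambda>\<theta>. c *\<^sub>R fder (F \<theta>) v x0)"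
        by (rule integral_cong) (simp add: linear_scale[OF has_derivative_linear[OF holo_onD(1)[OF F x0]]])
      then show "?D (c *\<^sub>R v) = c *\<^sub>R ?D v" by simp
    qed
    then have bl: "bounded_linear ?D" by (simp add: linear_conv_bounded_linear)
    show "(?G has_derivative ?D) (at x0)"
    proof (rule has_derivativeI_sandwich[where s=UNIV and e="r/2" and H="\<lambda>y. 32 * B / r\<^sup>2 * norm (y - x0)"])
      show "((\<lambda>y. 32 * B / r\<^sup>2 * norm (y - x0)) \<longlongrightarrow> 0) (at x0)"
      proof -
        have "((\<lambda>y. 32 * B / r\<^sup>2 * norm (y - x0)) \<longlongrightarrow> 32 * B / r\<^sup>2 * norm (x0 - x0)) (at x0)"
          by (intro tendsto_intros)
        then show ?thesis by simp
      qed
      fix y assume y: "y \<noteq> x0" "dist y x0 < r / 2"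
      let ?R = "\<lambda>\<theta>. F \<theta> y - F \<theta> x0 - fder (F \<theta>) (y - x0) x0"
      have yS: "y \<in> S" using y bS r by (auto simp: dist_commute)
      have "?G y - ?G x0 - ?D (y - x0) = integral {0..1} ?R"
        by (simp add: integral_diff integrable_continuous_real cF[OF yS] cF[OF x0] int integrable_diff)
      moreover have "norm (integral {0..1} ?R) \<le> 32 * B / r\<^sup>2 * (norm (y - x0))\<^sup>2 * (1 - 0)"
      proof (rule integral_bound)
        show "continuous_on {0..1} ?R"
          by (intro continuous_intros cF yS x0 cd)
        show "norm (?R t) \<le> 32 * B / r\<^sup>2 * (norm (y - x0))\<^sup>2" if "t \<in> {0..1}" for t
          using taylor[OF that, of "y - x0"] y(2) by (simp add: dist_norm)
      qed simp
      ultimately have "norm (?G y - ?G x0 - ?D (y - x0)) \<le> 32 * B / r\<^sup>2 * (norm (y - x0))\<^sup>2"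
        by simp
      then show "norm (?G y - ?G x0 - ?D (y - x0)) / norm (y - x0) \<le> 32 * B / r\<^sup>2 * norm (y - x0)"
        using y(1) by (simp add: divide_le_eq power2_eq_square)
    qed (use r bl in auto)
  qed
  show "holo_on ?G S"
    unfolding holo_on_def
  proof (intro ballI exI conjI allI)
    fix x0 c v assume x0: "x0 \<in> S"
    show "(?G has_derivative (\<lambda>v. integral {0..1} (\<lambda>\<theta>. fder (F \<theta>) v x0))) (at x0)"
      using *[OF x0] by blast
    have "integral {0..1} (\<lambda>\<theta>. fder (F \<theta>) (cscale c v) x0) = integral {0..1} (\<lambda>\<theta>. c * fder (F \<theta>) v x0)"
      by (rule integral_cong) (simp add: holo_onD(2)[OF F x0])
    then show "integral {0..1} (\<lambda>\<theta>. fder (F \<theta>) (cscale c v) x0) = c * integral {0..1} (\<lambda>\<theta>. fder (F \<theta>) v x0)"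
      by simp
  qed
  show "x \<in> S \<Longrightarrow> fder ?G v x = integral {0..1} (\<lambda>\<theta>. fder (F \<theta>) v x)"
    using * fder_eqI by blast
qed

subsection \<open>Holomorphic maps\<close>

text \<open>Holomorphy is recorded coordinate by coordinate, so that all scalar results apply
  directly.\<close>

definition hmap :: "('n::finite phase \<Rightarrow> 'n phase) \<Rightarrow> 'n phase set \<Rightarrow> bool" where
  "hmap \<Phi> S \<longleftrightarrow> (\<forall>i. holo_on (\<lambda>x. fst (\<Phi> x) $ i) S) \<and> (\<forall>i. holo_on (\<lambda>x. fst (snd (\<Phi> x)) $ i) S) \<and>
     holo_on (\<lambda>x. snd (snd (\<Phi> x))) S"

definition hder :: "('n::finite phase \<Rightarrow> 'n phase) \<Rightarrow> 'n phase \<Rightarrow> 'n phase \<Rightarrow> 'n phase" where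
  "hder \<Phi> v x = (\<chi> i. fder (\<lambda>x. fst (\<Phi> x) $ i) v x, \<chi> i. fder (\<lambda>x. fst (snd (\<Phi> x)) $ i) v x,
     fder (\<lambda>x. snd (snd (\<Phi> x))) v x)"

lemma hmapD:
  assumes "hmap \<Phi> S"
  shows "holo_on (\<lambda>x. fst (\<Phi> x) $ i) S" "holo_on (\<lambda>x. fst (snd (\<Phi> x)) $ i) S" "holo_on (\<lambda>x. snd (snd (\<Phi> x))) S"
  using assms by (auto simp: hmap_def)

lemma has_derivative_vec:
  fixes f :: "'a::real_normed_vector \<Rightarrow> complex ^ 'n::finite"
  assumes "\<And>i. ((\<lambda>x. f x $ i) has_derivative (\<lambda>v. f' v $ i)) F"
  shows "(f has_derivative f') F"
proof -
  have e: "(\<lambda>x. \<Sum>i\<in>UNIV. axis i (f x $ i)) = f" "(\<lambda>x. \<Sum>i\<in>UNIV. axis i (f' x $ i)) = f'"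
    by (auto simp: vec_eq_iff axis_def if_distrib cong: if_cong)
  have bl: "bounded_linear (axis i :: complex \<Rightarrow> complex ^ 'n)" for i
    unfolding linear_conv_bounded_linear[symmetric]
    by (rule linearI) (auto simp: axis_def vec_eq_iff)
  have "((\<lambda>x. \<Sum>i\<in>UNIV. axis i (f x $ i)) has_derivative (\<lambda>x. \<Sum>i\<in>UNIV. axis i (f' x $ i))) F"
    by (rule has_derivative_sum) (rule bounded_linear.has_derivative[OF bl assms])
  then show ?thesis unfolding e .
qed

lemma hmap_derivative:
  assumes "hmap \<Phi> S" "x \<in> S"
  shows "(\<Phi> has_derivative (\<lambda>v. hder \<Phi> v x)) (at x)"
proof -
  have "((\<lambda>x. (fst (\<Phi> x), fst (snd (\<Phi> x)), snd (snd (\<Phi> x)))) has_derivative (\<lambda>v. hder \<Phi> v x)) (at x)"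
    unfolding hder_def
    by (intro has_derivative_Pair has_derivative_vec; (unfold vec_lambda_beta)?)
      (rule holo_onD(1)[OF hmapD(1)[OF assms(1)] assms(2)] holo_onD(1)[OF hmapD(2)[OF assms(1)] assms(2)]
        holo_onD(1)[OF hmapD(3)[OF assms(1)] assms(2)])+
  then show ?thesis by simp
qed

lemma
  assumes f: "holo_on f T" and \<Phi>: "hmap \<Phi> S" and sub: "\<And>x. x \<in> S \<Longrightarrow> \<Phi> x \<in> T"
  shows holo_on_compose: "holo_on (\<lambda>x. f (\<Phi> x)) S"
    and fder_compose: "x \<in> S \<Longrightarrow> fder (\<lambda>x. f (\<Phi> x)) v x = fder f (hder \<Phi> v x) (\<Phi> x)"
proof -
  have d: "((\<lambda>x. f (\<Phi> x)) has_derivative (\<lambda>v. fder f (hder \<Phi> v x) (\<Phi> x))) (at x)" if x: "x \<in> S" for x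
    using diff_chain_at[OF hmap_derivative[OF \<Phi> x] holo_onD(1)[OF f sub[OF x]]]
    by (simp add: o_def)
  have s: "hder \<Phi> (cscale c v) x = cscale c (hder \<Phi> v x)" if "x \<in> S" for c v x
    using \<Phi> holo_onD(2)[OF _ that] unfolding hder_def cscale_def hmap_def
    by (auto simp: vec_eq_iff)
  show "holo_on (\<lambda>x. f (\<Phi> x)) S"
    unfolding holo_on_def
  proof (intro ballI exI conjI allI)
    fix x c v assume x: "x \<in> S"
    show "((\<lambda>x. f (\<Phi> x)) has_derivative (\<lambda>v. fder f (hder \<Phi> v x) (\<Phi> x))) (at x)" by (rule d[OF x])
    show "fder f (hder \<Phi> (cscale c v) x) (\<Phi> x) = c * fder f (hder \<Phi> v x) (\<Phi> x)"
      by (simp add: s[OF x] holo_onD(2)[OF f sub[OF x]])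
  qed
  show "x \<in> S \<Longrightarrow> fder (\<lambda>x. f (\<Phi> x)) v x = fder f (hder \<Phi> v x) (\<Phi> x)"
    by (rule fder_eqI[OF d])
qed

lemma hmap_compose:
  assumes "hmap \<Psi> T" "hmap \<Phi> S" "\<And>x. x \<in> S \<Longrightarrow> \<Phi> x \<in> T"
  shows "hmap (\<lambda>x. \<Psi> (\<Phi> x)) S"
  unfolding hmap_def
  by (intro conjI allI holo_on_compose[OF _ assms(2,3)])
    (use assms(1) in \<open>auto simp: hmap_def\<close>)

lemma hmap_subset: "hmap \<Phi> S \<Longrightarrow> T \<subseteq> S \<Longrightarrow> hmap \<Phi> T"
  by (auto simp: hmap_def intro: holo_on_subset)

subsection \<open>Polydomains\<close>

text \<open>The neighbourhood \<open>toric_nhd\<close> with a separate radius \<tau> for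
  \<open>t\<close>: all maps of the iteration fix \<open>t\<close>, so only \<open>s\<close> has to
  shrink.\<close>

definition tdom :: "real \<Rightarrow> real \<Rightarrow> 'n::finite phase set" where
  "tdom s \<tau> = {x. (\<forall>i. 1 - s < cmod (fst x $ i) \<and> cmod (fst x $ i) < 1 + s) \<and>
     (\<forall>i. cmod (fst (snd x) $ i) < s) \<and> cmod (snd (snd x)) < \<tau>}"

lemma toric_nhd_eq_tdom: "toric_nhd s = tdom s s"
  by (auto simp: toric_nhd_def tdom_def)

lemma open_tdom: "open (tdom s \<tau>)"
  unfolding tdom_def Collect_conj_eq Collect_all_eq
  by (intro open_Int open_INT finite ballI open_Collect_less continuous_intros)

text \<open>A displacement without \<open>t\<close> component: moving a point by it costs \<delta>
  in the radius \<open>s\<close> and nothing in \<tau>.\<close>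

definition small :: "real \<Rightarrow> 'n::finite phase \<Rightarrow> bool" where
  "small \<delta> v \<longleftrightarrow> (\<forall>i. cmod (fst v $ i) \<le> \<delta>) \<and> (\<forall>i. cmod (fst (snd v) $ i) \<le> \<delta>) \<and> snd (snd v) = 0"

lemma small_cscale: "small \<delta> v \<Longrightarrow> small (cmod z * \<delta>) (cscale z v)"
  by (auto simp: small_def cscale_def norm_mult mult_left_mono split: prod.splits)

lemma small_axis: "small 1 (axis i 1, 0, 0)" "small 1 (0, axis i 1, 0)"
  by (auto simp: small_def axis_def)

lemma tdom_shift:
  assumes x: "x \<in> tdom s \<tau>" and y: "small \<delta> y"
  shows "x + y \<in> tdom (s + \<delta>) \<tau>"
proof -
  have "1 - (s + \<delta>) < cmod (fst x $ i + fst y $ i)" "cmod (fst x $ i + fst y $ i) < 1 + (s + \<delta>)"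
    "cmod (fst (snd x) $ i + fst (snd y) $ i) < s + \<delta>" for i
    using norm_triangle_ineq[of "fst x $ i" "fst y $ i"] norm_diff_ineq[of "fst x $ i" "fst y $ i"]
      norm_triangle_ineq[of "fst (snd x) $ i" "fst (snd y) $ i"] x y
    unfolding tdom_def small_def mem_Collect_eq by (smt (verit, best))+
  then show ?thesis using x y by (auto simp: tdom_def small_def)
qed

lemma tdom_mono: "s \<le> s' \<Longrightarrow> \<tau> \<le> \<tau>' \<Longrightarrow> x \<in> tdom s \<tau> \<Longrightarrow> x \<in> tdom s' \<tau>'"
  unfolding tdom_def mem_Collect_eq by (smt (verit, best))

lemma tdom_shift_line:
  assumes x: "x \<in> tdom (s - \<sigma>) \<tau>" and v: "small \<delta> v" and "0 < \<delta>" and z: "cmod z < \<sigma> / \<delta>"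
  shows "x + cscale z v \<in> tdom s \<tau>"
proof -
  have "cmod z * \<delta> \<le> \<sigma>" using z assms(3) by (simp add: field_simps)
  then show ?thesis using tdom_mono[OF _ order_refl tdom_shift[OF x small_cscale[OF v, of z]]] by simp
qed

lemma small_0: "small 0 v \<Longrightarrow> v = 0"
  by (simp add: small_def prod_eq_iff vec_eq_iff)

text \<open>A displacement of size \<delta> can be multiplied by any complex number of modulus below
  \<sigma>/\<delta> without leaving the larger domain; Cauchy's inequality on that disc yields the
  factor \<delta>/\<sigma>.\<close>

lemma fder_tdom:
  assumes f: "holo_on f (tdom s \<tau>)" and B: "\<And>y. y \<in> tdom s \<tau> \<Longrightarrow> cmod (f y) \<le> B"
    and \<sigma>: "0 < \<sigma>" and x: "x \<in> tdom (s - \<sigma>) \<tau>" and v: "small \<delta> v" and \<delta>: "0 \<le> \<delta>"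
  shows "cmod (fder f v x) \<le> 2 * B * \<delta> / \<sigma>"
\<comment> \<open>The quotient \<sigma>/\<delta> would be 0 here, not infinity, and the disc would
  degenerate.\<close>
proof (cases "\<delta> = 0")
  case True
  have "x \<in> tdom s \<tau>" by (rule tdom_mono[OF _ _ x]) (use \<sigma> in auto)
  moreover have "v = 0" using small_0 v True by blast
  ultimately show ?thesis using True fder_linear_vec(2)[OF f] by simp
next
  case False
  then have "0 < \<delta>" using \<delta> by simp
  note L = tdom_shift_line[OF x v this]
  have "cmod (fder f v x) \<le> 2 * B / (\<sigma> / \<delta>)"
    by (rule fder_bound_line[OF f L B[OF L]]) (use \<sigma> False \<delta> in auto)
  then show ?thesis by simp
qed

lemma taylor_tdom:
  assumes f: "holo_on f (tdom s \<tau>)" and B: "\<And>y. y \<in> tdom s \<tau> \<Longrightarrow> cmod (f y) \<le> B"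
    and \<sigma>: "0 < \<sigma>" and x: "x \<in> tdom (s - \<sigma>) \<tau>" and v: "small \<delta> v" and \<delta>: "0 \<le> \<delta>" "\<delta> < \<sigma> / 2"
  shows "cmod (f (x + v) - f x - fder f v x) \<le> 32 * B * (\<delta> / \<sigma>)\<^sup>2"
proof (cases "\<delta> = 0")
  case True
  have "x \<in> tdom s \<tau>" by (rule tdom_mono[OF _ _ x]) (use \<sigma> in auto)
  moreover have "v = 0" using small_0 v True by blast
  ultimately show ?thesis using True fder_linear_vec(2)[OF f] by simp
next
  case False
  then have d: "0 < \<delta>" using \<delta> by simp
  note L = tdom_shift_line[OF x v this]
  have "cmod (f (x + v) - f x - fder f v x) \<le> 32 * B / (\<sigma> / \<delta>)\<^sup>2"
    by (rule taylor_bound_line[OF f L B[OF L]]) (use \<sigma> d \<delta> in \<open>auto simp: field_simps\<close>)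
  then show ?thesis by (simp add: power_divide)
qed

subsection \<open>Laurent coefficients\<close>

abbreviation unit_exp :: "real \<Rightarrow> complex" where
  "unit_exp \<theta> \<equiv> exp (2 * of_real pi * \<i> * of_real \<theta>)"

text \<open>The Laurent coefficient as an average over the unit circle, parametrised by the unit
  interval so that it can be differentiated under the integral with respect to further
  variables.\<close>

definition lc :: "(complex \<Rightarrow> complex) \<Rightarrow> int \<Rightarrow> complex" where
  "lc f m = integral {0..1} (\<lambda>\<theta>. unit_exp \<theta> powi (- m) * f (unit_exp \<theta>))"

definition annulus :: "real \<Rightarrow> complex set" where
  "annulus s = {z. 1 - s < cmod z \<and> cmod z < 1 + s}"

lemma open_annulus: "open (annulus s)"
  unfolding annulus_def Collect_conj_eq by (intro open_Int open_Collect_less continuous_intros)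

lemma norm_unit_exp [simp]: "cmod (unit_exp \<theta>) = 1"
  by (simp add: norm_exp_eq_Re)

text \<open>All circles about 0 inside the annulus are homotopic there, and the coefficient is a
  contour integral of a function holomorphic on the annulus. The radius may therefore be adapted to
  the sign of \<open>m\<close>, which is what gives decay in both directions.\<close>

lemma lc_radius:
  fixes r :: real
  assumes f: "f holomorphic_on annulus s" and s: "0 < s" "s < 1" and r: "1 - s < r" "r < 1 + s"
  shows "lc f m = integral {0..1} (\<lambda>\<theta>. (r * unit_exp \<theta>) powi (- m) * f (r * unit_exp \<theta>))"
proof -
  let ?g = "\<lambda>w. f w * w powi (- m - 1)"
  have r0: "0 < r" using r s by simp
  have nz: "z \<noteq> 0" if "z \<in> annulus s" for z using that s by (auto simp: annulus_def)
  have hol: "?g holomorphic_on annulus s"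
    by (intro holomorphic_intros f) (use nz in auto)
  have c: "contour_integral (circlepath 0 \<rho>) ?g =
      2 * of_real pi * \<i> * integral {0..1} (\<lambda>\<theta>. (\<rho> * unit_exp \<theta>) powi (- m) * f (\<rho> * unit_exp \<theta>))"
    if "0 < \<rho>" for \<rho> :: real
  proof -
    have "contour_integral (circlepath 0 \<rho>) ?g = integral {0..1} (\<lambda>x. ?g (circlepath 0 \<rho> x) *
        vector_derivative (circlepath 0 \<rho>) (at x))"
      by (rule contour_integral_integral)
    also have "\<dots> = integral {0..1} (\<lambda>\<theta>. 2 * of_real pi * \<i> *
        ((\<rho> * unit_exp \<theta>) powi (- m) * f (\<rho> * unit_exp \<theta>)))"
    proof (rule integral_cong)
      fix \<theta> :: real
      define w where "w = \<rho> * unit_exp \<theta>"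
      have w: "w \<noteq> 0" using that by (simp add: w_def)
      have "w powi (- m) = w powi (- m - 1) * w"
        using power_int_add_1[of w "- m - 1"] w by simp
      then show "?g (circlepath 0 \<rho> \<theta>) * vector_derivative (circlepath 0 \<rho>) (at \<theta>) =
        2 * of_real pi * \<i> * ((\<rho> * unit_exp \<theta>) powi (- m) * f (\<rho> * unit_exp \<theta>))"
        unfolding vector_derivative_circlepath unfolding circlepath add_0 w_def[symmetric]
        by (simp add: w_def)
    qed
    finally show ?thesis by simp
  qed
  have "homotopic_loops (annulus s) (circlepath 0 1) (circlepath 0 r)"
  proof (rule homotopic_loops_linear)
    fix \<theta> :: real
    show "closed_segment (circlepath 0 1 \<theta>) (circlepath 0 r \<theta>) \<subseteq> annulus s"
    proof
      fix z assume "z \<in> closed_segment (circlepath 0 1 \<theta>) (circlepath 0 r \<theta>)"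
      then obtain u where u: "0 \<le> u" "u \<le> 1" "z = (1 - u) *\<^sub>R unit_exp \<theta> + u *\<^sub>R (r * unit_exp \<theta>)"
        by (auto simp: closed_segment_def circlepath)
      then have "z = of_real (1 - u + u * r) * unit_exp \<theta>"
        by (simp add: scaleR_conv_of_real algebra_simps)
      moreover have "1 - u + u * r = 1 + u * (r - 1)" by (simp add: algebra_simps)
      moreover have "\<bar>u * (r - 1)\<bar> \<le> 1 * \<bar>r - 1\<bar>" unfolding abs_mult by (intro mult_right_mono) (use u in auto)
      ultimately have "cmod z = \<bar>1 + u * (r - 1)\<bar>" "\<bar>u * (r - 1)\<bar> < s"
        using r by (auto simp: norm_mult simp del: of_real_add of_real_diff)
      then show "z \<in> annulus s" using s by (auto simp: annulus_def)
    qed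
  qed auto
  from Cauchy_theorem_homotopic_loops[OF this open_annulus hol]
  have "contour_integral (circlepath 0 1) ?g = contour_integral (circlepath 0 r) ?g" by simp
  then show ?thesis unfolding lc_def using c[of 1] c[OF r0] by simp
qed

lemma lc_continuous:
  assumes f: "f holomorphic_on annulus s" and s: "0 < s" "s < 1" and r: "1 - s < r" "r < 1 + s"
  shows "continuous_on {0..1} (\<lambda>\<theta>. (of_real r * unit_exp \<theta>) powi m * f (of_real r * unit_exp \<theta>))"
proof -
  have "continuous_on {0..1} (f \<circ> (\<lambda>\<theta>. of_real r * unit_exp \<theta>))"
    by (intro continuous_on_compose continuous_intros
        continuous_on_subset[OF holomorphic_on_imp_continuous_on[OF f]])
      (use r s in \<open>auto simp: annulus_def norm_mult\<close>)
  then show ?thesis using r s by (intro continuous_intros) (auto simp: o_def)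
qed

lemma lc_bound:
  assumes f: "f holomorphic_on annulus s" and s: "0 < s" "s < 1" and r: "1 - s < r" "r < 1 + s"
    and B: "\<And>z. cmod z = r \<Longrightarrow> cmod (f z) \<le> B"
  shows "cmod (lc f m) \<le> B * r powi (- m)"
proof -
  have "cmod (lc f m) \<le> r powi (- m) * B * (1 - 0)"
    unfolding lc_radius[OF f s r]
  proof (rule integral_bound)
    show "continuous_on {0..1} (\<lambda>\<theta>. (of_real r * unit_exp \<theta>) powi (- m) * f (of_real r * unit_exp \<theta>))"
      by (rule lc_continuous[OF f s r])
    fix \<theta> :: real
    have n: "cmod (of_real r * unit_exp \<theta>) = r" using r s by (simp add: norm_mult)
    have "cmod ((of_real r * unit_exp \<theta>) powi (- m) * f (of_real r * unit_exp \<theta>)) =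
        r powi (- m) * cmod (f (of_real r * unit_exp \<theta>))"
      unfolding norm_mult[of "_ powi _"] norm_power_int n ..
    also have "\<dots> \<le> r powi (- m) * B"
      by (rule mult_left_mono[OF B[OF n]]) (use r s in \<open>simp add: zero_le_power_int\<close>)
    finally show "cmod ((of_real r * unit_exp \<theta>) powi (- m) * f (of_real r * unit_exp \<theta>)) \<le> r powi (- m) * B" .
  qed simp
  then show ?thesis by (simp add: mult.commute)
qed

lemma lc_const: "lc (\<lambda>_. c) m = (if m = 0 then c else 0)"
proof (cases "m = 0")
  case False
  define d where "d = 2 * of_real pi * \<i> * of_int (- m)"
  have d: "d \<noteq> 0" using False by (simp add: d_def)
  have e: "unit_exp \<theta> powi (- m) = exp (d * of_real \<theta>)" for \<theta>
    by (simp add: exp_power_int d_def algebra_simps)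
  have "((\<lambda>\<theta>. exp (d * of_real \<theta>)) has_integral (exp (d * of_real 1) / d - exp (d * of_real 0) / d)) {0..1}"
  proof (rule fundamental_theorem_of_calculus)
    fix x :: real
    have "((\<lambda>z. exp (d * z) / d) has_field_derivative exp (d * of_real x)) (at (of_real x))"
      by (rule derivative_eq_intros refl | use d in simp)+
    then show "((\<lambda>a. exp (d * of_real a) / d) has_vector_derivative exp (d * of_real x)) (at x within {0..1})"
      using has_vector_derivative_real_field by blast
  qed simp
  moreover have "exp d = 1" unfolding d_def
    using exp_integer_2pi[of "of_int (- m)"] by (simp add: mult_ac)
  ultimately have "integral {0..1} (\<lambda>\<theta>. exp (d * of_real \<theta>)) = 0"
    by (simp add: integral_unique)
  then show ?thesis unfolding lc_def e using False by simp
qed (simp add: lc_def)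

section \<open>Unconditional sums and the Laurent expansion in one variable\<close>

lemma has_sum_imp_sums_sets:
  assumes f: "(f has_sum S) A" and X: "\<And>n. finite (X n)" "\<And>n. X n \<subseteq> A"
    and ev: "\<And>a. a \<in> A \<Longrightarrow> \<forall>\<^sub>F n in sequentially. a \<in> X n"
  shows "(\<lambda>n. sum f (X n)) \<longlonglongrightarrow> S" and "filterlim X (finite_subsets_at_top A) sequentially"
proof -
  show *: "filterlim X (finite_subsets_at_top A) sequentially"
    unfolding filterlim_finite_subsets_at_top
  proof (intro allI impI)
    fix Y assume Y: "finite Y \<and> Y \<subseteq> A"
    then have "\<forall>\<^sub>F n in sequentially. \<forall>a\<in>Y. a \<in> X n"
      using ev by (intro eventually_ball_finite) auto
    then show "\<forall>\<^sub>F n in sequentially. finite (X n) \<and> Y \<subseteq> X n \<and> X n \<subseteq> A"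
      by eventually_elim (use X in auto)
  qed
  show "(\<lambda>n. sum f (X n)) \<longlonglongrightarrow> S"
    using filterlim_compose[OF f[unfolded has_sum_def] *] .
qed

text \<open>The integers are split into the values \<open>int n\<close> and
  \<open>- int n - 1\<close>, two copies of the naturals; the negative half carries an extra factor
  \<open>c\<close>.\<close>

lemma has_sum_int_geometric:
  fixes c :: real assumes c: "0 \<le> c" "c < 1"
  shows "((\<lambda>m::int. c ^ nat \<bar>m\<bar>) has_sum (1 + c) / (1 - c)) UNIV"
proof -
  have g: "((\<lambda>n::nat. c ^ n) has_sum 1 / (1 - c)) UNIV"
    using geometric_sums[of c] c by (intro norm_summable_imp_has_sum) (auto simp: summable_geometric power_abs)
  have "((\<lambda>m::int. c ^ nat \<bar>m\<bar>) has_sum 1 / (1 - c)) (range int)"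
    unfolding has_sum_reindex[OF inj_of_nat] using g by (simp add: o_def)
  moreover have "((\<lambda>m::int. c ^ nat \<bar>m\<bar>) has_sum c / (1 - c)) (range (\<lambda>n. - int n - 1))"
  proof -
    have "inj (\<lambda>n. - int n - 1)" by (auto intro: injI)
    moreover have "((\<lambda>n. c * c ^ n) has_sum c * (1 / (1 - c))) UNIV" by (rule has_sum_cmult_right[OF g])
    moreover have "nat \<bar>- int n - 1\<bar> = Suc n" for n by simp
    ultimately show ?thesis by (subst has_sum_reindex) (simp_all add: o_def)
  qed
  moreover have "range int \<inter> range (\<lambda>n. - int n - 1) = {}" by auto
  ultimately have "((\<lambda>m::int. c ^ nat \<bar>m\<bar>) has_sum 1 / (1 - c) + c / (1 - c)) (range int \<union> range (\<lambda>n. - int n - 1))"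
    by (rule has_sum_Un_disjoint)
  moreover have "range int \<union> range (\<lambda>n. - int n - 1) = UNIV"
  proof -
    have "m \<in> range int \<union> range (\<lambda>n. - int n - 1)" for m :: int
    proof (cases "0 \<le> m")
      case False
      then have "m = - int (nat (- m - 1)) - 1" by simp
      then show ?thesis by blast
    qed (metis UnI1 nat_0_le rangeI)
    then show ?thesis by blast
  qed
  ultimately show ?thesis by (simp add: add_divide_distrib)
qed

text \<open>The circle lies half way between the boundaries of the smaller and the larger annulus,
  on the favourable side: outside for nonnegative \<open>m\<close>, inside for negative
  \<open>m\<close>. Since the radii involved are below 2, the ratio of the moduli is at most 1 -
  \<sigma>/4.\<close>

lemma powi_quotient_bound:
  fixes q :: real
  assumes q: "1 - s + \<sigma> < q" "q < 1 + s - \<sigma>" and \<sigma>: "0 < \<sigma>" "\<sigma> < s" "s < 1"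
  defines "r m \<equiv> (if 0 \<le> m then 1 + s - \<sigma> / 2 else 1 - s + \<sigma> / 2)"
  shows "r m powi (- m) * q powi m \<le> (1 - \<sigma> / 4) ^ nat \<bar>m\<bar>"
proof (cases "0 \<le> m")
  case True
  have "q / r m \<le> 1 - \<sigma> / 4"
  proof -
    have "1 + s - \<sigma> \<le> (1 - \<sigma> / 4) * (1 + s - \<sigma> / 2)"
    proof -
      have "(1 - \<sigma> / 4) * (1 + s - \<sigma> / 2) = 1 + s - \<sigma> / 2 - \<sigma> / 4 * (1 + s - \<sigma> / 2)"
        by (simp add: algebra_simps)
      moreover have "\<sigma> / 4 * (1 + s - \<sigma> / 2) \<le> \<sigma> / 4 * 2" by (rule mult_left_mono) (use \<sigma> in auto)
      ultimately show ?thesis by simp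
    qed
    then show ?thesis using True q \<sigma> by (simp add: r_def divide_le_eq)
  qed
  then have "(q / r m) ^ nat m \<le> (1 - \<sigma> / 4) ^ nat m"
    by (rule power_mono) (use q \<sigma> True in \<open>auto simp: r_def\<close>)
  moreover have "r m powi (- m) * q powi m = (q / r m) powi m"
    unfolding power_int_divide_distrib power_int_minus unfolding divide_inverse by (rule mult.commute)
  ultimately show ?thesis using True by (simp add: power_int_def)
next
  case False
  have "r m / q \<le> 1 - \<sigma> / 4"
  proof -
    have "1 - s + \<sigma> / 2 \<le> (1 - \<sigma> / 4) * (1 - s + \<sigma>)"
    proof -
      have "(1 - \<sigma> / 4) * (1 - s + \<sigma>) = 1 - s + \<sigma> - \<sigma> / 4 * (1 - s + \<sigma>)"
        by (simp add: algebra_simps)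
      moreover have "\<sigma> / 4 * (1 - s + \<sigma>) \<le> \<sigma> / 4 * 2" by (rule mult_left_mono) (use \<sigma> in auto)
      ultimately show ?thesis by simp
    qed
    also have "\<dots> \<le> (1 - \<sigma> / 4) * q" by (rule mult_left_mono) (use q \<sigma> in auto)
    finally show ?thesis using False q \<sigma> by (simp add: r_def divide_le_eq)
  qed
  then have "(r m / q) ^ nat (- m) \<le> (1 - \<sigma> / 4) ^ nat (- m)"
    by (rule power_mono) (use q \<sigma> False in \<open>auto simp: r_def\<close>)
  moreover have "r m powi (- m) * q powi m = (r m / q) powi (- m)"
    unfolding power_int_divide_distrib power_int_minus unfolding divide_inverse by simp
  ultimately show ?thesis using False by (simp add: power_int_def)
qed

text \<open>The divided difference \<open>k\<close> of \<open>f\<close> at \<open>z\<close> is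
  holomorphic on the whole annulus, and comparing coefficients in
  \<open>(w - z) * k w = f w - f z\<close> expresses those of \<open>f\<close> through those of
  \<open>k\<close>. Multiplied by \<open>z powi m\<close> the relation telescopes, and the boundary
  terms decay geometrically. Principal and regular part are thus handled at once.\<close>

lemma laurent_has_sum:
  assumes f: "f holomorphic_on annulus s" and B: "\<And>z. z \<in> annulus s \<Longrightarrow> cmod (f z) \<le> B"
    and \<sigma>: "0 < \<sigma>" "\<sigma> < s" "s < 1" and z: "z \<in> annulus (s - \<sigma>)"
  shows "((\<lambda>m. lc f m * z powi m) has_sum f z) UNIV"
proof -
  have s: "0 < s" "s < 1" using \<sigma> by auto
  have zq: "1 - s + \<sigma> < cmod z" "cmod z < 1 + s - \<sigma>" using z by (auto simp: annulus_def)
  have zA: "z \<in> annulus s" using zq \<sigma> by (auto simp: annulus_def)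
  have z0: "z \<noteq> 0" using zq \<sigma> by auto
  define r where "r m = (if 0 \<le> m then 1 + s - \<sigma> / 2 else 1 - s + \<sigma> / 2)" for m :: int
  have r: "1 - s < r m" "r m < 1 + s" for m using \<sigma> by (auto simp: r_def)
  define c where "c = 1 - \<sigma> / 4"
  have c: "0 \<le> c" "c < 1" using \<sigma> by (auto simp: c_def)
  have gen: "cmod (lc g m * z powi m) \<le> C * c ^ nat \<bar>m\<bar>"
    if "g holomorphic_on annulus s" "\<And>w. cmod w = r m \<Longrightarrow> cmod (g w) \<le> C" "0 \<le> C" for g C m
  proof -
    have "cmod (lc g m) * cmod z powi m \<le> C * r m powi (- m) * cmod z powi m"
      by (intro mult_right_mono lc_bound[OF that(1) s r] that(2)) (auto simp: zero_le_power_int)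
    also have "\<dots> \<le> C * c ^ nat \<bar>m\<bar>"
      using mult_left_mono[OF powi_quotient_bound[OF zq \<sigma>, of m] that(3)] by (simp add: mult.assoc r_def c_def)
    finally show ?thesis by (simp add: norm_mult norm_power_int)
  qed
  have B0: "0 \<le> B" using B[OF zA] norm_ge_zero order_trans by blast
  define k where "k w = (if w = z then deriv f z else (f w - f z) / (w - z))" for w
  have k: "k holomorphic_on annulus s"
    unfolding k_def by (rule pole_lemma_open[OF f open_annulus])
  \<comment> \<open>The circle chosen for \<open>m\<close> keeps distance at least \<sigma>/2 from
    \<open>z\<close>, so the bound depends neither on \<open>w\<close> nor on
    \<open>m\<close>.\<close>
  have kb: "cmod (k w) \<le> 4 * B / \<sigma>" if "cmod w = r m" for w m
  proof -
    have d: "\<sigma> / 2 \<le> cmod (w - z)"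
      using norm_triangle_ineq2[of w z] norm_triangle_ineq2[of z w] that zq norm_minus_commute[of w z] \<sigma>
      by (auto simp: r_def split: if_splits)
    have "w \<in> annulus s" using that r by (auto simp: annulus_def)
    then have "cmod (f w - f z) \<le> B + B" using norm_triangle_ineq4[of "f w" "f z"] B[OF zA] B[of w] by simp
    moreover have "w \<noteq> z" using d \<sigma> by auto
    ultimately have "cmod (k w) \<le> (B + B) / (\<sigma> / 2)"
      unfolding k_def using d \<sigma> B0 by (simp only: if_False norm_divide) (intro frac_le; simp)
    then show ?thesis by (simp add: field_simps)
  qed
  have rel: "lc f m - (if m = 0 then f z else 0) = lc k (m - 1) - z * lc k m" for m
  proof -
    have cont: "continuous_on {0..1} (\<lambda>\<theta>. unit_exp \<theta> powi m * g (unit_exp \<theta>))"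
      if "g holomorphic_on annulus s" for g m
      using lc_continuous[OF that s, of 1 m] s by simp
    have "lc f m - lc (\<lambda>_. f z) m = integral {0..1} (\<lambda>\<theta>. unit_exp \<theta> powi (- m) * f (unit_exp \<theta>) -
        unit_exp \<theta> powi (- m) * f z)"
      unfolding lc_def using cont[OF f] cont[of "\<lambda>_. f z"]
      by (intro integral_diff[symmetric] integrable_continuous_real) auto
    also have "\<dots> = integral {0..1} (\<lambda>\<theta>. unit_exp \<theta> powi (- (m - 1)) * k (unit_exp \<theta>) -
        z * (unit_exp \<theta> powi (- m) * k (unit_exp \<theta>)))"
    proof (rule integral_cong)
      fix \<theta> :: real
      define w where "w = unit_exp \<theta>"
      have "(w - z) * k w = f w - f z" by (simp add: k_def)
      then have "w powi (- m) * (f w - f z) = w powi (- m) * w * k w - z * (w powi (- m) * k w)"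
        by (metis (no_types, lifting) left_diff_distrib mult.assoc mult.left_commute right_diff_distrib)
      moreover have "w powi (- m) * w = w powi (- (m - 1))"
        using power_int_add_1[of w "- m"] by (simp add: w_def)
      ultimately show "unit_exp \<theta> powi (- m) * f (unit_exp \<theta>) - unit_exp \<theta> powi (- m) * f z =
        unit_exp \<theta> powi (- (m - 1)) * k (unit_exp \<theta>) - z * (unit_exp \<theta> powi (- m) * k (unit_exp \<theta>))"
        unfolding w_def[symmetric] by (simp add: algebra_simps)
    qed
    also have "\<dots> = lc k (m - 1) - z * lc k m"
      unfolding lc_def
      by (subst integral_diff[OF integrable_continuous_real[OF cont[OF k]]
            integrable_continuous_real[OF continuous_on_mult_left[OF cont[OF k]]]]) simp
    finally show ?thesis by (simp add: lc_const)
  qed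
  \<comment> \<open>The terms whose differences make up the series; at both ends of a symmetric
    partial sum they tend to 0.\<close>
  define a where "a m = z powi m * lc k (m - 1)" for m
  have step: "lc f m * z powi m = (if m = 0 then f z else 0) + (a m - a (m + 1))" for m
  proof -
    have "lc f m * z powi m = (if m = 0 then f z else 0) * z powi m + (lc k (m - 1) - z * lc k m) * z powi m"
      using rel[of m] unfolding diff_eq_eq distrib_right[symmetric] by (simp only: add.commute)
    also have "(if m = 0 then f z else 0) * z powi m = (if m = 0 then f z else 0)" by simp
    also have "(lc k (m - 1) - z * lc k m) * z powi m = a m - a (m + 1)"
      using power_int_add_1[of z m] z0 by (simp add: a_def algebra_simps)
    finally show ?thesis .
  qed
  have partial: "(\<Sum>m\<in>{- int N..int N}. lc f m * z powi m) = f z + (a (- int N) - a (int N + 1))" for N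
  proof -
    have "(\<Sum>m\<in>{- int N..int N}. a m - a (m + 1)) = a (- int N) - a (int N + 1)"
    proof (induction N)
      case (Suc N)
      have "{- int (Suc N)..int (Suc N)} = insert (- 1 - int N) (insert (1 + int N) {- int N..int N})" by auto
      with Suc show ?case by (simp add: add.commute)
    qed simp
    then show ?thesis unfolding step sum.distrib by simp
  qed
  have abound: "cmod (a m) \<le> cmod z * (4 * B / \<sigma>) * c ^ nat \<bar>m - 1\<bar>" for m
  proof -
    have "a m = z * (lc k (m - 1) * z powi (m - 1))"
      using power_int_add_1[of z "m - 1"] z0 by (simp add: a_def)
    then show ?thesis
      using mult_left_mono[OF gen[OF k kb, of "m - 1"] norm_ge_zero[of z]] B0 \<sigma>
      by (simp add: norm_mult mult.assoc)
  qed
  have cl: "(\<lambda>n. C * c ^ n) \<longlonglongrightarrow> 0" for C :: real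
    using tendsto_mult_right_zero[OF LIMSEQ_power_zero[of c]] c by simp
  have a1: "(\<lambda>N. a (int N + 1)) \<longlonglongrightarrow> 0"
    by (rule Lim_null_comparison[OF always_eventually cl[of "cmod z * (4 * B / \<sigma>)"]])
      (use abound[of "int _ + 1"] in simp)
  have a2: "(\<lambda>N. a (- int N)) \<longlonglongrightarrow> 0"
  proof (rule Lim_null_comparison[OF always_eventually cl[of "cmod z * (4 * B / \<sigma>) * c"]], rule allI)
    fix N show "cmod (a (- int N)) \<le> cmod z * (4 * B / \<sigma>) * c * c ^ N"
      using abound[of "- int N"] by (simp add: nat_add_distrib mult.assoc)
  qed
  have "(\<lambda>m. lc f m * z powi m) summable_on UNIV"
  proof (rule Infinite_Sum.abs_summable_summable, rule Infinite_Sum.abs_summable_on_comparison_test')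
    show "(\<lambda>m. B * c ^ nat \<bar>m::int\<bar>) summable_on UNIV"
      using has_sum_imp_summable[OF has_sum_int_geometric[OF c]] by (rule summable_on_cmult_right)
    show "cmod (lc f m * z powi m) \<le> B * c ^ nat \<bar>m\<bar>" for m
      by (rule gen[OF f _ B0]) (use B r in \<open>auto simp: annulus_def\<close>)
  qed
  then have hs: "((\<lambda>m. lc f m * z powi m) has_sum (\<Sum>\<^sub>\<infinity>m. lc f m * z powi m)) UNIV"
    by (rule has_sum_infsum)
  have "(\<lambda>N. \<Sum>m\<in>{- int N..int N}. lc f m * z powi m) \<longlonglongrightarrow> (\<Sum>\<^sub>\<infinity>m. lc f m * z powi m)"
  proof (rule has_sum_imp_sums_sets(1)[OF hs])
    fix m :: int
    show "\<forall>\<^sub>F n in sequentially. m \<in> {- int n..int n}"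
      using eventually_ge_at_top[of "nat \<bar>m\<bar>"] by eventually_elim auto
  qed auto
  moreover have "(\<lambda>N. \<Sum>m\<in>{- int N..int N}. lc f m * z powi m) \<longlonglongrightarrow> f z"
    unfolding partial using tendsto_add[OF tendsto_const tendsto_diff[OF a2 a1], of "f z"] by simp
  ultimately have "(\<Sum>\<^sub>\<infinity>m. lc f m * z powi m) = f z" by (rule LIMSEQ_unique)
  with hs show ?thesis by simp
qed

subsection \<open>Fourier expansion on the torus\<close>

definition setq :: "'n::finite \<Rightarrow> complex \<Rightarrow> 'n phase \<Rightarrow> 'n phase" where
  "setq i z x = (\<chi> j. if j = i then z else fst x $ j, snd x)"

text \<open>Independence of \<open>p\<close> is required on the whole space and not only on a
  domain; derivatives then inherit it by translation invariance.\<close>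

definition pindep :: "('n::finite phase \<Rightarrow> complex) \<Rightarrow> bool" where
  "pindep f \<longleftrightarrow> (\<forall>x y. fst x = fst y \<and> snd (snd x) = snd (snd y) \<longrightarrow> f x = f y)"

text \<open>Functions of \<open>t\<close> alone play the role of constants, \<open>t\<close> being a
  parameter.\<close>

definition tonly :: "('n::finite phase \<Rightarrow> complex) \<Rightarrow> bool" where
  "tonly f \<longleftrightarrow> (\<forall>x y. snd (snd x) = snd (snd y) \<longrightarrow> f x = f y)"

definition fc :: "'n::finite \<Rightarrow> int \<Rightarrow> ('n phase \<Rightarrow> complex) \<Rightarrow> 'n phase \<Rightarrow> complex" where
  "fc i m h x = lc (\<lambda>z. h (setq i z x)) m"

text \<open>The torus is treated one angle at a time, so that one-variable Laurent theory suffices.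
  Entries of \<open>M\<close> at indices outside the list do not enter.\<close>

primrec fcs :: "'n::finite list \<Rightarrow> ('n \<Rightarrow> int) \<Rightarrow> ('n phase \<Rightarrow> complex) \<Rightarrow> 'n phase \<Rightarrow> complex" where
  "fcs [] M h = h"
| "fcs (i # is) M h = fc i (M i) (fcs is M h)"

lemma setq_simps [simp]:
  "fst (setq i z x) $ j = (if j = i then z else fst x $ j)" "snd (setq i z x) = snd x"
  "setq i z (setq i w x) = setq i z x" "setq i (fst x $ i) x = x"
  by (auto simp: setq_def prod_eq_iff vec_eq_iff)

lemma setq_commute: "i \<noteq> j \<Longrightarrow> setq i z (setq j w x) = setq j w (setq i z x)"
  by (auto simp: prod_eq_iff vec_eq_iff)

lemma setq_eq_line: "setq i z x = setq i w x + cscale (z - w) (axis i 1, 0, 0)"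
  by (auto simp: prod_eq_iff vec_eq_iff cscale_def axis_def)

lemma setq_eq_line': "x + cscale z (axis i 1, 0, 0) = setq i (fst x $ i + z) x"
  by (auto simp: prod_eq_iff vec_eq_iff cscale_def axis_def)

lemma setq_tdom: "x \<in> tdom s \<tau> \<Longrightarrow> z \<in> annulus s \<Longrightarrow> setq i z x \<in> tdom s \<tau>"
  by (auto simp: tdom_def annulus_def)

lemma hmap_setq: "hmap (setq i z) S"
  unfolding hmap_def
proof (intro conjI allI)
  show "holo_on (\<lambda>x. fst (setq i z x) $ j) S" for j
    by (cases "j = i") (auto intro: holo_on_const holo_on_coords)
qed (auto intro: holo_on_coords)

lemma unit_exp_annulus: "0 < s \<Longrightarrow> unit_exp \<theta> \<in> annulus s"
  by (simp add: annulus_def)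

lemma setq_holomorphic:
  assumes h: "holo_on h (tdom s \<tau>)" and x: "x \<in> tdom s \<tau>"
  shows "(\<lambda>z. h (setq i z x)) holomorphic_on annulus s"
  unfolding holomorphic_on_open[OF open_annulus]
proof
  have e: "setq i w x = setq i 0 x + cscale w (axis i 1, 0, 0)" for w
    by (rule setq_eq_line[of i w x 0, unfolded diff_zero])
  have e': "(\<lambda>z. h (setq i z x)) = (\<lambda>z. h (setq i 0 x + cscale z (axis i 1, 0, 0)))"
    by (rule ext, rule arg_cong[OF e])
  fix z assume "z \<in> annulus s"
  then have "setq i 0 x + cscale z (axis i 1, 0, 0) \<in> tdom s \<tau>"
    unfolding e[symmetric] by (rule setq_tdom[OF x])
  from holo_on_line[OF h this]
  show "\<exists>f'. ((\<lambda>z. h (setq i z x)) has_field_derivative f') (at z)"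
    unfolding e' by (rule exI)
qed

lemma holo_on_fc:
  assumes h: "holo_on h (tdom s \<tau>)" and s: "0 < s"
  shows "holo_on (fc i m h) (tdom s \<tau>)"
proof -
  let ?F = "\<lambda>\<theta> x. unit_exp \<theta> powi (- m) * h (setq i (unit_exp \<theta>) x)"
  have eq: "fc i m h = (\<lambda>x. integral {0..1} (\<lambda>\<theta>. ?F \<theta> x))"
    by (simp add: fc_def lc_def fun_eq_iff)
  show ?thesis unfolding eq
  proof (rule holo_on_integral(1)[OF open_tdom])
    fix \<theta> :: real
    show "holo_on (?F \<theta>) (tdom s \<tau>)"
      by (intro holo_on_mult holo_on_const holo_on_compose[OF h hmap_setq] setq_tdom unit_exp_annulus s)
  next
    have "continuous_on ({0..1} \<times> tdom s \<tau>) (h \<circ> (\<lambda>(\<theta>, x). setq i (unit_exp \<theta>) x))"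
    proof (rule continuous_on_compose)
      have "continuous_on ({0..1} \<times> tdom s \<tau>) (\<lambda>y. if j = i then unit_exp (fst y) else fst (snd y) $ j)" for j
        by (cases "j = i") (auto intro!: continuous_intros)
      then show "continuous_on ({0..1} \<times> tdom s \<tau>) (\<lambda>(\<theta>, x). setq i (unit_exp \<theta>) x)"
        unfolding setq_def case_prod_beta by (intro continuous_intros)
      show "continuous_on ((\<lambda>(\<theta>, x). setq i (unit_exp \<theta>) x) ` ({0..1} \<times> tdom s \<tau>)) h"
        by (rule continuous_on_subset[OF holo_on_imp_continuous_on[OF h]])
          (auto intro!: setq_tdom unit_exp_annulus s)
    qed
    moreover have "continuous_on ({0..1} \<times> tdom s \<tau>) (\<lambda>y :: real \<times> _. unit_exp (fst y) powi (- m))"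
      by (intro continuous_intros) auto
    ultimately have "continuous_on ({0..1} \<times> tdom s \<tau>)
      (\<lambda>y. unit_exp (fst y) powi (- m) * (h \<circ> (\<lambda>(\<theta>, x). setq i (unit_exp \<theta>) x)) y)"
      by (intro continuous_on_mult)
    then show "continuous_on ({0..1} \<times> tdom s \<tau>) (\<lambda>(\<theta>, x). ?F \<theta> x)"
      by (simp add: case_prod_beta o_def)
  qed
qed

lemma fc_bound:
  assumes h: "holo_on h (tdom s \<tau>)" and s: "0 < s" "s < 1" and r: "1 - s < r" "r < 1 + s"
    and B: "\<And>x. x \<in> tdom s \<tau> \<Longrightarrow> cmod (h x) \<le> B" and x: "x \<in> tdom s \<tau>"
  shows "cmod (fc i m h x) \<le> B * r powi (- m)"
  unfolding fc_def
  by (rule lc_bound[OF setq_holomorphic[OF h x] s r B[OF setq_tdom[OF x]]])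
    (use r in \<open>auto simp: annulus_def\<close>)

lemma holo_on_fcs:
  assumes h: "holo_on h (tdom s \<tau>)" and s: "0 < s"
  shows "holo_on (fcs is M h) (tdom s \<tau>)"
  by (induction "is") (auto intro: holo_on_fc h s)

text \<open>The radius may differ from angle to angle, which allows it to follow the sign of each
  \<open>M i\<close>.\<close>

lemma fcs_bound:
  assumes h: "holo_on h (tdom s \<tau>)" and s: "0 < s" "s < 1" and r: "\<And>i. 1 - s < r i" "\<And>i. r i < 1 + s"
    and B: "\<And>x. x \<in> tdom s \<tau> \<Longrightarrow> cmod (h x) \<le> B"
  shows "x \<in> tdom s \<tau> \<Longrightarrow> distinct is \<Longrightarrow> cmod (fcs is M h x) \<le> B * (\<Prod>i\<in>set is. r i powi (- M i))"
proof (induction "is" arbitrary: x)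
  case (Cons i "is")
  have "cmod (fc i (M i) (fcs is M h) x) \<le> B * (\<Prod>i\<in>set is. r i powi (- M i)) * r i powi (- M i)"
    by (rule fc_bound[OF holo_on_fcs[OF h s(1)] s r Cons.IH]) (use Cons.prems in auto)
  then show ?case using Cons.prems by (simp add: mult_ac)
qed (simp add: B)

lemma fcs_setq: "j \<in> set is \<Longrightarrow> fcs is M h (setq j z x) = fcs is M h x"
proof (induction "is" arbitrary: x)
  case (Cons i "is")
  show ?case
  proof (cases "j = i")
    case False
    then have "j \<in> set is" using Cons.prems by simp
    from Cons.IH[OF this] show ?thesis unfolding fcs.simps fc_def setq_commute[OF False[symmetric]] by simp
  qed (simp add: fc_def)
qed simp

lemma pindepD: "pindep f \<Longrightarrow> fst x = fst y \<Longrightarrow> snd (snd x) = snd (snd y) \<Longrightarrow> f x = f y"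
  unfolding pindep_def by blast

lemma tonlyD: "tonly f \<Longrightarrow> snd (snd x) = snd (snd y) \<Longrightarrow> f x = f y"
  unfolding tonly_def by blast

lemma pindepI: "(\<And>x y. fst x = fst y \<Longrightarrow> snd (snd x) = snd (snd y) \<Longrightarrow> f x = f y) \<Longrightarrow> pindep f"
  unfolding pindep_def by blast

lemma pindep_setq: "pindep h \<Longrightarrow> pindep (\<lambda>x. h (setq i z x))"
  by (rule pindepI, erule pindepD) (simp_all add: setq_def cong: if_cong)

lemma fcs_pindep: "pindep h \<Longrightarrow> pindep (fcs is M h)"
proof (induction "is")
  case (Cons i "is")
  show ?case
  proof (rule pindepI)
    fix x y :: "'a phase" assume "fst x = fst y" "snd (snd x) = snd (snd y)"
    then have "fcs is M h (setq i z x) = fcs is M h (setq i z y)" for z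
      by (rule pindepD[OF pindep_setq[OF Cons.IH[OF Cons.prems]]])
    then show "fcs (i # is) M h x = fcs (i # is) M h y" by (simp add: fc_def)
  qed
qed simp

text \<open>Vanishing at \<open>t = 0\<close> has to pass through every construction, because it is
  what makes the final map the identity at \<open>t = 0\<close>.\<close>

lemma fcs_zero:
  assumes h: "\<And>x. x \<in> tdom s \<tau> \<Longrightarrow> snd (snd x) = 0 \<Longrightarrow> h x = 0" and s: "0 < s"
  shows "x \<in> tdom s \<tau> \<Longrightarrow> snd (snd x) = 0 \<Longrightarrow> fcs is M h x = 0"
proof (induction "is" arbitrary: x)
  case (Cons i "is")
  have "fcs is M h (setq i (unit_exp \<theta>) x) = 0" for \<theta>
    by (rule Cons.IH) (use Cons.prems in \<open>auto intro!: setq_tdom unit_exp_annulus s\<close>)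
  then show ?case by (simp add: fc_def lc_def)
qed (simp add: h)

lemma fcs_fun_upd: "i \<notin> set is \<Longrightarrow> fcs is (M(i := m)) h = fcs is M h"
  by (induction "is") auto

section \<open>Summation over integer multi-indices and the Fourier series in several angles\<close>

definition supp_in :: "'n set \<Rightarrow> ('n \<Rightarrow> int) set" where
  "supp_in I = {M. \<forall>i. i \<notin> I \<longrightarrow> M i = 0}"

lemma supp_in_empty: "supp_in {} = {\<lambda>_. 0}"
  by (auto simp: supp_in_def)

lemma bij_supp_insert:
  assumes "i \<notin> I"
  shows "bij_betw (\<lambda>(M, m). M(i := m)) (supp_in I \<times> UNIV) (supp_in (insert i I))"
proof (rule bij_betwI[where g="\<lambda>M. (M(i := 0), M i)"])
  show "(\<lambda>(M, m). M(i := m)) \<in> supp_in I \<times> UNIV \<rightarrow> supp_in (insert i I)"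
    by (auto simp: supp_in_def)
  show "(\<lambda>M. (M(i := 0), M i)) \<in> supp_in (insert i I) \<rightarrow> supp_in I \<times> UNIV"
    by (auto simp: supp_in_def)
qed (use assms in \<open>auto simp: supp_in_def fun_eq_iff\<close>)

text \<open>A product of one-dimensional sums, obtained by adding one angle at a time and summing
  the nonnegative terms iteratively.\<close>

lemma has_sum_weights:
  fixes c :: real assumes c: "0 \<le> c" "c < 1" and I: "finite I"
  shows "((\<lambda>M. \<Prod>i\<in>I. c ^ nat \<bar>M i\<bar>) has_sum ((1 + c) / (1 - c)) ^ card I) (supp_in I)"
  using I
proof (induction I)
  case empty
  show ?case using has_sum_finite[of "{\<lambda>_. 0}" "\<lambda>_. 1 :: real"] by (simp add: supp_in_empty)
next
  case (insert i I)
  let ?G = "(1 + c) / (1 - c)" and ?W = "\<lambda>I M. \<Prod>i\<in>I. c ^ nat \<bar>M i\<bar>"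
  have eq: "?W (insert i I) (M(i := m)) = ?W I M * c ^ nat \<bar>m\<bar>" for M m
  proof -
    have "?W I (M(i := m)) = ?W I M" by (rule prod.cong) (use insert.hyps in auto)
    then show ?thesis using insert.hyps by (simp add: mult.commute)
  qed
  have s1: "((\<lambda>m. ?W I M * c ^ nat \<bar>m\<bar>) has_sum ?W I M * ?G) UNIV" for M
    by (rule has_sum_cmult_right[OF has_sum_int_geometric[OF c]])
  have s2: "((\<lambda>M. ?W I M * ?G) has_sum ?G ^ card I * ?G) (supp_in I)"
    by (rule has_sum_cmult_left[OF insert.IH])
  have sm: "(\<lambda>(M, m). ?W I M * c ^ nat \<bar>m\<bar>) summable_on supp_in I \<times> UNIV"
    by (rule summable_on_SigmaI[where g="\<lambda>M. ?W I M * ?G"])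
      (use s1 has_sum_imp_summable[OF s2] c in \<open>auto intro!: mult_nonneg_nonneg prod_nonneg\<close>)
  have "((\<lambda>(M, m). ?W I M * c ^ nat \<bar>m\<bar>) has_sum ?G ^ card I * ?G) (supp_in I \<times> UNIV)"
    by (rule has_sum_SigmaI[OF _ s2 sm]) (use s1 in simp)
  then have "((\<lambda>x. ?W (insert i I) (case x of (M, m) \<Rightarrow> M(i := m))) has_sum ?G ^ card I * ?G) (supp_in I \<times> UNIV)"
    unfolding case_prod_beta eq .
  then have "(?W (insert i I) has_sum ?G ^ card I * ?G) (supp_in (insert i I))"
    unfolding has_sum_reindex_bij_betw[OF bij_supp_insert[OF insert.hyps(2)], of "?W (insert i I)"] .
  moreover have "?G ^ card I * ?G = ?G ^ card (insert i I)"
    using insert.hyps by simp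
  ultimately show ?case by (simp only:)
qed

lemma summable_on_bound:
  fixes f :: "'a \<Rightarrow> complex"
  assumes "g summable_on A" "\<And>x. x \<in> A \<Longrightarrow> cmod (f x) \<le> g x"
  shows "f summable_on A"
  by (rule Infinite_Sum.abs_summable_summable, rule Infinite_Sum.abs_summable_on_comparison_test'[OF assms])

text \<open>Bounding the coefficient on outer circles for nonnegative exponents and on inner circles
  for negative ones yields geometric decay in each \<open>M i\<close> separately, hence in the sum
  of all absolute values.\<close>

lemma fcs_term_bound:
  assumes h: "holo_on h (tdom s \<tau>)" and \<sigma>: "0 < \<sigma>" "\<sigma> < s" "s < 1"
    and B: "\<And>x. x \<in> tdom s \<tau> \<Longrightarrow> cmod (h x) \<le> B" and d: "distinct is" and x: "x \<in> tdom (s - \<sigma>) \<tau>"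
  shows "cmod (fcs is M h x * (\<Prod>i\<in>set is. (fst x $ i) powi M i)) \<le> B * (\<Prod>i\<in>set is. (1 - \<sigma> / 4) ^ nat \<bar>M i\<bar>)"
proof -
  have s: "0 < s" "s < 1" using \<sigma> by auto
  have xs: "x \<in> tdom s \<tau>" by (rule tdom_mono[OF _ _ x]) (use \<sigma> in auto)
  have q: "1 - s + \<sigma> < cmod (fst x $ i)" "cmod (fst x $ i) < 1 + s - \<sigma>" for i
  proof -
    have "1 - (s - \<sigma>) < cmod (fst x $ i)" "cmod (fst x $ i) < 1 + (s - \<sigma>)"
      using x unfolding tdom_def by blast+
    then show "1 - s + \<sigma> < cmod (fst x $ i)" "cmod (fst x $ i) < 1 + s - \<sigma>" by linarith+
  qed
  define r where "r i = (if 0 \<le> M i then 1 + s - \<sigma> / 2 else 1 - s + \<sigma> / 2)" for i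
  have r: "1 - s < r i" "r i < 1 + s" for i using \<sigma> by (auto simp: r_def)
  have r0: "0 < r i" for i using r(1)[of i] s by linarith
  have B0: "0 \<le> B" using B[OF xs] norm_ge_zero order_trans by blast
  have "cmod (fcs is M h x) * (\<Prod>i\<in>set is. cmod (fst x $ i) powi M i) \<le>
      B * (\<Prod>i\<in>set is. r i powi (- M i)) * (\<Prod>i\<in>set is. cmod (fst x $ i) powi M i)"
    by (intro mult_right_mono fcs_bound[OF h s r B xs d] prod_nonneg zero_le_power_int norm_ge_zero)
  also have "\<dots> = B * (\<Prod>i\<in>set is. r i powi (- M i) * cmod (fst x $ i) powi M i)"
    by (simp add: prod.distrib)
  also have "\<dots> \<le> B * (\<Prod>i\<in>set is. (1 - \<sigma> / 4) ^ nat \<bar>M i\<bar>)"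
  proof (intro mult_left_mono prod_mono B0 conjI)
    fix i
    show "0 \<le> r i powi (- M i) * cmod (fst x $ i) powi M i"
      using r0[of i] by (intro mult_nonneg_nonneg zero_le_power_int) auto
    show "r i powi (- M i) * cmod (fst x $ i) powi M i \<le> (1 - \<sigma> / 4) ^ nat \<bar>M i\<bar>"
      unfolding r_def by (rule powi_quotient_bound[OF q \<sigma>])
  qed
  finally show ?thesis by (simp add: norm_mult prod_norm[symmetric] norm_power_int)
qed

text \<open>Induction over the angles: for fixed remaining exponents, the sum over the new exponent
  is the Laurent expansion of the previous coefficient in that angle. Absolute summability, from the
  geometric weights, allows the iterated sum to be taken over all exponents at once.\<close>

lemma fcs_has_sum:
  assumes h: "holo_on h (tdom s \<tau>)" and \<sigma>: "0 < \<sigma>" "\<sigma> < s" "s < 1"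
    and B: "\<And>x. x \<in> tdom s \<tau> \<Longrightarrow> cmod (h x) \<le> B"
    and x: "x \<in> tdom (s - \<sigma>) \<tau>"
  shows "distinct is \<Longrightarrow>
    ((\<lambda>M. fcs is M h x * (\<Prod>i\<in>set is. (fst x $ i) powi M i)) has_sum h x) (supp_in (set is))"
proof (induction "is")
  case Nil
  show ?case using has_sum_finite[of "{\<lambda>_. 0}" "\<lambda>_. h x"] by (simp add: supp_in_empty)
next
  case (Cons i "is")
  have s: "0 < s" "s < 1" using \<sigma> by auto
  have xs: "x \<in> tdom s \<tau>" by (rule tdom_mono[OF _ _ x]) (use \<sigma> in auto)
  define c where "c = 1 - \<sigma> / 4"
  have c: "0 \<le> c" "c < 1" using \<sigma> by (auto simp: c_def)
  have d: "distinct is" "i \<notin> set is" using Cons.prems by auto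
  let ?T = "\<lambda>is M. fcs is M h x * (\<Prod>i\<in>set is. (fst x $ i) powi M i)"
  let ?Q = "\<lambda>M. \<Prod>j\<in>set is. (fst x $ j) powi M j"
  have T: "?T (i # is) (M(i := m)) = ?Q M * (fc i m (fcs is M h) x * (fst x $ i) powi m)" for M m
  proof -
    have "?Q (M(i := m)) = ?Q M" by (rule prod.cong) (use d in auto)
    then show ?thesis using d by (simp add: fcs_fun_upd)
  qed
  have s1: "((\<lambda>m. ?T (i # is) (M(i := m))) has_sum ?T is M) UNIV" for M
  proof -
    have "((\<lambda>m. lc (\<lambda>z. fcs is M h (setq i z x)) m * (fst x $ i) powi m) has_sum
        fcs is M h (setq i (fst x $ i) x)) UNIV"
    proof (rule laurent_has_sum[OF setq_holomorphic[OF holo_on_fcs[OF h s(1)] xs] _ \<sigma>])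
      show "fst x $ i \<in> annulus (s - \<sigma>)" using x by (auto simp: tdom_def annulus_def)
      fix z assume "z \<in> annulus s"
      \<comment> \<open>The unit radii are an arbitrary choice: any bound uniform in
        \<open>z\<close> will do.\<close>
      then show "cmod (fcs is M h (setq i z x)) \<le> B * (\<Prod>i\<in>set is. 1 powi (- M i))"
        by (intro fcs_bound[OF h s _ _ B _ d(1)] setq_tdom xs) (use s in auto)
    qed
    then have "((\<lambda>m. fc i m (fcs is M h) x * (fst x $ i) powi m) has_sum fcs is M h x) UNIV"
      by (simp add: fc_def)
    from has_sum_cmult_right[OF this, of "?Q M"] show ?thesis unfolding T by (simp only: mult.commute)
  qed
  have bij: "bij_betw (\<lambda>(M, m). M(i := m)) (supp_in (set is) \<times> UNIV) (supp_in (set (i # is)))"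
    using bij_supp_insert[OF d(2)] by simp
  have "?T (i # is) summable_on supp_in (set (i # is))"
  proof (rule summable_on_bound)
    show "(\<lambda>M. B * (\<Prod>j\<in>set (i # is). c ^ nat \<bar>M j\<bar>)) summable_on supp_in (set (i # is))"
      by (rule summable_on_cmult_right[OF has_sum_imp_summable[OF has_sum_weights[OF c]]]) simp
    show "cmod (?T (i # is) M) \<le> B * (\<Prod>j\<in>set (i # is). c ^ nat \<bar>M j\<bar>)" for M
      unfolding c_def by (rule fcs_term_bound[OF h \<sigma> B Cons.prems x])
  qed
  then have "(\<lambda>y. ?T (i # is) (case y of (M, m) \<Rightarrow> M(i := m))) summable_on supp_in (set is) \<times> UNIV"
    unfolding summable_on_reindex_bij_betw[OF bij, of "?T (i # is)"] .
  then have "((\<lambda>y. ?T (i # is) (case y of (M, m) \<Rightarrow> M(i := m))) has_sum h x) (supp_in (set is) \<times> UNIV)"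
    by (rule has_sum_SigmaI[where g="?T is", rotated 2])
      (use s1 Cons.IH[OF d(1)] in \<open>simp_all del: fcs.simps\<close>)
  then show ?case unfolding has_sum_reindex_bij_betw[OF bij, of "?T (i # is)"] .
qed

text \<open>The \<open>q\<close> coordinates are exchanged one after another, over finite sets of
  indices, and then \<open>p\<close> all at once.\<close>

lemma tonlyI:
  fixes f :: "'n::finite phase \<Rightarrow> complex"
  assumes q: "\<And>i z x. f (setq i z x) = f x" and p: "pindep f"
  shows "tonly f"
proof -
  have *: "f (\<chi> j. if j \<in> J then fst y $ j else fst x $ j, snd x) = f x" if "finite J" for J x y
    using that
  proof (induction J)
    case (insert i J)
    have "(\<chi> j. if j \<in> insert i J then fst y $ j else fst x $ j, snd x) =
      setq i (fst y $ i) (\<chi> j. if j \<in> J then fst y $ j else fst x $ j, snd x)"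
      by (simp add: prod_eq_iff vec_eq_iff)
    then show ?case using q insert.IH by presburger
  qed simp
  show ?thesis
    unfolding tonly_def
  proof (intro allI impI)
    fix x y :: "'n phase"
    assume t: "snd (snd x) = snd (snd y)"
    have "f x = f (fst y, snd x)" using *[of UNIV y x] by simp
    also have "\<dots> = f y" by (rule pindepD[OF p]) (use t in simp_all)
    finally show "f x = f y" .
  qed
qed

lemma fder_zero_line:
  assumes f: "holo_on f S" and x: "x \<in> S" and c: "\<And>z. f (x + cscale z v) = f x"
  shows "fder f v x = 0"
proof -
  have "((\<lambda>z. f (x + cscale z v)) has_field_derivative fder f v (x + cscale 0 v)) (at 0)"
    by (rule holo_on_line[OF f]) (simp add: x)
  then have "((\<lambda>z::complex. f x) has_field_derivative fder f v x) (at 0)" unfolding c by simp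
  from DERIV_unique[OF this DERIV_const] show ?thesis .
qed

lemma pindep_dp:
  assumes "holo_on f S" "x \<in> S" "pindep f"
  shows "dp i f x = 0"
  by (rule fder_zero_line[OF assms(1,2)])
    (rule pindepD[OF assms(3)]; simp add: cscale_def)

lemma tonly_fder:
  assumes "holo_on f S" "x \<in> S" "tonly f" "snd (snd v) = 0"
  shows "fder f v x = 0"
  by (rule fder_zero_line[OF assms(1,2)])
    (rule tonlyD[OF assms(3)]; use assms(4) in \<open>cases v; simp add: cscale_def\<close>)

subsection \<open>The cohomological equation\<close>

text \<open>The logarithmic derivative along the i-th angle. It is diagonal on monomials in
  \<open>q\<close> and is the bracket of the i-th momentum with the function.\<close>

abbreviation Dq :: "'n::finite \<Rightarrow> ('n phase \<Rightarrow> complex) \<Rightarrow> 'n phase \<Rightarrow> complex" where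
  "Dq i f x \<equiv> fst x $ i * dq i f x"

text \<open>Here \<open>u\<close> solves the equation for \<open>h\<close> with a loss \<sigma> of
  domain, and \<open>c\<close>, a function of \<open>t\<close> alone, stands for the torus average
  of \<open>h\<close>. The constant \<open>K\<close> is meant to contain the power of \<sigma>. The
  last clause transports vanishing at \<open>t = 0\<close>.\<close>

definition sd_sol :: "complex ^ 'n::finite \<Rightarrow> real \<Rightarrow> real \<Rightarrow> real \<Rightarrow> real \<Rightarrow> real \<Rightarrow> ('n phase \<Rightarrow> complex) \<Rightarrow>
    ('n phase \<Rightarrow> complex) \<Rightarrow> ('n phase \<Rightarrow> complex) \<Rightarrow> bool" where
  "sd_sol \<omega> K s \<sigma> \<tau> B h u c \<longleftrightarrow>
     holo_on u (tdom (s - \<sigma>) \<tau>) \<and> pindep u \<and> (\<forall>x\<in>tdom (s - \<sigma>) \<tau>. cmod (u x) \<le> K * B) \<and>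
     holo_on c (tdom s \<tau>) \<and> tonly c \<and> (\<forall>x\<in>tdom s \<tau>. cmod (c x) \<le> B) \<and>
     (\<forall>x\<in>tdom (s - \<sigma>) \<tau>. (\<Sum>i\<in>UNIV. \<omega> $ i * Dq i u x) = h x - c x) \<and>
     ((\<forall>x\<in>tdom s \<tau>. snd (snd x) = 0 \<longrightarrow> h x = 0) \<longrightarrow>
        (\<forall>x\<in>tdom (s - \<sigma>) \<tau>. snd (snd x) = 0 \<longrightarrow> u x = 0) \<and>
        (\<forall>x\<in>tdom s \<tau>. snd (snd x) = 0 \<longrightarrow> c x = 0))"

definition sd_solvable :: "complex ^ 'n::finite \<Rightarrow> real \<Rightarrow> nat \<Rightarrow> bool" where
  "sd_solvable \<omega> K \<nu> \<longleftrightarrow> (\<forall>s \<sigma> \<tau> B h. 0 < \<sigma> \<longrightarrow> \<sigma> < s \<longrightarrow> s < 1 \<longrightarrow> holo_on h (tdom s \<tau>) \<longrightarrow> pindep h \<longrightarrow>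
     (\<forall>x\<in>tdom s \<tau>. cmod (h x) \<le> B) \<longrightarrow> (\<exists>u c. sd_sol \<omega> (K / \<sigma> ^ \<nu>) s \<sigma> \<tau> B h u c))"

lemma q_nonzero: "x \<in> tdom s \<tau> \<Longrightarrow> s < 1 \<Longrightarrow> fst x $ i \<noteq> 0"
  unfolding tdom_def by (smt (verit) mem_Collect_eq norm_zero)

lemma holo_on_powi:
  assumes "s < 1" shows "holo_on (\<lambda>x. (fst x $ i) powi m) (tdom s \<tau>)"
  by (rule holo_on_chain1[OF holo_on_coords(1), where h'="\<lambda>z. of_int m * z powi (m - 1)"])
    (auto intro!: derivative_eq_intros dest: q_nonzero[OF _ assms])

text \<open>Monomials in \<open>q\<close> are common eigenvectors of the operators
  \<open>Dq i\<close>, and a factor that does not depend on \<open>q\<close> acts as a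
  scalar.\<close>

lemma fourier_term:
  fixes M :: "'n::finite \<Rightarrow> int"
  assumes g: "holo_on g (tdom s \<tau>)" and gi: "\<And>i z x. g (setq i z x) = g x" and s: "s < 1"
  defines "T \<equiv> \<lambda>x. g x * (\<Prod>i\<in>UNIV. (fst x $ i) powi M i)"
  shows "holo_on T (tdom s \<tau>)" and "x \<in> tdom s \<tau> \<Longrightarrow> Dq i T x = of_int (M i) * T x"
proof -
  show T: "holo_on T (tdom s \<tau>)"
    unfolding T_def by (intro holo_on_mult g holo_on_prod holo_on_powi s)
  assume x: "x \<in> tdom s \<tau>"
  let ?C = "g x * (\<Prod>j\<in>UNIV - {i}. (fst x $ j) powi M j)"
  have P: "T (setq i w x) = ?C * w powi M i" for w
  proof -
    have "(\<Prod>j\<in>UNIV. (fst (setq i w x) $ j) powi M j) =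
        w powi M i * (\<Prod>j\<in>UNIV - {i}. (fst (setq i w x) $ j) powi M j)"
      by (subst prod.remove[of UNIV i]) simp_all
    also have "(\<Prod>j\<in>UNIV - {i}. (fst (setq i w x) $ j) powi M j) = (\<Prod>j\<in>UNIV - {i}. (fst x $ j) powi M j)"
      by (rule prod.cong) auto
    finally show ?thesis by (simp add: T_def gi)
  qed
  have "((\<lambda>z. T (x + cscale z (axis i 1, 0, 0))) has_field_derivative dq i T (x + cscale 0 (axis i 1, 0, 0))) (at 0)"
    by (rule holo_on_line[OF T]) (simp add: x)
  then have "((\<lambda>z. ?C * (fst x $ i + z) powi M i) has_field_derivative dq i T x) (at 0)"
    unfolding setq_eq_line' P by simp
  moreover have "((\<lambda>z. ?C * (fst x $ i + z) powi M i) has_field_derivative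
      ?C * (of_int (M i) * (fst x $ i) powi (M i - 1))) (at 0)"
    by (rule derivative_eq_intros refl | use q_nonzero[OF x s] in simp)+
  ultimately have d: "dq i T x = ?C * (of_int (M i) * (fst x $ i) powi (M i - 1))"
    by (rule DERIV_unique)
  have "fst x $ i * (fst x $ i) powi (M i - 1) = (fst x $ i) powi M i"
    using power_int_add_1'[of "fst x $ i" "M i - 1"] q_nonzero[OF x s] by simp
  then have "Dq i T x = of_int (M i) * (?C * (fst x $ i) powi M i)"
    unfolding d by (simp add: mult.left_commute)
  then show "Dq i T x = of_int (M i) * T x" using P[of "fst x $ i"] by simp
qed

text \<open>This trades the polynomial growth of the reciprocal small divisors for a power of the
  decay rate \<open>y\<close>. The source is the inequality (1 + x/\<nu>)^\<nu> \<le> e^x.\<close>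

lemma power_exp_bound:
  fixes y :: real and N \<nu> :: nat
  assumes "0 < y" "0 < \<nu>"
  shows "real N ^ \<nu> * exp (- (y * real N)) \<le> (real \<nu> / y) ^ \<nu>"
proof -
  have "(y * real N / real \<nu>) ^ \<nu> \<le> (1 + y * real N / real \<nu>) ^ \<nu>"
    by (rule power_mono) (use assms in auto)
  also have "\<dots> \<le> exp (y * real N)"
    by (rule exp_ge_one_plus_x_over_n_power_n) (use assms in \<open>auto intro: order_trans[of _ 0]\<close>)
  finally have "(y * real N / real \<nu>) ^ \<nu> * exp (- (y * real N)) \<le> exp (y * real N) * exp (- (y * real N))"
    by (rule mult_right_mono) simp
  then have "(y * real N / real \<nu>) ^ \<nu> * exp (- (y * real N)) \<le> 1"
    by (simp only: exp_minus_inverse)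
  moreover have "real N ^ \<nu> = (real \<nu> / y) ^ \<nu> * (y * real N / real \<nu>) ^ \<nu>"
    using assms by (simp add: power_mult_distrib[symmetric])
  ultimately show ?thesis
    using mult_left_mono[of "(y * real N / real \<nu>) ^ \<nu> * exp (- (y * real N))" 1 "(real \<nu> / y) ^ \<nu>"] assms
    by (simp add: mult.assoc)
qed

text \<open>The value of a two-sided geometric series with ratio e^(-y); each angle costs one factor
  1/y.\<close>

lemma exp_weight_bound:
  fixes y :: real assumes "0 < y" "y \<le> 1"
  shows "(1 + exp (- y)) / (1 - exp (- y)) \<le> 4 / y" "exp (- y) < 1"
proof -
  have e: "exp (- y) \<le> 1 / (1 + y)"
    using exp_ge_add_one_self[of y] assms by (simp add: exp_minus field_simps)
  have "1 / (1 + y) \<le> 1 - y / 2"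
  proof -
    have "y * y \<le> y * 1" by (rule mult_left_mono) (use assms in auto)
    then have "1 \<le> (1 - y / 2) * (1 + y)" using assms by (simp add: algebra_simps)
    then show ?thesis using assms by (simp only: pos_divide_le_eq add_pos_pos zero_less_one)
  qed
  with e have d: "y / 2 \<le> 1 - exp (- y)" by simp
  show "exp (- y) < 1" using assms by simp
  have "(1 + exp (- y)) / (1 - exp (- y)) \<le> 2 / (y / 2)"
    by (rule frac_le) (use d assms in auto)
  then show "(1 + exp (- y)) / (1 - exp (- y)) \<le> 4 / y" by simp
qed

text \<open>The exponent may be raised because |M| \<ge> 1, so a positive natural number serves;
  positivity is used when the growth of order \<nu> is absorbed by an exponential.\<close>

lemma diophantine_nat:
  fixes \<omega> :: "complex ^ 'n::finite"
  assumes "kolmogorov_diophantine \<omega>"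
  obtains C \<nu> where "0 < C" "0 < \<nu>"
    "\<And>M. M \<noteq> (\<lambda>_. 0) \<Longrightarrow> C / real (\<Sum>i\<in>UNIV. nat \<bar>M i\<bar>) ^ \<nu> \<le> cmod (\<Sum>i\<in>UNIV. \<omega> $ i * of_int (M i))"
proof -
  obtain C k where C: "0 < C" "0 \<le> k" and D: "\<And>M :: int ^ 'n. M \<noteq> 0 \<Longrightarrow>
     C / real_of_int (\<Sum>i\<in>UNIV. \<bar>M $ i\<bar>) powr k \<le> cmod (\<Sum>i\<in>UNIV. \<omega> $ i * of_int (M $ i))"
    using assms unfolding kolmogorov_diophantine_def by blast
  define \<nu> where "\<nu> = Suc (nat \<lceil>k\<rceil>)"
  have k: "k \<le> real \<nu>" by (simp add: \<nu>_def) linarith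
  show thesis
  proof (rule that[OF C(1), of \<nu>])
    fix M :: "'n \<Rightarrow> int" assume M: "M \<noteq> (\<lambda>_. 0)"
    define N where "N = (\<Sum>i\<in>UNIV. nat \<bar>M i\<bar>)"
    have NI: "real_of_int (\<Sum>i\<in>UNIV. \<bar>M i\<bar>) = real N" by (simp add: N_def)
    obtain i where i: "M i \<noteq> 0" using M by auto
    have "nat \<bar>M i\<bar> \<le> N" unfolding N_def by (rule member_le_sum) auto
    then have N1: "1 \<le> real N" using i by linarith
    have "real N powr k \<le> real N powr real \<nu>" by (rule powr_mono[OF k N1])
    also have "\<dots> = real N ^ \<nu>" using N1 by (simp add: powr_realpow)
    finally have "C / real N ^ \<nu> \<le> C / real N powr k"
      using C N1 by (intro divide_left_mono) auto
    also have "\<dots> \<le> cmod (\<Sum>i\<in>UNIV. \<omega> $ i * of_int (M i))"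
      using D[of "\<chi> i. M i"] i NI by (auto simp: vec_eq_iff)
    finally show "C / real (\<Sum>i\<in>UNIV. nat \<bar>M i\<bar>) ^ \<nu> \<le> cmod (\<Sum>i\<in>UNIV. \<omega> $ i * of_int (M i))"
      by (simp add: N_def)
  qed (simp add: \<nu>_def)
qed

text \<open>Each Fourier term is divided by its divisor (\<omega>, M). The terms decay like
  e^(-\<sigma>|M|/4); one half of this rate absorbs the growth |M|^\<nu> of the reciprocal divisors,
  the other half makes the sum over M converge. Convergence is uniform, so the series may be
  differentiated term by term.\<close>

lemma small_divisors:
  fixes \<omega> :: "complex ^ 'n::finite"
  assumes "kolmogorov_diophantine \<omega>"
  obtains K \<nu> where "0 < K" "sd_solvable \<omega> K \<nu>"
proof -
  obtain C \<nu> where C: "0 < C" "0 < \<nu>" and D: "\<And>M. M \<noteq> (\<lambda>_. 0) \<Longrightarrow>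
      C / real (\<Sum>i\<in>UNIV. nat \<bar>M i\<bar>) ^ \<nu> \<le> cmod (\<Sum>i\<in>UNIV. \<omega> $ i * of_int (M i))"
    using diophantine_nat[OF assms] by metis
  obtain L :: "'n list" where L: "set L = UNIV" "distinct L"
    using finite_distinct_list[OF finite, of UNIV] by auto
  define n where "n = CARD('n)"
  \<comment> \<open>Both halves of the decay rate are \<sigma>/8. Absorbing |M|^\<nu> gives (8
    \<nu>/\<sigma>)^\<nu>, and summing over \<open>n\<close> angles gives (32/\<sigma>)^n.\<close>
  define K where "K = inverse C * (8 * real \<nu>) ^ \<nu> * 32 ^ n"
  have K: "0 < K" using C by (simp add: K_def)
  have "sd_solvable \<omega> K (\<nu> + n)"
    unfolding sd_solvable_def
  proof (intro allI impI)
    fix s \<sigma> \<tau> B and h :: "'n phase \<Rightarrow> complex"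
    assume \<sigma>: "0 < \<sigma>" "\<sigma> < s" "s < 1" and h: "holo_on h (tdom s \<tau>)" and hp: "pindep h"
      and B: "\<forall>x\<in>tdom s \<tau>. cmod (h x) \<le> B"
    have s: "0 < s" "s < 1" using \<sigma> by auto
    have B': "\<And>x. x \<in> tdom s \<tau> \<Longrightarrow> cmod (h x) \<le> B" using B by blast
    have sub: "x \<in> tdom s \<tau>" if "x \<in> tdom (s - \<sigma>) \<tau>" for x
      by (rule tdom_mono[OF _ _ that]) (use \<sigma> in auto)
    define d where "d M = (\<Sum>i\<in>UNIV. \<omega> $ i * of_int (M i))" for M
    define N where "N M = (\<Sum>i\<in>UNIV. nat \<bar>M i\<bar>)" for M :: "'n \<Rightarrow> int"
    define T where "T M x = fcs L M h x * (\<Prod>i\<in>UNIV. (fst x $ i) powi M i)" for M x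
    \<comment> \<open>Division by zero yields 0, so the mean term \<open>M = 0\<close>, where
      \<open>d M = 0\<close>, drops out of the solution by itself.\<close>
    define U where "U M x = inverse (d M) * T M x" for M x
    define \<mu> where "\<mu> = exp (- (\<sigma> / 8))"
    define W where "W M = B * inverse C * (8 * real \<nu> / \<sigma>) ^ \<nu> * (\<Prod>i\<in>UNIV. \<mu> ^ nat \<bar>M i\<bar>)" for M :: "'n \<Rightarrow> int"
    have d0: "d (\<lambda>_. 0) = 0" by (simp add: d_def)
    have d1: "C / real (N M) ^ \<nu> \<le> cmod (d M)" "0 < real (N M)" if M: "M \<noteq> (\<lambda>_. 0)" for M
    proof -
      show "C / real (N M) ^ \<nu> \<le> cmod (d M)" using D[OF M] by (simp add: d_def N_def)
      obtain i where i: "M i \<noteq> 0" using M by auto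
      have "nat \<bar>M i\<bar> \<le> N M" unfolding N_def by (rule member_le_sum) auto
      then show "0 < real (N M)" using i by linarith
    qed
    have dn: "d M \<noteq> 0" if "M \<noteq> (\<lambda>_. 0)" for M
      using d1[OF that] C by (metis divide_pos_pos leD norm_zero zero_less_power)
    have \<mu>: "0 \<le> \<mu>" "\<mu> < 1" using \<sigma> by (auto simp: \<mu>_def)
    have Tb: "cmod (T M x) \<le> B * (1 - \<sigma> / 4) ^ N M" if "x \<in> tdom (s - \<sigma>) \<tau>" for M x
      using fcs_term_bound[OF h \<sigma> B' L(2) that, of M] unfolding T_def L(1) N_def power_sum .
    have Tsum: "((\<lambda>M. T M x) has_sum h x) UNIV" if "x \<in> tdom (s - \<sigma>) \<tau>" for x
      using fcs_has_sum[OF h \<sigma> B' that L(2)] unfolding T_def L(1) by (simp add: supp_in_def)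
    have g: "fcs L M h (setq i z x) = fcs L M h x" for M i z x
      by (rule fcs_setq) (simp add: L)
    have Th: "holo_on (T M) (tdom s \<tau>)" and TD: "x \<in> tdom s \<tau> \<Longrightarrow> Dq i (T M) x = of_int (M i) * T M x" for M x i
      by (rule fourier_term[OF holo_on_fcs[OF h s(1), of L M] g s(2), where M=M, folded T_def], assumption?)+
    have Uh: "holo_on (U M) (tdom s \<tau>)" for M
      unfolding U_def by (intro holo_on_mult holo_on_const Th)
    have UD: "Dq i (U M) x = of_int (M i) * U M x" if "x \<in> tdom s \<tau>" for M x i
    proof -
      have U': "U M = (\<lambda>x. inverse (d M) * T M x)" by (rule ext) (simp only: U_def)
      have "dq i (U M) x = inverse (d M) * dq i (T M) x"
        unfolding U' by (rule fder_cmult[OF Th that])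
      then have "Dq i (U M) x = inverse (d M) * Dq i (T M) x" by (simp only: mult.left_commute)
      also have "\<dots> = inverse (d M) * (of_int (M i) * T M x)" by (simp only: TD[OF that])
      finally show ?thesis by (simp only: U_def mult.left_commute)
    qed
    have Tp: "pindep (T M)" for M
    proof (rule pindepI)
      fix x y :: "'n phase" assume xy: "fst x = fst y" "snd (snd x) = snd (snd y)"
      show "T M x = T M y" unfolding T_def pindepD[OF fcs_pindep[OF hp] xy] xy(1) ..
    qed
    have Ub: "cmod (U M x) \<le> W M" if x: "x \<in> tdom (s - \<sigma>) \<tau>" for M x
    proof (cases "M = (\<lambda>_. 0)")
      case True
      have "0 \<le> B" using order_trans[OF norm_ge_zero B'[OF sub[OF x]]] .
      then show ?thesis using True C \<mu> \<sigma> by (auto simp: U_def d0 W_def intro!: mult_nonneg_nonneg prod_nonneg)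
    next
      case False
      note d1 = d1[OF False]
      have B0: "0 \<le> B" using order_trans[OF norm_ge_zero B'[OF sub[OF x]]] .
      have "cmod (U M x) = inverse (cmod (d M)) * cmod (T M x)"
        by (simp add: U_def norm_mult norm_inverse)
      also have "\<dots> \<le> inverse (C / real (N M) ^ \<nu>) * (B * (1 - \<sigma> / 4) ^ N M)"
        by (intro mult_mono le_imp_inverse_le d1 Tb x) (use C d1 in auto)
      also have "\<dots> \<le> inverse (C / real (N M) ^ \<nu>) * (B * exp (- (\<sigma> / 4)) ^ N M)"
        by (intro mult_left_mono power_mono)
          (use exp_ge_add_one_self[of "- (\<sigma> / 4)"] C d1 \<sigma> B0 in auto)
      also have "\<dots> = B * inverse C * (real (N M) ^ \<nu> * exp (- (\<sigma> / 8 * real (N M)))) * \<mu> ^ N M"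
      proof -
        have "exp (- (\<sigma> / 4)) ^ N M = exp (- (\<sigma> / 8 * real (N M))) * \<mu> ^ N M"
          by (simp add: \<mu>_def exp_of_nat_mult[symmetric] exp_add[symmetric] algebra_simps)
        then show ?thesis by (simp add: field_simps)
      qed
      also have "\<dots> \<le> B * inverse C * (real \<nu> / (\<sigma> / 8)) ^ \<nu> * \<mu> ^ N M"
        by (intro mult_right_mono mult_left_mono power_exp_bound)
          (use \<sigma> C B0 \<mu> in auto)
      also have "\<dots> = W M" by (simp add: W_def N_def power_sum mult.commute)
      finally show ?thesis .
    qed
    have Wsum: "(W has_sum B * inverse C * (8 * real \<nu> / \<sigma>) ^ \<nu> * ((1 + \<mu>) / (1 - \<mu>)) ^ n) UNIV"
      using has_sum_cmult_right[OF has_sum_weights[OF \<mu>, of "UNIV :: 'n set"], of "B * inverse C * (8 * real \<nu> / \<sigma>) ^ \<nu>"]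
      unfolding W_def n_def by (simp add: supp_in_def)
    define u where "u x = (\<Sum>\<^sub>\<infinity>M. U M x)" for x
    define c where "c = fcs L (\<lambda>_. 0) h"
    have usum: "((\<lambda>M. U M x) has_sum u x) UNIV" if "x \<in> tdom (s - \<sigma>) \<tau>" for x
      unfolding u_def
      by (rule has_sum_infsum, rule summable_on_bound[OF has_sum_imp_summable[OF Wsum]]) (rule Ub[OF that])
    \<comment> \<open>Boxes exhausting the lattice: the finite sums over them are holomorphic and
      form a sequence, as the limit theorem requires.\<close>
    define X where "X m = {M :: 'n \<Rightarrow> int. \<forall>i. \<bar>M i\<bar> \<le> int m}" for m
    have Xf: "finite (X m)" for m
    proof -
      have "X m = PiE UNIV (\<lambda>_. {- int m..int m})" by (auto simp: X_def PiE_UNIV_domain Pi_def abs_le_iff minus_le_iff)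
      then show ?thesis by (simp add: finite_PiE)
    qed
    have Xe: "\<forall>\<^sub>F m in sequentially. M \<in> X m" for M
      unfolding X_def mem_Collect_eq
    proof (rule eventually_all_finite)
      show "\<forall>\<^sub>F m in sequentially. \<bar>M i\<bar> \<le> int m" for i
        using eventually_ge_at_top[of "nat \<bar>M i\<bar>"] by eventually_elim auto
    qed
    note Xlim = has_sum_imp_sums_sets[OF _ Xf subset_UNIV Xe]
    \<comment> \<open>The M-test gives uniform convergence along the filter of finite sets;
      composing with the boxes turns it into a sequential limit.\<close>
    have ul: "uniform_limit (tdom (s - \<sigma>) \<tau>) (\<lambda>m x. \<Sum>M\<in>X m. U M x) u sequentially"
    proof -
      have "uniform_limit (tdom (s - \<sigma>) \<tau>) (\<lambda>X y. \<Sum>M\<in>X. U M y) (\<lambda>y. \<Sum>\<^sub>\<infinity>M. U M y) (finite_subsets_at_top UNIV)"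
        by (rule Weierstrass_m_test_general[where M=W, OF Ub has_sum_imp_summable[OF Wsum]])
      from filterlim_compose[OF this Xlim(2)[OF Wsum]] show ?thesis
        by (simp add: u_def[abs_def])
    qed
    have Sh: "holo_on (\<lambda>x. \<Sum>M\<in>X m. U M x) (tdom (s - \<sigma>) \<tau>)" for m
      by (intro holo_on_sum holo_on_subset[OF Uh]) (use sub in auto)
    note lim = holo_on_limit_uniform[OF open_tdom Sh ul]
    have ub: "cmod (u x) \<le> K * B / \<sigma> ^ (\<nu> + n)" if x: "x \<in> tdom (s - \<sigma>) \<tau>" for x
    proof -
      have B0: "0 \<le> B" using order_trans[OF norm_ge_zero B'[OF sub[OF x]]] .
      have "cmod (u x) \<le> B * inverse C * (8 * real \<nu> / \<sigma>) ^ \<nu> * ((1 + \<mu>) / (1 - \<mu>)) ^ n"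
        by (rule norm_infsum_le[OF usum[OF x] Wsum Ub[OF x]])
      also have "\<dots> \<le> B * inverse C * (8 * real \<nu> / \<sigma>) ^ \<nu> * (4 / (\<sigma> / 8)) ^ n"
        by (intro mult_left_mono power_mono)
          (use exp_weight_bound(1)[of "\<sigma> / 8"] \<mu> \<sigma> C B0 in \<open>auto simp: \<mu>_def intro!: divide_nonneg_nonneg\<close>)
      also have "\<dots> = K * B / \<sigma> ^ (\<nu> + n)"
        by (simp add: K_def power_divide power_add)
      finally show ?thesis .
    qed
    have eqn: "(\<Sum>i\<in>UNIV. \<omega> $ i * Dq i u x) = h x - c x" if x: "x \<in> tdom (s - \<sigma>) \<tau>" for x
    proof -
      have A: "(\<lambda>m. \<Sum>i\<in>UNIV. \<omega> $ i * Dq i (\<lambda>x. \<Sum>M\<in>X m. U M x) x) \<longlonglongrightarrow> (\<Sum>i\<in>UNIV. \<omega> $ i * Dq i u x)"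
        by (intro tendsto_intros lim(2) x)
      \<comment> \<open>Multiplying by the divisor restores every Fourier term except the mean,
        which every box contains.\<close>
      have E: "(\<Sum>i\<in>UNIV. \<omega> $ i * Dq i (\<lambda>x. \<Sum>M\<in>X m. U M x) x) = (\<Sum>M\<in>X m. T M x) - c x" for m
      proof -
        have "(\<Sum>i\<in>UNIV. \<omega> $ i * Dq i (\<lambda>x. \<Sum>M\<in>X m. U M x) x) = (\<Sum>i\<in>UNIV. \<Sum>M\<in>X m. \<omega> $ i * (of_int (M i) * U M x))"
          unfolding fder_sum[OF Uh sub[OF x]] sum_distrib_left UD[OF sub[OF x]] ..
        also have "\<dots> = (\<Sum>M\<in>X m. d M * U M x)"
          by (subst sum.swap) (simp add: d_def sum_distrib_right mult.assoc)
        also have "\<dots> = (\<Sum>M\<in>X m. T M x - (if M = (\<lambda>_. 0) then c x else 0))"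
          by (rule sum.cong) (auto simp: U_def d0 dn T_def c_def)
        also have "\<dots> = (\<Sum>M\<in>X m. T M x) - c x"
          using Xf by (simp add: sum_subtractf X_def)
        finally show ?thesis .
      qed
      have "(\<lambda>m. (\<Sum>M\<in>X m. T M x) - c x) \<longlonglongrightarrow> h x - c x"
        by (intro tendsto_intros Xlim(1)[OF Tsum[OF x]])
      then show ?thesis by (rule LIMSEQ_unique[OF A[unfolded E]])
    qed
    have cb: "cmod (c x) \<le> B" if "x \<in> tdom s \<tau>" for x
      using fcs_bound[OF h s _ _ B' that L(2), of "\<lambda>_. 1" "\<lambda>_. 0"] s by (simp add: c_def)
    have ct: "tonly c"
      unfolding c_def by (rule tonlyI[OF g fcs_pindep[OF hp]])
    have up: "pindep u"
    proof (rule pindepI)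
      fix x y :: "'n phase" assume xy: "fst x = fst y" "snd (snd x) = snd (snd y)"
      show "u x = u y" unfolding u_def U_def pindepD[OF Tp xy] ..
    qed
    have z: "(\<forall>x\<in>tdom (s - \<sigma>) \<tau>. snd (snd x) = 0 \<longrightarrow> u x = 0) \<and> (\<forall>x\<in>tdom s \<tau>. snd (snd x) = 0 \<longrightarrow> c x = 0)"
      if h0: "\<forall>x\<in>tdom s \<tau>. snd (snd x) = 0 \<longrightarrow> h x = 0"
    proof -
      have f0: "fcs L M h x = 0" if "x \<in> tdom s \<tau>" "snd (snd x) = 0" for M x
        by (rule fcs_zero[OF _ s(1) that]) (use h0 in blast)
      then have "u x = 0" if "x \<in> tdom (s - \<sigma>) \<tau>" "snd (snd x) = 0" for x
        using sub[OF that(1)] that(2) by (simp add: u_def U_def T_def)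
      then show ?thesis using f0 unfolding c_def by blast
    qed
    have "sd_sol \<omega> (K / \<sigma> ^ (\<nu> + n)) s \<sigma> \<tau> B h u c"
      unfolding sd_sol_def
      using lim(1) up ub holo_on_fcs[OF h s(1), of L "\<lambda>_. 0"] ct cb eqn z unfolding c_def[symmetric] by auto
    then show "\<exists>u c. sd_sol \<omega> (K / \<sigma> ^ (\<nu> + n)) s \<sigma> \<tau> B h u c" by blast
  qed
  with K show thesis by (rule that)
qed

subsection \<open>Linear systems close to the identity\<close>

lemma cmod_sum_mult_le:
  fixes a b :: "'n::finite \<Rightarrow> complex"
  assumes "\<And>j. cmod (a j) \<le> \<alpha>" "\<And>j. cmod (b j) \<le> \<beta>"
  shows "cmod (\<Sum>j\<in>UNIV. a j * b j) \<le> real CARD('n) * (\<alpha> * \<beta>)"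
proof -
  have "cmod (a j * b j) \<le> \<alpha> * \<beta>" for j
    unfolding norm_mult
    by (rule mult_mono[OF assms order_trans[OF norm_ge_zero assms(1)] norm_ge_zero])
  from sum_norm_bound[of UNIV "\<lambda>j. a j * b j", OF this] show ?thesis by simp
qed

text \<open>Cramer's rule for the system (1 + N) v = b. A quotient of determinants makes the
  holomorphic dependence on parameters visible.\<close>

definition nsolve :: "('n::finite \<Rightarrow> 'n \<Rightarrow> complex) \<Rightarrow> ('n \<Rightarrow> complex) \<Rightarrow> 'n \<Rightarrow> complex" where
  "nsolve N b k = det (\<chi> i j. if j = k then b i else (if i = j then 1 else 0) + N i j) /
     det (\<chi> i j. (if i = j then 1 else 0) + N i j)"

text \<open>At an entry of largest modulus m the perturbation contributes at most m/2, so m \<le>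
  \<beta> + m/2. With \<beta> = 0 this is a uniqueness statement, and in this form it later proves
  the bracket relations.\<close>

lemma near_identity_bound:
  fixes v :: "'n::finite \<Rightarrow> complex"
  assumes eq: "\<And>i. v i + (\<Sum>j\<in>UNIV. N i j * v j) = b i" and N: "\<And>i j. cmod (N i j) \<le> \<delta>"
    and \<delta>: "real CARD('n) * \<delta> \<le> 1 / 2" and b: "\<And>i. cmod (b i) \<le> \<beta>"
  shows "cmod (v i) \<le> 2 * \<beta>"
proof -
  define m where "m = Max (range (\<lambda>i. cmod (v i)))"
  have m: "cmod (v i) \<le> m" for i unfolding m_def by (rule Max_ge) auto
  have "m \<in> range (\<lambda>i. cmod (v i))" unfolding m_def by (rule Max_in) auto
  then obtain k where k: "m = cmod (v k)" by auto
  have "cmod (\<Sum>j\<in>UNIV. N k j * v j) \<le> real CARD('n) * \<delta> * m"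
    using cmod_sum_mult_le[of "N k" \<delta> v m] N m by simp
  also have "\<dots> \<le> 1 / 2 * m" by (rule mult_right_mono[OF \<delta>]) (simp add: k)
  finally have "cmod (\<Sum>j\<in>UNIV. N k j * v j) \<le> 1 / 2 * m" .
  moreover have "v k = b k - (\<Sum>j\<in>UNIV. N k j * v j)" using eq[of k] by (simp add: algebra_simps)
  ultimately have "m \<le> \<beta> + 1 / 2 * m"
    using norm_triangle_ineq4[of "b k" "\<Sum>j\<in>UNIV. N k j * v j"] b[of k] k by simp
  then show ?thesis using m[of i] by linarith
qed

text \<open>The bound for right-hand side 0 shows that the kernel is trivial.\<close>

lemma
  fixes N :: "'n::finite \<Rightarrow> 'n \<Rightarrow> complex"
  assumes N: "\<And>i j. cmod (N i j) \<le> \<delta>" and \<delta>: "real CARD('n) * \<delta> \<le> 1 / 2"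
  shows nsolve_det: "det (\<chi> i j. (if i = j then 1 else 0) + N i j) \<noteq> 0"
    and nsolve_eq: "nsolve N b i + (\<Sum>j\<in>UNIV. N i j * nsolve N b j) = b i"
proof -
  let ?A = "(\<chi> i j. (if i = j then 1 else 0) + N i j) :: complex ^ 'n ^ 'n"
  have mv: "(?A *v v) $ i = v $ i + (\<Sum>j\<in>UNIV. N i j * v $ j)" for v i
  proof -
    have "((if i = j then 1 else 0) + N i j) * v $ j = (if i = j then v $ j else 0) + N i j * v $ j" for j
      by (simp add: distrib_right)
    then show ?thesis by (simp add: matrix_vector_mult_def sum.distrib)
  qed
  have "v = 0" if "?A *v v = 0" for v
  proof -
    have "v $ i + (\<Sum>j\<in>UNIV. N i j * v $ j) = 0" for i
      using mv[of v i] that by simp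
    then have "cmod (v $ i) \<le> 2 * 0" for i
      by (rule near_identity_bound[OF _ N \<delta>]) simp
    then show ?thesis by (simp add: vec_eq_iff)
  qed
  then have "invertible ?A"
    unfolding invertible_left_inverse matrix_left_invertible_ker by blast
  then show d: "det ?A \<noteq> 0" by (simp add: invertible_det_nz)
  have "(\<chi> k. nsolve N b k) = (\<chi> k. det (\<chi> i j. if j = k then (\<chi> i. b i) $ i else ?A $ i $ j) / det ?A)"
    by (simp only: nsolve_def vec_lambda_beta)
  then have "?A *v (\<chi> k. nsolve N b k) = (\<chi> i. b i)"
    using cramer[OF d] by blast
  then show "nsolve N b i + (\<Sum>j\<in>UNIV. N i j * nsolve N b j) = b i"
    using mv[of "\<chi> k. nsolve N b k" i] by simp
qed

lemma holo_on_det: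
  assumes "\<And>i j. holo_on (A i j) S"
  shows "holo_on (\<lambda>x. det (\<chi> i j. A i j x)) S"
  unfolding det_def by (auto intro!: holo_on_sum holo_on_mult holo_on_const holo_on_prod assms)

lemma holo_on_nsolve:
  fixes N :: "'m::finite \<Rightarrow> 'm \<Rightarrow> 'n::finite phase \<Rightarrow> complex"
  assumes N: "\<And>i j. holo_on (N i j) S" and b: "\<And>i. holo_on (b i) S"
    and \<delta>: "\<And>i j x. x \<in> S \<Longrightarrow> cmod (N i j x) \<le> \<delta>" "real CARD('m) * \<delta> \<le> 1 / 2"
  shows "holo_on (\<lambda>x. nsolve (\<lambda>i j. N i j x) (\<lambda>i. b i x) k) S"
  unfolding nsolve_def
proof (rule holo_on_divide)
  have "holo_on (\<lambda>x. if j = k then b i x else (if i = j then 1 else 0) + N i j x) S" for i j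
    by (cases "j = k") (auto intro!: b N holo_on_add holo_on_const)
  then show "holo_on (\<lambda>x. det (\<chi> i j. if j = k then b i x else (if i = j then 1 else 0) + N i j x)) S"
    by (rule holo_on_det)
  show "holo_on (\<lambda>x. det (\<chi> i j. (if i = j then 1 else 0) + N i j x)) S"
    by (intro holo_on_det holo_on_add holo_on_const N)
  show "det (\<chi> i j. (if i = j then 1 else 0) + N i j x) \<noteq> 0" if "x \<in> S" for x
    by (rule nsolve_det[OF \<delta>(1)[OF that] \<delta>(2)])
qed

subsection \<open>The linearised conjugacy problem\<close>

lemma fder_shift_eq:
  assumes "\<And>z. f (z + a) = f z"
  shows "fder f v (x + a) = fder f v x"
proof -
  have *: "(f has_derivative D) (at (x + a))" if "(f has_derivative D) (at x)" "\<And>z. f (z + a) = f z" for D x a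
  proof -
    have "((\<lambda>z. z - a) has_derivative (\<lambda>k. k)) (at (x + a))"
      by (auto intro!: derivative_eq_intros)
    from diff_chain_at[OF this, of f D] that(1) have "(f \<circ> (\<lambda>z. z - a) has_derivative D) (at (x + a))"
      by (simp add: o_def)
    moreover have "f \<circ> (\<lambda>z. z - a) = f" using that(2)[of "_ - a"] by (simp add: fun_eq_iff)
    ultimately show ?thesis by simp
  qed
  have m: "f (z + (- a)) = f z" for z using assms[of "z + (- a)"] by simp
  have "(f has_derivative D) (at x)" if h: "(f has_derivative D) (at (x + a))" for D
    using *[OF h m] by simp
  then have "(f has_derivative D) (at (x + a)) \<longleftrightarrow> (f has_derivative D) (at x)" for D
    using *[OF _ assms] by blast
  then show ?thesis unfolding frechet_derivative_def by simp
qed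

text \<open>Two points with the same \<open>q\<close> and \<open>t\<close> differ by a translation
  that leaves \<open>f\<close> invariant.\<close>

lemma pindep_fder:
  assumes "pindep f" shows "pindep (fder f v)"
proof (rule pindepI)
  fix x y :: "'a phase" assume xy: "fst x = fst y" "snd (snd x) = snd (snd y)"
  have "fder f v (y + (x - y)) = fder f v y"
    by (rule fder_shift_eq, rule pindepD[OF assms]) (use xy in auto)
  then show "fder f v x = fder f v y" by simp
qed

lemma pindep_Dq: "pindep f \<Longrightarrow> pindep (\<lambda>x. Dq i f x)"
  by (rule pindepI) (use pindepD[OF pindep_fder] in metis)

lemma axis_norm_le: "norm ((axis i 1, 0, 0) :: 'n::finite phase) \<le> 1" "norm ((0, axis i 1, 0) :: 'n phase) \<le> 1"
  by (simp_all add: norm_Pair)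

lemma holo_on_dq: "holo_on f S \<Longrightarrow> open S \<Longrightarrow> holo_on (dq i f) S"
  by (rule holo_on_fder[OF _ _ axis_norm_le(1)])

lemma holo_on_dp: "holo_on f S \<Longrightarrow> open S \<Longrightarrow> holo_on (dp i f) S"
  by (rule holo_on_fder[OF _ _ axis_norm_le(2)])

lemma holo_on_Dq: "holo_on f S \<Longrightarrow> open S \<Longrightarrow> holo_on (\<lambda>x. Dq i f x) S"
  by (intro holo_on_mult holo_on_coords holo_on_dq)

lemma Dq_Dq:
  assumes f: "holo_on f S" "open S" "x \<in> S"
  shows "Dq i (\<lambda>x. Dq j f x) x = fst x $ i * ((if i = j then 1 else 0) * dq j f x + fst x $ j * dq i (dq j f) x)"
  using fder_mult[OF holo_on_coords(1)[of j] holo_on_dq[OF f(1,2), of j] f(3), where v="(axis i 1, 0, 0)"]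
  by (simp add: axis_def algebra_simps)

lemma Dq_commute:
  assumes f: "holo_on f S" "open S" "x \<in> S"
  shows "Dq i (\<lambda>x. Dq j f x) x = Dq j (\<lambda>x. Dq i f x) x"
  unfolding Dq_Dq[OF f] fder_commute[OF f(1,2) axis_norm_le(1) axis_norm_le(1) f(3), of j i]
  by (auto simp: algebra_simps)

lemma Dq_bound:
  assumes f: "holo_on f (tdom s \<tau>)" "\<And>y. y \<in> tdom s \<tau> \<Longrightarrow> cmod (f y) \<le> B"
    and \<sigma>: "0 < \<sigma>" "s < 1" and x: "x \<in> tdom (s - \<sigma>) \<tau>"
  shows "cmod (Dq i f x) \<le> 4 * B / \<sigma>"
proof -
  have "cmod (fst x $ i) < 1 + (s - \<sigma>)" using x unfolding tdom_def by blast
  then have q: "cmod (fst x $ i) \<le> 2" using \<sigma> by linarith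
  have "cmod (dq i f x) \<le> 2 * B * 1 / \<sigma>"
    by (rule fder_tdom[OF f \<sigma>(1) x small_axis(1)]) auto
  then have "cmod (fst x $ i) * cmod (dq i f x) \<le> 2 * (2 * B * 1 / \<sigma>)"
    by (intro mult_mono q) auto
  then show ?thesis by (simp add: norm_mult)
qed

lemma dp_bound:
  assumes f: "holo_on f (tdom s \<tau>)" "\<And>y. y \<in> tdom s \<tau> \<Longrightarrow> cmod (f y) \<le> B"
    and \<sigma>: "0 < \<sigma>" and x: "x \<in> tdom (s - \<sigma>) \<tau>"
  shows "cmod (dp i f x) \<le> 2 * B / \<sigma>"
  using fder_tdom[OF f \<sigma> x small_axis(2)] by simp

lemma sd_solD:
  assumes "sd_sol \<omega> K s \<sigma> \<tau> B h u c"
  shows "holo_on u (tdom (s - \<sigma>) \<tau>)" "pindep u" "x \<in> tdom (s - \<sigma>) \<tau> \<Longrightarrow> cmod (u x) \<le> K * B"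
    "holo_on c (tdom s \<tau>)" "tonly c" "x \<in> tdom s \<tau> \<Longrightarrow> cmod (c x) \<le> B"
    "x \<in> tdom (s - \<sigma>) \<tau> \<Longrightarrow> (\<Sum>i\<in>UNIV. \<omega> $ i * Dq i u x) = h x - c x"
    "(\<forall>x\<in>tdom s \<tau>. snd (snd x) = 0 \<longrightarrow> h x = 0) \<Longrightarrow> x \<in> tdom (s - \<sigma>) \<tau> \<Longrightarrow> snd (snd x) = 0 \<Longrightarrow> u x = 0"
    "(\<forall>x\<in>tdom s \<tau>. snd (snd x) = 0 \<longrightarrow> h x = 0) \<Longrightarrow> x \<in> tdom s \<tau> \<Longrightarrow> snd (snd x) = 0 \<Longrightarrow> c x = 0"
  using assms unfolding sd_sol_def by blast+

text \<open>The two first-order conditions under which a lift removes the errors: \<open>e0\<close>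
  is the error of the value and \<open>e1 i\<close> that of the i-th p-derivative at
  \<open>p = 0\<close>, \<open>Q\<close> is the Hessian there, \<open>w\<close> moves the torus and
  \<eta> shifts the momenta. The symmetry condition says that \<eta> is closed in logarithmic
  coordinates, from which the lift gets its symplecticity.\<close>

definition hom_sol :: "complex ^ 'n::finite \<Rightarrow> real \<Rightarrow> 'n phase set \<Rightarrow> 'n phase set \<Rightarrow> ('n phase \<Rightarrow> complex) \<Rightarrow>
    ('n \<Rightarrow> 'n phase \<Rightarrow> complex) \<Rightarrow> ('n \<Rightarrow> 'n \<Rightarrow> 'n phase \<Rightarrow> complex) \<Rightarrow>
    ('n \<Rightarrow> 'n phase \<Rightarrow> complex) \<Rightarrow> ('n \<Rightarrow> 'n phase \<Rightarrow> complex) \<Rightarrow> ('n phase \<Rightarrow> complex) \<Rightarrow> bool" where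
  "hom_sol \<omega> \<beta> S S' e0 e1 Q w \<eta> C \<longleftrightarrow>
     (\<forall>i. holo_on (w i) S' \<and> pindep (w i) \<and> holo_on (\<eta> i) S' \<and> pindep (\<eta> i)) \<and> tonly C \<and>
     (\<forall>x\<in>S'. e0 x + (\<Sum>i\<in>UNIV. \<omega> $ i * \<eta> i x) = C x) \<and>
     (\<forall>x\<in>S'. \<forall>i. cmod (w i x) \<le> \<beta> \<and> cmod (\<eta> i x) \<le> \<beta>) \<and>
     (\<forall>x\<in>S'. \<forall>i. (\<Sum>j\<in>UNIV. \<omega> $ j * Dq j (w i) x) = e1 i x + (\<Sum>j\<in>UNIV. Q i j x * \<eta> j x)) \<and>
     (\<forall>x\<in>S'. \<forall>i j. Dq i (\<eta> j) x = Dq j (\<eta> i) x) \<and>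
     ((\<forall>x\<in>S. snd (snd x) = 0 \<longrightarrow> e0 x = 0 \<and> (\<forall>i. e1 i x = 0)) \<longrightarrow>
       (\<forall>x\<in>S'. snd (snd x) = 0 \<longrightarrow> (\<forall>i. w i x = 0 \<and> \<eta> i x = 0)))"

text \<open>The tolerance \<delta> for the Hessian, like \<open>c\<close> and \<kappa>, is fixed
  before the data: \<open>Q\<close> varies along the iteration while \<open>A\<close> does
  not.\<close>

definition hom_solvable :: "complex ^ 'n::finite \<Rightarrow> complex ^ 'n ^ 'n \<Rightarrow> real \<Rightarrow> nat \<Rightarrow> real \<Rightarrow> bool" where
  "hom_solvable \<omega> A c \<kappa> \<delta> \<longleftrightarrow> (\<forall>s \<sigma> \<tau> \<epsilon> e0 e1 Q. 0 < \<sigma> \<longrightarrow> 3 * \<sigma> < s \<longrightarrow> s < 1 \<longrightarrow>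
     holo_on e0 (tdom s \<tau>) \<longrightarrow> pindep e0 \<longrightarrow> (\<forall>i. holo_on (e1 i) (tdom s \<tau>) \<and> pindep (e1 i)) \<longrightarrow>
     (\<forall>i j. holo_on (Q i j) (tdom s \<tau>) \<and> pindep (Q i j)) \<longrightarrow>
     (\<forall>x\<in>tdom s \<tau>. cmod (e0 x) \<le> \<epsilon> \<and> (\<forall>i. cmod (e1 i x) \<le> \<epsilon>) \<and> (\<forall>i j. cmod (Q i j x - A $ i $ j) \<le> \<delta>)) \<longrightarrow>
     (\<exists>w \<eta> C. hom_sol \<omega> (c * \<epsilon> / \<sigma> ^ \<kappa>) (tdom s \<tau>) (tdom (s - 3 * \<sigma>) \<tau>) e0 e1 Q w \<eta> C))"

lemma nsolve_zero:
  fixes N :: "'n::finite \<Rightarrow> 'n \<Rightarrow> complex"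
  assumes "\<And>i j. cmod (N i j) \<le> \<delta>" "real CARD('n) * \<delta> \<le> 1 / 2" "\<And>i. b i = 0"
  shows "nsolve N b i = 0"
proof -
  have "cmod (nsolve N b i) \<le> 2 * 0"
    by (rule near_identity_bound[OF nsolve_eq[OF assms(1,2)] assms(1,2)]) (simp add: assms(3))
  then show ?thesis by simp
qed

text \<open>A direction without \<open>t\<close> component stays inside the slice
  \<open>t = 0\<close>, on which the function vanishes near the point.\<close>

lemma fder_zero_slice:
  assumes u: "holo_on u S" "open S" "\<And>x. x \<in> S \<Longrightarrow> snd (snd x) = 0 \<Longrightarrow> u x = 0"
    and x: "x \<in> S" "snd (snd x) = 0" and v: "snd (snd v) = 0"
  shows "fder u v x = 0"
proof -
  have "((\<lambda>z. u (x + cscale z v)) has_field_derivative fder u v (x + cscale 0 v)) (at 0)"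
    by (rule holo_on_line[OF u(1)]) (simp add: x)
  moreover have "\<forall>\<^sub>F z in nhds 0. u (x + cscale z v) = 0"
  proof -
    have "continuous_on UNIV (\<lambda>z. x + cscale z v)"
      by (intro continuous_intros linear_continuous_on cscale_bl)
    then have "open ((\<lambda>z. x + cscale z v) -` S)"
      using open_vimage u(2) by blast
    moreover have "u (x + cscale z v) = 0" if "x + cscale z v \<in> S" for z
      using u(3)[OF that] x(2) v by (simp add: cscale_def case_prod_beta)
    ultimately show ?thesis unfolding eventually_nhds
      using x(1) by (intro exI[of _ "(\<lambda>z. x + cscale z v) -` S"]) auto
  qed
  ultimately have "((\<lambda>_. 0) has_field_derivative fder u v x) (at (0::complex))"
    using DERIV_cong_ev[of 0 0 "\<lambda>z. u (x + cscale z v)" "\<lambda>_. 0" "fder u v x"] by simp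
  from DERIV_unique[OF this DERIV_const] show ?thesis by simp
qed

text \<open>The ansatz is \<eta> = \<xi>(t) - D u, closed for every \<xi>, with \<open>u\<close>
  solving the equation for \<open>e0\<close>. The second condition then has right-hand side f + Q
  \<xi> with f = e1 - Q D u. Solving it separately for \<open>f\<close> and for the entries of Q - A
  leaves one obstruction, the average fm + (A + g) \<xi>, and \<xi> is chosen to make it vanish;
  here (K) enters.\<close>

lemma hom_solvable_exists:
  fixes \<omega> :: "complex ^ 'n::finite" and A :: "complex ^ 'n ^ 'n"
  assumes sd: "sd_solvable \<omega> K \<nu>" and K: "0 < K" and A: "invertible A"
  obtains c \<kappa> \<delta> where "0 < c" "0 < \<delta>" "hom_solvable \<omega> A c \<kappa> \<delta>"
proof -
  obtain A' where AA: "A ** A' = mat 1" using A unfolding invertible_def by blast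
  define n where "n = real CARD('n)"
  have n: "1 \<le> n" unfolding n_def using zero_less_card_finite[where 'a='n] by linarith
  define \<alpha> where "\<alpha> = 1 + (\<Sum>i\<in>UNIV. \<Sum>j\<in>UNIV. cmod (A' $ i $ j))"
  have ent: "cmod (M $ i $ j) \<le> (\<Sum>i\<in>UNIV. \<Sum>j\<in>UNIV. cmod (M $ i $ j))" for M :: "complex ^ 'n ^ 'n" and i j
  proof -
    have "cmod (M $ i $ j) \<le> (\<Sum>j\<in>UNIV. cmod (M $ i $ j))" by (rule member_le_sum) auto
    also have "\<dots> \<le> (\<Sum>i\<in>UNIV. \<Sum>j\<in>UNIV. cmod (M $ i $ j))" by (rule member_le_sum) (auto intro: sum_nonneg)
    finally show ?thesis .
  qed
  have \<alpha>: "1 \<le> \<alpha>" "cmod (A' $ i $ j) \<le> \<alpha>" for i j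
    using ent[of A' i j] by (auto simp: \<alpha>_def intro!: sum_nonneg)
  \<comment> \<open>The entries of A' g are at most n \<alpha> \<delta>; the near-identity lemmas
    need \<open>n\<close> times this to be at most 1/2.\<close>
  define \<delta> where "\<delta> = 1 / (2 * n * n * \<alpha>)"
  have \<delta>: "0 < \<delta>" "n * (n * (\<alpha> * \<delta>)) = 1 / 2" using n \<alpha>(1) by (auto simp: \<delta>_def)
  define B where "B = (\<Sum>i\<in>UNIV. \<Sum>j\<in>UNIV. cmod (A $ i $ j)) + \<delta>"
  have B: "0 < B" unfolding B_def using \<delta> by (intro add_nonneg_pos sum_nonneg) auto
  \<comment> \<open>Bounds \<open>f\<close>: the error itself plus \<open>n\<close> products of a
    Hessian entry with a derivative of \<open>u\<close>, the 4 coming from the Cauchy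
    estimate.\<close>
  define c1 where "c1 = 1 + n * B * 4 * K"
  have c1: "0 < c1" using n B K by (simp add: c1_def add_pos_pos)
  \<comment> \<open>The summands bound, in this order, \<open>w\<close>, the part \<xi> of \<eta>,
    and the derivative of \<open>u\<close>.\<close>
  define c where "c = c1 * K * (1 + n * \<delta> * 2 * n * \<alpha>) + 2 * n * \<alpha> * c1 + 4 * K"
  have c: "0 < c" using n \<alpha>(1) c1 K \<delta> by (auto simp: c_def intro!: add_pos_pos mult_pos_pos)
  \<comment> \<open>Two successive solutions, for \<open>u\<close> and then for \<open>f\<close>,
    cost \<sigma>^\<nu> each, and the derivative of \<open>u\<close> taken in between costs one more
    factor.\<close>
  have "hom_solvable \<omega> A c (2 * \<nu> + 1) \<delta>"
    unfolding hom_solvable_def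
  proof (intro allI impI)
    fix s \<sigma> \<tau> \<epsilon> and e0 :: "'n phase \<Rightarrow> complex" and e1 :: "'n \<Rightarrow> 'n phase \<Rightarrow> complex"
      and Q :: "'n \<Rightarrow> 'n \<Rightarrow> 'n phase \<Rightarrow> complex"
    assume \<sigma>: "0 < \<sigma>" "3 * \<sigma> < s" "s < 1" and e0: "holo_on e0 (tdom s \<tau>)" "pindep e0"
      and e1: "\<forall>i. holo_on (e1 i) (tdom s \<tau>) \<and> pindep (e1 i)"
      and Q: "\<forall>i j. holo_on (Q i j) (tdom s \<tau>) \<and> pindep (Q i j)"
      and bd: "\<forall>x\<in>tdom s \<tau>. cmod (e0 x) \<le> \<epsilon> \<and> (\<forall>i. cmod (e1 i x) \<le> \<epsilon>) \<and>
        (\<forall>i j. cmod (Q i j x - A $ i $ j) \<le> \<delta>)"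
    let ?D0 = "tdom s \<tau>" and ?D1 = "tdom (s - \<sigma>) \<tau>" and ?D2 = "tdom (s - 2 * \<sigma>) \<tau>" and ?D3 = "tdom (s - 3 * \<sigma>) \<tau>"
    have D32: "x \<in> ?D2" if "x \<in> ?D3" for x by (rule tdom_mono[OF _ _ that]) (use \<sigma> in auto)
    have D21: "x \<in> ?D1" if "x \<in> ?D2" for x by (rule tdom_mono[OF _ _ that]) (use \<sigma> in auto)
    have D10: "x \<in> ?D0" if "x \<in> ?D1" for x by (rule tdom_mono[OF _ _ that]) (use \<sigma> in auto)
    note D = D32 D21 D10
    have \<sigma>1: "\<sigma> < 1" using \<sigma> by linarith
    have \<sigma>s: "\<sigma> < s" "\<sigma> < s - 2 * \<sigma>" "s - 2 * \<sigma> < 1" "s - \<sigma> < 1" using \<sigma> by auto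
    have e0b: "\<And>x. x \<in> ?D0 \<Longrightarrow> cmod (e0 x) \<le> \<epsilon>" using bd by blast
    obtain u c0 where U: "sd_sol \<omega> (K / \<sigma> ^ \<nu>) s \<sigma> \<tau> \<epsilon> e0 u c0"
      using sd \<sigma>(1,3) \<sigma>s(1) e0 e0b unfolding sd_solvable_def by meson
    note u = sd_solD(1-3)[OF U] and c0 = sd_solD(5)[OF U] and ueq = sd_solD(7)[OF U] and uz = sd_solD(8)[OF U]
    have D1eq: "s - \<sigma> - \<sigma> = s - 2 * \<sigma>" by simp
    have D2eq: "s - 2 * \<sigma> - \<sigma> = s - 3 * \<sigma>" by simp
    have Dub: "cmod (Dq i u x) \<le> 4 * K * \<epsilon> / \<sigma> ^ (\<nu> + 1)" if "x \<in> ?D2" for i x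
      using Dq_bound[OF u(1,3) \<sigma>(1) \<sigma>s(4), unfolded D1eq, OF _ that] by (simp add: mult_ac)
    define f where "f i x = e1 i x - (\<Sum>j\<in>UNIV. Q i j x * Dq j u x)" for i x
    define F where "F = c1 * \<epsilon> / \<sigma> ^ (\<nu> + 1)"
    have Qb: "cmod (Q i j x) \<le> B" if "x \<in> ?D0" for i j x
    proof -
      have "cmod (Q i j x - A $ i $ j) \<le> \<delta>" using bd that by blast
      then show ?thesis
        unfolding B_def using norm_triangle_ineq2[of "Q i j x" "A $ i $ j"] ent[of A i j] by linarith
    qed
    have f_holo: "holo_on (f i) ?D2" for i
      unfolding f_def
    proof (intro holo_on_diff holo_on_sum holo_on_mult[of "Q i _"])
      show "holo_on (e1 i) ?D2" "holo_on (Q i j) ?D2" for j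
        by (rule holo_on_subset[of _ ?D0]; use e1 Q D in blast)+
      show "holo_on (\<lambda>x. Dq j u x) ?D2" for j
        by (rule holo_on_subset[OF holo_on_Dq[OF u(1) open_tdom]]) (use D in blast)
    qed
    have f_pindep: "pindep (f i)" for i
    proof (rule pindepI)
      fix x y :: "'n phase" assume xy: "fst x = fst y" "snd (snd x) = snd (snd y)"
      have "e1 i x = e1 i y" "Q i j x = Q i j y" "Dq j u x = Dq j u y" for j
        using pindepD[OF _ xy] e1 Q pindep_Dq[OF u(2)] by blast+
      then show "f i x = f i y" by (simp add: f_def)
    qed
    have fb: "cmod (f i x) \<le> F" if x: "x \<in> ?D2" for i x
    proof -
      have x0: "x \<in> ?D0" using D x by blast
      have \<epsilon>: "0 \<le> \<epsilon>" using order_trans[OF norm_ge_zero e0b[OF x0]] .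
      have "cmod (\<Sum>j\<in>UNIV. Q i j x * Dq j u x) \<le> n * (B * (4 * K * \<epsilon> / \<sigma> ^ (\<nu> + 1)))"
        unfolding n_def by (rule cmod_sum_mult_le[OF Qb[OF x0] Dub[OF x]])
      moreover have "cmod (e1 i x) \<le> \<epsilon>" using bd x0 by blast
      moreover have "\<epsilon> \<le> \<epsilon> / \<sigma> ^ (\<nu> + 1)"
      proof -
        have "\<sigma> ^ (\<nu> + 1) \<le> 1" by (rule power_le_one) (use \<sigma> \<sigma>1 in auto)
        then show ?thesis using \<epsilon> \<sigma> by (simp add: pos_le_divide_eq mult_left_le)
      qed
      ultimately have "cmod (f i x) \<le> \<epsilon> / \<sigma> ^ (\<nu> + 1) + n * (B * (4 * K * \<epsilon> / \<sigma> ^ (\<nu> + 1)))"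
        unfolding f_def using norm_triangle_ineq4[of "e1 i x" "\<Sum>j\<in>UNIV. Q i j x * Dq j u x"]
        by linarith
      also have "\<dots> = F" by (simp add: F_def c1_def algebra_simps add_divide_distrib)
      finally show ?thesis .
    qed
    have "\<exists>z fm. sd_sol \<omega> (K / \<sigma> ^ \<nu>) (s - 2 * \<sigma>) \<sigma> \<tau> F (f i) z fm" for i
      using sd \<sigma>(1) \<sigma>s(2,3) f_holo[of i] f_pindep[of i] fb[of _ i] unfolding sd_solvable_def by meson
    then obtain z fm where Z: "\<And>i. sd_sol \<omega> (K / \<sigma> ^ \<nu>) (s - 2 * \<sigma>) \<sigma> \<tau> F (f i) (z i) (fm i)" by metis
    note z = sd_solD(1-3)[OF Z, unfolded D2eq] and fm = sd_solD(4-6)[OF Z] and zeq = sd_solD(7)[OF Z, unfolded D2eq]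
      and zz = sd_solD(8)[OF Z, unfolded D2eq] and fmz = sd_solD(9)[OF Z]
    have QA: "holo_on (\<lambda>x. Q i j x - A $ i $ j) ?D0" "pindep (\<lambda>x. Q i j x - A $ i $ j)"
      "\<And>x. x \<in> ?D0 \<Longrightarrow> cmod (Q i j x - A $ i $ j) \<le> \<delta>" for i j
    proof -
      show "holo_on (\<lambda>x. Q i j x - A $ i $ j) ?D0" using Q by (intro holo_on_diff holo_on_const) auto
      show "pindep (\<lambda>x. Q i j x - A $ i $ j)"
        by (rule pindepI) (use Q pindepD in metis)
      show "\<And>x. x \<in> ?D0 \<Longrightarrow> cmod (Q i j x - A $ i $ j) \<le> \<delta>" using bd by blast
    qed
    have "\<exists>y g. sd_sol \<omega> (K / \<sigma> ^ \<nu>) s \<sigma> \<tau> \<delta> (\<lambda>x. Q i j x - A $ i $ j) y g" for i j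
      using sd \<sigma>(1,3) \<sigma>s(1) QA(1,2)[of i j] QA(3)[of _ i j] unfolding sd_solvable_def by meson
    then obtain y g where Y: "\<And>i j. sd_sol \<omega> (K / \<sigma> ^ \<nu>) s \<sigma> \<tau> \<delta> (\<lambda>x. Q i j x - A $ i $ j) (y i j) (g i j)" by metis
    note y = sd_solD(1-3)[OF Y] and g = sd_solD(4-6)[OF Y] and yeq = sd_solD(7)[OF Y]
    \<comment> \<open>The averaged equation is multiplied by the inverse A' of \<open>A\<close>,
      which turns it into a system close to the identity.\<close>
    define N where "N k j x = (\<Sum>i\<in>UNIV. A' $ k $ i * g i j x)" for k j x
    define b where "b k x = - (\<Sum>i\<in>UNIV. A' $ k $ i * fm i x)" for k x
    define \<xi> where "\<xi> k x = nsolve (\<lambda>i j. N i j x) (\<lambda>i. b i x) k" for k x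
    have Nb: "cmod (N k j x) \<le> n * (\<alpha> * \<delta>)" if "x \<in> ?D0" for k j x
      unfolding N_def n_def by (rule cmod_sum_mult_le[OF \<alpha>(2) g(3)[OF that]])
    have bb: "cmod (b k x) \<le> n * (\<alpha> * F)" if "x \<in> ?D2" for k x
      unfolding b_def n_def norm_minus_cancel by (rule cmod_sum_mult_le[OF \<alpha>(2) fm(3)[OF that]])
    have nd: "real CARD('n) * (n * (\<alpha> * \<delta>)) \<le> 1 / 2" using \<delta>(2) by (simp add: n_def)
    have Nb2: "cmod (N k j x) \<le> n * (\<alpha> * \<delta>)" if "x \<in> ?D2" for k j x using Nb D that by blast
    have \<xi>eq: "\<xi> i x + (\<Sum>j\<in>UNIV. N i j x * \<xi> j x) = b i x" if "x \<in> ?D2" for i x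
      unfolding \<xi>_def by (rule nsolve_eq[OF Nb2[OF that] nd])
    have \<xi>b: "cmod (\<xi> i x) \<le> 2 * (n * (\<alpha> * F))" if "x \<in> ?D2" for i x
      by (rule near_identity_bound[OF \<xi>eq[OF that] Nb2[OF that] nd bb[OF that]])
    have \<xi>h: "holo_on (\<xi> i) ?D2" for i
      unfolding \<xi>_def
    proof (rule holo_on_nsolve[OF _ _ Nb2 nd])
      show "holo_on (N i j) ?D2" for i j
        unfolding N_def by (intro holo_on_sum holo_on_mult holo_on_const holo_on_subset[OF g(1)]) (use D in blast)
      show "holo_on (b i) ?D2" for i
        unfolding b_def by (intro holo_on_minus holo_on_sum holo_on_mult holo_on_const fm(1))
    qed
    have \<xi>t: "tonly (\<xi> i)" for i
    proof (unfold tonly_def, intro allI impI)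
      fix x y :: "'n phase" assume t: "snd (snd x) = snd (snd y)"
      have "(\<lambda>i j. N i j x) = (\<lambda>i j. N i j y)" "(\<lambda>i. b i x) = (\<lambda>i. b i y)"
        unfolding N_def b_def using tonlyD[OF g(2) t] tonlyD[OF fm(2) t] by simp_all
      then show "\<xi> i x = \<xi> i y" by (simp add: \<xi>_def)
    qed
    \<comment> \<open>Multiplying back by \<open>A\<close>, with A A' = 1, recovers the averaged
      equation.\<close>
    have key: "fm i x + (\<Sum>j\<in>UNIV. (A $ i $ j + g i j x) * \<xi> j x) = 0" if x: "x \<in> ?D2" for i x
    proof -
      have AAe: "(\<Sum>k\<in>UNIV. A $ i $ k * A' $ k $ l) = (if i = l then 1 else 0)" for l
        using AA by (simp add: matrix_matrix_mult_def mat_def vec_eq_iff)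
      have sw: "(\<Sum>k\<in>UNIV. A $ i $ k * (\<Sum>l\<in>UNIV. A' $ k $ l * h l)) = h i" for h :: "'n \<Rightarrow> complex"
      proof -
        have "(\<Sum>k\<in>UNIV. A $ i $ k * (\<Sum>l\<in>UNIV. A' $ k $ l * h l)) = (\<Sum>l\<in>UNIV. (\<Sum>k\<in>UNIV. A $ i $ k * A' $ k $ l) * h l)"
          unfolding sum_distrib_left sum_distrib_right by (subst sum.swap) (simp add: mult.assoc)
        then show ?thesis by (simp add: AAe if_distrib if_distribR cong: if_cong)
      qed
      have "(\<Sum>k\<in>UNIV. A $ i $ k * (\<xi> k x + (\<Sum>j\<in>UNIV. N k j x * \<xi> j x))) = (\<Sum>k\<in>UNIV. A $ i $ k * b k x)"
        using \<xi>eq[OF x] by simp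
      moreover have "(\<Sum>k\<in>UNIV. A $ i $ k * b k x) = - fm i x"
        using sw[of "\<lambda>i. fm i x"] by (simp add: b_def sum_negf)
      moreover have "(\<Sum>k\<in>UNIV. A $ i $ k * (\<Sum>j\<in>UNIV. N k j x * \<xi> j x)) = (\<Sum>j\<in>UNIV. g i j x * \<xi> j x)"
      proof -
        have "(\<Sum>j\<in>UNIV. N k j x * \<xi> j x) = (\<Sum>l\<in>UNIV. A' $ k $ l * (\<Sum>j\<in>UNIV. g l j x * \<xi> j x))" for k
          unfolding N_def sum_distrib_left sum_distrib_right by (subst sum.swap) (simp add: mult.assoc)
        then show ?thesis using sw[of "\<lambda>l. \<Sum>j\<in>UNIV. g l j x * \<xi> j x"] by simp
      qed
      ultimately show ?thesis by (simp add: algebra_simps sum.distrib)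
    qed
    define w where "w i x = z i x + (\<Sum>j\<in>UNIV. y i j x * \<xi> j x)" for i x
    define \<eta> where "\<eta> i x = \<xi> i x - Dq i u x" for i x
    have h3: "holo_on (y i j) ?D3" "holo_on (\<xi> i) ?D3" "holo_on (\<lambda>x. Dq i u x) ?D3" for i j
      by (rule holo_on_subset[OF y(1)] holo_on_subset[OF \<xi>h] holo_on_subset[OF holo_on_Dq[OF u(1) open_tdom]];
          use D in blast)+
    have wh: "holo_on (w i) ?D3" for i
      unfolding w_def by (intro holo_on_add holo_on_sum holo_on_mult z h3)
    have \<eta>h: "holo_on (\<eta> i) ?D3" for i
      unfolding \<eta>_def[abs_def] by (rule holo_on_diff[OF h3(2,3)])
    have wp: "pindep (w i)" and \<eta>p: "pindep (\<eta> i)" for i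
    proof -
      have "w i x = w i x' \<and> \<eta> i x = \<eta> i x'" if xy: "fst x = fst x'" "snd (snd x) = snd (snd x')" for x x'
      proof -
        have "z i x = z i x'" "y i j x = y i j x'" "\<xi> j x = \<xi> j x'" "Dq i u x = Dq i u x'" for j
          using pindepD[OF z(2) xy] pindepD[OF y(2) xy] tonlyD[OF \<xi>t xy(2)] pindepD[OF pindep_Dq[OF u(2)] xy] by blast+
        then show ?thesis by (simp only: w_def \<eta>_def)
      qed
      then show "pindep (w i)" "pindep (\<eta> i)" using pindepI by blast+
    qed
    let ?C = "\<lambda>x. c0 x + (\<Sum>i\<in>UNIV. \<omega> $ i * \<xi> i x)"
    have Ct: "tonly ?C"
      unfolding tonly_def using tonlyD[OF c0] tonlyD[OF \<xi>t] by (metis (no_types, lifting) sum.cong)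
    have e0eq: "e0 x + (\<Sum>i\<in>UNIV. \<omega> $ i * \<eta> i x) = ?C x" if "x \<in> ?D3" for x
    proof -
      have "x \<in> ?D1" using D that by blast
      then show ?thesis using ueq[of x] by (simp add: \<eta>_def right_diff_distrib sum_subtractf)
    qed
    \<comment> \<open>For the angles \<xi> is a constant, so it passes through every
      \<open>Dq k\<close>.\<close>
    have xz: "fder (\<xi> j) (axis k 1, 0, 0) x = 0" if "x \<in> ?D3" for j k x
      by (rule tonly_fder[OF h3(2) that \<xi>t]) simp
    have weq: "(\<Sum>k\<in>UNIV. \<omega> $ k * Dq k (w i) x) = e1 i x + (\<Sum>j\<in>UNIV. Q i j x * \<eta> j x)" if x: "x \<in> ?D3" for i x
    proof -
      have x1: "x \<in> ?D1" "x \<in> ?D2" using D x by blast+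
      have "dq k (w i) x = dq k (z i) x + (\<Sum>j\<in>UNIV. dq k (y i j) x * \<xi> j x)" for k
        unfolding w_def[abs_def]
        by (simp add: fder_add[OF z(1) holo_on_sum[OF holo_on_mult[OF h3(1,2)]] x]
            fder_sum[OF holo_on_mult[OF h3(1,2)] x] fder_mult[OF h3(1,2) x] xz[OF x])
      then have "(\<Sum>k\<in>UNIV. \<omega> $ k * Dq k (w i) x) =
          (\<Sum>k\<in>UNIV. \<omega> $ k * Dq k (z i) x) + (\<Sum>k\<in>UNIV. \<Sum>j\<in>UNIV. \<omega> $ k * Dq k (y i j) x * \<xi> j x)"
        by (simp add: distrib_left sum.distrib sum_distrib_left mult.assoc)
      also have "(\<Sum>k\<in>UNIV. \<Sum>j\<in>UNIV. \<omega> $ k * Dq k (y i j) x * \<xi> j x) =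
          (\<Sum>j\<in>UNIV. ((Q i j x - A $ i $ j) - g i j x) * \<xi> j x)"
        by (subst sum.swap) (simp only: sum_distrib_right[symmetric] yeq[OF x1(1)])
      also have "(\<Sum>k\<in>UNIV. \<omega> $ k * Dq k (z i) x) = f i x - fm i x" by (rule zeq[OF x])
      also have "f i x - fm i x + (\<Sum>j\<in>UNIV. ((Q i j x - A $ i $ j) - g i j x) * \<xi> j x) =
          f i x + (\<Sum>j\<in>UNIV. Q i j x * \<xi> j x) - (fm i x + (\<Sum>j\<in>UNIV. (A $ i $ j + g i j x) * \<xi> j x))"
        by (simp add: algebra_simps sum.distrib sum_subtractf)
      also have "\<dots> = e1 i x + (\<Sum>j\<in>UNIV. Q i j x * \<eta> j x)"
        unfolding key[OF x1(2)] by (simp add: f_def \<eta>_def algebra_simps sum_subtractf)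
      finally show ?thesis .
    qed
    have sym: "Dq i (\<eta> j) x = Dq j (\<eta> i) x" if x: "x \<in> ?D3" for i j x
    proof -
      have "x \<in> ?D1" using D x by blast
      from Dq_commute[OF u(1) open_tdom this, of i j]
      show ?thesis unfolding \<eta>_def[abs_def] fder_diff[OF h3(2,3) x] xz[OF x] by simp
    qed
    have bounds: "cmod (w i x) \<le> c * \<epsilon> / \<sigma> ^ (2 * \<nu> + 1) \<and> cmod (\<eta> i x) \<le> c * \<epsilon> / \<sigma> ^ (2 * \<nu> + 1)" if x: "x \<in> ?D3" for i x
    proof -
      have x1: "x \<in> ?D0" "x \<in> ?D1" "x \<in> ?D2" using D x by blast+
      have \<epsilon>: "0 \<le> \<epsilon>" using order_trans[OF norm_ge_zero e0b[OF x1(1)]] .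
      define E where "E = \<epsilon> / \<sigma> ^ (2 * \<nu> + 1)"
      have E0: "0 \<le> E" using \<epsilon> \<sigma> by (simp add: E_def)
      have E1: "\<epsilon> / \<sigma> ^ (\<nu> + 1) \<le> E" unfolding E_def
        by (intro divide_left_mono power_decreasing) (use \<epsilon> \<sigma> \<sigma>1 in auto)
      have FE: "F \<le> c1 * E" using mult_left_mono[OF E1, of c1] c1 by (simp add: F_def)
      have FE': "F / \<sigma> ^ \<nu> = c1 * E"
        by (simp add: F_def E_def power_add[symmetric] mult_2)
      have "cmod (\<Sum>j\<in>UNIV. y i j x * \<xi> j x) \<le> n * (K / \<sigma> ^ \<nu> * \<delta> * (2 * (n * (\<alpha> * F))))"
        unfolding n_def by (rule cmod_sum_mult_le[OF y(3)[OF x1(2)] \<xi>b[OF x1(3), unfolded n_def]])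
      also have "\<dots> = n * (K * \<delta> * (2 * (n * \<alpha>))) * (F / \<sigma> ^ \<nu>)" by simp
      finally have "cmod (w i x) \<le> K * (F / \<sigma> ^ \<nu>) + n * (K * \<delta> * (2 * (n * \<alpha>))) * (F / \<sigma> ^ \<nu>)"
        unfolding w_def using norm_triangle_ineq[of "z i x" "\<Sum>j\<in>UNIV. y i j x * \<xi> j x"] z(3)[OF x, of i] by simp
      also have "\<dots> = c1 * K * (1 + n * \<delta> * 2 * n * \<alpha>) * E" unfolding FE' by (simp add: algebra_simps)
      also have "\<dots> \<le> c * E" unfolding c_def by (rule mult_right_mono) (use n \<alpha>(1) c1 K E0 in auto)
      finally have 1: "cmod (w i x) \<le> c * E" .
      have "cmod (\<eta> i x) \<le> 2 * (n * (\<alpha> * F)) + 4 * K * \<epsilon> / \<sigma> ^ (\<nu> + 1)"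
        unfolding \<eta>_def using norm_triangle_ineq4[of "\<xi> i x" "Dq i u x"] \<xi>b[OF x1(3), of i] Dub[OF x1(3), of i] by linarith
      also have "\<dots> \<le> 2 * (n * (\<alpha> * (c1 * E))) + 4 * K * E"
        using mult_left_mono[OF E1, of "4 * K"] K n \<alpha>(1) FE
        by (intro add_mono mult_left_mono) (auto simp: mult.assoc)
      also have "\<dots> = (2 * n * \<alpha> * c1 + 4 * K) * E" by (simp add: algebra_simps)
      also have "\<dots> \<le> c * E" unfolding c_def
        by (rule mult_right_mono) (use n \<alpha>(1) c1 K E0 \<delta> in \<open>auto intro!: mult_nonneg_nonneg add_nonneg_nonneg\<close>)
      finally show ?thesis using 1 by (simp add: E_def)
    qed
    have zero: "\<forall>x\<in>?D3. snd (snd x) = 0 \<longrightarrow> (\<forall>i. w i x = 0 \<and> \<eta> i x = 0)"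
      if z0: "\<forall>x\<in>?D0. snd (snd x) = 0 \<longrightarrow> e0 x = 0 \<and> (\<forall>i. e1 i x = 0)"
    proof -
      have u0: "\<forall>x\<in>?D1. snd (snd x) = 0 \<longrightarrow> u x = 0" using uz z0 by blast
      have Du0: "Dq i u x = 0" if x: "x \<in> ?D1" "snd (snd x) = 0" for i x
        using fder_zero_slice[OF u(1) open_tdom _ x, of "(axis i 1, 0, 0)"] u0 by simp
      have f0: "f i x = 0" if "x \<in> ?D2" "snd (snd x) = 0" for i x
      proof -
        have "e1 i x = 0" using z0 D that by blast
        moreover have "Dq j u x = 0" for j by (rule Du0) (use D that in blast)+
        ultimately show ?thesis unfolding f_def by (simp only: mult_zero_right sum.neutral_const diff_zero)
      qed
      have z1: "z i x = 0" if "x \<in> ?D3" "snd (snd x) = 0" for i x using zz f0 that by blast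
      have fm0: "fm i x = 0" if "x \<in> ?D2" "snd (snd x) = 0" for i x using fmz f0 that by blast
      have \<xi>0: "\<xi> i x = 0" if "x \<in> ?D2" "snd (snd x) = 0" for i x
        unfolding \<xi>_def by (rule nsolve_zero[OF Nb2[OF that(1)] nd]) (simp add: b_def fm0[OF that])
      show ?thesis
      proof (intro ballI impI allI)
        fix x :: "'n phase" and i assume x: "x \<in> ?D3" "snd (snd x) = 0"
        have "\<xi> j x = 0" "Dq j u x = 0" for j using \<xi>0 Du0 D x by blast+
        then show "w i x = 0 \<and> \<eta> i x = 0"
          using z1[OF x] by (simp only: w_def \<eta>_def mult_zero_right sum.neutral_const diff_zero add_0_right simp_thms)
      qed
    qed
    have "hom_sol \<omega> (c * \<epsilon> / \<sigma> ^ (2 * \<nu> + 1)) ?D0 ?D3 e0 e1 Q w \<eta> ?C"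
      unfolding hom_sol_def using wh wp \<eta>h \<eta>p Ct e0eq bounds weq sym zero by (intro conjI allI ballI impI; blast)
    then show "\<exists>w \<eta> C. hom_sol \<omega> (c * \<epsilon> / \<sigma> ^ (2 * \<nu> + 1)) ?D0 ?D3 e0 e1 Q w \<eta> C" by blast
  qed
  with c \<delta>(1) show thesis by (rule that)
qed

subsection \<open>Symplectic maps\<close>

definition pb :: "('n::finite phase \<Rightarrow> complex) \<Rightarrow> ('n phase \<Rightarrow> complex) \<Rightarrow> 'n phase \<Rightarrow> complex" where
  "pb f g x = (\<Sum>i\<in>UNIV. dp i f x * Dq i g x - Dq i f x * dp i g x)"

abbreviation qpart :: "('n::finite phase \<Rightarrow> 'n phase) \<Rightarrow> 'n \<Rightarrow> 'n phase \<Rightarrow> complex" where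
  "qpart \<Phi> i \<equiv> \<lambda>x. fst (\<Phi> x) $ i"

abbreviation ppart :: "('n::finite phase \<Rightarrow> 'n phase) \<Rightarrow> 'n \<Rightarrow> 'n phase \<Rightarrow> complex" where
  "ppart \<Phi> i \<equiv> \<lambda>x. fst (snd (\<Phi> x)) $ i"

lemma pb_antisym: "pb g f x = - pb f g x"
  by (simp add: pb_def sum_negf[symmetric] mult.commute)

text \<open>The bracket depends on its first argument only through the gradient in \<open>q\<close>
  and \<open>p\<close>, and linearly. Together with the chain rule this computes brackets of
  composites.\<close>

lemma pb_combination:
  assumes "\<And>i. dp i F x = (\<Sum>a\<in>I. c a * dp i (A a) x)" "\<And>i. dq i F x = (\<Sum>a\<in>I. c a * dq i (A a) x)"
  shows "pb F G x = (\<Sum>a\<in>I. c a * pb (A a) G x)"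
proof -
  have "pb F G x = (\<Sum>i\<in>UNIV. \<Sum>a\<in>I. c a * (dp i (A a) x * Dq i G x - Dq i (A a) x * dp i G x))"
    unfolding pb_def assms
    by (simp add: sum_distrib_left sum_distrib_right sum_subtractf[symmetric] algebra_simps)
  then show ?thesis unfolding pb_def sum_distrib_left by (subst sum.swap) simp
qed

lemma
  assumes f: "holo_on f S" and g: "holo_on g S" and x: "x \<in> S"
  shows pb_add: "pb (\<lambda>x. f x + g x) h x = pb f h x + pb g h x"
    and pb_mult: "pb (\<lambda>x. f x * g x) h x = f x * pb g h x + g x * pb f h x"
  by (simp_all add: pb_def fder_add[OF f g x] fder_mult[OF f g x] sum.distrib[symmetric] sum_distrib_left algebra_simps)

lemma pb_sum:
  assumes "\<And>i. i \<in> I \<Longrightarrow> holo_on (f i) S" "x \<in> S"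
  shows "pb (\<lambda>x. \<Sum>i\<in>I. f i x) h x = (\<Sum>i\<in>I. pb (f i) h x)"
  using pb_combination[of "\<lambda>x. \<Sum>i\<in>I. f i x" x "\<lambda>_. 1" f I h] by (simp add: fder_sum[OF assms])

lemma pb_cong:
  assumes "open S" "\<And>x. x \<in> S \<Longrightarrow> f x = g x" "x \<in> S"
  shows "pb f h x = pb g h x"
  unfolding pb_def using fder_cong[OF assms] by simp

lemma pb_pindep:
  assumes "holo_on f S" "holo_on g S" "x \<in> S" "pindep f" "pindep g"
  shows "pb f g x = 0"
  using assms by (simp add: pb_def pindep_dp)

lemma pb_p:
  shows "pb (\<lambda>x. fst (snd x) $ i) g x = Dq i g x"
proof -
  have "pb (\<lambda>x. fst (snd x) $ i) g x = (\<Sum>k\<in>UNIV. if k = i then Dq i g x else 0)"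
    unfolding pb_def by (rule sum.cong) (auto simp: axis_def)
  then show ?thesis by simp
qed

text \<open>Only brackets of coordinates are prescribed, with the momenta conjugate to log q;
  brackets of arbitrary functions follow by the chain rule.\<close>

definition symp :: "('n::finite phase \<Rightarrow> 'n phase) \<Rightarrow> 'n phase set \<Rightarrow> bool" where
  "symp \<Phi> S \<longleftrightarrow> hmap \<Phi> S \<and> (\<forall>x\<in>S. snd (snd (\<Phi> x)) = snd (snd x)) \<and>
     (\<forall>x\<in>S. \<forall>i j. pb (ppart \<Phi> i) (qpart \<Phi> j) x = (if i = j then qpart \<Phi> j x else 0) \<and>
        pb (ppart \<Phi> i) (ppart \<Phi> j) x = 0 \<and> pb (qpart \<Phi> i) (qpart \<Phi> j) x = 0)"

lemma sympD:
  assumes "symp \<Phi> S"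
  shows "hmap \<Phi> S" "x \<in> S \<Longrightarrow> snd (snd (\<Phi> x)) = snd (snd x)"
    "x \<in> S \<Longrightarrow> pb (ppart \<Phi> i) (qpart \<Phi> j) x = (if i = j then qpart \<Phi> j x else 0)"
    "x \<in> S \<Longrightarrow> pb (ppart \<Phi> i) (ppart \<Phi> j) x = 0" "x \<in> S \<Longrightarrow> pb (qpart \<Phi> i) (qpart \<Phi> j) x = 0"
  using assms unfolding symp_def by blast+

text \<open>The \<open>t\<close> component of the map has derivative 0 in a direction without
  \<open>t\<close> part, so only the \<open>q\<close> and \<open>p\<close> derivatives of
  \<open>f\<close> occur.\<close>

lemma fder_symp_compose:
  assumes \<Phi>: "symp \<Phi> S" "open S" and sub: "\<And>x. x \<in> S \<Longrightarrow> \<Phi> x \<in> T" and f: "holo_on f T"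
    and x: "x \<in> S" and v: "snd (snd v) = 0"
  shows "fder (\<lambda>x. f (\<Phi> x)) v x = (\<Sum>a\<in>UNIV. dq a f (\<Phi> x) * fder (qpart \<Phi> a) v x) +
    (\<Sum>a\<in>UNIV. dp a f (\<Phi> x) * fder (ppart \<Phi> a) v x)"
proof -
  have "fder (\<lambda>x. snd (snd (\<Phi> x))) v x = fder (\<lambda>x. snd (snd x)) v x"
    by (rule fder_cong[OF \<Phi>(2) sympD(2)[OF \<Phi>(1)] x])
  then have h1: "hder \<Phi> v x = (\<chi> a. fder (qpart \<Phi> a) v x, \<chi> a. fder (ppart \<Phi> a) v x, 0)"
    by (simp add: hder_def v)
  have h2: "fder (\<lambda>x. f (\<Phi> x)) v x = fder f (hder \<Phi> v x) (\<Phi> x)"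
    by (rule fder_compose[OF f sympD(1)[OF \<Phi>(1)] sub x])
  have h3: "fder f (\<chi> a. fder (qpart \<Phi> a) v x, \<chi> a. fder (ppart \<Phi> a) v x, 0) (\<Phi> x) =
    (\<Sum>a\<in>UNIV. fder (qpart \<Phi> a) v x * dq a f (\<Phi> x)) + (\<Sum>a\<in>UNIV. fder (ppart \<Phi> a) v x * dp a f (\<Phi> x))"
    using fder_decomp[OF f sub[OF x], of "\<chi> a. fder (qpart \<Phi> a) v x" "\<chi> a. fder (ppart \<Phi> a) v x" 0]
    unfolding vec_lambda_beta mult_zero_left add_0_right .
  have h4: "(\<Sum>a\<in>UNIV. fder (qpart \<Phi> a) v x * dq a f (\<Phi> x)) = (\<Sum>a\<in>UNIV. dq a f (\<Phi> x) * fder (qpart \<Phi> a) v x)"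
    "(\<Sum>a\<in>UNIV. fder (ppart \<Phi> a) v x * dp a f (\<Phi> x)) = (\<Sum>a\<in>UNIV. dp a f (\<Phi> x) * fder (ppart \<Phi> a) v x)"
    by (simp_all add: mult.commute)
  show ?thesis using h2 h3 unfolding h1 h4 by (rule trans)
qed

text \<open>The gradient of a composite is a combination of the gradients of the component
  functions, so the bracket expands into the brackets of the components, which are
  prescribed.\<close>

lemma symp_pb:
  assumes \<Phi>: "symp \<Phi> S" "open S" and sub: "\<And>x. x \<in> S \<Longrightarrow> \<Phi> x \<in> T"
    and f: "holo_on f T" and g: "holo_on g T" and x: "x \<in> S"
  shows "pb (\<lambda>x. f (\<Phi> x)) (\<lambda>x. g (\<Phi> x)) x = pb f g (\<Phi> x)"
proof -
  \<comment> \<open>The sum type indexes all components of the map, left for \<open>q\<close> and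
    right for \<open>p\<close>, so that the expansion is a single sum.\<close>
  define c where "c f a = (case a of Inl a \<Rightarrow> dq a f (\<Phi> x) | Inr a \<Rightarrow> dp a f (\<Phi> x))" for f and a :: "'a + 'a"
  define A where "A a = (case a of Inl a \<Rightarrow> qpart \<Phi> a | Inr a \<Rightarrow> ppart \<Phi> a)" for a :: "'a + 'a"
  have S: "(\<Sum>a\<in>UNIV. F a) = (\<Sum>a\<in>UNIV. F (Inl a)) + (\<Sum>a\<in>UNIV. F (Inr a))" for F :: "'a + 'a \<Rightarrow> complex"
    unfolding UNIV_Plus_UNIV[symmetric] by (subst sum.Plus) auto
  have D: "fder (\<lambda>x. f (\<Phi> x)) v x = (\<Sum>a\<in>UNIV. c f a * fder (A a) v x)" if "holo_on f T" "snd (snd v) = 0" for f v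
    unfolding S c_def A_def sum.case by (rule fder_symp_compose[OF \<Phi> sub that(1) x that(2)])
  have P: "pb (\<lambda>x. f (\<Phi> x)) G x = (\<Sum>a\<in>UNIV. c f a * pb (A a) G x)" if "holo_on f T" for f G
    by (rule pb_combination) (rule D[OF that], simp)+
  have "pb (\<lambda>x. f (\<Phi> x)) (\<lambda>x. g (\<Phi> x)) x = (\<Sum>a\<in>UNIV. c f a * - (\<Sum>b\<in>UNIV. c g b * pb (A b) (A a) x))"
    unfolding P[OF f] pb_antisym[of "A _" "\<lambda>x. g (\<Phi> x)"] P[OF g] ..
  also have "\<dots> = (\<Sum>a\<in>UNIV. dp a f (\<Phi> x) * Dq a g (\<Phi> x)) - (\<Sum>a\<in>UNIV. Dq a f (\<Phi> x) * dp a g (\<Phi> x))"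
  proof -
    have 1: "(\<Sum>b\<in>UNIV. c g b * pb (A b) (A (Inl a)) x) = dp a g (\<Phi> x) * fst (\<Phi> x) $ a" for a
      unfolding S by (simp add: A_def c_def sympD(3-5)[OF \<Phi>(1) x] if_distrib cong: if_cong)
    have 2: "(\<Sum>b\<in>UNIV. c g b * pb (A b) (A (Inr a)) x) = - (dq a g (\<Phi> x) * fst (\<Phi> x) $ a)" for a
      unfolding S by (simp add: A_def c_def sympD(3-5)[OF \<Phi>(1) x] pb_antisym[of "qpart \<Phi> _" "ppart \<Phi> _"] if_distrib cong: if_cong)
    show ?thesis by (subst S, unfold 1 2) (simp add: c_def sum_negf algebra_simps)
  qed
  also have "\<dots> = pb f g (\<Phi> x)" by (simp add: pb_def sum_subtractf)
  finally show ?thesis .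
qed

subsection \<open>Lifts of torus maps\<close>

definition lift_N :: "('n::finite \<Rightarrow> 'n phase \<Rightarrow> complex) \<Rightarrow> 'n phase \<Rightarrow> 'n \<Rightarrow> 'n \<Rightarrow> complex" where
  "lift_N w x i j = Dq i (w j) x"

text \<open>The momentum $p'$ is determined by $(1 + N) p' = p + \eta$ with $N_{ij} = q_i \partial_{q_i} w_j$,
  so that $\sum_j p'_j \, d \log q'_j = \sum_i (p_i + \eta_i) \, d \log q_i$.\<close>

definition lift_map :: "('n::finite \<Rightarrow> 'n phase \<Rightarrow> complex) \<Rightarrow> ('n \<Rightarrow> 'n phase \<Rightarrow> complex) \<Rightarrow> 'n phase \<Rightarrow> 'n phase" where
  "lift_map w \<eta> x = (\<chi> j. fst x $ j * exp (w j x),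
     \<chi> k. nsolve (lift_N w x) (\<lambda>i. fst (snd x) $ i + \<eta> i x) k, snd (snd x))"

text \<open>The first-order part of the lift minus the identity: to first order, (1 + N) p' = p +
  \<eta> gives p' - p = \<eta> - N p.\<close>

definition lift_field :: "('n::finite \<Rightarrow> 'n phase \<Rightarrow> complex) \<Rightarrow> ('n \<Rightarrow> 'n phase \<Rightarrow> complex) \<Rightarrow> 'n phase \<Rightarrow> 'n phase" where
  "lift_field w \<eta> x = (\<chi> j. fst x $ j * w j x, \<chi> j. \<eta> j x - (\<Sum>k\<in>UNIV. lift_N w x j k * fst (snd x) $ k), 0)"

text \<open>The momenta are known only through (1 + N) P = p + \<eta>, so brackets are taken of this
  equation. Functions independent of \<open>p\<close> commute, hence the unknown brackets satisfy
  near-identity systems, whose solutions are unique and can be guessed. The closedness of \<eta> and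
  the commuting of second derivatives of \<open>w\<close> make the bracket of two momenta
  vanish.\<close>

lemma lift_symp:
  fixes w \<eta> :: "'n::finite \<Rightarrow> 'n phase \<Rightarrow> complex"
  assumes S: "open S" and w: "\<And>i. holo_on (w i) S" "\<And>i. pindep (w i)"
    and \<eta>: "\<And>i. holo_on (\<eta> i) S" "\<And>i. pindep (\<eta> i)"
    and sym: "\<And>x i j. x \<in> S \<Longrightarrow> Dq i (\<eta> j) x = Dq j (\<eta> i) x"
    and N: "\<And>x i j. x \<in> S \<Longrightarrow> cmod (lift_N w x i j) \<le> \<gamma>" and \<gamma>: "real CARD('n) * \<gamma> \<le> 1 / 2"
  shows "symp (lift_map w \<eta>) S"
proof -
  let ?Q = "\<lambda>j x. fst x $ j * exp (w j x)"
  let ?P = "\<lambda>k x. nsolve (lift_N w x) (\<lambda>i. fst (snd x) $ i + \<eta> i x) k"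
  let ?N = "\<lambda>i j x. lift_N w x i j"
  have Nh: "holo_on (?N i j) S" for i j
    unfolding lift_N_def by (rule holo_on_Dq[OF w(1) S])
  have Np: "pindep (?N i j)" for i j
    unfolding lift_N_def by (rule pindep_Dq[OF w(2)])
  have Qh: "holo_on (?Q j) S" for j
    by (intro holo_on_mult holo_on_coords holo_on_exp(1) w)
  have Qp: "pindep (?Q j)" for j
  proof (rule pindepI)
    fix x y :: "'n phase" assume xy: "fst x = fst y" "snd (snd x) = snd (snd y)"
    show "?Q j x = ?Q j y" unfolding pindepD[OF w(2) xy] xy(1) ..
  qed
  have Ph: "holo_on (?P k) S" for k
    by (rule holo_on_nsolve[OF Nh _ N \<gamma>]) (auto intro!: holo_on_add holo_on_coords \<eta>)
  have Peq: "?P i x + (\<Sum>j\<in>UNIV. ?N i j x * ?P j x) = fst (snd x) $ i + \<eta> i x" if "x \<in> S" for i x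
    by (rule nsolve_eq[OF N[OF that] \<gamma>])
  have DQ: "Dq i (?Q k) x = ((if i = k then 1 else 0) + ?N i k x) * ?Q k x" if x: "x \<in> S" for i k x
    by (simp add: fder_mult[OF holo_on_coords(1) holo_on_exp(1)[OF w(1)] x] holo_on_exp(2)[OF w(1) x]
        lift_N_def axis_def algebra_simps)
  have NPh: "holo_on (\<lambda>x. ?N i j x * ?P j x) S" for i j by (intro holo_on_mult Nh Ph)
  have SNPh: "holo_on (\<lambda>x. \<Sum>j\<in>UNIV. ?N i j x * ?P j x) S" for i by (intro holo_on_sum NPh)
  \<comment> \<open>The bracket of the defining equation of the momenta with an arbitrary
    \<open>h\<close>; the terms in which \<open>N\<close> is differentiated move to the
    right.\<close>
  have id: "pb (?P i) h x + (\<Sum>j\<in>UNIV. ?N i j x * pb (?P j) h x) =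
      Dq i h x + pb (\<eta> i) h x - (\<Sum>j\<in>UNIV. ?P j x * pb (?N i j) h x)" if x: "x \<in> S" for i h x
  proof -
    have "pb (\<lambda>x. ?P i x + (\<Sum>j\<in>UNIV. ?N i j x * ?P j x)) h x = pb (\<lambda>x. fst (snd x) $ i + \<eta> i x) h x"
      by (rule pb_cong[OF S Peq x])
    then show ?thesis
      unfolding pb_add[OF Ph SNPh x] pb_add[OF holo_on_coords(2) \<eta>(1) x] pb_p pb_sum[OF NPh x] pb_mult[OF Nh Ph x]
      by (simp add: sum.distrib algebra_simps)
  qed
  have aux: "(\<Sum>j\<in>UNIV. a j * (b j - (if j = k then c else 0))) = (\<Sum>j\<in>UNIV. a j * b j) - a k * c"
    for a b :: "'n \<Rightarrow> complex" and k c
  proof -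
    have "a j * (b j - (if j = k then c else 0)) = a j * b j - (if j = k then a j * c else 0)" for j
      by (simp add: right_diff_distrib)
    then show ?thesis by (simp add: sum_subtractf)
  qed
  \<comment> \<open>By the formula for \<open>Dq i (?Q k)\<close>, the expected values solve the
    same linear system as the brackets.\<close>
  have PQ: "pb (?P i) (?Q k) x = (if i = k then ?Q k x else 0)" if x: "x \<in> S" for i k x
  proof -
    have "cmod (pb (?P i) (?Q k) x - (if i = k then ?Q k x else 0)) \<le> 2 * 0"
    proof (rule near_identity_bound[where v="\<lambda>i. pb (?P i) (?Q k) x - (if i = k then ?Q k x else 0)" and b="\<lambda>_. 0",
          OF _ N[OF x] \<gamma>])
      fix i
      have "pb (?P i) (?Q k) x + (\<Sum>j\<in>UNIV. ?N i j x * pb (?P j) (?Q k) x) = Dq i (?Q k) x"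
        using id[OF x, of i "?Q k"] by (simp add: pb_pindep[OF \<eta>(1) Qh x \<eta>(2) Qp] pb_pindep[OF Nh Qh x Np Qp])
      then have "pb (?P i) (?Q k) x + (\<Sum>j\<in>UNIV. ?N i j x * pb (?P j) (?Q k) x) =
          (if i = k then ?Q k x else 0) + ?N i k x * ?Q k x"
        unfolding DQ[OF x] by (simp only: distrib_right if_distribR mult_1_left mult_zero_left split: if_split) simp
      then show "pb (?P i) (?Q k) x - (if i = k then ?Q k x else 0) +
          (\<Sum>j\<in>UNIV. ?N i j x * (pb (?P j) (?Q k) x - (if j = k then ?Q k x else 0))) = 0"
        unfolding aux by (simp only: diff_add_eq add_diff_eq) simp
    qed simp
    then show ?thesis by simp
  qed
  \<comment> \<open>The same identity in the second slot, by antisymmetry.\<close>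
  have id': "pb f (?P l) x + (\<Sum>k\<in>UNIV. ?N l k x * pb f (?P k) x) =
      - Dq l f x + pb f (\<eta> l) x - (\<Sum>k\<in>UNIV. ?P k x * pb f (?N l k) x)" if x: "x \<in> S" for l f x
    using id[OF x, of l f] unfolding pb_antisym[of "?P _" f] pb_antisym[of "\<eta> _" f] pb_antisym[of "?N _ _" f]
    by (simp add: sum_negf algebra_simps)
  have PP: "pb (?P i) (?P k) x = 0" if x: "x \<in> S" for i k x
  proof -
    \<comment> \<open>The right-hand side of the system for the brackets of two momenta. It vanishes
      because, in its second index, it solves a homogeneous system of the same kind.\<close>
    define Z where "Z i k = Dq i (?P k) x + pb (\<eta> i) (?P k) x - (\<Sum>j\<in>UNIV. ?P j x * pb (?N i j) (?P k) x)" for i k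
    have Z0: "Z i l = 0" for i l
    proof -
      have "cmod (Z i l) \<le> 2 * 0"
      proof (rule near_identity_bound[where v="Z i" and b="\<lambda>_. 0", OF _ N[OF x] \<gamma>])
        fix l
        have p: "Dq i (?P l) x + (\<Sum>k\<in>UNIV. ?N l k x * Dq i (?P k) x) = Dq i (\<eta> l) x - (\<Sum>k\<in>UNIV. ?P k x * Dq i (?N l k) x)"
          using id'[OF x, of "\<lambda>x. fst (snd x) $ i" l] by (simp add: pb_p)
        have e: "pb (\<eta> i) (?P l) x + (\<Sum>k\<in>UNIV. ?N l k x * pb (\<eta> i) (?P k) x) = - Dq l (\<eta> i) x"
          using id'[OF x, of "\<eta> i" l] by (simp add: pb_pindep[OF \<eta>(1) \<eta>(1) x \<eta>(2) \<eta>(2)] pb_pindep[OF \<eta>(1) Nh x \<eta>(2) Np])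
        have n: "pb (?N i j) (?P l) x + (\<Sum>k\<in>UNIV. ?N l k x * pb (?N i j) (?P k) x) = - Dq l (?N i j) x" for j
          using id'[OF x, of "?N i j" l] by (simp add: pb_pindep[OF Nh \<eta>(1) x Np \<eta>(2)] pb_pindep[OF Nh Nh x Np Np])
        have "(\<Sum>k\<in>UNIV. ?N l k x * (\<Sum>j\<in>UNIV. ?P j x * pb (?N i j) (?P k) x)) =
            (\<Sum>j\<in>UNIV. ?P j x * (\<Sum>k\<in>UNIV. ?N l k x * pb (?N i j) (?P k) x))"
          unfolding sum_distrib_left by (subst sum.swap) (simp add: mult_ac)
        then have "Z i l + (\<Sum>k\<in>UNIV. ?N l k x * Z i k) =
            (Dq i (?P l) x + (\<Sum>k\<in>UNIV. ?N l k x * Dq i (?P k) x)) +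
            (pb (\<eta> i) (?P l) x + (\<Sum>k\<in>UNIV. ?N l k x * pb (\<eta> i) (?P k) x)) -
            (\<Sum>j\<in>UNIV. ?P j x * (pb (?N i j) (?P l) x + (\<Sum>k\<in>UNIV. ?N l k x * pb (?N i j) (?P k) x)))"
          unfolding Z_def by (simp add: algebra_simps sum.distrib sum_subtractf)
        also have "\<dots> = Dq i (\<eta> l) x - Dq l (\<eta> i) x + (\<Sum>j\<in>UNIV. ?P j x * (Dq l (?N i j) x - Dq i (?N l j) x))"
          unfolding p e n by (simp add: right_diff_distrib sum_subtractf sum_negf)
        also have "\<dots> = 0"
          using sym[OF x, of i l] Dq_commute[OF w(1) S x, of l i] by (simp add: lift_N_def)
        finally show "Z i l + (\<Sum>k\<in>UNIV. ?N l k x * Z i k) = 0" .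
      qed simp
      then show ?thesis by simp
    qed
    have "cmod (pb (?P i) (?P k) x) \<le> 2 * 0"
    proof (rule near_identity_bound[where v="\<lambda>i. pb (?P i) (?P k) x" and b="\<lambda>_. 0", OF _ N[OF x] \<gamma>])
      show "pb (?P i) (?P k) x + (\<Sum>j\<in>UNIV. ?N i j x * pb (?P j) (?P k) x) = 0" for i
        using id[OF x, of i "?P k"] Z0[of i k] unfolding Z_def by (rule trans)
    qed simp
    then show ?thesis by simp
  qed
  have "hmap (lift_map w \<eta>) S"
    unfolding hmap_def lift_map_def by (simp add: Qh Ph holo_on_coords)
  then show ?thesis
    unfolding symp_def using PQ PP pb_pindep[OF Qh Qh _ Qp Qp] by (simp add: lift_map_def)
qed

section \<open>Size of the lift and of its deviation from the linearisation\<close>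

lemma exp_quadratic_bound:
  fixes z :: complex assumes "cmod z \<le> 1"
  shows "cmod (exp z - 1 - z) \<le> 3 * (cmod z)\<^sup>2"
proof -
  have "cmod (exp z - (\<Sum>k\<le>1. z ^ k / fact k)) \<le> exp \<bar>Re z\<bar> * cmod z ^ Suc 1 / fact 1"
    by (rule Taylor_exp)
  moreover have "exp \<bar>Re z\<bar> \<le> 3"
    using abs_Re_le_cmod[of z] assms exp_le by (meson exp_le_cancel_iff order_trans)
  ultimately show ?thesis
    using mult_right_mono[of "exp \<bar>Re z\<bar>" 3 "(cmod z)\<^sup>2"] by (simp add: power2_eq_square diff_diff_eq)
qed

text \<open>Writing P - p = \<eta> - N P bounds the displacement of the momenta; inserting this once
  more gives P - p - (\<eta> - N p) = - N (P - p), which is quadratic. The angles are handled by the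
  Taylor expansion of exp. The constants use |q| \<le> 2, |p| \<le> 1 and |P| \<le> 4.\<close>

lemma lift_estimates:
  fixes w \<eta> :: "'n::finite \<Rightarrow> 'n phase \<Rightarrow> complex"
  assumes w: "\<And>i. cmod (w i x) \<le> \<gamma>" and \<eta>: "\<And>i. cmod (\<eta> i x) \<le> \<gamma>"
    and N: "\<And>i j. cmod (lift_N w x i j) \<le> \<gamma>" and \<gamma>: "real CARD('n) * \<gamma> \<le> 1 / 2"
    and x: "x \<in> tdom s \<tau>" "s < 1"
  defines "n \<equiv> real CARD('n)"
  shows "small (5 * n * \<gamma>) (lift_map w \<eta> x - x)"
    "small (6 * (n * \<gamma>)\<^sup>2) (lift_map w \<eta> x - x - lift_field w \<eta> x)"
    "small (5 * n * \<gamma>) (lift_field w \<eta> x)"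
proof -
  have n: "1 \<le> n" unfolding n_def using zero_less_card_finite[where 'a='n] by linarith
  have g0: "0 \<le> \<gamma>" using w norm_ge_zero order_trans by blast
  have ng: "\<gamma> \<le> n * \<gamma>" using mult_right_mono[OF n g0] by simp
  have g1: "n * \<gamma> \<le> 1 / 2" using \<gamma> by (simp add: n_def)
  define G where "G = n * \<gamma>"
  have G: "0 \<le> G" "\<gamma> \<le> G" "G \<le> 1 / 2" using ng g0 g1 by (auto simp: G_def)
  have GG: "\<gamma>\<^sup>2 \<le> G\<^sup>2" using G g0 by (intro power_mono) auto
  have q: "cmod (fst x $ i) \<le> 2" and p: "cmod (fst (snd x) $ i) \<le> 1" for i
  proof -
    have "cmod (fst x $ i) < 1 + s" "cmod (fst (snd x) $ i) < s" using x unfolding tdom_def by blast+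
    then show "cmod (fst x $ i) \<le> 2" "cmod (fst (snd x) $ i) \<le> 1" using x(2) by linarith+
  qed
  define P where "P k = nsolve (lift_N w x) (\<lambda>i. fst (snd x) $ i + \<eta> i x) k" for k
  have Peq: "P i + (\<Sum>j\<in>UNIV. lift_N w x i j * P j) = fst (snd x) $ i + \<eta> i x" for i
    unfolding P_def by (rule nsolve_eq[OF N \<gamma>])
  have Pb: "cmod (P k) \<le> 2 * 2" for k
  proof (rule near_identity_bound[OF Peq N \<gamma>])
    show "cmod (fst (snd x) $ i + \<eta> i x) \<le> 2" for i
      using norm_triangle_ineq[of "fst (snd x) $ i" "\<eta> i x"] p[of i] \<eta>[of i] G by linarith
  qed
  have NP: "cmod (\<Sum>j\<in>UNIV. lift_N w x i j * P j) \<le> 4 * G" for i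
    using cmod_sum_mult_le[of "lift_N w x i" \<gamma> P 4] N Pb by (simp add: G_def n_def)
  have Pd: "P i - fst (snd x) $ i = \<eta> i x - (\<Sum>j\<in>UNIV. lift_N w x i j * P j)" for i
    using Peq[of i] by (simp add: algebra_simps)
  have Pd1: "cmod (P i - fst (snd x) $ i) \<le> 5 * G" for i
    unfolding Pd using norm_triangle_ineq4[of "\<eta> i x" "\<Sum>j\<in>UNIV. lift_N w x i j * P j"] \<eta>[of i] NP[of i] G by linarith
  have Pd2: "cmod (P i - fst (snd x) $ i - (\<eta> i x - (\<Sum>k\<in>UNIV. lift_N w x i k * fst (snd x) $ k))) \<le> 6 * G\<^sup>2" for i
  proof -
    have "P i - fst (snd x) $ i - (\<eta> i x - (\<Sum>k\<in>UNIV. lift_N w x i k * fst (snd x) $ k)) =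
        - (\<Sum>k\<in>UNIV. lift_N w x i k * (P k - fst (snd x) $ k))"
      unfolding Pd[of i] by (simp add: right_diff_distrib sum_subtractf)
    moreover have "cmod (\<Sum>k\<in>UNIV. lift_N w x i k * (P k - fst (snd x) $ k)) \<le> n * (\<gamma> * (5 * G))"
      unfolding n_def by (rule cmod_sum_mult_le[OF N Pd1])
    moreover have "n * (\<gamma> * (5 * G)) = 5 * G\<^sup>2" by (simp add: G_def power2_eq_square)
    ultimately have "cmod (P i - fst (snd x) $ i - (\<eta> i x - (\<Sum>k\<in>UNIV. lift_N w x i k * fst (snd x) $ k))) \<le> 5 * G\<^sup>2"
      by simp
    then show ?thesis by (rule order_trans) simp
  qed
  have w1: "cmod (w i x) \<le> 1" for i using w[of i] G by linarith
  have W2: "cmod (exp (w i x) - 1 - w i x) \<le> 3 * G\<^sup>2" for i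
    using exp_quadratic_bound[OF w1, of i] power_mono[OF w norm_ge_zero, of i 2] GG by linarith
  have W1: "cmod (exp (w i x) - 1) \<le> 5 / 2 * G" for i
  proof -
    have "G\<^sup>2 \<le> G / 2" using mult_left_mono[of G "1 / 2" G] G by (simp add: power2_eq_square)
    moreover have "cmod (exp (w i x) - 1) \<le> cmod (exp (w i x) - 1 - w i x) + cmod (w i x)"
      using norm_triangle_ineq[of "exp (w i x) - 1 - w i x" "w i x"] by simp
    ultimately show ?thesis using W2[of i] w[of i] G by linarith
  qed
  have Q1: "cmod (fst x $ i * exp (w i x) - fst x $ i) \<le> 5 * G" for i
  proof -
    have "fst x $ i * exp (w i x) - fst x $ i = fst x $ i * (exp (w i x) - 1)" by (simp add: algebra_simps)
    then have "cmod (fst x $ i * exp (w i x) - fst x $ i) \<le> 2 * (5 / 2 * G)"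
      unfolding norm_mult using mult_mono[OF q W1 _ norm_ge_zero] by (simp add: norm_mult)
    then show ?thesis using G by linarith
  qed
  have Q2: "cmod (fst x $ i * exp (w i x) - fst x $ i - fst x $ i * w i x) \<le> 6 * G\<^sup>2" for i
  proof -
    have "fst x $ i * exp (w i x) - fst x $ i - fst x $ i * w i x = fst x $ i * (exp (w i x) - 1 - w i x)"
      by (simp add: algebra_simps)
    then have "cmod (fst x $ i * exp (w i x) - fst x $ i - fst x $ i * w i x) \<le> 2 * (3 * G\<^sup>2)"
      using mult_mono[OF q W2 _ norm_ge_zero] by (simp add: norm_mult)
    then show ?thesis using zero_le_power2[of G] by linarith
  qed
  have V1: "cmod (fst x $ i * w i x) \<le> 5 * G" for i
    using mult_mono[OF q w _ norm_ge_zero, of i i] G by (simp add: norm_mult)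
  have V2: "cmod (\<eta> i x - (\<Sum>k\<in>UNIV. lift_N w x i k * fst (snd x) $ k)) \<le> 5 * G" for i
  proof -
    have "cmod (\<Sum>k\<in>UNIV. lift_N w x i k * fst (snd x) $ k) \<le> n * (\<gamma> * 1)"
      unfolding n_def by (rule cmod_sum_mult_le[OF N p])
    then show ?thesis
      using norm_triangle_ineq4[of "\<eta> i x" "\<Sum>k\<in>UNIV. lift_N w x i k * fst (snd x) $ k"] \<eta>[of i] G
      by (simp add: G_def)
  qed
  have G': "5 * n * \<gamma> = 5 * G" "(n * \<gamma>)\<^sup>2 = G\<^sup>2" by (simp_all add: G_def)
  show "small (5 * n * \<gamma>) (lift_map w \<eta> x - x)"
    "small (6 * (n * \<gamma>)\<^sup>2) (lift_map w \<eta> x - x - lift_field w \<eta> x)"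
    "small (5 * n * \<gamma>) (lift_field w \<eta> x)"
    unfolding small_def lift_map_def lift_field_def G' using Q1 Q2 Pd1 Pd2 V1 V2 by (simp_all add: P_def[symmetric])
qed

subsection \<open>One step of the iteration\<close>

definition pz :: "'n::finite phase \<Rightarrow> 'n phase" where
  "pz x = (fst x, 0, snd (snd x))"

text \<open>The point with all angles 1 over the same \<open>t\<close>: evaluating there extracts a
  function of \<open>t\<close> alone, and every domain of positive radius contains the point over
  each of its \<open>t\<close>.\<close>

definition bp :: "'n::finite phase \<Rightarrow> 'n phase" where
  "bp x = (\<chi> i. 1, 0, snd (snd x))"

lemma pz_simps [simp]: "fst (pz x) = fst x" "fst (snd (pz x)) = 0" "snd (snd (pz x)) = snd (snd x)"
  "fst (snd (bp x)) = 0" "snd (snd (bp x)) = snd (snd x)" "pz (bp x) = bp x" "bp (pz x) = bp x" "pz (pz x) = pz x"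
  "bp (bp x) = bp x" "fst (bp x) $ i = 1"
  by (auto simp: pz_def bp_def)

lemma pz_tdom: "x \<in> tdom s \<tau> \<Longrightarrow> 0 < s \<Longrightarrow> pz x \<in> tdom s \<tau>"
  by (simp add: tdom_def)

lemma bp_tdom: "x \<in> tdom s \<tau> \<Longrightarrow> 0 < s \<Longrightarrow> bp x \<in> tdom s \<tau>"
  by (simp add: tdom_def)

lemma hmap_pz: "hmap pz S"
  by (simp add: hmap_def holo_on_coords holo_on_const)

lemma hmap_bp: "hmap bp S"
  by (simp add: hmap_def holo_on_coords holo_on_const)

lemma hder_pz: "hder pz (axis i 1, 0, 0) x = (axis i 1, 0, 0)"
  by (simp add: hder_def vec_eq_iff)

lemma tonly_bp: "tonly (\<lambda>x. f (bp x))"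
  by (simp add: tonly_def bp_def)

lemma pindep_at_pz: "pindep f \<Longrightarrow> f (pz x) = f x"
  by (rule pindepD) simp_all

lemma tonly_at_bp: "tonly f \<Longrightarrow> f (bp x) = f x"
  by (rule tonlyD) simp_all

text \<open>Distance of \<open>P\<close> from Kolmogorov's normal form at $p = 0$; constants in $t$ are
  split off by subtracting the value at the point $q = 1$.\<close>

definition kerr :: "complex ^ 'n::finite \<Rightarrow> ('n phase \<Rightarrow> complex) \<Rightarrow> 'n phase set \<Rightarrow> real \<Rightarrow> bool" where
  "kerr \<omega> P S \<epsilon> \<longleftrightarrow> (\<forall>x\<in>S. cmod (P (pz x) - P (bp x)) \<le> \<epsilon> \<and> (\<forall>i. cmod (dp i P (pz x) - \<omega> $ i) \<le> \<epsilon>))"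

text \<open>The first-order expansion of \<open>P\<close> along the lift, written out in coordinates
  so that its p-derivatives can be computed term by term.\<close>

definition lift_taylor :: "('n::finite \<Rightarrow> 'n phase \<Rightarrow> complex) \<Rightarrow> ('n \<Rightarrow> 'n phase \<Rightarrow> complex) \<Rightarrow> ('n phase \<Rightarrow> complex) \<Rightarrow>
    'n phase \<Rightarrow> complex" where
  "lift_taylor w \<eta> P x = P x + ((\<Sum>j\<in>UNIV. (fst x $ j * w j x) * dq j P x) +
     (\<Sum>j\<in>UNIV. (\<eta> j x - (\<Sum>k\<in>UNIV. lift_N w x j k * fst (snd x) $ k)) * dp j P x))"

lemma lift_taylor_eq:
  assumes "holo_on P S" "x \<in> S"
  shows "lift_taylor w \<eta> P x = P x + fder P (lift_field w \<eta> x) x"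
  unfolding lift_field_def by (subst fder_decomp[OF assms]) (simp add: lift_taylor_def)

lemma lift_taylor_at_pz:
  assumes w: "\<And>i. pindep (w i)" and \<eta>: "\<And>i. pindep (\<eta> i)"
  shows "lift_taylor w \<eta> P (pz x) = P (pz x) + ((\<Sum>j\<in>UNIV. w j x * Dq j P (pz x)) + (\<Sum>j\<in>UNIV. \<eta> j x * dp j P (pz x)))"
  by (simp add: lift_taylor_def pindep_at_pz[OF w] pindep_at_pz[OF \<eta>] mult_ac)

lemma holo_on_lift_taylor:
  assumes S: "open S" and P: "holo_on P S" and w: "\<And>i. holo_on (w i) S" and \<eta>: "\<And>i. holo_on (\<eta> i) S"
  shows "holo_on (lift_taylor w \<eta> P) S"
  unfolding lift_taylor_def[abs_def] lift_N_def
  by (intro holo_on_add P holo_on_sum holo_on_mult holo_on_diff holo_on_coords w \<eta> holo_on_dq[OF P S]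
      holo_on_dp[OF P S] holo_on_dq[OF w S])

text \<open>In the vector field only the term - N p depends on \<open>p\<close>; it produces the
  products of \<open>N\<close> with first derivatives of \<open>P\<close>, while the other terms
  contribute second derivatives of \<open>P\<close>.\<close>

lemma dp_lift_taylor_at_pz:
  assumes S: "open S" and P: "holo_on P S" and w: "\<And>i. holo_on (w i) S" "\<And>i. pindep (w i)"
    and \<eta>: "\<And>i. holo_on (\<eta> i) S" "\<And>i. pindep (\<eta> i)" and x: "pz x \<in> S"
  shows "dp i (lift_taylor w \<eta> P) (pz x) = dp i P (pz x) + ((\<Sum>j\<in>UNIV. w j x * (fst x $ j * dq j (dp i P) (pz x))) +
     (\<Sum>j\<in>UNIV. \<eta> j x * dp i (dp j P) (pz x) - lift_N w x j i * dp j P (pz x)))"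
proof -
  let ?a = "\<lambda>j x. fst x $ j * w j x" and ?N = "\<lambda>j k x. lift_N w x j k"
  let ?S = "\<lambda>j x. \<Sum>k\<in>UNIV. ?N j k x * fst (snd x) $ k"
  let ?d = "\<lambda>j x. \<eta> j x - ?S j x"
  have Nh: "holo_on (?N j k) S" for j k
    unfolding lift_N_def by (rule holo_on_Dq[OF w(1) S])
  have Np: "pindep (?N j k)" for j k
    unfolding lift_N_def by (rule pindep_Dq[OF w(2)])
  have ah: "holo_on (?a j) S" for j by (intro holo_on_mult holo_on_coords w)
  have sh: "holo_on (\<lambda>x. ?N j k x * fst (snd x) $ k) S" for j k by (intro holo_on_mult holo_on_coords Nh)
  have Sh: "holo_on (?S j) S" for j by (intro holo_on_sum sh)
  have dh: "holo_on (?d j) S" for j by (intro holo_on_diff \<eta> Sh)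
  have aq: "holo_on (\<lambda>x. ?a j x * dq j P x) S" for j by (rule holo_on_mult[OF ah holo_on_dq[OF P S]])
  have dp': "holo_on (\<lambda>x. ?d j x * dp j P x) S" for j by (rule holo_on_mult[OF dh holo_on_dp[OF P S]])
  have da: "dp i (?a j) (pz x) = 0" for j
    unfolding fder_mult[OF holo_on_coords(1) w(1) x] by (simp add: pindep_dp[OF w(1) x w(2)])
  have dS: "dp i (?S j) (pz x) = ?N j i x" for j
  proof -
    have "dp i (?S j) (pz x) = (\<Sum>k\<in>UNIV. ?N j k (pz x) * axis i 1 $ k)"
      unfolding fder_sum[OF sh x] fder_mult[OF Nh holo_on_coords(2) x] by (simp add: pindep_dp[OF Nh x Np])
    also have "\<dots> = (\<Sum>k\<in>UNIV. if k = i then ?N j i (pz x) else 0)"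
      by (rule sum.cong) (auto simp: axis_def)
    finally show ?thesis by (simp add: pindep_at_pz[OF Np])
  qed
  have dd: "dp i (?d j) (pz x) = - ?N j i x" for j
    unfolding fder_diff[OF \<eta>(1) Sh x] dS by (simp add: pindep_dp[OF \<eta>(1) x \<eta>(2)])
  have d0: "?d j (pz x) = \<eta> j x" for j by (simp add: pindep_at_pz[OF \<eta>(2)])
  have a0: "?a j (pz x) = fst x $ j * w j x" for j by (simp add: pindep_at_pz[OF w(2)])
  have 1: "dp i (\<lambda>x. ?a j x * dq j P x) (pz x) = fst x $ j * w j x * dq j (dp i P) (pz x)" for j
    unfolding fder_mult[OF ah holo_on_dq[OF P S] x] da a0
      fder_commute[OF P S axis_norm_le(1) axis_norm_le(2) x, of j i] by simp
  have 2: "dp i (\<lambda>x. ?d j x * dp j P x) (pz x) = \<eta> j x * dp i (dp j P) (pz x) - ?N j i x * dp j P (pz x)" for j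
    unfolding fder_mult[OF dh holo_on_dp[OF P S] x] dd d0 by simp
  show ?thesis
    unfolding lift_taylor_def[abs_def] fder_add[OF P holo_on_add[OF holo_on_sum[OF aq] holo_on_sum[OF dp']] x]
      fder_add[OF holo_on_sum[OF aq] holo_on_sum[OF dp'] x] fder_sum[OF aq x] fder_sum[OF dp' x] 1 2
    by (simp only: mult.assoc mult.left_commute)
qed

lemma cmod_two_sums_le:
  fixes a b c d :: "'n::finite \<Rightarrow> complex"
  assumes "\<And>j. cmod (a j) \<le> \<alpha>" "\<And>j. cmod (b j) \<le> \<beta>" "\<And>j. cmod (c j) \<le> \<alpha>'" "\<And>j. cmod (d j) \<le> \<beta>'"
  shows "cmod ((\<Sum>j\<in>UNIV. a j * b j) + (\<Sum>j\<in>UNIV. c j * d j)) \<le> real CARD('n) * (\<alpha> * \<beta> + \<alpha>' * \<beta>')"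
  using norm_triangle_ineq[of "\<Sum>j\<in>UNIV. a j * b j" "\<Sum>j\<in>UNIV. c j * d j"]
    cmod_sum_mult_le[of a \<alpha> b \<beta>, OF assms(1,2)] cmod_sum_mult_le[of c \<alpha>' d \<beta>', OF assms(3,4)]
  unfolding distrib_left by linarith

lemma hom_solD:
  assumes "hom_sol \<omega> \<beta> S S' e0 e1 Q w \<eta> C"
  shows "holo_on (w i) S'" "pindep (w i)" "holo_on (\<eta> i) S'" "pindep (\<eta> i)" "tonly C"
    "x \<in> S' \<Longrightarrow> e0 x + (\<Sum>i\<in>UNIV. \<omega> $ i * \<eta> i x) = C x"
    "x \<in> S' \<Longrightarrow> cmod (w i x) \<le> \<beta>" "x \<in> S' \<Longrightarrow> cmod (\<eta> i x) \<le> \<beta>"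
    "x \<in> S' \<Longrightarrow> (\<Sum>j\<in>UNIV. \<omega> $ j * Dq j (w i) x) = e1 i x + (\<Sum>j\<in>UNIV. Q i j x * \<eta> j x)"
    "x \<in> S' \<Longrightarrow> Dq i (\<eta> j) x = Dq j (\<eta> i) x"
    "(\<forall>x\<in>S. snd (snd x) = 0 \<longrightarrow> e0 x = 0 \<and> (\<forall>i. e1 i x = 0)) \<Longrightarrow> x \<in> S' \<Longrightarrow> snd (snd x) = 0 \<Longrightarrow> w i x = 0"
    "(\<forall>x\<in>S. snd (snd x) = 0 \<longrightarrow> e0 x = 0 \<and> (\<forall>i. e1 i x = 0)) \<Longrightarrow> x \<in> S' \<Longrightarrow> snd (snd x) = 0 \<Longrightarrow> \<eta> i x = 0"
  using assms unfolding hom_sol_def by blast+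

text \<open>Three domains are kept apart: the map lives at the loss 5 \<sigma>, takes values at the
  loss 4 \<sigma>, and the new error is measured at the loss 6 \<sigma>, because a p-derivative is
  estimated by Cauchy. The last clause keeps the maps trivial at \<open>t = 0\<close>.\<close>

definition step_sol :: "complex ^ 'n::finite \<Rightarrow> real \<Rightarrow> real \<Rightarrow> real \<Rightarrow> real \<Rightarrow> real \<Rightarrow> ('n phase \<Rightarrow> complex) \<Rightarrow> ('n phase \<Rightarrow> 'n phase) \<Rightarrow> bool" where
  "step_sol \<omega> \<beta> \<epsilon>' s \<sigma> \<tau> P \<Phi> \<longleftrightarrow> symp \<Phi> (tdom (s - 5 * \<sigma>) \<tau>) \<and>
     (\<forall>x\<in>tdom (s - 5 * \<sigma>) \<tau>. \<Phi> x \<in> tdom (s - 4 * \<sigma>) \<tau> \<and> small \<beta> (\<Phi> x - x)) \<and>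
     kerr \<omega> (\<lambda>x. P (\<Phi> x)) (tdom (s - 6 * \<sigma>) \<tau>) \<epsilon>' \<and>
     ((\<forall>x\<in>tdom s \<tau>. snd (snd x) = 0 \<longrightarrow> P (pz x) = P (bp x) \<and> (\<forall>i. dp i P (pz x) = \<omega> $ i)) \<longrightarrow>
        (\<forall>x\<in>tdom (s - 5 * \<sigma>) \<tau>. snd (snd x) = 0 \<longrightarrow> \<Phi> x = x))"

text \<open>Up to a remainder of order \<gamma>^2/\<sigma>^2 the new Hamiltonian is its first-order
  expansion \<open>T\<close>. In \<open>T\<close> the linear errors cancel by the choice of
  \<open>w\<close> and \<eta>; what is left are products of the correction with the old errors or
  their derivatives. Both contributions are quadratic in \<epsilon>.\<close>

lemma step_exists:
  fixes \<omega> :: "complex ^ 'n::finite" and A :: "complex ^ 'n ^ 'n"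
  assumes hom: "hom_solvable \<omega> A c \<kappa> \<delta>" and c: "0 < c" and B: "1 \<le> B"
  obtains K where "1 \<le> K" "\<And>s \<sigma> \<tau> \<epsilon> P. 0 < \<sigma> \<Longrightarrow> 6 * \<sigma> < s \<Longrightarrow> s < 1 \<Longrightarrow> 0 \<le> \<epsilon> \<Longrightarrow> holo_on P (tdom s \<tau>) \<Longrightarrow>
      (\<And>x. x \<in> tdom s \<tau> \<Longrightarrow> cmod (P x) \<le> B) \<Longrightarrow> kerr \<omega> P (tdom s \<tau>) \<epsilon> \<Longrightarrow>
      (\<And>x i j. x \<in> tdom s \<tau> \<Longrightarrow> cmod (dp i (dp j P) (pz x) - A $ i $ j) \<le> \<delta>) \<Longrightarrow>
      K * \<epsilon> / \<sigma> ^ (2 * \<kappa> + 5) \<le> \<sigma> \<Longrightarrow>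
      \<exists>\<Phi>. step_sol \<omega> (K * \<epsilon> / \<sigma> ^ (2 * \<kappa> + 5)) (K * \<epsilon>\<^sup>2 / \<sigma> ^ (2 * \<kappa> + 5)) s \<sigma> \<tau> P \<Phi>"
proof -
  define n where "n = real CARD('n)"
  have n: "1 \<le> n" unfolding n_def using zero_less_card_finite[where 'a='n] by linarith
  \<comment> \<open>80 n c comes from 20 n \<gamma> with \<gamma> = 4 c
    \<epsilon>/\<sigma>^(\<kappa>+1). In the error bound 40 n c comes from twice \<open>E2\<close>,
    and 1624 from twice the constant 812 = 32 * 25 + 12 of \<open>E1\<close>; 16 c^2 is the square
    of 4 c.\<close>
  define K where "K = 1 + 80 * n * c + 1624 * B * n\<^sup>2 * 16 * c\<^sup>2"
  have K: "1 \<le> K" "80 * n * c \<le> K" "40 * n * c + 1624 * B * n\<^sup>2 * 16 * c\<^sup>2 \<le> K"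
    using n c B by (auto simp: K_def intro!: mult_nonneg_nonneg add_nonneg_nonneg)
  show thesis
  proof (rule that[OF K(1)])
    fix s \<sigma> \<tau> \<epsilon> and P :: "'n phase \<Rightarrow> complex"
    assume \<sigma>: "0 < \<sigma>" "6 * \<sigma> < s" "s < 1" and \<epsilon>: "0 \<le> \<epsilon>" and P: "holo_on P (tdom s \<tau>)"
      and PB: "\<And>x. x \<in> tdom s \<tau> \<Longrightarrow> cmod (P x) \<le> B" and err: "kerr \<omega> P (tdom s \<tau>) \<epsilon>"
      and QA: "\<And>x i j. x \<in> tdom s \<tau> \<Longrightarrow> cmod (dp i (dp j P) (pz x) - A $ i $ j) \<le> \<delta>"
      and sm: "K * \<epsilon> / \<sigma> ^ (2 * \<kappa> + 5) \<le> \<sigma>"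
    \<comment> \<open>\<open>S k\<close> has lost \<open>k\<close> times \<sigma>; a larger index
      means a smaller domain.\<close>
    define S where "S k = (tdom (s - real k * \<sigma>) \<tau> :: 'n phase set)" for k
    have S0: "S 0 = tdom s \<tau>" by (simp add: S_def)
    have S3: "S 3 = tdom (s - 3 * \<sigma>) \<tau>" and S4: "S 4 = tdom (s - 4 * \<sigma>) \<tau>" and S5: "S 5 = tdom (s - 5 * \<sigma>) \<tau>"
      and S6: "S 6 = tdom (s - 6 * \<sigma>) \<tau>" by (simp_all add: S_def)
    have sub: "x \<in> S j" if "x \<in> S k" "j \<le> k" for x j k
      using that \<sigma> unfolding S_def by (intro tdom_mono[OF _ _ that(1)[unfolded S_def]]) (auto intro!: mult_right_mono)
    have pzS: "pz x \<in> S k" and bpS: "bp x \<in> S k" if "x \<in> S k" "k \<le> 6" for x k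
    proof -
      have "real k * \<sigma> \<le> 6 * \<sigma>" using that \<sigma> by (intro mult_right_mono) auto
      then have "0 < s - real k * \<sigma>" using \<sigma> by linarith
      then show "pz x \<in> S k" "bp x \<in> S k" using that pz_tdom bp_tdom unfolding S_def by blast+
    qed
    have \<sigma>1: "\<sigma> < 1" using \<sigma> by linarith
    define e0 where "e0 x = P (pz x) - P (bp x)" for x
    define e1 where "e1 i x = dp i P (pz x) - \<omega> $ i" for i x
    define Q where "Q i j x = dp i (dp j P) (pz x)" for i j x
    have Sopen: "open (S k)" for k unfolding S_def by (rule open_tdom)
    have P0: "holo_on P (S 0)" using P by (simp add: S0)
    have Pk: "holo_on P (S k)" for k by (rule holo_on_subset[OF P0]) (use sub in blast)
    have pz0: "\<And>x. x \<in> S 0 \<Longrightarrow> pz x \<in> S 0" and bp0: "\<And>x. x \<in> S 0 \<Longrightarrow> bp x \<in> S 0" using pzS bpS by blast+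
    have Ppz: "holo_on (\<lambda>x. P (pz x)) (S 0)" and Pbp: "holo_on (\<lambda>x. P (bp x)) (S 0)"
      by (rule holo_on_compose[OF P0 hmap_pz pz0] holo_on_compose[OF P0 hmap_bp bp0]; assumption)+
    have dPpz: "holo_on (\<lambda>x. dp i P (pz x)) (S 0)" for i
      by (rule holo_on_compose[OF holo_on_dp[OF P0 Sopen] hmap_pz pz0])
    have e0h: "holo_on e0 (S 0)" unfolding e0_def[abs_def] by (rule holo_on_diff[OF Ppz Pbp])
    have e1h: "holo_on (e1 i) (S 0)" for i unfolding e1_def[abs_def] by (rule holo_on_diff[OF dPpz holo_on_const])
    have Qh: "holo_on (Q i j) (S 0)" for i j unfolding Q_def[abs_def]
      by (rule holo_on_compose[OF holo_on_dp[OF holo_on_dp[OF P0 Sopen] Sopen] hmap_pz pz0])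
    have e0p: "pindep e0" by (rule pindepI) (simp add: e0_def pz_def bp_def)
    have e1p: "pindep (e1 i)" for i by (rule pindepI) (simp add: e1_def pz_def)
    have Qp: "pindep (Q i j)" for i j by (rule pindepI) (simp add: Q_def pz_def)
    have e0b: "cmod (e0 x) \<le> \<epsilon>" and e1b: "cmod (e1 i x) \<le> \<epsilon>" if "x \<in> S 0" for i x
      using err that unfolding kerr_def e0_def e1_def S0 by blast+
    have "\<exists>w \<eta> C. hom_sol \<omega> (c * \<epsilon> / \<sigma> ^ \<kappa>) (tdom s \<tau>) (tdom (s - 3 * \<sigma>) \<tau>) e0 e1 Q w \<eta> C"
    proof (rule hom[unfolded hom_solvable_def, THEN spec, THEN spec, THEN spec, THEN spec, THEN spec, THEN spec, THEN spec,
          THEN mp, THEN mp, THEN mp, THEN mp, THEN mp, THEN mp, THEN mp, THEN mp])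
      show "\<forall>x\<in>tdom s \<tau>. cmod (e0 x) \<le> \<epsilon> \<and> (\<forall>i. cmod (e1 i x) \<le> \<epsilon>) \<and> (\<forall>i j. cmod (Q i j x - A $ i $ j) \<le> \<delta>)"
        using e0b e1b QA unfolding S0 Q_def by blast
      show "0 < \<sigma>" "3 * \<sigma> < s" "s < 1" using \<sigma> by auto
    qed (use e0h e1h Qh e0p e1p Qp in \<open>simp_all add: S0\<close>)
    then obtain w \<eta> C where sol: "hom_sol \<omega> (c * \<epsilon> / \<sigma> ^ \<kappa>) (S 0) (S 3) e0 e1 Q w \<eta> C"
      unfolding S0 S3 by blast
    note h = hom_solD[OF sol]
    define \<beta> where "\<beta> = c * \<epsilon> / \<sigma> ^ \<kappa>"
    \<comment> \<open>\<beta> bounds \<open>w\<close> and \<eta>; the Cauchy estimate for the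
      logarithmic derivatives of \<open>w\<close> gives \<gamma>, and \<beta> \<le> \<gamma> lets
      one constant serve for all three.\<close>
    define \<gamma> where "\<gamma> = 4 * \<beta> / \<sigma>"
    have \<beta>0: "0 \<le> \<beta>" using c \<epsilon> \<sigma> by (simp add: \<beta>_def)
    have \<gamma>0: "0 \<le> \<gamma>" using \<beta>0 \<sigma> by (simp add: \<gamma>_def)
    have \<beta>\<gamma>: "\<beta> \<le> \<gamma>"
    proof -
      have "\<beta> * \<sigma> \<le> \<beta> * 4" by (rule mult_left_mono) (use \<sigma>1 \<beta>0 in auto)
      then show ?thesis using \<sigma> by (simp add: \<gamma>_def pos_le_divide_eq mult.commute)
    qed
    have \<gamma>eq: "\<gamma> = 4 * c * \<epsilon> / \<sigma> ^ (\<kappa> + 1)" by (simp add: \<gamma>_def \<beta>_def mult_ac)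
    \<comment> \<open>The exponent 2 \<kappa> + 5 is the worst loss: \<gamma>^2 costs 2 \<kappa> +
      2, the Taylor remainder 2, the final p-derivative 1.\<close>
    have pw: "1 / \<sigma> ^ j \<le> 1 / \<sigma> ^ (2 * \<kappa> + 5)" if "j \<le> 2 * \<kappa> + 5" for j
      by (intro divide_left_mono power_decreasing that) (use \<sigma> \<sigma>1 in auto)
    have small5: "5 * n * \<gamma> \<le> K * \<epsilon> / \<sigma> ^ (2 * \<kappa> + 5)" "20 * n * \<gamma> \<le> K * \<epsilon> / \<sigma> ^ (2 * \<kappa> + 5)"
    proof -
      have "20 * n * \<gamma> = 80 * n * c * (\<epsilon> * (1 / \<sigma> ^ (\<kappa> + 1)))" by (simp add: \<gamma>eq)
      also have "\<dots> \<le> K * (\<epsilon> * (1 / \<sigma> ^ (2 * \<kappa> + 5)))"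
        by (intro mult_mono K mult_left_mono pw \<epsilon>) (use K \<epsilon> \<sigma> in auto)
      finally show *: "20 * n * \<gamma> \<le> K * \<epsilon> / \<sigma> ^ (2 * \<kappa> + 5)" by simp
      have "5 * n * \<gamma> \<le> 20 * n * \<gamma>" using n \<gamma>0 by (intro mult_right_mono) auto
      with * show "5 * n * \<gamma> \<le> K * \<epsilon> / \<sigma> ^ (2 * \<kappa> + 5)" by linarith
    qed
    \<comment> \<open>The factor 20 makes 5 n \<gamma> at most \<sigma>/4, below the \<sigma>/2 of
      the Taylor estimate, and keeps n \<gamma> below 1/2.\<close>
    have n\<gamma>: "20 * (n * \<gamma>) \<le> \<sigma>" "0 \<le> n * \<gamma>" using small5(2) sm n \<gamma>0 by (auto simp: mult.assoc)
    have half: "real CARD('n) * \<gamma> \<le> 1 / 2" using n\<gamma>(1) \<sigma>1 unfolding n_def by linarith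
    define \<Phi> where "\<Phi> = lift_map w \<eta>"
    define T where "T = lift_taylor w \<eta> P"
    have wS: "holo_on (w i) (S 4)" "holo_on (\<eta> i) (S 4)" for i
      by (rule holo_on_subset[OF h(1)] holo_on_subset[OF h(3)]; use sub[of _ 4 3] in auto)+
    have Nb: "cmod (lift_N w x i j) \<le> \<gamma>" if "x \<in> S 4" for x i j
    proof -
      have 34: "s - 3 * \<sigma> - \<sigma> = s - 4 * \<sigma>" by simp
      show ?thesis unfolding lift_N_def \<gamma>_def
        by (rule Dq_bound[OF h(1)[unfolded S3] _ \<sigma>(1), unfolded 34])
          (use h(7) that \<sigma> in \<open>auto simp: S3 S4 \<beta>_def\<close>)
    qed
    have \<Phi>symp4: "symp \<Phi> (S 4)" unfolding \<Phi>_def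
      by (rule lift_symp[OF Sopen wS(1) h(2) wS(2) h(4) h(10) Nb half]) (use sub[of _ 4 3] in auto)
    have \<Phi>symp: "symp \<Phi> (S 5)" using \<Phi>symp4 sub[of _ 5 4] unfolding symp_def
      by (auto intro: hmap_subset)
    have est: "small (5 * n * \<gamma>) (\<Phi> x - x)" "small (6 * (n * \<gamma>)\<^sup>2) (\<Phi> x - x - lift_field w \<eta> x)"
      "small (5 * n * \<gamma>) (lift_field w \<eta> x)" if x: "x \<in> S 5" for x
    proof -
      have x4: "x \<in> S 4" and x3: "x \<in> S 3" and x0: "x \<in> tdom s \<tau>"
        using sub[OF x, of 4] sub[OF x, of 3] sub[OF x, of 0] by (auto simp: S0)
      have "cmod (w i x) \<le> \<gamma>" "cmod (\<eta> i x) \<le> \<gamma>" for i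
        using h(7)[OF x3, of i] h(8)[OF x3, of i] \<beta>\<gamma> by (auto simp: \<beta>_def)
      from lift_estimates[where w=w and \<eta>=\<eta> and x=x, OF this Nb[OF x4] half x0 \<sigma>(3)]
      show "small (5 * n * \<gamma>) (\<Phi> x - x)" "small (6 * (n * \<gamma>)\<^sup>2) (\<Phi> x - x - lift_field w \<eta> x)"
        "small (5 * n * \<gamma>) (lift_field w \<eta> x)" unfolding \<Phi>_def n_def .
    qed
    have \<Phi>dom: "\<Phi> x \<in> S 4" if x: "x \<in> S 5" for x
    proof -
      have "x + (\<Phi> x - x) \<in> tdom (s - 5 * \<sigma> + 5 * n * \<gamma>) \<tau>"
        by (rule tdom_shift[OF _ est(1)[OF x]]) (use x in \<open>simp add: S5\<close>)
      then have "\<Phi> x \<in> tdom (s - 5 * \<sigma> + 5 * n * \<gamma>) \<tau>" by simp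
      then show ?thesis unfolding S4 by (rule tdom_mono[rotated 2]) (use n\<gamma> in auto)
    qed
    have small_mono: "small b v" if "small a v" "a \<le> b" for a b and v :: "'n phase"
      using that unfolding small_def by (meson order_trans)
    \<comment> \<open>\<open>E1\<close> collects the Taylor remainder and the quadratic part of the
      lift, \<open>E2\<close> what remains of the first-order terms.\<close>
    define E1 where "E1 = 812 * B * (n * \<gamma>)\<^sup>2 / \<sigma>\<^sup>2"
    define E2 where "E2 = 5 * (n * \<gamma>) * \<epsilon> / \<sigma>"
    \<comment> \<open>Taylor expansion in the actual displacement, which is then replaced by the
      field; the difference of the two is quadratic.\<close>
    have PT: "cmod (P (\<Phi> x) - T x) \<le> E1" if x: "x \<in> S 5" for x
    proof -
      have x0: "x \<in> S 0" using sub[OF x] by simp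
      have x1: "x \<in> tdom (s - \<sigma>) \<tau>" using sub[OF x, of 1] by (simp add: S_def)
      have 1: "cmod (P (x + (\<Phi> x - x)) - P x - fder P (\<Phi> x - x) x) \<le> 32 * B * (5 * n * \<gamma> / \<sigma>)\<^sup>2"
      proof (rule taylor_tdom[OF P PB \<sigma>(1) x1 est(1)[OF x]])
        show "0 \<le> 5 * n * \<gamma>" "5 * n * \<gamma> < \<sigma> / 2"
          unfolding mult.assoc using n\<gamma> \<sigma>(1) by linarith+
      qed
      have 2: "cmod (fder P (\<Phi> x - x - lift_field w \<eta> x) x) \<le> 2 * B * (6 * (n * \<gamma>)\<^sup>2) / \<sigma>"
        by (rule fder_tdom[OF P PB \<sigma>(1) x1 est(2)[OF x]]) simp_all
      have "fder P (\<Phi> x - x - lift_field w \<eta> x) x = fder P (\<Phi> x - x) x - fder P (lift_field w \<eta> x) x"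
        by (rule fder_linear_vec(4)[OF P0 x0])
      then have eq: "P (\<Phi> x) - T x = (P (x + (\<Phi> x - x)) - P x - fder P (\<Phi> x - x) x) + fder P (\<Phi> x - x - lift_field w \<eta> x) x"
        unfolding T_def lift_taylor_eq[OF P0 x0] by simp
      have "cmod (P (\<Phi> x) - T x) \<le> 32 * B * (5 * n * \<gamma> / \<sigma>)\<^sup>2 + 2 * B * (6 * (n * \<gamma>)\<^sup>2) / \<sigma>"
        unfolding eq by (rule norm_triangle_mono[OF 1 2])
      also have "2 * B * (6 * (n * \<gamma>)\<^sup>2) / \<sigma> \<le> 12 * B * (n * \<gamma>)\<^sup>2 / \<sigma>\<^sup>2"
      proof -
        have "\<sigma>\<^sup>2 \<le> \<sigma>" using \<sigma> \<sigma>1 by (simp add: power2_eq_square mult_left_le)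
        moreover have "2 * B * (6 * (n * \<gamma>)\<^sup>2) = 12 * B * (n * \<gamma>)\<^sup>2" by simp
        moreover have "0 \<le> 12 * B * (n * \<gamma>)\<^sup>2" using B by simp
        ultimately show ?thesis using \<sigma>(1) by (simp only:) (rule divide_left_mono; simp)
      qed
      also have "32 * B * (5 * n * \<gamma> / \<sigma>)\<^sup>2 + 12 * B * (n * \<gamma>)\<^sup>2 / \<sigma>\<^sup>2 = E1"
        by (simp add: E1_def power_divide power_mult_distrib add_divide_distrib[symmetric])
      finally show ?thesis by simp
    qed
    \<comment> \<open>At \<open>p = 0\<close> the functions \<open>P\<close> and \<open>e0\<close>
      differ by a function of \<open>t\<close>, so their derivatives along the angles agree and are
      small.\<close>
    have De0: "Dq j P (pz x) = Dq j e0 x" if "x \<in> S 0" for j x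
    proof -
      have A: "dq j (\<lambda>x. P (pz x)) x = fder P (hder pz (axis j 1, 0, 0) x) (pz x)"
        by (rule fder_compose[OF P0 hmap_pz pz0 that])
      have B: "dq j e0 x = dq j (\<lambda>x. P (pz x)) x - dq j (\<lambda>x. P (bp x)) x"
        unfolding e0_def[abs_def] by (rule fder_diff[OF Ppz Pbp that])
      have C: "dq j (\<lambda>x. P (bp x)) x = 0" by (rule tonly_fder[OF Pbp that tonly_bp]) simp
      show ?thesis by (simp only: A B C hder_pz diff_zero pz_simps)
    qed
    have De1: "fst x $ j * dq j (dp i P) (pz x) = Dq j (e1 i) x" if "x \<in> S 0" for i j x
    proof -
      have A: "dq j (\<lambda>x. dp i P (pz x)) x = fder (dp i P) (hder pz (axis j 1, 0, 0) x) (pz x)"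
        by (rule fder_compose[OF holo_on_dp[OF P0 Sopen] hmap_pz pz0 that])
      have B: "dq j (e1 i) x = dq j (\<lambda>x. dp i P (pz x)) x - dq j (\<lambda>x. \<omega> $ i) x"
        unfolding e1_def[abs_def] by (rule fder_diff[OF dPpz holo_on_const that])
      show ?thesis by (simp only: A B fder_const hder_pz diff_zero)
    qed
    have De0b: "cmod (Dq j e0 x) \<le> 4 * \<epsilon> / \<sigma>" and De1b: "cmod (Dq j (e1 i) x) \<le> 4 * \<epsilon> / \<sigma>" if x: "x \<in> S 3" for i j x
    proof -
      have x1: "x \<in> tdom (s - \<sigma>) \<tau>" using sub[OF x, of 1] by (simp add: S_def)
      show "cmod (Dq j e0 x) \<le> 4 * \<epsilon> / \<sigma>"
        by (rule Dq_bound[OF e0h[unfolded S0] e0b[unfolded S0] \<sigma>(1,3) x1])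
      show "cmod (Dq j (e1 i) x) \<le> 4 * \<epsilon> / \<sigma>"
        by (rule Dq_bound[OF e1h[unfolded S0] e1b[unfolded S0] \<sigma>(1,3) x1])
    qed
    \<comment> \<open>One bound for two pairs of products: \<open>w\<close> with derivatives of
      \<open>e0\<close> and \<eta> with \<open>e1\<close> for the value, \<open>w\<close> with
      derivatives of \<open>e1\<close> and \<open>N\<close> with \<open>e1\<close> for the
      p-derivative.\<close>
    have E2_bound: "n * (\<beta> * (4 * \<epsilon> / \<sigma>) + \<gamma> * \<epsilon>) \<le> E2"
    proof -
      have "\<beta> * (4 * \<epsilon> / \<sigma>) + \<gamma> * \<epsilon> \<le> \<gamma> * (4 * \<epsilon> / \<sigma>) + \<gamma> * (\<epsilon> / \<sigma>)"
      proof (intro add_mono mult_right_mono mult_left_mono \<beta>\<gamma> \<gamma>0)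
        have "\<epsilon> * \<sigma> \<le> \<epsilon> * 1" by (rule mult_left_mono) (use \<sigma>1 \<epsilon> in auto)
        then show "\<epsilon> \<le> \<epsilon> / \<sigma>" using \<sigma> by (simp add: pos_le_divide_eq)
      qed (use \<epsilon> \<sigma> in auto)
      also have "\<dots> = 5 * \<gamma> * \<epsilon> / \<sigma>" by (simp add: add_divide_distrib[symmetric])
      finally have "n * (\<beta> * (4 * \<epsilon> / \<sigma>) + \<gamma> * \<epsilon>) \<le> n * (5 * \<gamma> * \<epsilon> / \<sigma>)"
        by (rule mult_left_mono) (use n in auto)
      then show ?thesis by (simp add: E2_def mult_ac)
    qed
    \<comment> \<open>The term \<omega> \<cdot> \<eta> turns \<open>e0\<close> into the function
      \<open>C\<close> of \<open>t\<close>, which cancels in the comparison with the base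
      point.\<close>
    have T0: "cmod (T (pz x) - (P (bp x) + C x)) \<le> E2" if x: "x \<in> S 3" for x
    proof -
      have x0: "x \<in> S 0" using sub[OF x] by simp
      have e0x: "P (pz x) = P (bp x) + e0 x" by (simp add: e0_def)
      have "T (pz x) = P (pz x) + ((\<Sum>j\<in>UNIV. w j x * Dq j e0 x) + (\<Sum>j\<in>UNIV. \<eta> j x * (\<omega> $ j + e1 j x)))"
        unfolding T_def lift_taylor_at_pz[OF h(2,4)] De0[OF x0, symmetric] by (simp add: e1_def)
      also have "(\<Sum>j\<in>UNIV. \<eta> j x * (\<omega> $ j + e1 j x)) = (C x - e0 x) + (\<Sum>j\<in>UNIV. \<eta> j x * e1 j x)"
        using h(6)[OF x] by (simp add: distrib_left sum.distrib mult.commute algebra_simps)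
      finally have "T (pz x) - (P (bp x) + C x) = (\<Sum>j\<in>UNIV. w j x * Dq j e0 x) + (\<Sum>j\<in>UNIV. \<eta> j x * e1 j x)"
        using e0x by simp
      moreover have "cmod ((\<Sum>j\<in>UNIV. w j x * Dq j e0 x) + (\<Sum>j\<in>UNIV. \<eta> j x * e1 j x)) \<le> n * (\<beta> * (4 * \<epsilon> / \<sigma>) + \<gamma> * \<epsilon>)"
        unfolding n_def
        by (rule cmod_two_sums_le) (use h(7,8)[OF x] De0b[OF x] e1b[OF x0] \<beta>\<gamma> in \<open>auto simp: \<beta>_def intro: order_trans\<close>)
      ultimately show ?thesis using E2_bound by simp
    qed
    \<comment> \<open>The equation for \<open>w\<close> replaces \<omega> \<cdot> D w by e1 + Q
      \<eta>, which cancels both the old error and the Hessian term.\<close>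
    have T1: "cmod (dp i T (pz x) - \<omega> $ i) \<le> E2" if x: "x \<in> S 4" for i x
    proof -
      have x3: "x \<in> S 3" and x0: "x \<in> S 0" using sub[OF x] by auto
      have e1x: "dp i P (pz x) = \<omega> $ i + e1 i x" for i by (simp add: e1_def)
      have "dp i T (pz x) = dp i P (pz x) + ((\<Sum>j\<in>UNIV. w j x * Dq j (e1 i) x) +
          (\<Sum>j\<in>UNIV. \<eta> j x * Q i j x - lift_N w x j i * (\<omega> $ j + e1 j x)))"
        unfolding T_def dp_lift_taylor_at_pz[OF Sopen Pk wS(1) h(2) wS(2) h(4) pzS[OF x], simplified] De1[OF x0, symmetric]
        by (simp add: Q_def e1_def)
      also have "(\<Sum>j\<in>UNIV. \<eta> j x * Q i j x - lift_N w x j i * (\<omega> $ j + e1 j x)) =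
          (\<Sum>j\<in>UNIV. Q i j x * \<eta> j x) - (\<Sum>j\<in>UNIV. \<omega> $ j * Dq j (w i) x) + (\<Sum>j\<in>UNIV. - lift_N w x j i * e1 j x)"
        by (simp add: lift_N_def sum_subtractf sum.distrib sum_negf algebra_simps)
      finally have "dp i T (pz x) - \<omega> $ i = (\<Sum>j\<in>UNIV. w j x * Dq j (e1 i) x) + (\<Sum>j\<in>UNIV. - lift_N w x j i * e1 j x)"
        unfolding h(9)[OF x3] using e1x[of i] by simp
      moreover have "cmod ((\<Sum>j\<in>UNIV. w j x * Dq j (e1 i) x) + (\<Sum>j\<in>UNIV. - lift_N w x j i * e1 j x)) \<le>
          n * (\<beta> * (4 * \<epsilon> / \<sigma>) + \<gamma> * \<epsilon>)"
        unfolding n_def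
        by (rule cmod_two_sums_le) (use h(7)[OF x3] De1b[OF x3] e1b[OF x0] Nb[OF x] in \<open>auto simp: \<beta>_def\<close>)
      ultimately show ?thesis using E2_bound by simp
    qed
    have Th: "holo_on T (S 4)" unfolding T_def by (rule holo_on_lift_taylor[OF Sopen Pk wS])
    have P'h: "holo_on (\<lambda>x. P (\<Phi> x)) (S 5)"
      by (rule holo_on_compose[OF Pk sympD(1)[OF \<Phi>symp] \<Phi>dom])
    have T5: "holo_on T (S 5)" by (rule holo_on_subset[OF Th]) (use sub[of _ 5 4] in auto)
    have E1_0: "0 \<le> E1" using B by (simp add: E1_def)
    have tot: "2 * E1 / \<sigma> + 2 * E2 \<le> K * \<epsilon>\<^sup>2 / \<sigma> ^ (2 * \<kappa> + 5)"
    proof -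
      have a: "2 * E1 / \<sigma> = 1624 * B * n\<^sup>2 * 16 * c\<^sup>2 * (\<epsilon>\<^sup>2 * (1 / \<sigma> ^ (2 * \<kappa> + 5)))"
      proof -
        have "\<sigma> ^ (2 * \<kappa> + 5) = (\<sigma> ^ (\<kappa> + 1))\<^sup>2 * \<sigma>\<^sup>2 * \<sigma>"
          by (simp add: power_mult[symmetric] power_add[symmetric] power2_eq_square mult_2 power3_eq_cube numeral_eq_Suc)
        then show ?thesis by (simp add: E1_def \<gamma>eq power_divide power_mult_distrib)
      qed
      have "2 * E2 = 40 * n * c * (\<epsilon>\<^sup>2 * (1 / \<sigma> ^ (\<kappa> + 2)))"
        by (simp add: E2_def \<gamma>eq power2_eq_square mult_ac)
      also have "\<dots> \<le> 40 * n * c * (\<epsilon>\<^sup>2 * (1 / \<sigma> ^ (2 * \<kappa> + 5)))"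
        by (intro mult_left_mono pw) (use n c in auto)
      finally have "2 * E1 / \<sigma> + 2 * E2 \<le> (40 * n * c + 1624 * B * n\<^sup>2 * 16 * c\<^sup>2) * (\<epsilon>\<^sup>2 * (1 / \<sigma> ^ (2 * \<kappa> + 5)))"
        unfolding a by (simp add: distrib_right add_divide_distrib)
      also have "\<dots> \<le> K * (\<epsilon>\<^sup>2 * (1 / \<sigma> ^ (2 * \<kappa> + 5)))"
        by (rule mult_right_mono[OF K(3)]) (use \<sigma> in auto)
      finally show ?thesis by simp
    qed
    have E1\<sigma>: "E1 \<le> E1 / \<sigma>"
      using E1_0 \<sigma> \<sigma>1 by (simp add: pos_le_divide_eq mult_left_le)
    have E2_0: "0 \<le> E2" using n\<gamma>(2) \<epsilon> \<sigma> by (simp add: E2_def)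
    have "kerr \<omega> (\<lambda>x. P (\<Phi> x)) (S 6) (K * \<epsilon>\<^sup>2 / \<sigma> ^ (2 * \<kappa> + 5))"
      unfolding kerr_def
    proof (intro ballI conjI allI)
      fix x assume x: "x \<in> S 6"
      have x5: "x \<in> S 5" and x4: "x \<in> S 4" and x3: "x \<in> S 3" using sub[OF x] by auto
      have pz5: "pz x \<in> S 5" "bp x \<in> S 5" using pzS[OF x5] bpS[OF x5] by auto
      have bp3: "bp x \<in> S 3" using bpS[OF x3] by simp
      have 1: "cmod (P (\<Phi> (pz x)) - T (pz x)) \<le> E1" "cmod (P (\<Phi> (bp x)) - T (bp x)) \<le> E1"
        by (rule PT pz5)+
      have 2: "cmod (T (pz x) - (P (bp x) + C x)) \<le> E2" "cmod (T (bp x) - (P (bp x) + C x)) \<le> E2"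
        using T0[OF x3] T0[OF bp3] tonly_at_bp[OF h(5), of x] by simp_all
      \<comment> \<open>The common function of \<open>t\<close>, \<open>P (bp x) + C x\<close>,
        cancels between the two points.\<close>
      have 3: "P (\<Phi> (pz x)) - P (\<Phi> (bp x)) = (P (\<Phi> (pz x)) - T (pz x)) - (P (\<Phi> (bp x)) - T (bp x)) +
          ((T (pz x) - (P (bp x) + C x)) - (T (bp x) - (P (bp x) + C x)))" by simp
      have "cmod (P (\<Phi> (pz x)) - P (\<Phi> (bp x))) \<le> (E1 + E1) + (E2 + E2)"
        unfolding 3 by (intro norm_triangle_mono order_trans[OF norm_triangle_ineq4 add_mono] 1 2)
      also have "\<dots> \<le> 2 * E1 / \<sigma> + 2 * E2" using E1\<sigma> by simp
      finally show "cmod (P (\<Phi> (pz x)) - P (\<Phi> (bp x))) \<le> K * \<epsilon>\<^sup>2 / \<sigma> ^ (2 * \<kappa> + 5)" using tot by linarith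
      fix i
      have 56: "s - 5 * \<sigma> - \<sigma> = s - 6 * \<sigma>" by simp
      \<comment> \<open>The p-derivative of the remainder is estimated by Cauchy; this spends the
        sixth \<sigma>.\<close>
      have "cmod (dp i (\<lambda>x. P (\<Phi> x) - T x) (pz x)) \<le> 2 * E1 / \<sigma>"
        by (rule dp_bound[OF holo_on_diff[OF P'h T5, unfolded S5] PT[unfolded S5] \<sigma>(1), unfolded 56])
          (use pzS[OF x] in \<open>auto simp: S6\<close>)
      then have "cmod (dp i (\<lambda>x. P (\<Phi> x)) (pz x) - dp i T (pz x)) \<le> 2 * E1 / \<sigma>"
        unfolding fder_diff[OF P'h T5 pz5(1)] .
      moreover have "cmod (dp i T (pz x) - \<omega> $ i) \<le> E2" by (rule T1[OF x4])
      ultimately have "cmod (dp i (\<lambda>x. P (\<Phi> x)) (pz x) - \<omega> $ i) \<le> 2 * E1 / \<sigma> + E2"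
        using norm_triangle_ineq[of "dp i (\<lambda>x. P (\<Phi> x)) (pz x) - dp i T (pz x)" "dp i T (pz x) - \<omega> $ i"] by simp
      then show "cmod (dp i (\<lambda>x. P (\<Phi> x)) (pz x) - \<omega> $ i) \<le> K * \<epsilon>\<^sup>2 / \<sigma> ^ (2 * \<kappa> + 5)"
        using tot E2_0 by linarith
    qed
    \<comment> \<open>Without error at \<open>t = 0\<close> the corrections \<open>w\<close> and
      \<eta> and the angular derivatives of \<open>w\<close> vanish there, so that the lift is the
      identity.\<close>
    moreover have "\<Phi> x = x" if z: "\<forall>x\<in>tdom s \<tau>. snd (snd x) = 0 \<longrightarrow> P (pz x) = P (bp x) \<and> (\<forall>i. dp i P (pz x) = \<omega> $ i)"
      and x: "x \<in> S 5" "snd (snd x) = 0" for x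
    proof -
      have z': "\<forall>x\<in>S 0. snd (snd x) = 0 \<longrightarrow> e0 x = 0 \<and> (\<forall>i. e1 i x = 0)"
        using z by (simp add: S0 e0_def e1_def)
      have x3: "x \<in> S 3" and x4: "x \<in> S 4" using sub[OF x(1)] by auto
      have w0: "w i x = 0" "\<eta> i x = 0" for i using h(11,12)[OF z' x3 x(2)] by auto
      have "dq i (w j) x = 0" for i j
        by (rule fder_zero_slice[OF h(1) Sopen h(11)[OF z'] x3 x(2)]) simp_all
      then have N0: "lift_N w x = (\<lambda>i j. 0)" by (simp add: lift_N_def fun_eq_iff)
      have "nsolve (lift_N w x) (\<lambda>i. fst (snd x) $ i) k = fst (snd x) $ k" for k
        using nsolve_eq[OF Nb[OF x4] half, where b="\<lambda>i. fst (snd x) $ i" and i=k] by (simp add: N0)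
      then show ?thesis
        by (simp add: \<Phi>_def lift_map_def w0 prod_eq_iff vec_eq_iff)
    qed
    moreover have "small (K * \<epsilon> / \<sigma> ^ (2 * \<kappa> + 5)) (\<Phi> x - x)" if "x \<in> S 5" for x
      by (rule small_mono[OF est(1)[OF that] small5(1)])
    ultimately have "step_sol \<omega> (K * \<epsilon> / \<sigma> ^ (2 * \<kappa> + 5)) (K * \<epsilon>\<^sup>2 / \<sigma> ^ (2 * \<kappa> + 5)) s \<sigma> \<tau> P \<Phi>"
      unfolding step_sol_def S5[symmetric] S4[symmetric] S6[symmetric] using \<Phi>symp \<Phi>dom by blast
    then show "\<exists>\<Phi>. step_sol \<omega> (K * \<epsilon> / \<sigma> ^ (2 * \<kappa> + 5)) (K * \<epsilon>\<^sup>2 / \<sigma> ^ (2 * \<kappa> + 5)) s \<sigma> \<tau> P \<Phi>" by blast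
  qed
qed

subsection \<open>Convergence of the iteration\<close>

lemma symp_id: "symp (\<lambda>x. x) S"
proof -
  have p: "pb (\<lambda>x. fst (snd x) $ i) (\<lambda>x. fst x $ j) x = (if i = j then fst x $ j else 0)" for i j and x :: "'a phase"
    by (simp add: pb_p axis_def)
  have pp: "pb (\<lambda>x. fst (snd x) $ i) (\<lambda>x. fst (snd x) $ j) x = 0" for i j and x :: "'a phase"
    by (simp add: pb_p)
  have qq: "pb (\<lambda>x. fst x $ i) (\<lambda>x. fst x $ j) x = 0" for i j and x :: "'a phase"
    by (simp add: pb_def)
  show ?thesis unfolding symp_def using p pp qq by (auto simp: hmap_def holo_on_coords)
qed

lemma symp_compose:
  assumes \<Theta>: "symp \<Theta> T" and \<Phi>: "symp \<Phi> S" "open S" and sub: "\<And>x. x \<in> S \<Longrightarrow> \<Phi> x \<in> T"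
  shows "symp (\<lambda>x. \<Theta> (\<Phi> x)) S"
  unfolding symp_def
proof (intro conjI ballI allI)
  note h = hmapD[OF sympD(1)[OF \<Theta>]]
  show "hmap (\<lambda>x. \<Theta> (\<Phi> x)) S" by (rule hmap_compose[OF sympD(1)[OF \<Theta>] sympD(1)[OF \<Phi>(1)] sub])
  fix x i j assume x: "x \<in> S"
  show "snd (snd (\<Theta> (\<Phi> x))) = snd (snd x)" using sympD(2)[OF \<Theta> sub[OF x]] sympD(2)[OF \<Phi>(1) x] by simp
  have "pb (\<lambda>x. ppart \<Theta> i (\<Phi> x)) (\<lambda>x. qpart \<Theta> j (\<Phi> x)) x = pb (ppart \<Theta> i) (qpart \<Theta> j) (\<Phi> x)"
    by (rule symp_pb[OF \<Phi> sub h(2) h(1) x])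
  then show "pb (ppart (\<lambda>x. \<Theta> (\<Phi> x)) i) (qpart (\<lambda>x. \<Theta> (\<Phi> x)) j) x = (if i = j then qpart (\<lambda>x. \<Theta> (\<Phi> x)) j x else 0)"
    using sympD(3)[OF \<Theta> sub[OF x], of i j] by (rule trans)
  have "pb (\<lambda>x. ppart \<Theta> i (\<Phi> x)) (\<lambda>x. ppart \<Theta> j (\<Phi> x)) x = pb (ppart \<Theta> i) (ppart \<Theta> j) (\<Phi> x)"
    by (rule symp_pb[OF \<Phi> sub h(2) h(2) x])
  then show "pb (ppart (\<lambda>x. \<Theta> (\<Phi> x)) i) (ppart (\<lambda>x. \<Theta> (\<Phi> x)) j) x = 0"
    using sympD(4)[OF \<Theta> sub[OF x], of i j] by (rule trans)
  have "pb (\<lambda>x. qpart \<Theta> i (\<Phi> x)) (\<lambda>x. qpart \<Theta> j (\<Phi> x)) x = pb (qpart \<Theta> i) (qpart \<Theta> j) (\<Phi> x)"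
    by (rule symp_pb[OF \<Phi> sub h(1) h(1) x])
  then show "pb (qpart (\<lambda>x. \<Theta> (\<Phi> x)) i) (qpart (\<lambda>x. \<Theta> (\<Phi> x)) j) x = 0"
    using sympD(5)[OF \<Theta> sub[OF x], of i j] by (rule trans)
qed

lemma symp_subset: "symp \<Phi> S \<Longrightarrow> T \<subseteq> S \<Longrightarrow> symp \<Phi> T"
  unfolding symp_def using hmap_subset by blast

text \<open>The strips in the $p$ direction have full width at $p = 0$, so no loss occurs here.\<close>

lemma dp_dp_bound_at_pz:
  assumes f: "holo_on f (tdom s \<tau>)" and B: "\<And>x. x \<in> tdom s \<tau> \<Longrightarrow> cmod (f x) \<le> \<Delta>" and s: "0 < s" and x: "x \<in> tdom s \<tau>"
  shows "cmod (dp i (dp j f) (pz x)) \<le> 16 * \<Delta> / s\<^sup>2"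
proof -
  have line: "y + cscale z (0, axis k 1, 0) \<in> tdom s \<tau>"
    if "y \<in> tdom s \<tau>" "\<And>l. cmod (fst (snd y) $ l) + cmod z < s" for y :: "'a phase" and z k
  proof -
    have "cmod (fst (snd y) $ l + z * axis k 1 $ l) < s" for l
    proof -
      have "cmod (z * axis k 1 $ l) \<le> cmod z" by (auto simp: axis_def)
      then show ?thesis using norm_triangle_ineq[of "fst (snd y) $ l" "z * axis k 1 $ l"] that(2)[of l] by linarith
    qed
    then show ?thesis using that(1) by (auto simp: tdom_def cscale_def)
  qed
  have 1: "cmod (dp j f y) \<le> 2 * \<Delta> / (s / 2)" if y: "y \<in> tdom s \<tau>" "\<And>l. cmod (fst (snd y) $ l) < s / 2" for y
  proof -
    have in1: "y + cscale z (0, axis j 1, 0) \<in> tdom s \<tau>" if "cmod z < s / 2" for z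
    proof (rule line[OF y(1)])
      show "cmod (fst (snd y) $ l) + cmod z < s" for l using y(2)[of l] that by linarith
    qed
    show ?thesis by (rule fder_bound_line[OF f in1 B[OF in1]]) (use s in auto)
  qed
  have in2: "pz x + cscale z (0, axis i 1, 0) \<in> tdom s \<tau>" if "cmod z < s / 2" for z
    by (rule line[OF pz_tdom[OF x s]]) (use that s in auto)
  have "cmod (dp i (dp j f) (pz x)) \<le> 2 * (2 * \<Delta> / (s / 2)) / (s / 2)"
  proof (rule fder_bound_line[OF holo_on_dp[OF f open_tdom] in2])
    fix z :: complex assume z: "cmod z < s / 2"
    show "cmod (dp j f (pz x + cscale z (0, axis i 1, 0))) \<le> 2 * \<Delta> / (s / 2)"
    proof (rule 1[OF in2[OF z]])
      show "cmod (fst (snd (pz x + cscale z (0, axis i 1, 0))) $ l) < s / 2" for l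
        using z s by (auto simp: cscale_def axis_def)
    qed
  qed (use s in auto)
  then show ?thesis by (simp add: power2_eq_square)
qed

text \<open>First-order term and Taylor remainder together; as \<beta> < \<sigma>, the square of
  \<beta>/\<sigma> is absorbed, and 34 = 32 + 2.\<close>

lemma displacement_bound:
  assumes f: "holo_on f (tdom s \<tau>)" and B: "\<And>y. y \<in> tdom s \<tau> \<Longrightarrow> cmod (f y) \<le> B"
    and \<sigma>: "0 < \<sigma>" and x: "x \<in> tdom (s - \<sigma>) \<tau>" and v: "small \<beta> (y - x)" and \<beta>: "0 \<le> \<beta>" "\<beta> < \<sigma> / 2"
  shows "cmod (f y - f x) \<le> 34 * B * \<beta> / \<sigma>"
proof -
  have 1: "cmod (f (x + (y - x)) - f x - fder f (y - x) x) \<le> 32 * B * (\<beta> / \<sigma>)\<^sup>2"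
    by (rule taylor_tdom[OF f B \<sigma> x v \<beta>])
  have 2: "cmod (fder f (y - x) x) \<le> 2 * B * \<beta> / \<sigma>"
    by (rule fder_tdom[OF f B \<sigma> x v \<beta>(1)])
  have "x \<in> tdom s \<tau>" by (rule tdom_mono[OF _ _ x]) (use \<sigma> in auto)
  then have B0: "0 \<le> B" using order_trans[OF norm_ge_zero B] by blast
  have "\<beta> / \<sigma> \<le> 1" using \<beta> \<sigma> by (simp add: divide_le_eq)
  then have "\<beta> / \<sigma> * (\<beta> / \<sigma>) \<le> \<beta> / \<sigma> * 1" by (rule mult_left_mono) (use \<beta> \<sigma> in auto)
  then have "(\<beta> / \<sigma>)\<^sup>2 \<le> \<beta> / \<sigma>" by (simp only: power2_eq_square mult_1_right)
  then have "32 * B * (\<beta> / \<sigma>)\<^sup>2 \<le> 32 * B * (\<beta> / \<sigma>)" by (rule mult_left_mono) (use B0 in simp)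
  moreover have "cmod (f y - f x) \<le> cmod (f (x + (y - x)) - f x - fder f (y - x) x) + cmod (fder f (y - x) x)"
    using norm_triangle_ineq[of "f (x + (y - x)) - f x - fder f (y - x) x" "fder f (y - x) x"] by simp
  ultimately have "cmod (f y - f x) \<le> 32 * B * (\<beta> / \<sigma>) + 2 * B * \<beta> / \<sigma>" using 1 2 by linarith
  then show ?thesis by (simp add: add_divide_distrib[symmetric])
qed

text \<open>The sequence is a telescoping series dominated by a geometric one.\<close>

lemma geometric_uniform_limit:
  fixes f :: "nat \<Rightarrow> 'a \<Rightarrow> complex"
  assumes "\<And>k x. x \<in> S \<Longrightarrow> cmod (f (Suc k) x - f k x) \<le> C / 2 ^ k"
  shows "uniform_limit S f (\<lambda>x. lim (\<lambda>k. f k x)) sequentially"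
proof -
  let ?g = "\<lambda>x. \<Sum>k. (f (Suc k) x - f k x)"
  have ul: "uniform_limit S (\<lambda>n x. \<Sum>k<n. (f (Suc k) x - f k x)) ?g sequentially"
  proof (rule Weierstrass_m_test)
    show "summable (\<lambda>k. C * (1 / 2 :: real) ^ k)" by (intro summable_mult summable_geometric) simp
    show "norm (f (Suc k) x - f k x) \<le> C * (1 / 2) ^ k" if "x \<in> S" for k x
      using assms[OF that, of k] by (simp add: power_divide)
  qed
  have "uniform_limit S (\<lambda>n x. (\<Sum>k<n. (f (Suc k) x - f k x)) + f 0 x) (\<lambda>x. ?g x + f 0 x) sequentially"
    by (intro uniform_limit_add ul uniform_limit_const)
  moreover have "(\<Sum>k<n. (f (Suc k) x - f k x)) + f 0 x = f n x" for n x
    by (simp add: sum_lessThan_telescope[of "\<lambda>k. f k x"])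
  ultimately have u: "uniform_limit S f (\<lambda>x. ?g x + f 0 x) sequentially" by simp
  have "?g x + f 0 x = lim (\<lambda>k. f k x)" if "x \<in> S" for x
    by (rule limI[symmetric]) (rule tendsto_uniform_limitI[OF u that])
  then show ?thesis using u unfolding uniform_limit_iff by (simp cong: ball_cong)
qed

lemma hmap_limit:
  fixes \<Theta> :: "nat \<Rightarrow> 'n::finite phase \<Rightarrow> 'n phase"
  assumes hm: "\<And>k. hmap (\<Theta> k) S" and t: "\<And>k x. x \<in> S \<Longrightarrow> snd (snd (\<Theta> k x)) = snd (snd x)" and S: "open S"
    and step: "\<And>k x. x \<in> S \<Longrightarrow> small (C / 2 ^ k) (\<Theta> (Suc k) x - \<Theta> k x)"
  obtains \<Theta>' where "hmap \<Theta>' S" "\<And>x. x \<in> S \<Longrightarrow> snd (snd (\<Theta>' x)) = snd (snd x)"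
    "\<And>x. x \<in> S \<Longrightarrow> (\<lambda>k. \<Theta> k x) \<longlonglongrightarrow> \<Theta>' x"
    "\<And>i x v. x \<in> S \<Longrightarrow> (\<lambda>k. fder (qpart (\<Theta> k) i) v x) \<longlonglongrightarrow> fder (qpart \<Theta>' i) v x"
    "\<And>i x v. x \<in> S \<Longrightarrow> (\<lambda>k. fder (ppart (\<Theta> k) i) v x) \<longlonglongrightarrow> fder (ppart \<Theta>' i) v x"
proof -
  define \<Theta>' where "\<Theta>' x = (\<chi> i. lim (\<lambda>k. fst (\<Theta> k x) $ i), \<chi> i. lim (\<lambda>k. fst (snd (\<Theta> k x)) $ i), snd (snd x))" for x
  have s: "cmod (qpart (\<Theta> (Suc k)) i x - qpart (\<Theta> k) i x) \<le> C / 2 ^ k"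
    "cmod (ppart (\<Theta> (Suc k)) i x - ppart (\<Theta> k) i x) \<le> C / 2 ^ k" if "x \<in> S" for k x i
    using step[OF that, of k] by (auto simp: small_def)
  have ulq: "uniform_limit S (\<lambda>k. qpart (\<Theta> k) i) (qpart \<Theta>' i) sequentially" for i
    using geometric_uniform_limit[of S "\<lambda>k. qpart (\<Theta> k) i" C, OF s(1)] by (simp add: \<Theta>'_def)
  have ulp: "uniform_limit S (\<lambda>k. ppart (\<Theta> k) i) (ppart \<Theta>' i) sequentially" for i
    using geometric_uniform_limit[of S "\<lambda>k. ppart (\<Theta> k) i" C, OF s(2)] by (simp add: \<Theta>'_def)
  note h = hmapD[OF hm]
  note lq = holo_on_limit_uniform[OF S h(1) ulq] and lp = holo_on_limit_uniform[OF S h(2) ulp]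
  have tq: "(\<lambda>k. qpart (\<Theta> k) i x) \<longlonglongrightarrow> qpart \<Theta>' i x" and tp: "(\<lambda>k. ppart (\<Theta> k) i x) \<longlonglongrightarrow> ppart \<Theta>' i x" if "x \<in> S" for i x
    by (rule tendsto_uniform_limitI[OF ulq that] tendsto_uniform_limitI[OF ulp that])+
  have t': "snd (snd (\<Theta>' x)) = snd (snd x)" for x by (simp add: \<Theta>'_def)
  have T: "(\<lambda>k. \<Theta> k x) \<longlonglongrightarrow> \<Theta>' x" if x: "x \<in> S" for x
  proof -
    have "(\<lambda>k. (fst (\<Theta> k x), fst (snd (\<Theta> k x)), snd (snd (\<Theta> k x)))) \<longlonglongrightarrow> (fst (\<Theta>' x), fst (snd (\<Theta>' x)), snd (snd (\<Theta>' x)))"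
      unfolding t[OF x] t' by (intro tendsto_Pair vec_tendstoI tq[OF x] tp[OF x] tendsto_const)
    then show ?thesis by simp
  qed
  have "hmap \<Theta>' S"
    unfolding hmap_def t' using lq(1) lp(1) by (simp add: holo_on_coords)
  then show thesis using t' T lq(2) lp(2) by (rule that)
qed

text \<open>Uniform limits of holomorphic functions may be differentiated, and a bracket at a point
  is a polynomial in first derivatives; hence the symplectic relations are closed under such
  limits.\<close>

lemma iteration_limit:
  fixes \<Theta> :: "nat \<Rightarrow> 'n::finite phase \<Rightarrow> 'n phase"
  assumes symp: "\<And>k. symp (\<Theta> k) S" and S: "open S"
    and step: "\<And>k x. x \<in> S \<Longrightarrow> small (C / 2 ^ k) (\<Theta> (Suc k) x - \<Theta> k x)"
  obtains \<Theta>' where "symp \<Theta>' S" "\<And>x. x \<in> S \<Longrightarrow> (\<lambda>k. \<Theta> k x) \<longlonglongrightarrow> \<Theta>' x"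
    "\<And>i x v. x \<in> S \<Longrightarrow> (\<lambda>k. fder (qpart (\<Theta> k) i) v x) \<longlonglongrightarrow> fder (qpart \<Theta>' i) v x"
    "\<And>i x v. x \<in> S \<Longrightarrow> (\<lambda>k. fder (ppart (\<Theta> k) i) v x) \<longlonglongrightarrow> fder (ppart \<Theta>' i) v x"
proof (rule hmap_limit[OF sympD(1)[OF symp] sympD(2)[OF symp] S step])
  fix \<Theta>'
  assume hm: "hmap \<Theta>' S" and t: "\<And>x. x \<in> S \<Longrightarrow> snd (snd (\<Theta>' x)) = snd (snd x)"
    and T: "\<And>x. x \<in> S \<Longrightarrow> (\<lambda>k. \<Theta> k x) \<longlonglongrightarrow> \<Theta>' x"
    and lq: "\<And>i x v. x \<in> S \<Longrightarrow> (\<lambda>k. fder (qpart (\<Theta> k) i) v x) \<longlonglongrightarrow> fder (qpart \<Theta>' i) v x"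
    and lp: "\<And>i x v. x \<in> S \<Longrightarrow> (\<lambda>k. fder (ppart (\<Theta> k) i) v x) \<longlonglongrightarrow> fder (ppart \<Theta>' i) v x"
  have pbl: "(\<lambda>k. pb (f k) (g k) x) \<longlonglongrightarrow> pb f' g' x"
    if "\<And>v. (\<lambda>k. fder (f k) v x) \<longlonglongrightarrow> fder f' v x" "\<And>v. (\<lambda>k. fder (g k) v x) \<longlonglongrightarrow> fder g' v x" for f g f' g' x
    unfolding pb_def by (intro tendsto_intros that)
  have "symp \<Theta>' S"
    unfolding symp_def
  proof (intro conjI ballI allI hm t)
    fix x i j assume x: "x \<in> S"
    have "(\<lambda>k. qpart (\<Theta> k) j x) \<longlonglongrightarrow> qpart \<Theta>' j x" by (intro tendsto_intros T[OF x])
    then have "(\<lambda>k. if i = j then qpart (\<Theta> k) j x else 0) \<longlonglongrightarrow> (if i = j then qpart \<Theta>' j x else 0)"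
      by auto
    then have "(\<lambda>k. pb (ppart (\<Theta> k) i) (qpart (\<Theta> k) j) x) \<longlonglongrightarrow> (if i = j then qpart \<Theta>' j x else 0)"
      unfolding sympD(3)[OF symp x] .
    from LIMSEQ_unique[OF pbl[OF lp[OF x] lq[OF x]] this]
    show "pb (ppart \<Theta>' i) (qpart \<Theta>' j) x = (if i = j then qpart \<Theta>' j x else 0)" .
    have "(\<lambda>k. pb (ppart (\<Theta> k) i) (ppart (\<Theta> k) j) x) \<longlonglongrightarrow> 0"
      unfolding sympD(4)[OF symp x] by simp
    from LIMSEQ_unique[OF pbl[OF lp[OF x] lp[OF x]] this]
    show "pb (ppart \<Theta>' i) (ppart \<Theta>' j) x = 0" .
    have "(\<lambda>k. pb (qpart (\<Theta> k) i) (qpart (\<Theta> k) j) x) \<longlonglongrightarrow> 0"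
      unfolding sympD(5)[OF symp x] by simp
    from LIMSEQ_unique[OF pbl[OF lq[OF x] lq[OF x]] this]
    show "pb (qpart \<Theta>' i) (qpart \<Theta>' j) x = 0" .
  qed
  then show thesis using T lq lp by (rule that)
qed

text \<open>\<open>A\<close> is the Hessian in \<open>p\<close> along \<open>p = 0\<close>, that is,
  twice the coefficient matrix of the quadratic part.\<close>

definition normal_ham :: "complex ^ 'n::finite \<Rightarrow> complex ^ 'n ^ 'n \<Rightarrow> ('n phase \<Rightarrow> complex) \<Rightarrow> 'n phase set \<Rightarrow> bool" where
  "normal_ham \<omega> A h S \<longleftrightarrow> holo_on h S \<and> (\<forall>x\<in>S. h (pz x) = h (bp x) \<and>
     (\<forall>i. dp i h (pz x) = \<omega> $ i) \<and> (\<forall>i j. dp i (dp j h) (pz x) = A $ i $ j))"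

text \<open>The errors are made to follow \<open>E k = \<theta> * \<sigma> k ^ (\<mu> + 2)\<close>
  with halving losses \<sigma>. Quadratic convergence beats this geometric law, which keeps all sums
  geometric. To start the scheme only \<tau>, the range of \<open>t\<close>, is reduced, so the size
  of \<open>r\<close> is arbitrary.\<close>

lemma kolmogorov_analytic:
  fixes \<omega> :: "complex ^ 'n::finite" and A :: "complex ^ 'n ^ 'n"
  assumes D: "kolmogorov_diophantine \<omega>" and A: "invertible A"
    and s0: "0 < s0" "s0 < 1" and h0: "normal_ham \<omega> A h0 (tdom s0 s0)" and r: "holo_on r (tdom s0 s0)"
    and B: "\<And>x. x \<in> tdom s0 s0 \<Longrightarrow> cmod (h0 x) \<le> B1 \<and> cmod (r x) \<le> B1"
  defines "P0 \<equiv> \<lambda>x. h0 x + snd (snd x) * r x"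
  obtains \<tau> \<rho> \<Theta> where "0 < \<tau>" "\<tau> \<le> s0" "0 < \<rho>" "\<rho> < s0" "symp \<Theta> (tdom \<rho> \<tau>)"
    "\<And>x. x \<in> tdom \<rho> \<tau> \<Longrightarrow> \<Theta> x \<in> tdom s0 \<tau>"
    "\<And>x. x \<in> tdom \<rho> \<tau> \<Longrightarrow> snd (snd x) = 0 \<Longrightarrow> \<Theta> x = x"
    "\<And>x. x \<in> tdom \<rho> \<tau> \<Longrightarrow> P0 (\<Theta> (pz x)) = P0 (\<Theta> (bp x))"
    "\<And>x i. x \<in> tdom \<rho> \<tau> \<Longrightarrow> dp i (\<lambda>x. P0 (\<Theta> x)) (pz x) = \<omega> $ i"
proof -
  obtain K0 \<nu> where K0: "0 < K0" "sd_solvable \<omega> K0 \<nu>" using small_divisors[OF D] by metis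
  obtain c \<kappa> \<delta> where c: "0 < c" "0 < \<delta>" and hom: "hom_solvable \<omega> A c \<kappa> \<delta>"
    using hom_solvable_exists[OF K0(2,1) A] by metis
  have base: "bp (1, 0, 0) \<in> tdom s0 s0" using s0 by (simp add: tdom_def)
  have B1: "0 \<le> B1" using B[OF base] norm_ge_zero order_trans by blast
  define B' where "B' = B1 + 1"
  have B': "1 \<le> B'" using B1 by (simp add: B'_def)
  define \<mu> where "\<mu> = 2 * \<kappa> + 5"
  obtain K where K: "1 \<le> K" and step: "\<And>s \<sigma> \<tau> \<epsilon> P. 0 < \<sigma> \<Longrightarrow> 6 * \<sigma> < s \<Longrightarrow> s < 1 \<Longrightarrow> 0 \<le> \<epsilon> \<Longrightarrow> holo_on P (tdom s \<tau>) \<Longrightarrow>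
      (\<And>x. x \<in> tdom s \<tau> \<Longrightarrow> cmod (P x) \<le> B') \<Longrightarrow> kerr \<omega> P (tdom s \<tau>) \<epsilon> \<Longrightarrow>
      (\<And>x i j. x \<in> tdom s \<tau> \<Longrightarrow> cmod (dp i (dp j P) (pz x) - A $ i $ j) \<le> \<delta>) \<Longrightarrow>
      K * \<epsilon> / \<sigma> ^ \<mu> \<le> \<sigma> \<Longrightarrow> \<exists>\<Phi>. step_sol \<omega> (K * \<epsilon> / \<sigma> ^ \<mu>) (K * \<epsilon>\<^sup>2 / \<sigma> ^ \<mu>) s \<sigma> \<tau> P \<Phi>"
    using step_exists[OF hom c(1) B'] unfolding \<mu>_def[symmetric] by metis
  \<comment> \<open>Halving the radius leaves room for the Cauchy estimate of the initial error and
    for the limit of the iterates, which is only known to lie in the closure of the smaller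
    domain.\<close>
  define s1 where "s1 = s0 / 2"
  define \<rho> where "\<rho> = s1 / 2"
  \<comment> \<open>The total loss is 12 times \<sigma> 0, that is s1/2: step \<open>k\<close> costs
    6 \<sigma> k, which is 12 times the difference of consecutive losses.\<close>
  define \<sigma> where "\<sigma> k = s1 / 24 / 2 ^ k" for k :: nat
  define s where "s k = \<rho> + 12 * \<sigma> k" for k
  have \<sigma>pos: "0 < \<sigma> k" for k using s0 by (simp add: \<sigma>_def s1_def)
  have \<sigma>dec: "\<sigma> k \<le> \<sigma> 0" for k using s0 by (simp add: \<sigma>_def s1_def divide_le_eq)
  have \<sigma>half: "\<sigma> (Suc k) = \<sigma> k / 2" for k by (simp add: \<sigma>_def)
  have \<sigma>0: "\<sigma> 0 < 1 / 4" using s0 by (simp add: \<sigma>_def s1_def)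
  have \<sigma>1: "\<sigma> k < 1 / 4" for k using \<sigma>dec[of k] \<sigma>0 by linarith
  have s_Suc: "s (Suc k) = s k - 6 * \<sigma> k" for k by (simp add: s_def \<sigma>half)
  have s_0: "s 0 = s1" by (simp add: s_def \<rho>_def \<sigma>_def)
  have s_le: "s k \<le> s1" for k using \<sigma>dec[of k] s_0 by (simp add: s_def)
  have \<rho>: "0 < \<rho>" "\<rho> < s k" "s1 < s0" "s1 < 1" for k
    using s0 \<sigma>pos[of k] by (auto simp: \<rho>_def s_def s1_def)
  have s6: "6 * \<sigma> k < s k" "s k < 1" "0 < s k" for k using \<rho>(1) \<rho>(2)[of k] s_le[of k] \<rho>(4) \<sigma>pos[of k] by (auto simp: s_def)
  \<comment> \<open>Budget for the sup-distance to \<open>h0\<close>. By the Cauchy estimate at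
    \<open>p = 0\<close> it keeps the Hessian within \<delta> of \<open>A\<close>; being at most 1,
    it keeps the Hamiltonian below B'.\<close>
  define \<Delta> where "\<Delta> = min 1 (\<delta> * \<rho>\<^sup>2 / 16)"
  have \<Delta>: "0 < \<Delta>" "\<Delta> \<le> 1" "16 * \<Delta> / \<rho>\<^sup>2 \<le> \<delta>"
    using c \<rho>(1) by (auto simp: \<Delta>_def min_def field_simps)
  \<comment> \<open>The first bound makes K \<theta> times the square of \<sigma> k at most
    2^(-\<mu>-2), the factor by which \<open>E\<close> shrinks; the second keeps the change of the
    Hamiltonian in step \<open>k\<close> below \<Delta>/2^(k+2).\<close>
  define \<theta> where "\<theta> = min (1 / (K * 2 ^ (\<mu> + 2))) (\<Delta> / (136 * B' * K))"
  have \<theta>: "0 < \<theta>" "K * \<theta> * 2 ^ (\<mu> + 2) \<le> 1" "136 * B' * (K * \<theta>) \<le> \<Delta>"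
  proof -
    show "0 < \<theta>" using K B' \<Delta> by (auto simp: \<theta>_def)
    have "\<theta> \<le> 1 / (K * 2 ^ (\<mu> + 2))" "\<theta> \<le> \<Delta> / (136 * B' * K)" by (auto simp: \<theta>_def)
    then show "K * \<theta> * 2 ^ (\<mu> + 2) \<le> 1" "136 * B' * (K * \<theta>) \<le> \<Delta>"
      using K B' by (auto simp: pos_le_divide_eq mult_ac)
  qed
  have K\<theta>: "0 < K * \<theta>" "K * \<theta> \<le> 1"
  proof -
    show "0 < K * \<theta>" using K \<theta> by simp
    have "(1 :: real) \<le> 2 ^ (\<mu> + 2)" by (rule one_le_power) simp
    from mult_left_mono[OF this, of "K * \<theta>"] have "K * \<theta> * 1 \<le> K * \<theta> * 2 ^ (\<mu> + 2)" using K \<theta>(1) by simp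
    then show "K * \<theta> \<le> 1" using \<theta>(2) by linarith
  qed
  define E where "E k = \<theta> * \<sigma> k ^ (\<mu> + 2)" for k
  have E0: "0 < E k" for k using \<theta> \<sigma>pos by (simp add: E_def)
  \<comment> \<open>\<open>C * \<tau>\<close> dominates the initial error: 2 B1 bounds the
    oscillation of \<open>r\<close>, and 2 B1/s1 its p-derivatives.\<close>
  define C where "C = 2 * B1 + 4 * (B1 / s1) + 1"
  have B1s: "0 \<le> B1 / s1" using B1 s0 by (simp add: s1_def)
  have C: "0 < C" "2 * B1 \<le> C" "2 * (B1 / s1) \<le> C" using B1 B1s by (auto simp: C_def)
  define \<tau> where "\<tau> = min s0 (min (E 0 / C) (\<Delta> / (2 * B')))"
  have \<tau>: "0 < \<tau>" "\<tau> \<le> s0" "C * \<tau> \<le> E 0" "\<tau> * B1 \<le> \<Delta> / 2"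
  proof -
    show "0 < \<tau>" "\<tau> \<le> s0" using s0 E0 C(1) \<Delta> B' by (auto simp: \<tau>_def)
    have "\<tau> \<le> E 0 / C" "\<tau> \<le> \<Delta> / (2 * B')" by (auto simp: \<tau>_def)
    then show "C * \<tau> \<le> E 0" using C(1) by (simp add: pos_le_divide_eq mult.commute)
    have "\<tau> * B1 \<le> \<tau> * B'" using \<open>0 < \<tau>\<close> by (auto simp: B'_def intro!: mult_left_mono)
    also have "\<dots> \<le> \<Delta> / 2" using \<open>\<tau> \<le> \<Delta> / (2 * B')\<close> B' by (simp add: pos_le_divide_eq mult_ac)
    finally show "\<tau> * B1 \<le> \<Delta> / 2" .
  qed
  have sub0: "x \<in> tdom s0 s0" if "x \<in> tdom s0 \<tau>" for x by (rule tdom_mono[OF _ _ that]) (use \<tau> in auto)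
  have sub1: "x \<in> tdom s0 \<tau>" if "x \<in> tdom s1 \<tau>" for x by (rule tdom_mono[OF _ _ that]) (use \<rho> in auto)
  have subk: "x \<in> tdom s1 \<tau>" if "x \<in> tdom (s k) \<tau>" for x k by (rule tdom_mono[OF _ _ that]) (use s_le in auto)
  have h0h: "holo_on h0 (tdom s0 s0)" using h0 by (simp add: normal_ham_def)
  have h0n: "h0 (pz x) = h0 (bp x)" "dp i h0 (pz x) = \<omega> $ i" "dp i (dp j h0) (pz x) = A $ i $ j" if "x \<in> tdom s0 s0" for x i j
    using h0 that unfolding normal_ham_def by blast+
  have P0h: "holo_on P0 (tdom s0 \<tau>)"
    unfolding P0_def by (rule holo_on_subset[of _ "tdom s0 s0"])
      (use sub0 in \<open>auto intro!: holo_on_add holo_on_mult holo_on_coords h0h r\<close>)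
  \<comment> \<open>The factor 1 - 1/2^(k+1) is half of the budget at the start and leaves exactly
    \<Delta>/2^(k+2) for step \<open>k\<close>.\<close>
  define Inv where "Inv k \<Theta> \<longleftrightarrow> symp \<Theta> (tdom (s k) \<tau>) \<and>
     (\<forall>x\<in>tdom (s k) \<tau>. \<Theta> x \<in> tdom s1 \<tau> \<and> (snd (snd x) = 0 \<longrightarrow> \<Theta> x = x) \<and>
        cmod (P0 (\<Theta> x) - h0 x) \<le> \<Delta> * (1 - 1 / 2 ^ (k + 1))) \<and>
     kerr \<omega> (\<lambda>x. P0 (\<Theta> x)) (tdom (s k) \<tau>) (E k)" for k \<Theta>
  \<comment> \<open>68 = 34 * 2, since the \<open>q\<close> and \<open>p\<close> components of
    \<Theta> are bounded by 2.\<close>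
  define Rel where "Rel k \<Theta> \<Theta>' \<longleftrightarrow> (\<forall>x\<in>tdom (s (Suc k)) \<tau>. small (68 / 2 ^ k) (\<Theta>' x - \<Theta> x))" for k and \<Theta> \<Theta>' :: "'n phase \<Rightarrow> 'n phase"
  have Inv0: "Inv 0 (\<lambda>x. x)"
    unfolding Inv_def s_0
  proof (intro conjI ballI impI symp_id)
    fix x :: "'n phase" assume x: "x \<in> tdom s1 \<tau>"
    have "cmod (snd (snd x) * r x) \<le> \<tau> * B1"
      unfolding norm_mult by (intro mult_mono) (use x B[OF sub0[OF sub1[OF x]]] \<tau> in \<open>auto simp: tdom_def\<close>)
    then show "cmod (P0 x - h0 x) \<le> \<Delta> * (1 - 1 / 2 ^ (0 + 1))" using \<tau>(4) by (simp add: P0_def)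
    show "x = x" ..
  next
    show "kerr \<omega> P0 (tdom s1 \<tau>) (E 0)"
      unfolding kerr_def
    proof (intro ballI conjI allI)
      fix x :: "'n phase" and i assume x: "x \<in> tdom s1 \<tau>"
      have x0: "x \<in> tdom s0 s0" using sub0 sub1 x by blast
      have pzx: "pz x \<in> tdom s0 s0" "bp x \<in> tdom s0 s0" using pz_tdom[OF x0] bp_tdom[OF x0] s0 by auto
      have t: "cmod (snd (snd x)) \<le> \<tau>" using x by (simp add: tdom_def)
      have "P0 (pz x) - P0 (bp x) = snd (snd x) * (r (pz x) - r (bp x))"
        using h0n(1)[OF x0] by (simp add: P0_def algebra_simps)
      moreover have "cmod (r (pz x) - r (bp x)) \<le> 2 * B1"
        using norm_triangle_ineq4[of "r (pz x)" "r (bp x)"] B[OF pzx(1)] B[OF pzx(2)] by linarith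
      ultimately have "cmod (P0 (pz x) - P0 (bp x)) \<le> \<tau> * (2 * B1)"
        using mult_mono[OF t, of "cmod (r (pz x) - r (bp x))" "2 * B1"] \<tau>(1) by (simp add: norm_mult)
      also have "\<dots> \<le> \<tau> * C" by (intro mult_left_mono C) (use \<tau> in simp)
      finally show "cmod (P0 (pz x) - P0 (bp x)) \<le> E 0" using \<tau>(3) by (simp add: mult.commute)
      have "dp i P0 (pz x) = dp i h0 (pz x) + snd (snd x) * dp i r (pz x)"
        unfolding P0_def fder_add[OF h0h holo_on_mult[OF holo_on_coords(3) r] pzx(1)]
          fder_mult[OF holo_on_coords(3) r pzx(1)] by simp
      then have e: "dp i P0 (pz x) - \<omega> $ i = snd (snd x) * dp i r (pz x)" using h0n(2)[OF x0] by simp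
      have x1': "pz x \<in> tdom (s0 - s1) s0"
        by (rule pz_tdom, rule tdom_mono[OF _ _ x]) (use \<tau> s0 in \<open>auto simp: s1_def\<close>)
      have "cmod (dp i r (pz x)) \<le> 2 * B1 / s1"
        by (rule dp_bound[OF r _ _ x1']) (use B s0 in \<open>auto simp: s1_def\<close>)
      then have "cmod (dp i P0 (pz x) - \<omega> $ i) \<le> \<tau> * (2 * B1 / s1)"
        unfolding e norm_mult by (intro mult_mono t) (use \<tau> in auto)
      also have "\<dots> \<le> \<tau> * C" unfolding times_divide_eq_right[symmetric] by (intro mult_left_mono C) (use \<tau> in simp)
      finally show "cmod (dp i P0 (pz x) - \<omega> $ i) \<le> E 0" using \<tau>(3) by (simp add: mult.commute)
    qed
  qed
  have next_step: "\<exists>\<Theta>'. Inv (Suc k) \<Theta>' \<and> Rel k \<Theta> \<Theta>'" if inv: "Inv k \<Theta>" for k \<Theta>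
  proof -
    let ?S = "tdom (s k) \<tau> :: 'n phase set"
    let ?P = "\<lambda>x. P0 (\<Theta> x)"
    have sy: "symp \<Theta> ?S" and \<Theta>dom: "\<And>x. x \<in> ?S \<Longrightarrow> \<Theta> x \<in> tdom s1 \<tau>"
      and \<Theta>0: "\<And>x. x \<in> ?S \<Longrightarrow> snd (snd x) = 0 \<Longrightarrow> \<Theta> x = x"
      and close: "\<And>x. x \<in> ?S \<Longrightarrow> cmod (?P x - h0 x) \<le> \<Delta> * (1 - 1 / 2 ^ (k + 1))"
      and err: "kerr \<omega> ?P ?S (E k)"
      using inv unfolding Inv_def by blast+
    have close1: "cmod (?P x - h0 x) \<le> \<Delta>" if "x \<in> ?S" for x
    proof -
      have "\<Delta> * (1 - 1 / 2 ^ (k + 1)) \<le> \<Delta> * 1" by (rule mult_left_mono) (use \<Delta> in auto)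
      then show ?thesis using close[OF that] by linarith
    qed
    have Ss0: "x \<in> tdom s0 s0" if "x \<in> ?S" for x using sub0 sub1 subk that by blast
    have Ph: "holo_on ?P ?S"
      by (rule holo_on_compose[OF P0h sympD(1)[OF sy]]) (use \<Theta>dom sub1 in blast)
    have h0S: "holo_on h0 ?S" by (rule holo_on_subset[OF h0h]) (use Ss0 in blast)
    have PB: "cmod (?P x) \<le> B'" if "x \<in> ?S" for x
      using norm_triangle_ineq2[of "?P x" "h0 x"] close1[OF that] \<Delta>(2) B[OF Ss0[OF that]] unfolding B'_def by linarith
    \<comment> \<open>The Hessian of \<open>h0\<close> at \<open>p = 0\<close> is exactly
      \<open>A\<close>, so the deviation is the Hessian of a difference whose sup-norm is within the
      budget.\<close>
    have QA: "cmod (dp i (dp j ?P) (pz x) - A $ i $ j) \<le> \<delta>" if x: "x \<in> ?S" for x i j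
    proof -
      have pzx: "pz x \<in> ?S" by (rule pz_tdom[OF x s6(3)])
      have eq: "dp j (\<lambda>x. ?P x - h0 x) y = dp j ?P y - dp j h0 y" if "y \<in> ?S" for y
        by (rule fder_diff[OF Ph h0S that])
      have "dp i (dp j (\<lambda>x. ?P x - h0 x)) (pz x) = dp i (\<lambda>y. dp j ?P y - dp j h0 y) (pz x)"
        by (rule fder_cong[OF open_tdom eq pzx])
      also have "\<dots> = dp i (dp j ?P) (pz x) - dp i (dp j h0) (pz x)"
        by (rule fder_diff[OF holo_on_dp[OF Ph open_tdom] holo_on_dp[OF h0S open_tdom] pzx])
      finally have "dp i (dp j ?P) (pz x) - A $ i $ j = dp i (dp j (\<lambda>x. ?P x - h0 x)) (pz x)"
        using h0n(3)[OF Ss0[OF x]] by simp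
      moreover have "cmod (dp i (dp j (\<lambda>x. ?P x - h0 x)) (pz x)) \<le> 16 * \<Delta> / (s k)\<^sup>2"
        by (rule dp_dp_bound_at_pz[OF holo_on_diff[OF Ph h0S] close1 s6(3) x])
      moreover have "16 * \<Delta> / (s k)\<^sup>2 \<le> 16 * \<Delta> / \<rho>\<^sup>2"
        by (intro divide_left_mono power_mono) (use \<Delta> \<rho>(1) \<rho>(2)[of k] in auto)
      ultimately show ?thesis using \<Delta>(3) by simp
    qed
    define \<beta> where "\<beta> = K * E k / \<sigma> k ^ \<mu>"
    have \<beta>eq: "\<beta> = K * \<theta> * (\<sigma> k)\<^sup>2" using \<sigma>pos[of k] by (simp add: \<beta>_def E_def power_add power2_eq_square)
    have \<beta>\<sigma>: "\<beta> \<le> \<sigma> k * \<sigma> k"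
    proof -
      have "K * \<theta> * (\<sigma> k)\<^sup>2 \<le> 1 * (\<sigma> k)\<^sup>2" by (rule mult_right_mono[OF K\<theta>(2)]) simp
      then show ?thesis by (simp add: \<beta>eq power2_eq_square)
    qed
    have \<beta>4: "\<beta> < \<sigma> k / 4 + \<sigma> k * \<sigma> k * 0" "\<beta> \<le> \<sigma> k" "0 \<le> \<beta>"
    proof -
      have "\<sigma> k * \<sigma> k < \<sigma> k * (1 / 4)" by (rule mult_strict_left_mono[OF \<sigma>1 \<sigma>pos])
      then show "\<beta> < \<sigma> k / 4 + \<sigma> k * \<sigma> k * 0" using \<beta>\<sigma> by simp
      then show "\<beta> \<le> \<sigma> k" using \<sigma>pos[of k] by simp
      show "0 \<le> \<beta>" using K\<theta>(1) by (simp add: \<beta>eq)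
    qed
    obtain \<Phi> where sol: "step_sol \<omega> \<beta> (K * (E k)\<^sup>2 / \<sigma> k ^ \<mu>) (s k) (\<sigma> k) \<tau> ?P \<Phi>"
      using step[OF \<sigma>pos s6(1,2) less_imp_le[OF E0] Ph PB err QA] \<beta>4(2) unfolding \<beta>_def by blast
    let ?S5 = "tdom (s k - 5 * \<sigma> k) \<tau> :: 'n phase set"
    have \<Phi>: "symp \<Phi> ?S5" "\<And>x. x \<in> ?S5 \<Longrightarrow> \<Phi> x \<in> tdom (s k - 4 * \<sigma> k) \<tau>" "\<And>x. x \<in> ?S5 \<Longrightarrow> small \<beta> (\<Phi> x - x)"
      and err': "kerr \<omega> (\<lambda>x. ?P (\<Phi> x)) (tdom (s (Suc k)) \<tau>) (K * (E k)\<^sup>2 / \<sigma> k ^ \<mu>)"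
      and \<Phi>0: "(\<forall>x\<in>?S. snd (snd x) = 0 \<longrightarrow> ?P (pz x) = ?P (bp x) \<and> (\<forall>i. dp i ?P (pz x) = \<omega> $ i)) \<Longrightarrow>
        (\<forall>x\<in>?S5. snd (snd x) = 0 \<longrightarrow> \<Phi> x = x)"
      using sol unfolding step_sol_def s_Suc by blast+
    have S5: "x \<in> ?S5" if "x \<in> tdom (s (Suc k)) \<tau>" for x
      by (rule tdom_mono[OF _ _ that]) (use \<sigma>pos[of k] in \<open>auto simp: s_Suc\<close>)
    have S4: "x \<in> ?S" if "x \<in> tdom (s k - 4 * \<sigma> k) \<tau>" for x
      by (rule tdom_mono[OF _ _ that]) (use \<sigma>pos[of k] in auto)
    have S1: "x \<in> tdom (s k - \<sigma> k) \<tau>" if "x \<in> ?S5" for x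
      by (rule tdom_mono[OF _ _ that]) (use \<sigma>pos[of k] in auto)
    have S5S: "x \<in> ?S" if "x \<in> ?S5" for x
      by (rule tdom_mono[OF _ _ that]) (use \<sigma>pos[of k] in auto)
    have \<Phi>S: "\<Phi> x \<in> ?S" if "x \<in> ?S5" for x using S4 \<Phi>(2) that by blast
    define \<Theta>' where "\<Theta>' = (\<lambda>x. \<Theta> (\<Phi> x))"
    have disp: "34 * M * \<beta> / \<sigma> k \<le> 34 * M * (K * \<theta>) / 2 ^ (k + 2)" if "0 \<le> M" for M
    proof -
      have "\<beta> / \<sigma> k = K * \<theta> * \<sigma> k" using \<sigma>pos[of k] by (simp add: \<beta>eq power2_eq_square)
      moreover have "\<sigma> k \<le> 1 / 2 ^ (k + 2)"
        using s0 by (simp add: \<sigma>_def s1_def divide_simps)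
      ultimately have "\<beta> / \<sigma> k \<le> K * \<theta> * (1 / 2 ^ (k + 2))" using K\<theta>(1) by (metis less_imp_le mult_left_mono)
      from mult_left_mono[OF this, of "34 * M"] that show ?thesis by (simp add: mult.assoc)
    qed
    have "Inv (Suc k) \<Theta>'"
      unfolding Inv_def
    proof (intro conjI ballI impI)
      show "symp \<Theta>' (tdom (s (Suc k)) \<tau>)" unfolding \<Theta>'_def
        by (rule symp_subset[OF symp_compose[OF sy \<Phi>(1) open_tdom \<Phi>S]]) (assumption, rule subsetI, rule S5)
      \<comment> \<open>The error law reproduces itself, since halving \<sigma> divides
        \<open>E\<close> by 2^(\<mu>+2).\<close>
      have "K * (E k)\<^sup>2 / \<sigma> k ^ \<mu> \<le> E (Suc k)"
      proof -
        have "K * (E k)\<^sup>2 / \<sigma> k ^ \<mu> = \<theta> * \<sigma> k ^ (\<mu> + 2) * (K * \<theta> * (\<sigma> k)\<^sup>2)"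
          using \<sigma>pos[of k] by (simp add: E_def power2_eq_square power_add)
        also have "\<dots> \<le> \<theta> * \<sigma> k ^ (\<mu> + 2) * (1 / 2 ^ (\<mu> + 2))"
        proof (rule mult_left_mono)
          have "(\<sigma> k)\<^sup>2 \<le> 1" using \<sigma>1[of k] \<sigma>pos[of k] by (intro power_le_one) auto
          then have "K * \<theta> * (\<sigma> k)\<^sup>2 \<le> K * \<theta> * 1" by (rule mult_left_mono) (use K\<theta> in auto)
          also have "\<dots> \<le> 1 / 2 ^ (\<mu> + 2)" using \<theta>(2) by (simp add: pos_le_divide_eq)
          finally show "K * \<theta> * (\<sigma> k)\<^sup>2 \<le> 1 / 2 ^ (\<mu> + 2)" .
        qed (use \<theta>(1) \<sigma>pos[of k] in auto)
        also have "\<dots> = E (Suc k)" by (simp add: E_def \<sigma>half power_divide)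
        finally show ?thesis .
      qed
      then show "kerr \<omega> (\<lambda>x. P0 (\<Theta>' x)) (tdom (s (Suc k)) \<tau>) (E (Suc k))"
        using err' unfolding kerr_def \<Theta>'_def by (meson order_trans)
      fix x :: "'n phase" assume x: "x \<in> tdom (s (Suc k)) \<tau>"
      show "\<Theta>' x \<in> tdom s1 \<tau>" unfolding \<Theta>'_def by (rule \<Theta>dom[OF \<Phi>S[OF S5[OF x]]])
      have "cmod (?P (\<Phi> x) - ?P x) \<le> 34 * B' * \<beta> / \<sigma> k"
        by (rule displacement_bound[OF Ph PB \<sigma>pos S1[OF S5[OF x]] \<Phi>(3)[OF S5[OF x]]]) (use \<beta>4 \<sigma>pos[of k] in auto)
      also have "\<dots> \<le> 34 * B' * (K * \<theta>) / 2 ^ (k + 2)" by (rule disp) (use B' in auto)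
      also have "\<dots> \<le> \<Delta> / 2 ^ (k + 2)"
      proof (rule divide_right_mono)
        have "0 \<le> B' * (K * \<theta>)" using B' K\<theta>(1) by simp
        then show "34 * B' * (K * \<theta>) \<le> \<Delta>" using \<theta>(3) unfolding mult.assoc by linarith
      qed simp
      finally have "cmod (?P (\<Phi> x) - h0 x) \<le> \<Delta> / 2 ^ (k + 2) + \<Delta> * (1 - 1 / 2 ^ (k + 1))"
        using norm_triangle_ineq[of "?P (\<Phi> x) - ?P x" "?P x - h0 x"] close[OF S5S[OF S5[OF x]]] by simp
      also have "\<dots> = \<Delta> * (1 - 1 / 2 ^ (Suc k + 1))" by (simp add: field_simps)
      finally show "cmod (P0 (\<Theta>' x) - h0 x) \<le> \<Delta> * (1 - 1 / 2 ^ (Suc k + 1))" by (simp add: \<Theta>'_def)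
      assume x0: "snd (snd x) = 0"
      \<comment> \<open>At \<open>t = 0\<close> the previous map is the identity and the
        perturbation is multiplied by 0, so the Hamiltonian is \<open>h0\<close> there and has no
        error.\<close>
      have "?P (pz y) = ?P (bp y) \<and> (\<forall>i. dp i ?P (pz y) = \<omega> $ i)" if y: "y \<in> ?S" "snd (snd y) = 0" for y
      proof -
        have yS: "pz y \<in> ?S" "bp y \<in> ?S" using pz_tdom[OF y(1) s6(3)] bp_tdom[OF y(1) s6(3)] by auto
        have z: "?P u - h0 u = 0" if "u \<in> ?S" "snd (snd u) = 0" for u
          using \<Theta>0[OF that] that(2) by (simp add: P0_def)
        have "dp i (\<lambda>x. ?P x - h0 x) (pz y) = 0" for i
          by (rule fder_zero_slice[OF holo_on_diff[OF Ph h0S] open_tdom z yS(1)]) (use y in simp_all)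
        then have "dp i ?P (pz y) = dp i h0 (pz y)" for i
          unfolding fder_diff[OF Ph h0S yS(1)] by simp
        then show ?thesis using z[OF yS(1)] z[OF yS(2)] y(2) h0n(1,2)[OF Ss0[OF y(1)]] by simp
      qed
      then have "\<Phi> x = x" using \<Phi>0 S5[OF x] x0 by blast
      then show "\<Theta>' x = x" using \<Theta>0[OF S5S[OF S5[OF x]] x0] by (simp add: \<Theta>'_def)
    qed
    moreover have "Rel k \<Theta> \<Theta>'"
      unfolding Rel_def
    proof
      fix x :: "'n phase" assume x: "x \<in> tdom (s (Suc k)) \<tau>"
      note h = hmapD[OF sympD(1)[OF sy]]
      have b: "cmod (fst (\<Theta> y) $ i) \<le> 2" "cmod (fst (snd (\<Theta> y)) $ i) \<le> 2" if "y \<in> ?S" for y i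
        using \<Theta>dom[OF that] \<rho>(4) unfolding tdom_def by (smt (verit) mem_Collect_eq)+
      have "34 * 2 * \<beta> / \<sigma> k \<le> 68 / 2 ^ k"
      proof -
        have "34 * 2 * (K * \<theta>) / 2 ^ (k + 2) \<le> 34 * 2 * 1 / 2 ^ k"
          by (intro frac_le mult_left_mono power_increasing) (use K\<theta> in auto)
        then show ?thesis using disp[of 2] by simp
      qed
      then have "cmod (fst (\<Theta> (\<Phi> x)) $ i - fst (\<Theta> x) $ i) \<le> 68 / 2 ^ k"
        "cmod (fst (snd (\<Theta> (\<Phi> x))) $ i - fst (snd (\<Theta> x)) $ i) \<le> 68 / 2 ^ k" for i
        using displacement_bound[OF h(1) b(1) \<sigma>pos S1[OF S5[OF x]] \<Phi>(3)[OF S5[OF x]] \<beta>4(3), of i]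
          displacement_bound[OF h(2) b(2) \<sigma>pos S1[OF S5[OF x]] \<Phi>(3)[OF S5[OF x]] \<beta>4(3), of i] \<beta>4 \<sigma>pos[of k] by auto
      moreover have "snd (snd (\<Theta> (\<Phi> x))) = snd (snd (\<Theta> x))"
        using sympD(2)[OF sy \<Phi>S[OF S5[OF x]]] sympD(2)[OF sy S5S[OF S5[OF x]]] sympD(2)[OF \<Phi>(1) S5[OF x]] by simp
      ultimately show "small (68 / 2 ^ k) (\<Theta>' x - \<Theta> x)" by (simp add: small_def \<Theta>'_def)
    qed
    ultimately show ?thesis by blast
  qed
  obtain \<Theta> where \<Theta>: "\<And>k. Inv k (\<Theta> k)" "\<And>k. Rel k (\<Theta> k) (\<Theta> (Suc k))"
  proof -
    have "\<exists>f. \<forall>n. Inv n (f n) \<and> Rel n (f n) (f (Suc n))"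
    proof (rule dependent_nat_choice)
      show "\<exists>\<Theta>. Inv 0 \<Theta>" using Inv0 by blast
      show "\<exists>\<Theta>'. Inv (Suc k) \<Theta>' \<and> Rel k \<Theta> \<Theta>'" if "Inv k \<Theta>" for \<Theta> k by (rule next_step[OF that])
    qed
    then obtain f where f: "\<forall>n. Inv n (f n) \<and> Rel n (f n) (f (Suc n))" ..
    show thesis by (rule that[of f]; rule f[rule_format, THEN conjunct1] f[rule_format, THEN conjunct2])
  qed
  let ?R = "tdom \<rho> \<tau> :: 'n phase set"
  have Rk: "x \<in> tdom (s k) \<tau>" if "x \<in> ?R" for x k
    by (rule tdom_mono[OF _ _ that]) (use \<rho>(2)[of k] in auto)
  have sy: "symp (\<Theta> k) ?R" for k
    using \<Theta>(1)[of k] Rk symp_subset[of "\<Theta> k" "tdom (s k) \<tau>" ?R] unfolding Inv_def by blast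
  have dom: "\<Theta> k x \<in> tdom s1 \<tau>" and \<Theta>0: "snd (snd x) = 0 \<Longrightarrow> \<Theta> k x = x" if "x \<in> ?R" for k x
    using \<Theta>(1)[of k] Rk[OF that, of k] unfolding Inv_def by blast+
  have err: "cmod (P0 (\<Theta> k (pz x)) - P0 (\<Theta> k (bp x))) \<le> E k" "cmod (dp i (\<lambda>x. P0 (\<Theta> k x)) (pz x) - \<omega> $ i) \<le> E k"
    if "x \<in> ?R" for k x i
    using \<Theta>(1)[of k] Rk[OF that, of k] unfolding Inv_def kerr_def by blast+
  have st: "small (68 / 2 ^ k) (\<Theta> (Suc k) x - \<Theta> k x)" if "x \<in> ?R" for k x
    using \<Theta>(2)[of k] Rk[OF that, of "Suc k"] unfolding Rel_def by blast
  have Elim: "E \<longlonglongrightarrow> 0"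
  proof -
    have "(\<lambda>k. s1 / 24 * (1 / 2) ^ k) \<longlonglongrightarrow> s1 / 24 * 0" by (intro tendsto_intros LIMSEQ_power_zero) simp
    then have "\<sigma> \<longlonglongrightarrow> 0" by (simp add: \<sigma>_def[abs_def] power_divide)
    then have "(\<lambda>k. \<theta> * \<sigma> k ^ (\<mu> + 2)) \<longlonglongrightarrow> \<theta> * 0 ^ (\<mu> + 2)" by (intro tendsto_intros)
    then show ?thesis by (simp add: E_def[abs_def])
  qed
  obtain \<Theta>' where T': "symp \<Theta>' ?R" "\<And>x. x \<in> ?R \<Longrightarrow> (\<lambda>k. \<Theta> k x) \<longlonglongrightarrow> \<Theta>' x"
    "\<And>i x v. x \<in> ?R \<Longrightarrow> (\<lambda>k. fder (qpart (\<Theta> k) i) v x) \<longlonglongrightarrow> fder (qpart \<Theta>' i) v x"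
    "\<And>i x v. x \<in> ?R \<Longrightarrow> (\<lambda>k. fder (ppart (\<Theta> k) i) v x) \<longlonglongrightarrow> fder (ppart \<Theta>' i) v x"
    using iteration_limit[of \<Theta> ?R 68, OF sy open_tdom st] by blast
  \<comment> \<open>Strict inequalities become weak in the limit; the gap between s1 and s0 restores
    them.\<close>
  have dom': "\<Theta>' x \<in> tdom s0 \<tau>" if x: "x \<in> ?R" for x
  proof -
    have q: "(\<lambda>k. cmod (fst (\<Theta> k x) $ i)) \<longlonglongrightarrow> cmod (fst (\<Theta>' x) $ i)"
      and p: "(\<lambda>k. cmod (fst (snd (\<Theta> k x)) $ i)) \<longlonglongrightarrow> cmod (fst (snd (\<Theta>' x)) $ i)" for i
      by (intro tendsto_intros T'(2)[OF x])+
    have "1 - s1 \<le> cmod (fst (\<Theta>' x) $ i)" "cmod (fst (\<Theta>' x) $ i) \<le> 1 + s1" "cmod (fst (snd (\<Theta>' x)) $ i) \<le> s1" for i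
      using dom[OF x] by (intro LIMSEQ_le_const[OF q] LIMSEQ_le_const2[OF q] LIMSEQ_le_const2[OF p]; force simp: tdom_def less_imp_le)+
    moreover have "snd (snd (\<Theta>' x)) = snd (snd x)" by (rule sympD(2)[OF T'(1) x])
    ultimately show ?thesis using \<rho>(3) x unfolding tdom_def mem_Collect_eq by (smt (verit, best))
  qed
  have Plim: "(\<lambda>k. f (\<Theta> k x)) \<longlonglongrightarrow> f (\<Theta>' x)" if "x \<in> ?R" "holo_on f (tdom s0 \<tau>)" for f x
    by (rule isCont_tendsto_compose[OF holo_on_imp_continuous[OF that(2) dom'[OF that(1)]] T'(2)[OF that(1)]])
  have c1: "P0 (\<Theta>' (pz x)) = P0 (\<Theta>' (bp x))" if x: "x \<in> ?R" for x
  proof -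
    have "(\<lambda>k. P0 (\<Theta> k (pz x)) - P0 (\<Theta> k (bp x))) \<longlonglongrightarrow> P0 (\<Theta>' (pz x)) - P0 (\<Theta>' (bp x))"
      by (intro tendsto_diff Plim P0h pz_tdom bp_tdom x \<rho>)
    moreover have "(\<lambda>k. P0 (\<Theta> k (pz x)) - P0 (\<Theta> k (bp x))) \<longlonglongrightarrow> 0"
      by (rule Lim_null_comparison[OF always_eventually Elim]) (use err(1)[OF x] in blast)
    ultimately have "P0 (\<Theta>' (pz x)) - P0 (\<Theta>' (bp x)) = 0" by (rule LIMSEQ_unique)
    then show ?thesis by simp
  qed
  \<comment> \<open>Convergence is known for the derivatives of the components of the maps; the
    chain rule carries it over to the composite Hamiltonian.\<close>
  have c2: "dp i (\<lambda>x. P0 (\<Theta>' x)) (pz x) = \<omega> $ i" if x: "x \<in> ?R" for i x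
  proof -
    have pzx: "pz x \<in> ?R" by (rule pz_tdom[OF x \<rho>(1)])
    have d: "\<Theta> k x \<in> tdom s0 \<tau>" if "x \<in> ?R" for k x using dom[OF that] sub1 by blast
    have v: "snd (snd (0, axis i 1, 0 :: complex)) = 0" for i by simp
    have e: "dp i (\<lambda>x. P0 (\<Theta> k x)) (pz x) = (\<Sum>a\<in>UNIV. dq a P0 (\<Theta> k (pz x)) * dp i (qpart (\<Theta> k) a) (pz x)) +
        (\<Sum>a\<in>UNIV. dp a P0 (\<Theta> k (pz x)) * dp i (ppart (\<Theta> k) a) (pz x))" for k
      by (rule fder_symp_compose[OF sy open_tdom d P0h pzx]) simp_all
    have e': "dp i (\<lambda>x. P0 (\<Theta>' x)) (pz x) = (\<Sum>a\<in>UNIV. dq a P0 (\<Theta>' (pz x)) * dp i (qpart \<Theta>' a) (pz x)) +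
        (\<Sum>a\<in>UNIV. dp a P0 (\<Theta>' (pz x)) * dp i (ppart \<Theta>' a) (pz x))"
      by (rule fder_symp_compose[OF T'(1) open_tdom dom' P0h pzx]) simp_all
    have "(\<lambda>k. dp i (\<lambda>x. P0 (\<Theta> k x)) (pz x)) \<longlonglongrightarrow> dp i (\<lambda>x. P0 (\<Theta>' x)) (pz x)"
      unfolding e e'
      by (intro tendsto_intros Plim[OF pzx] holo_on_dq[OF P0h open_tdom] holo_on_dp[OF P0h open_tdom] T'(3,4)[OF pzx])
    then have 1: "(\<lambda>k. dp i (\<lambda>x. P0 (\<Theta> k x)) (pz x) - \<omega> $ i) \<longlonglongrightarrow> dp i (\<lambda>x. P0 (\<Theta>' x)) (pz x) - \<omega> $ i"
      by (intro tendsto_intros)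
    have 2: "(\<lambda>k. dp i (\<lambda>x. P0 (\<Theta> k x)) (pz x) - \<omega> $ i) \<longlonglongrightarrow> 0"
      by (rule Lim_null_comparison[OF always_eventually Elim]) (use err(2)[OF x] in blast)
    from LIMSEQ_unique[OF 1 2] show ?thesis by simp
  qed
  have c0: "\<Theta>' x = x" if "x \<in> ?R" "snd (snd x) = 0" for x
    using T'(2)[OF that(1)] \<Theta>0[OF that] by (simp add: LIMSEQ_const_iff)
  have "\<rho> < s0" using \<rho>(3) s0 by (simp add: \<rho>_def s1_def)
  from that[OF \<tau>(1,2) \<rho>(1) this T'(1) dom' c0 c1 c2] show thesis .
qed

subsection \<open>Near-identity maps and their action on germs\<close>

text \<open>The one-variable Schwarz lemma along the line in direction \<open>t\<close>, rescaled by
  \<tau>. Dividing by 2 M rather than \<open>M\<close> makes the function strictly smaller than 1 in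
  modulus.\<close>

lemma schwarz_t:
  fixes g :: "'n::finite phase \<Rightarrow> complex"
  assumes g: "holo_on g (tdom \<rho> \<tau>)" and M: "\<And>x. x \<in> tdom \<rho> \<tau> \<Longrightarrow> cmod (g x) \<le> M" "0 < M"
    and z: "\<And>x. x \<in> tdom \<rho> \<tau> \<Longrightarrow> snd (snd x) = 0 \<Longrightarrow> g x = 0" and \<tau>: "0 < \<tau>" and x: "x \<in> tdom \<rho> \<tau>"
  shows "cmod (g x) \<le> 2 * M / \<tau> * cmod (snd (snd x))"
proof -
  let ?x0 = "(fst x, fst (snd x), 0) :: 'n phase" and ?v = "(0, 0, complex_of_real \<tau>) :: 'n phase"
  define f where "f z = g (?x0 + cscale z ?v) / of_real (2 * M)" for z
  have dom: "?x0 + cscale z ?v \<in> tdom \<rho> \<tau>" if "cmod z < 1" for z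
    using x \<tau> that by (simp add: tdom_def cscale_def norm_mult)
  have "(\<lambda>z. g (?x0 + cscale z ?v)) holomorphic_on ball 0 1"
    by (rule holo_on_line_holomorphic'[OF g dom])
  then have f: "f holomorphic_on ball 0 1"
    unfolding f_def using M(2) by (intro holomorphic_intros) auto
  have f1: "norm (f z) < 1" if "norm z < 1" for z
  proof -
    have "cmod (g (?x0 + cscale z ?v)) < 2 * M" using M(1)[OF dom[OF that]] M(2) by linarith
    then show ?thesis using M(2) by (simp add: f_def norm_divide norm_mult)
  qed
  have f0: "f 0 = 0"
    using z[OF dom[of 0]] by (simp add: f_def)
  define \<xi> where "\<xi> = snd (snd x) / of_real \<tau>"
  have \<xi>: "cmod \<xi> < 1" using x \<tau> by (simp add: \<xi>_def norm_divide tdom_def)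
  have "?x0 + cscale \<xi> ?v = x"
    using \<tau> by (auto simp: \<xi>_def cscale_def prod_eq_iff)
  moreover have "norm (f \<xi>) \<le> norm \<xi>" by (rule Schwarz_Lemma(1)[OF f f0 f1 \<xi>])
  ultimately show ?thesis using M(2) \<tau> by (simp add: f_def \<xi>_def norm_divide norm_mult field_simps)
qed

lemma small_diff: "small \<alpha> u \<Longrightarrow> small \<beta> v \<Longrightarrow> small (\<alpha> + \<beta>) (u - v)"
  unfolding small_def by (auto intro!: norm_triangle_le_diff add_mono)

lemma small_minus: "small \<alpha> (u - v) \<Longrightarrow> small \<alpha> (v - u)"
  unfolding small_def by (simp add: norm_minus_commute)

lemma small_mono: "small \<alpha> u \<Longrightarrow> \<alpha> \<le> \<beta> \<Longrightarrow> small \<beta> u"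
  unfolding small_def using order_trans by blast

text \<open>Repeated halving: the uniqueness half of the contraction principle, phrased for the
  coordinatewise size.\<close>

lemma small_half_zero:
  assumes "small \<beta> v" "\<And>\<alpha>. 0 \<le> \<alpha> \<Longrightarrow> \<alpha> \<le> \<beta> \<Longrightarrow> small \<alpha> v \<Longrightarrow> small (\<alpha> / 2) v" "0 \<le> \<beta>"
  shows "v = 0"
proof -
  have s: "small (\<beta> * (1 / 2) ^ n) v" for n
  proof (induction n)
    case (Suc n)
    have "\<beta> * (1 / 2) ^ n \<le> \<beta> * 1" by (intro mult_left_mono power_le_one assms) auto
    then show ?case using assms(2)[of "\<beta> * (1 / 2) ^ n"] Suc assms(3) by simp
  qed (use assms in simp)
  have "(\<lambda>n. \<beta> * (1 / 2) ^ n) \<longlonglongrightarrow> \<beta> * 0" by (intro tendsto_intros LIMSEQ_power_zero) simp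
  then have l: "(\<lambda>n. \<beta> * (1 / 2) ^ n) \<longlonglongrightarrow> 0" by simp
  have "small 0 v"
    unfolding small_def
  proof (intro conjI allI)
    show "cmod (fst v $ i) \<le> 0" for i
      by (rule LIMSEQ_le_const[OF l]) (use s in \<open>auto simp: small_def\<close>)
    show "cmod (fst (snd v) $ i) \<le> 0" for i
      by (rule LIMSEQ_le_const[OF l]) (use s in \<open>auto simp: small_def\<close>)
    show "snd (snd v) = 0" using assms(1) by (simp add: small_def)
  qed
  then show ?thesis by (rule small_0)
qed

text \<open>A displacement bounded by a multiple of |t| tends to 0 along the torus. This lets the
  map act on germs, as small neighbourhoods are mapped into prescribed ones.\<close>

definition near_id :: "('n::finite phase \<Rightarrow> 'n phase) \<Rightarrow> real \<Rightarrow> real \<Rightarrow> bool" where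
  "near_id \<Phi> C r \<longleftrightarrow> 0 \<le> C \<and> 0 < r \<and> hmap \<Phi> (tdom r r) \<and>
     (\<forall>x\<in>tdom r r. small (C * cmod (snd (snd x))) (\<Phi> x - x))"

lemma near_idD:
  assumes "near_id \<Phi> C r"
  shows "0 \<le> C" "0 < r" "hmap \<Phi> (tdom r r)"
    "x \<in> tdom r r \<Longrightarrow> small (C * cmod (snd (snd x))) (\<Phi> x - x)"
    "x \<in> tdom r r \<Longrightarrow> snd (snd (\<Phi> x)) = snd (snd x)"
  using assms unfolding near_id_def small_def by auto

text \<open>Dividing the radius by \<open>C + 1\<close> makes room for the displacement.\<close>

lemma near_id_shrink:
  assumes N: "near_id \<Phi> C r" and s: "0 < s"
  obtains s' where "0 < s'" "s' \<le> r" "s' \<le> s" "\<And>x. x \<in> tdom s' s' \<Longrightarrow> \<Phi> x \<in> tdom s s"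
proof
  note n = near_idD[OF N]
  define s' where "s' = min r (s / (C + 1))"
  show s': "0 < s'" "s' \<le> r" using n s by (auto simp: s'_def)
  have le: "s' * (C + 1) \<le> s"
  proof -
    have "s' \<le> s / (C + 1)" by (simp add: s'_def)
    then show ?thesis using n(1) by (simp add: field_simps)
  qed
  moreover have "0 \<le> C * s'" using n(1) s'(1) by simp
  ultimately show s's: "s' \<le> s" by (simp add: distrib_left mult.commute)
  fix x :: "'a phase" assume x: "x \<in> tdom s' s'"
  have xr: "x \<in> tdom r r" by (rule tdom_mono[OF s'(2,2) x])
  have t: "cmod (snd (snd x)) \<le> s'" using x by (simp add: tdom_def)
  have "small (C * s') (\<Phi> x - x)" by (rule small_mono[OF n(4)[OF xr] mult_left_mono[OF t n(1)]])
  from tdom_shift[OF x this] have "\<Phi> x \<in> tdom (s' + C * s') s'" by simp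
  then show "\<Phi> x \<in> tdom s s" by (rule tdom_mono[rotated 2]) (use le s's in \<open>auto simp: algebra_simps\<close>)
qed

text \<open>The inverse is the limit of the Picard iterates $y \mapsto x - (\Phi(y) - y)$.\<close>

lemma near_id_inverse:
  assumes N: "near_id \<Phi> C r"
  obtains \<Psi> r' s where "near_id \<Psi> C r'" "0 < s" "\<And>x. x \<in> tdom s s \<Longrightarrow> \<Phi> (\<Psi> x) = x"
    "\<And>x. x \<in> tdom s s \<Longrightarrow> \<Psi> (\<Phi> x) = x"
proof -
  note n = near_idD[OF N]
  \<comment> \<open>With a loss r/4, the displacement bound 34 gives the Lipschitz constant
    136/1000, below 1/2, for the map \<open>G\<close>; \<tau> is then chosen so that C |t| \<le>
    b.\<close>
  define b where "b = r / 1000"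
  define \<tau> where "\<tau> = min r (b / (C + 1))"
  have b: "0 < b" "b < r / 8" using n by (auto simp: b_def)
  have \<tau>: "0 < \<tau>" "\<tau> \<le> r" using n b by (auto simp: \<tau>_def)
  have C\<tau>: "C * \<tau> \<le> b"
  proof -
    have "\<tau> \<le> b / (C + 1)" by (simp add: \<tau>_def)
    then have "\<tau> * (C + 1) \<le> b" using n(1) by (simp add: field_simps)
    then show ?thesis using \<tau> by (simp add: algebra_simps)
  qed
  define G where "G x = \<Phi> x - x" for x
  let ?R = "tdom r \<tau> :: 'a phase set" and ?Q = "tdom (r - r / 4) \<tau> :: 'a phase set" and ?D = "tdom (r / 2) \<tau> :: 'a phase set"
  have R: "x \<in> tdom r r" if "x \<in> ?R" for x by (rule tdom_mono[OF _ \<tau>(2) that]) simp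
  have QR: "x \<in> ?R" if "x \<in> ?Q" for x by (rule tdom_mono[OF _ _ that]) (use n in auto)
  have DQ: "x \<in> ?Q" if "x \<in> ?D" for x by (rule tdom_mono[OF _ _ that]) (use n in auto)
  have hR: "hmap \<Phi> ?R" by (rule hmap_subset[OF n(3)]) (use R in blast)
  have GC: "small (C * cmod (snd (snd x))) (G x)" if "x \<in> ?R" for x
    unfolding G_def by (rule n(4)[OF R[OF that]])
  have Gb: "small b (G x)" if x: "x \<in> ?R" for x
  proof (rule small_mono[OF GC[OF x]])
    have "C * cmod (snd (snd x)) \<le> C * \<tau>" using x n(1) by (intro mult_left_mono) (auto simp: tdom_def)
    then show "C * cmod (snd (snd x)) \<le> b" using C\<tau> by linarith
  qed
  have Lip: "small (\<beta> / 2) (G y - G x)" if x: "x \<in> ?Q" and y: "small \<beta> (y - x)" "y \<in> ?R" and \<beta>: "0 \<le> \<beta>" "\<beta> < r / 8" for x y \<beta>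
  proof -
    have *: "cmod (f y - f x) \<le> \<beta> / 2" if f: "holo_on f ?R" "\<And>z. z \<in> ?R \<Longrightarrow> cmod (f z) \<le> b" for f
    proof -
      have "cmod (f y - f x) \<le> 34 * b * \<beta> / (r / 4)"
        by (rule displacement_bound[OF f _ x y(1) \<beta>(1)]) (use n \<beta> in auto)
      also have "\<dots> = 136 / 1000 * \<beta>" using n(2) by (simp add: b_def field_simps)
      finally show ?thesis using \<beta> by linarith
    qed
    have "cmod (fst (G y) $ i - fst (G x) $ i) \<le> \<beta> / 2" for i
    proof (rule *)
      show "holo_on (\<lambda>x. fst (G x) $ i) ?R"
        unfolding G_def fst_diff vector_minus_component by (intro holo_on_diff hmapD[OF hR] holo_on_coords)
    qed (use Gb in \<open>auto simp: small_def\<close>)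
    moreover have "cmod (fst (snd (G y)) $ i - fst (snd (G x)) $ i) \<le> \<beta> / 2" for i
    proof (rule *)
      show "holo_on (\<lambda>x. fst (snd (G x)) $ i) ?R"
        unfolding G_def fst_diff snd_diff vector_minus_component by (intro holo_on_diff hmapD[OF hR] holo_on_coords)
    qed (use Gb in \<open>auto simp: small_def\<close>)
    moreover have "snd (snd (G y - G x)) = 0"
      using Gb[OF y(2)] Gb[OF QR[OF x]] by (simp add: small_def)
    ultimately show ?thesis by (simp add: small_def)
  qed
  define Y where "Y k x = ((\<lambda>y. x - G y) ^^ k) x" for k x
  have Y0: "Y 0 x = x" and YS: "Y (Suc k) x = x - G (Y k x)" for k x by (simp_all add: Y_def)
  have near: "y \<in> ?Q" if "x \<in> ?D" "small b (y - x)" for x y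
  proof -
    have "x + (y - x) \<in> tdom (r / 2 + b) \<tau>" by (rule tdom_shift[OF that])
    then have "y \<in> tdom (r / 2 + b) \<tau>" by simp
    then show ?thesis by (rule tdom_mono[rotated 2]) (use b in auto)
  qed
  have YQ: "Y k x \<in> ?Q" if x: "x \<in> ?D" for k x
  proof (induction k)
    case (Suc k)
    have "small b (Y (Suc k) x - x)"
      using small_minus[of b "G (Y k x)" 0] Gb[OF QR[OF Suc]] by (simp add: YS)
    then show ?case by (rule near[OF x])
  qed (use DQ[OF x] in \<open>simp add: Y0\<close>)
  have Yx: "small (C * cmod (snd (snd x))) (Y k x - x) \<and> snd (snd (Y k x)) = snd (snd x)" if x: "x \<in> ?D" for k x
  proof (induction k)
    case 0
    show ?case using n(1) by (simp add: Y0 small_def)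
  next
    case (Suc k)
    have "small (C * cmod (snd (snd x))) (G (Y k x))" using GC[OF QR[OF YQ[OF x]], of k] Suc by simp
    then show ?case by (simp add: YS small_def)
  qed
  have hY: "hmap (Y k) ?D" for k
  proof (induction k)
    case 0
    show ?case unfolding Y0 hmap_def by (intro conjI allI holo_on_coords)
  next
    case (Suc k)
    have h: "hmap (\<lambda>x. \<Phi> (Y k x)) ?D" by (rule hmap_compose[OF hR Suc QR[OF YQ]])
    show ?case
      unfolding hmap_def YS G_def fst_diff snd_diff vector_minus_component
      by (intro conjI allI holo_on_diff holo_on_coords hmapD[OF h] hmapD[OF Suc])
  qed
  \<comment> \<open>Two consecutive steps differ by a difference of values of \<open>G\<close>, so
    the contraction halves the step each time.\<close>
  have step: "small (b / 2 ^ k) (Y (Suc k) x - Y k x)" if x: "x \<in> ?D" for k x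
  proof (induction k)
    case 0
    show ?case using small_minus[of b "G x" 0] Gb[OF QR[OF DQ[OF x]]] by (simp add: YS Y0)
  next
    case (Suc k)
    have "b / 2 ^ k \<le> b / 1" by (rule divide_left_mono) (use b in auto)
    then have lt: "b / 2 ^ k < r / 8" using b(2) by (simp only: div_by_1 order.strict_trans1)
    then have "small (b / 2 ^ k / 2) (G (Y (Suc k) x) - G (Y k x))"
      by (intro Lip[OF YQ[OF x] Suc QR[OF YQ[OF x]]]) (use b lt in \<open>simp_all only: zero_le_divide_iff, simp\<close>)
    from small_minus[OF this] show ?case by (simp add: YS[of "Suc k"] YS[of k x, symmetric] mult.commute) (simp add: YS)
  qed
  obtain \<Psi> where \<Psi>: "hmap \<Psi> ?D" "\<And>x. x \<in> ?D \<Longrightarrow> snd (snd (\<Psi> x)) = snd (snd x)"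
    "\<And>x. x \<in> ?D \<Longrightarrow> (\<lambda>k. Y k x) \<longlonglongrightarrow> \<Psi> x"
    by (rule hmap_limit[of Y ?D b, OF hY _ open_tdom step]) (use Yx in blast)+
  have \<Psi>s: "small (C * cmod (snd (snd x))) (\<Psi> x - x)" if x: "x \<in> ?D" for x
    unfolding small_def
  proof (intro conjI allI)
    note l = \<Psi>(3)[OF x]
    have q: "(\<lambda>k. cmod (fst (Y k x - x) $ i)) \<longlonglongrightarrow> cmod (fst (\<Psi> x - x) $ i)"
      and p: "(\<lambda>k. cmod (fst (snd (Y k x - x)) $ i)) \<longlonglongrightarrow> cmod (fst (snd (\<Psi> x - x)) $ i)" for i
      by (intro tendsto_intros l)+
    show "cmod (fst (\<Psi> x - x) $ i) \<le> C * cmod (snd (snd x))" for i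
      by (rule LIMSEQ_le_const2[OF q]) (use Yx[OF x] in \<open>auto simp: small_def\<close>)
    show "cmod (fst (snd (\<Psi> x - x)) $ i) \<le> C * cmod (snd (snd x))" for i
      by (rule LIMSEQ_le_const2[OF p]) (use Yx[OF x] in \<open>auto simp: small_def\<close>)
    show "snd (snd (\<Psi> x - x)) = 0" using \<Psi>(2)[OF x] by simp
  qed
  have \<Psi>b: "small b (\<Psi> x - x)" if x: "x \<in> ?D" for x
  proof (rule small_mono[OF \<Psi>s[OF x]])
    have "C * cmod (snd (snd x)) \<le> C * \<tau>" using x n(1) by (intro mult_left_mono) (auto simp: tdom_def)
    then show "C * cmod (snd (snd x)) \<le> b" using C\<tau> by linarith
  qed
  have \<Psi>Q: "\<Psi> x \<in> ?Q" if "x \<in> ?D" for x by (rule near[OF that \<Psi>b[OF that]])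
  have inv1: "\<Phi> (\<Psi> x) = x" if x: "x \<in> ?D" for x
  proof -
    have "isCont \<Phi> (\<Psi> x)"
      by (rule has_derivative_continuous[OF hmap_derivative[OF hR QR[OF \<Psi>Q[OF x]]]])
    then have "(\<lambda>k. \<Phi> (Y k x)) \<longlonglongrightarrow> \<Phi> (\<Psi> x)" by (rule isCont_tendsto_compose[OF _ \<Psi>(3)[OF x]])
    then have "(\<lambda>k. x - (\<Phi> (Y k x) - Y k x)) \<longlonglongrightarrow> x - (\<Phi> (\<Psi> x) - \<Psi> x)"
      by (intro tendsto_intros \<Psi>(3)[OF x])
    moreover have "(\<lambda>k. x - (\<Phi> (Y k x) - Y k x)) \<longlonglongrightarrow> \<Psi> x"
      using LIMSEQ_Suc[OF \<Psi>(3)[OF x]] by (simp only: YS G_def)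
    ultimately have "x - (\<Phi> (\<Psi> x) - \<Psi> x) = \<Psi> x" by (rule LIMSEQ_unique)
    then show ?thesis by (simp add: algebra_simps)
  qed
  \<comment> \<open>Both \<open>x\<close> and \<open>?y\<close> are preimages of the same point, so
    their difference equals a difference of values of \<open>G\<close> and can be halved
    indefinitely.\<close>
  have inv2: "\<Psi> (\<Phi> x) = x" if x: "x \<in> ?D" "\<Phi> x \<in> ?D" for x
  proof -
    let ?y = "\<Psi> (\<Phi> x)"
    have xb: "small b (x - \<Phi> x)" using small_minus[OF Gb[OF QR[OF DQ[OF x(1)]], unfolded G_def]] .
    have yb: "small b (?y - \<Phi> x)" by (rule \<Psi>b[OF x(2)])
    have yR: "?y \<in> ?R" by (rule QR[OF \<Psi>Q[OF x(2)]])
    have e: "G x - G ?y = ?y - x" by (simp add: G_def inv1[OF x(2)])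
    have "?y - x = 0"
    proof (rule small_half_zero)
      show "small (b + b) (?y - x)" using small_diff[OF yb xb] by simp
      show "small (\<alpha> / 2) (?y - x)" if \<alpha>: "0 \<le> \<alpha>" "\<alpha> \<le> b + b" "small \<alpha> (?y - x)" for \<alpha>
      proof -
        have "\<alpha> < r / 8" using \<alpha>(2) n(2) by (simp add: b_def)
        from small_minus[OF Lip[OF DQ[OF x(1)] \<alpha>(3) yR \<alpha>(1) this]] show ?thesis by (simp only: e)
      qed
    qed (use b in simp)
    then show ?thesis by simp
  qed
  define r' where "r' = min (r / 2) \<tau>"
  have r': "0 < r'" "r' \<le> r / 2" "r' \<le> \<tau>" using n \<tau> by (auto simp: r'_def)
  have rD: "x \<in> ?D" if "x \<in> tdom r' r'" for x by (rule tdom_mono[OF r'(2,3) that])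
  have N\<Psi>: "near_id \<Psi> C r'"
    unfolding near_id_def using n(1) r'(1) \<Psi>s rD hmap_subset[OF \<Psi>(1), of "tdom r' r'"] by blast
  obtain s where s: "0 < s" "s \<le> r" "s \<le> r'" "\<And>x. x \<in> tdom s s \<Longrightarrow> \<Phi> x \<in> tdom r' r'"
    using near_id_shrink[OF N r'(1)] by blast
  have sr: "x \<in> ?D" if "x \<in> tdom s s" for x by (rule rD[OF tdom_mono[OF s(3,3) that]])
  show thesis
    by (rule that[OF N\<Psi> s(1)]) (use inv1 inv2 sr rD s(4) in blast)+
qed

section \<open>Pullback of germs along near-identity maps\<close>

definition pull :: "('n::finite phase \<Rightarrow> 'n phase) \<Rightarrow> 'n germ \<Rightarrow> 'n germ" where
  "pull \<Phi> G = abs_germ (\<lambda>x. rep_germ G (\<Phi> x))"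

lemma germ_eq_pull:
  assumes N: "near_id \<Phi> C r" and fg: "germ_eq f g"
  shows "germ_eq (\<lambda>x. f (\<Phi> x)) (\<lambda>x. g (\<Phi> x))"
proof -
  obtain s where s: "0 < s" "holo_on f (tdom s s)" "holo_on g (tdom s s)" "\<forall>x\<in>tdom s s. f x = g x"
    using fg unfolding germ_eq_def toric_nhd_eq_tdom by blast
  obtain s' where s': "0 < s'" "s' \<le> r" "s' \<le> s" "\<And>x. x \<in> tdom s' s' \<Longrightarrow> \<Phi> x \<in> tdom s s"
    using near_id_shrink[OF N s(1)] by blast
  have h: "hmap \<Phi> (tdom s' s')" by (rule hmap_subset[OF near_idD(3)[OF N]]) (use tdom_mono[OF s'(2,2)] in blast)
  show ?thesis
    unfolding germ_eq_def toric_nhd_eq_tdom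
    using s'(1) holo_on_compose[OF s(2) h s'(4)] holo_on_compose[OF s(3) h s'(4)] s(4) s'(4) by blast
qed

lemma pull_abs:
  assumes N: "near_id \<Phi> C r" and f: "germ_eq f f"
  shows "pull \<Phi> (abs_germ f) = abs_germ (\<lambda>x. f (\<Phi> x))"
proof -
  have "germ_eq (rep_germ (abs_germ f)) f" by (rule rep_abs_rsp_left[OF Quotient3_germ, OF f])
  from germ_eq_pull[OF N this] show ?thesis
    unfolding pull_def by (rule Quotient3_rel_abs[OF Quotient3_germ])
qed

text \<open>Agreement on a neighbourhood makes \<open>g\<close> holomorphic there as well, so only
  \<open>f\<close> has to be known to represent a germ.\<close>

lemma abs_germ_eqI:
  assumes "germ_eq f f" "0 < s" "\<And>x. x \<in> tdom s s \<Longrightarrow> f x = g x"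
  shows "abs_germ f = abs_germ g"
proof (rule Quotient3_rel_abs[OF Quotient3_germ])
  obtain s' where s': "0 < s'" "holo_on f (tdom s' s')"
    using assms(1) unfolding germ_eq_def toric_nhd_eq_tdom by blast
  let ?S = "tdom (min s s') (min s s') :: 'a phase set"
  have S: "x \<in> tdom s s" "x \<in> tdom s' s'" if "x \<in> ?S" for x
    by (rule tdom_mono[OF _ _ that]; simp)+
  have f: "holo_on f ?S" by (rule holo_on_subset[OF s'(2)]) (use S in blast)
  have e: "f x = g x" if "x \<in> ?S" for x by (rule assms(3)[OF S(1)[OF that]])
  show "germ_eq f g"
    unfolding germ_eq_def toric_nhd_eq_tdom
    using holo_on_cong[OF open_tdom e f] f e s'(1) assms(2) by (intro exI[of _ "min s s'"]) auto
qed

lemma germ_eq_tdom: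
  assumes "germ_eq f f"
  obtains s where "0 < s" "s < 1" "holo_on f (tdom s s)"
proof -
  obtain s where s: "0 < s" "holo_on f (tdom s s)"
    using assms unfolding germ_eq_def toric_nhd_eq_tdom by blast
  show thesis
  proof (rule that[of "min s (1 / 2)"])
    show "holo_on f (tdom (min s (1 / 2)) (min s (1 / 2)))"
      by (rule holo_on_subset[OF s(2)]) (use tdom_mono[of "min s (1 / 2)" s "min s (1 / 2)" s] in auto)
  qed (use s in auto)
qed

lemma germ_eqI: "holo_on f (tdom s s) \<Longrightarrow> 0 < s \<Longrightarrow> germ_eq f f"
  unfolding germ_eq_def toric_nhd_eq_tdom by blast

lemma bracket_abs:
  assumes "germ_eq f f" "germ_eq g g"
  shows "bracket (abs_germ f) (abs_germ g) = abs_germ (pb f g)"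
proof -
  have "(\<lambda>x. \<Sum>i\<in>UNIV. (case x of (q, p, t) \<Rightarrow> q $ i) * (dp i f x * dq i g x - dq i f x * dp i g x)) = pb f g"
    by (rule ext) (auto simp: pb_def case_prod_beta' algebra_simps intro!: sum.cong)
  then show ?thesis by (simp only: bracket.abs_eq[OF assms])
qed

lemma germ_eq_pb:
  assumes "germ_eq f f" "germ_eq g g"
  shows "germ_eq (pb f g) (pb f g)"
proof -
  obtain s where s: "0 < s" "holo_on f (tdom s s)" using germ_eq_tdom[OF assms(1)] by blast
  obtain s' where s': "0 < s'" "holo_on g (tdom s' s')" using germ_eq_tdom[OF assms(2)] by blast
  let ?S = "tdom (min s s') (min s s') :: 'a phase set"
  have "?S \<subseteq> tdom s s" "?S \<subseteq> tdom s' s'" using tdom_mono[of "min s s'"] by (meson min.cobounded1 min.cobounded2 subsetI)+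
  then have h: "holo_on f ?S" "holo_on g ?S" using holo_on_subset s(2) s'(2) by blast+
  have "holo_on (pb f g) ?S"
    unfolding pb_def by (intro holo_on_sum holo_on_diff holo_on_mult[OF holo_on_dp holo_on_Dq] holo_on_mult[OF holo_on_Dq holo_on_dp] h open_tdom)
  then show ?thesis by (rule germ_eqI) (use s s' in simp)
qed

text \<open>Compatibility with the ring operations and the bracket is checked on representatives
  over a common neighbourhood. Functions of \<open>t\<close> are fixed because the map fixes
  \<open>t\<close>, and bijectivity comes from the pullback along the inverse map.\<close>

lemma pull_poisson_automorphism:
  fixes \<Phi> :: "'n::finite phase \<Rightarrow> 'n phase"
  assumes N: "near_id \<Phi> C r" and s: "0 < s" "symp \<Phi> (tdom s s)"
  shows "poisson_automorphism (pull \<Phi>)"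
proof -
  note pa = pull_abs[OF N] and ge = germ_eq_pull[OF N]
  have add: "pull \<Phi> (F + G) = pull \<Phi> F + pull \<Phi> G" and mult: "pull \<Phi> (F * G) = pull \<Phi> F * pull \<Phi> G"
    and br: "pull \<Phi> (bracket F G) = bracket (pull \<Phi> F) (pull \<Phi> G)" for F G
  proof -
    obtain f where f: "germ_eq f f" "F = abs_germ f" by (rule germ_cases)
    obtain g where g: "germ_eq g g" "G = abs_germ g" by (rule germ_cases)
    note fg = f(1) g(1) ge[OF f(1)] ge[OF g(1)]
    show "pull \<Phi> (F + G) = pull \<Phi> F + pull \<Phi> G" "pull \<Phi> (F * G) = pull \<Phi> F * pull \<Phi> G"
      by (simp_all add: f(2) g(2) plus_germ.abs_eq times_germ.abs_eq pa germ_eq_closed fg)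
    obtain u where u: "0 < u" "holo_on f (tdom u u)" using germ_eq_tdom[OF f(1)] by blast
    obtain v where v: "0 < v" "holo_on g (tdom v v)" using germ_eq_tdom[OF g(1)] by blast
    have m: "0 < min u v" using u(1) v(1) by simp
    obtain w where w: "0 < w" "w \<le> r" "w \<le> min u v" "\<And>x. x \<in> tdom w w \<Longrightarrow> \<Phi> x \<in> tdom (min u v) (min u v)"
      using near_id_shrink[OF N m] by blast
    let ?T = "tdom (min u v) (min u v) :: 'n phase set"
    have sub: "?T \<subseteq> tdom u u" "?T \<subseteq> tdom v v" using tdom_mono[of "min u v"] by (meson min.cobounded1 min.cobounded2 subsetI)+
    let ?k = "min s w"
    have kw: "x \<in> tdom w w" and ks: "x \<in> tdom s s" if "x \<in> tdom ?k ?k" for x :: "'n phase"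
      by (rule tdom_mono[OF _ _ that]; simp)+
    have sy: "symp \<Phi> (tdom ?k ?k)" by (rule symp_subset[OF s(2)]) (rule subsetI, rule ks)
    have eq: "pb (\<lambda>x. f (\<Phi> x)) (\<lambda>x. g (\<Phi> x)) x = pb f g (\<Phi> x)" if x: "x \<in> tdom ?k ?k" for x
      by (rule symp_pb[OF sy open_tdom _ holo_on_subset[OF u(2) sub(1)] holo_on_subset[OF v(2) sub(2)] x])
        (use w(4) kw in blast)
    have "bracket (pull \<Phi> F) (pull \<Phi> G) = abs_germ (pb (\<lambda>x. f (\<Phi> x)) (\<lambda>x. g (\<Phi> x)))"
      by (simp only: f(2) g(2) pa fg bracket_abs)
    also have "\<dots> = abs_germ (\<lambda>x. pb f g (\<Phi> x))"
      by (rule abs_germ_eqI[where s = ?k, OF germ_eq_pb[OF fg(3,4)] _ eq]) (use s w in auto)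
    also have "\<dots> = pull \<Phi> (bracket F G)"
      by (simp only: f(2) g(2) bracket_abs fg pa germ_eq_pb)
    finally show "pull \<Phi> (bracket F G) = bracket (pull \<Phi> F) (pull \<Phi> G)" by simp
  qed
  have Ct: "pull \<Phi> (c * F) = c * pull \<Phi> F" if "c \<in> Ct" for c F :: "'n germ"
  proof -
    obtain k where k: "germ_eq (\<lambda>(q :: complex ^ 'n, p :: complex ^ 'n, t). k t) (\<lambda>(q, p, t). k t)" "c = abs_germ (\<lambda>(q, p, t). k t)"
      using \<open>c \<in> Ct\<close> unfolding Ct_def represents_def by blast
    have "abs_germ (\<lambda>x. (case \<Phi> x of (q, p, t) \<Rightarrow> k t)) = abs_germ (\<lambda>(q :: complex ^ 'n, p :: complex ^ 'n, t). k t)"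
      by (rule abs_germ_eqI[OF ge[OF k(1)] near_idD(2)[OF N]]) (simp add: case_prod_beta' near_idD(5)[OF N])
    moreover have "(\<lambda>x. (\<lambda>(q :: complex ^ 'n, p :: complex ^ 'n, t). k t) (\<Phi> x)) = (\<lambda>x. (case \<Phi> x of (q, p, t) \<Rightarrow> k t))" ..
    ultimately have "pull \<Phi> c = c" by (simp only: k(2) pa[OF k(1)])
    then show ?thesis by (simp add: mult)
  qed
  have one: "pull \<Phi> 1 = 1"
    unfolding one_germ_def by (rule pa) (rule germ_eq_closed)
  obtain \<Psi> r' s' where \<Psi>: "near_id \<Psi> C r'" "0 < s'" "\<And>x. x \<in> tdom s' s' \<Longrightarrow> \<Phi> (\<Psi> x) = x"
    "\<And>x. x \<in> tdom s' s' \<Longrightarrow> \<Psi> (\<Phi> x) = x" using near_id_inverse[OF N] by blast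
  have bij: "bij (pull \<Phi>)"
  proof (rule o_bij)
    show "pull \<Psi> \<circ> pull \<Phi> = id"
    proof
      fix F :: "'n germ"
      obtain f where f: "germ_eq f f" "F = abs_germ f" by (rule germ_cases)
      have "abs_germ (\<lambda>x. f (\<Phi> (\<Psi> x))) = abs_germ f"
        by (rule abs_germ_eqI[OF germ_eq_pull[OF \<Psi>(1) ge[OF f(1)]] \<Psi>(2)]) (simp add: \<Psi>(3))
      then show "(pull \<Psi> \<circ> pull \<Phi>) F = id F"
        by (simp add: f(2) pa[OF f(1)] pull_abs[OF \<Psi>(1) ge[OF f(1)]])
    qed
    show "pull \<Phi> \<circ> pull \<Psi> = id"
    proof
      fix F :: "'n germ"
      obtain f where f: "germ_eq f f" "F = abs_germ f" by (rule germ_cases)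
      note gp = germ_eq_pull[OF \<Psi>(1) f(1)]
      have "abs_germ (\<lambda>x. f (\<Psi> (\<Phi> x))) = abs_germ f"
        by (rule abs_germ_eqI[OF ge[OF gp] \<Psi>(2)]) (simp add: \<Psi>(4))
      then show "(pull \<Phi> \<circ> pull \<Psi>) F = id F"
        by (simp add: f(2) pa[OF gp] pull_abs[OF \<Psi>(1) f(1)])
    qed
  qed
  show ?thesis
    unfolding poisson_automorphism_def using bij one add mult Ct br by blast
qed

subsection \<open>Hadamard's lemma\<close>

text \<open>The fundamental theorem of calculus along the segments \<open>P \<theta> x\<close>, with
  endpoints depending on \<open>x\<close>. It serves both divisions below, by the \<open>p\<close>
  coordinates and by \<open>t\<close>.\<close>

lemma segment_integral:
  fixes f :: "'n::finite phase \<Rightarrow> complex" and P :: "real \<Rightarrow> 'n phase \<Rightarrow> 'n phase"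
  assumes f: "holo_on f S" and S: "open S"
    and P: "\<And>\<theta>. hmap (P \<theta>) S" "\<And>\<theta> x. \<theta> \<in> {0..1} \<Longrightarrow> x \<in> S \<Longrightarrow> P \<theta> x \<in> S"
    and line: "\<And>\<theta> x. P \<theta> x = b x + cscale (of_real \<theta>) (v x)"
    and cont: "continuous_on ({0..1} \<times> S) (\<lambda>(\<theta>, x). P \<theta> x)"
  shows "norm w \<le> 1 \<Longrightarrow> holo_on (\<lambda>x. integral {0..1} (\<lambda>\<theta>. fder f w (P \<theta> x))) S"
    and "norm w \<le> 1 \<Longrightarrow> x \<in> S \<Longrightarrow> (\<lambda>\<theta>. fder f w (P \<theta> x)) integrable_on {0..1}"
    and "x \<in> S \<Longrightarrow> ((\<lambda>\<theta>. fder f (v x) (P \<theta> x)) has_integral f (P 1 x) - f (P 0 x)) {0..1}"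
proof -
  assume w: "norm w \<le> 1"
  have fw: "holo_on (fder f w) S" by (rule holo_on_fder[OF f S w])
  have c: "continuous_on ({0..1} \<times> S) (\<lambda>(\<theta>, x). fder f w (P \<theta> x))"
  proof -
    have "(\<lambda>x. P (fst x) (snd x)) ` ({0..1} \<times> S) \<subseteq> S" 
      by (rule image_subsetI, rule P(2)) (simp_all only: mem_Times_iff)
    from continuous_on_compose2[OF holo_on_imp_continuous_on[OF fw] cont[unfolded case_prod_beta'] this]
    show ?thesis unfolding case_prod_beta' .
  qed
  show "holo_on (\<lambda>x. integral {0..1} (\<lambda>\<theta>. fder f w (P \<theta> x))) S"
    by (rule holo_on_integral(1)[OF S holo_on_compose[OF fw P(1) P(2)] c])
  assume x: "x \<in> S"
  have "continuous_on {0..1} (\<lambda>\<theta>. (\<lambda>(\<theta>, x). fder f w (P \<theta> x)) (\<theta>, x))"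
    by (rule continuous_on_compose2[OF c]) (use x in \<open>auto intro!: continuous_intros\<close>)
  then show "(\<lambda>\<theta>. fder f w (P \<theta> x)) integrable_on {0..1}" by (simp add: integrable_continuous_real)
next
  assume x: "x \<in> S"
  show "((\<lambda>\<theta>. fder f (v x) (P \<theta> x)) has_integral f (P 1 x) - f (P 0 x)) {0..1}"
  proof (rule fundamental_theorem_of_calculus)
    fix \<theta> :: real assume \<theta>: "\<theta> \<in> {0..1}"
    have "((\<lambda>z. f (b x + cscale z (v x))) has_field_derivative fder f (v x) (P \<theta> x)) (at (of_real \<theta>))"
      unfolding line by (rule holo_on_line[OF f]) (use P(2)[OF \<theta> x] in \<open>simp add: line\<close>)
    then show "((\<lambda>\<theta>. f (P \<theta> x)) has_vector_derivative fder f (v x) (P \<theta> x)) (at \<theta> within {0..1})"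
      unfolding line by (rule has_vector_derivative_real_field)
  qed simp
qed

text \<open>The quotients are the averages of the partial derivatives over the segment from
  \<open>pz x\<close> to \<open>x\<close>. At \<open>p = 0\<close> they are the partial derivatives
  themselves, so the lemma can be applied again when those vanish; vanishing at \<open>t = 0\<close>
  is kept for the division by \<open>t\<close>.\<close>

lemma hadamard_p:
  fixes f :: "'n::finite phase \<Rightarrow> complex"
  assumes f: "holo_on f (tdom s \<tau>)" and s: "0 < s" and z: "\<forall>x\<in>tdom s \<tau>. f (pz x) = 0"
  shows "\<exists>g. (\<forall>i. holo_on (g i) (tdom s \<tau>)) \<and> (\<forall>x\<in>tdom s \<tau>. f x = (\<Sum>i\<in>UNIV. fst (snd x) $ i * g i x)) \<and>
    (\<forall>i x. g i (pz x) = dp i f (pz x)) \<and>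
    ((\<forall>x\<in>tdom s \<tau>. snd (snd x) = 0 \<longrightarrow> f x = 0) \<longrightarrow> (\<forall>i. \<forall>x\<in>tdom s \<tau>. snd (snd x) = 0 \<longrightarrow> g i x = 0))"
proof -
  let ?S = "tdom s \<tau> :: 'n phase set"
  define P :: "real \<Rightarrow> 'n phase \<Rightarrow> 'n phase" where "P \<theta> x = (fst x, \<chi> i. of_real \<theta> * fst (snd x) $ i, snd (snd x))" for \<theta> x
  define v :: "'n phase \<Rightarrow> 'n phase" where "v x = (0, fst (snd x), 0)" for x
  define g where "g i x = integral {0..1} (\<lambda>\<theta>. dp i f (P \<theta> x))" for i x
  have P1: "hmap (P \<theta>) ?S" for \<theta>
    unfolding hmap_def P_def by (auto intro!: holo_on_coords holo_on_mult holo_on_const)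
  have P2: "P \<theta> x \<in> ?S" if "\<theta> \<in> {0..1}" "x \<in> ?S" for \<theta> x
  proof -
    have "\<bar>\<theta>\<bar> * cmod (fst (snd x) $ i) \<le> 1 * cmod (fst (snd x) $ i)" for i
      using that(1) by (intro mult_right_mono) auto
    note le = this
    have "\<bar>\<theta>\<bar> * cmod (fst (snd x) $ i) < s" for i
    proof -
      have "cmod (fst (snd x) $ i) < s" using that(2) by (simp add: tdom_def)
      then show ?thesis using le[of i] by linarith
    qed
    then show ?thesis using that(2) by (simp add: tdom_def P_def norm_mult)
  qed
  have line: "P \<theta> x = pz x + cscale (of_real \<theta>) (v x)" for \<theta> x
    by (simp add: P_def pz_def v_def cscale_def vec_eq_iff)
  have cont: "continuous_on ({0..1} \<times> ?S) (\<lambda>(\<theta>, x). P \<theta> x)"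
    unfolding P_def case_prod_beta' by (intro continuous_intros)
  note SI = segment_integral[OF f open_tdom P1 P2 line cont]
  show ?thesis
  proof (intro exI[of _ g] conjI allI ballI impI)
    show "holo_on (g i) ?S" for i
      unfolding g_def[abs_def] by (rule SI(1); (assumption | rule axis_norm_le(2)))
    show "f x = (\<Sum>i\<in>UNIV. fst (snd x) $ i * g i x)" if x: "x \<in> ?S" for x
    proof -
      have d: "fder f (v x) (P \<theta> x) = (\<Sum>i\<in>UNIV. fst (snd x) $ i * dp i f (P \<theta> x))" if "\<theta> \<in> {0..1}" for \<theta>
        unfolding v_def by (subst fder_decomp[OF f P2[OF that x]]) simp
      have I2: "(\<lambda>\<theta>. dp i f (P \<theta> x)) integrable_on {0..1}" for i
        by (rule SI(2); (assumption | rule axis_norm_le(2) x))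
      have I3: "((\<lambda>\<theta>. fder f (v x) (P \<theta> x)) has_integral f (P 1 x) - f (P 0 x)) {0..1}"
        by (rule SI(3); (assumption | rule x))
      have "((\<lambda>\<theta>. \<Sum>i\<in>UNIV. fst (snd x) $ i * dp i f (P \<theta> x)) has_integral (\<Sum>i\<in>UNIV. fst (snd x) $ i * g i x)) {0..1}"
        unfolding g_def by (intro has_integral_sum has_integral_mult_right integrable_integral I2) simp
      then have "((\<lambda>\<theta>. fder f (v x) (P \<theta> x)) has_integral (\<Sum>i\<in>UNIV. fst (snd x) $ i * g i x)) {0..1}"
        by (rule has_integral_eq[rotated]) (simp add: d)
      from has_integral_unique[OF I3 this]
      have "f (P 1 x) - f (P 0 x) = (\<Sum>i\<in>UNIV. fst (snd x) $ i * g i x)" .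
      moreover have "P 1 x = x" "P 0 x = pz x" by (simp_all add: P_def pz_def vec_eq_iff prod_eq_iff)
      ultimately show ?thesis using bspec[OF z x] by simp
    qed
    \<comment> \<open>Over \<open>p = 0\<close> the segment is constant, so averaging does
      nothing.\<close>
    have "P \<theta> (pz x) = pz x" for \<theta> x by (simp add: P_def pz_def vec_eq_iff)
    then show "g i (pz x) = dp i f (pz x)" for i x by (simp add: g_def)
    show "g i x = 0" if z0: "\<forall>x\<in>?S. snd (snd x) = 0 \<longrightarrow> f x = 0" and x: "x \<in> ?S" "snd (snd x) = 0" for i x
    proof -
      have "integral {0..1} (\<lambda>\<theta>. dp i f (P \<theta> x)) = integral {0..1} (\<lambda>_::real. 0)"
      proof (rule integral_cong)
        fix \<theta> :: real assume "\<theta> \<in> {0..1}"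
        then show "dp i f (P \<theta> x) = 0"
          by (intro fder_zero_slice[OF f open_tdom z0[rule_format] P2[OF _ x(1)]]) (use x in \<open>simp_all add: P_def\<close>)
      qed
      then show ?thesis by (simp add: g_def)
    qed
  qed
qed

lemma hadamard_t:
  fixes f :: "'n::finite phase \<Rightarrow> complex"
  assumes f: "holo_on f (tdom s \<tau>)" and z: "\<forall>x\<in>tdom s \<tau>. snd (snd x) = 0 \<longrightarrow> f x = 0"
  shows "\<exists>g. holo_on g (tdom s \<tau>) \<and> (\<forall>x\<in>tdom s \<tau>. f x = snd (snd x) * g x)"
proof -
  let ?S = "tdom s \<tau> :: 'n phase set"
  define P :: "real \<Rightarrow> 'n phase \<Rightarrow> 'n phase" where "P \<theta> x = (fst x, fst (snd x), of_real \<theta> * snd (snd x))" for \<theta> x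
  define v :: "'n phase \<Rightarrow> 'n phase" where "v x = (0, 0, snd (snd x))" for x
  define g where "g x = integral {0..1} (\<lambda>\<theta>. fder f (0, 0, 1) (P \<theta> x))" for x
  have P1: "hmap (P \<theta>) ?S" for \<theta>
    unfolding hmap_def P_def by (auto intro!: holo_on_coords holo_on_mult holo_on_const)
  have P2: "P \<theta> x \<in> ?S" if "\<theta> \<in> {0..1}" "x \<in> ?S" for \<theta> x
  proof -
    have "\<bar>\<theta>\<bar> * cmod (snd (snd x)) \<le> 1 * cmod (snd (snd x))"
      using that(1) by (intro mult_right_mono) auto
    then have "\<bar>\<theta>\<bar> * cmod (snd (snd x)) < \<tau>"
      using that(2) by (simp add: tdom_def)
    then show ?thesis using that(2) by (simp add: tdom_def P_def norm_mult)
  qed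
  have line: "P \<theta> x = (fst x, fst (snd x), 0) + cscale (of_real \<theta>) (v x)" for \<theta> x
    by (simp add: P_def v_def cscale_def)
  have cont: "continuous_on ({0..1} \<times> ?S) (\<lambda>(\<theta>, x). P \<theta> x)"
    unfolding P_def case_prod_beta' by (intro continuous_intros)
  have n: "norm ((0, 0, 1) :: 'n phase) \<le> 1" by (simp add: norm_Pair)
  note SI = segment_integral[OF f open_tdom P1 P2 line cont]
  show ?thesis
  proof (intro exI[of _ g] conjI ballI)
    show "holo_on g ?S" unfolding g_def[abs_def] by (rule SI(1); (assumption | rule n))
    show "f x = snd (snd x) * g x" if x: "x \<in> ?S" for x
    proof -
      have d: "fder f (v x) (P \<theta> x) = snd (snd x) * fder f (0, 0, 1) (P \<theta> x)" if "\<theta> \<in> {0..1}" for \<theta>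
        unfolding v_def by (subst fder_decomp[OF f P2[OF that x]]) simp
      have I2: "(\<lambda>\<theta>. fder f (0, 0, 1) (P \<theta> x)) integrable_on {0..1}"
        by (rule SI(2); (assumption | rule n x))
      have I3: "((\<lambda>\<theta>. fder f (v x) (P \<theta> x)) has_integral f (P 1 x) - f (P 0 x)) {0..1}"
        by (rule SI(3); (assumption | rule x))
      have "((\<lambda>\<theta>. snd (snd x) * fder f (0, 0, 1) (P \<theta> x)) has_integral (snd (snd x) * g x)) {0..1}"
        unfolding g_def by (intro has_integral_mult_right integrable_integral I2)
      then have "((\<lambda>\<theta>. fder f (v x) (P \<theta> x)) has_integral (snd (snd x) * g x)) {0..1}"
        by (rule has_integral_eq[rotated]) (simp add: d)
      from has_integral_unique[OF I3 this]
      have "f (P 1 x) - f (P 0 x) = snd (snd x) * g x" .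
      moreover have "P 1 x = x" by (simp add: P_def prod_eq_iff)
      moreover have "f (P 0 x) = 0" by (rule z[rule_format, OF P2[OF _ x]]) (simp_all add: P_def)
      ultimately show ?thesis by simp
    qed
  qed
qed

subsection \<open>The Hamiltonian\<close>

text \<open>The closed version of the smaller domain is compact and lies in the larger one.\<close>

lemma holo_on_tdom_bounded:
  fixes f :: "'n::finite phase \<Rightarrow> complex"
  assumes f: "holo_on f (tdom s s)" and s: "s' < s"
  obtains B where "\<And>x. x \<in> tdom s' s' \<Longrightarrow> cmod (f x) \<le> B"
proof -
  define K :: "'n phase set" where "K = {x. (\<forall>i. 1 - s' \<le> cmod (fst x $ i) \<and> cmod (fst x $ i) \<le> 1 + s') \<and>
     (\<forall>i. cmod (fst (snd x) $ i) \<le> s') \<and> cmod (snd (snd x)) \<le> s'}"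
  have "closed K"
    unfolding K_def Collect_conj_eq Collect_all_eq
    by (intro closed_Int closed_INT ballI closed_Collect_le continuous_intros)
  moreover have "bounded K"
    unfolding bounded_iff
  proof (intro exI ballI)
    fix x assume x: "x \<in> K"
    have v: "norm u \<le> real CARD('n) * c" if "\<And>i. cmod (u $ i) \<le> c" for u :: "complex ^ 'n" and c
      unfolding norm_vec_def using L2_set_le_sum[of UNIV "\<lambda>i. norm (u $ i)"] sum_bounded_above[of UNIV "\<lambda>i. norm (u $ i)" c] that by force
    have "norm x \<le> norm (fst x) + norm (snd x)" by (metis norm_Pair_le prod.collapse)
    also have "norm (snd x) \<le> norm (fst (snd x)) + norm (snd (snd x))" by (metis norm_Pair_le prod.collapse)
    also have "norm (fst x) \<le> real CARD('n) * (1 + s')" by (rule v) (use x in \<open>auto simp: K_def\<close>)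
    also have "norm (fst (snd x)) \<le> real CARD('n) * s'" by (rule v) (use x in \<open>auto simp: K_def\<close>)
    also have "norm (snd (snd x)) \<le> s'" using x by (auto simp: K_def)
    finally show "norm x \<le> real CARD('n) * (1 + s') + (real CARD('n) * s' + s')" by simp
  qed
  ultimately have "compact K" by (simp add: compact_eq_bounded_closed)
  moreover have "K \<subseteq> tdom s s"
  proof
    fix x assume "x \<in> K"
    then have k: "1 - s' \<le> cmod (fst x $ i)" "cmod (fst x $ i) \<le> 1 + s'" "cmod (fst (snd x) $ i) \<le> s'"
      "cmod (snd (snd x)) \<le> s'" for i by (simp_all add: K_def)
    show "x \<in> tdom s s"
      unfolding tdom_def
      by (intro CollectI conjI allI order.strict_trans2[OF _ k(1)] order.strict_trans1[OF k(2)]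
          order.strict_trans1[OF k(3)] order.strict_trans1[OF k(4)]) (use s in auto)
  qed
  ultimately have "bounded (f ` K)"
    by (intro compact_imp_bounded compact_continuous_image continuous_on_subset[OF holo_on_imp_continuous_on[OF f]])
  then obtain B where "\<And>x. x \<in> K \<Longrightarrow> cmod (f x) \<le> B" unfolding bounded_iff by blast
  moreover have "x \<in> K" if "x \<in> tdom s' s'" for x using that by (auto simp: K_def tdom_def less_imp_le)
  ultimately show thesis using that by blast
qed

lemma zero_if_le_linear:
  fixes z :: complex
  assumes "0 < r" "\<And>s. 0 < s \<Longrightarrow> s < r \<Longrightarrow> cmod z \<le> K * s"
  shows "z = 0"
proof (rule ccontr)
  assume "z \<noteq> 0"
  define s where "s = min (r / 2) (cmod z / (2 * (\<bar>K\<bar> + 1)))"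
  have s: "0 < s" "s < r" "s \<le> cmod z / (2 * (\<bar>K\<bar> + 1))" using assms(1) \<open>z \<noteq> 0\<close> by (auto simp: s_def)
  have "K * s \<le> (\<bar>K\<bar> + 1) * s" using s(1) by (intro mult_right_mono) auto
  also have "\<dots> \<le> cmod z / 2" using s(3) by (simp add: field_simps)
  finally show False using assms(2)[OF s(1,2)] \<open>z \<noteq> 0\<close> zero_less_norm_iff[of z] by linarith
qed

lemma complex_abs_summable:
  fixes f :: "'a \<Rightarrow> complex"
  assumes "f summable_on A"
  shows "(\<lambda>x. cmod (f x)) summable_on A"
proof -
  have "(\<lambda>x. norm (Re (f x))) summable_on A"
    by (rule iffD1[OF summable_on_iff_abs_summable_on_real summable_on_Re[OF assms]])
  moreover have "(\<lambda>x. norm (Im (f x))) summable_on A"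
    by (rule iffD1[OF summable_on_iff_abs_summable_on_real summable_on_Im[OF assms]])
  ultimately have "(\<lambda>x. \<bar>Re (f x)\<bar> + \<bar>Im (f x)\<bar>) summable_on A" unfolding real_norm_def by (rule summable_on_add)
  then show ?thesis by (rule Infinite_Sum.abs_summable_on_comparison_test') (rule cmod_le)
qed

text \<open>Absolute convergence at the point with all coordinates s/2 gives one constant; scaling
  by \<theta> \<le> 1 multiplies each monomial of degree at least 3 by at most \<theta>^3.\<close>

lemma series_cubic_bound:
  fixes h :: "complex ^ 'n::finite \<Rightarrow> complex"
  assumes s: "0 < s" and h: "\<forall>p. (\<forall>i. cmod (p $ i) < s) \<longrightarrow>
       ((\<lambda>J :: 'n \<Rightarrow> nat. c J * (\<Prod>i\<in>UNIV. (p $ i) ^ J i)) has_sum h p) {J. 3 \<le> (\<Sum>i\<in>UNIV. J i)}"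
  shows "\<exists>M\<ge>0. \<forall>p \<theta>. 0 \<le> \<theta> \<longrightarrow> \<theta> \<le> 1 \<longrightarrow> (\<forall>i. cmod (p $ i) \<le> \<theta> * (s / 2)) \<longrightarrow> cmod (h p) \<le> \<theta> ^ 3 * M"
proof -
  let ?A = "{J :: 'n \<Rightarrow> nat. 3 \<le> (\<Sum>i\<in>UNIV. J i)}"
  define f where "f J = c J * (\<Prod>i\<in>UNIV. (of_real (s / 2)) ^ J i)" for J :: "'n \<Rightarrow> nat"
  have "f summable_on ?A"
    using h[THEN spec, of "\<chi> i. of_real (s / 2)"] s unfolding f_def[abs_def] summable_on_def by auto
  then have sm: "(\<lambda>J. cmod (f J)) summable_on ?A" by (rule complex_abs_summable)
  define M where "M = infsum (\<lambda>J. cmod (f J)) ?A"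
  have M: "((\<lambda>J. cmod (f J)) has_sum M) ?A" unfolding M_def by (rule has_sum_infsum[OF sm])
  show ?thesis
  proof (intro exI[of _ M] conjI allI impI)
    show "0 \<le> M" unfolding M_def by (rule infsum_nonneg) simp
    fix p :: "complex ^ 'n" and \<theta> :: real
    assume \<theta>: "0 \<le> \<theta>" "\<theta> \<le> 1" and p: "\<forall>i. cmod (p $ i) \<le> \<theta> * (s / 2)"
    let ?g = "\<lambda>J :: 'n \<Rightarrow> nat. c J * (\<Prod>i\<in>UNIV. (p $ i) ^ J i)"
    have b: "cmod (?g J) \<le> \<theta> ^ 3 * cmod (f J)" if J: "J \<in> ?A" for J
    proof -
      have "cmod (\<Prod>i\<in>UNIV. (p $ i) ^ J i) \<le> (\<Prod>i\<in>UNIV. (\<theta> * (s / 2)) ^ J i)"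
        unfolding prod_norm[symmetric] by (rule prod_mono) (use p in \<open>simp add: norm_power power_mono\<close>)
      also have "\<dots> = \<theta> ^ (\<Sum>i\<in>UNIV. J i) * (\<Prod>i\<in>UNIV. (s / 2) ^ J i)"
        by (simp only: power_mult_distrib prod.distrib power_sum)
      also have "\<dots> \<le> \<theta> ^ 3 * (\<Prod>i\<in>UNIV. (s / 2) ^ J i)"
        using J \<theta> s by (intro mult_right_mono power_decreasing prod_nonneg) auto
      finally have "cmod (c J) * cmod (\<Prod>i\<in>UNIV. (p $ i) ^ J i) \<le> cmod (c J) * (\<theta> ^ 3 * (\<Prod>i\<in>UNIV. (s / 2) ^ J i))"
        by (rule mult_left_mono) simp
      moreover have "cmod (\<Prod>i\<in>UNIV. (of_real (s / 2)) ^ J i) = (\<Prod>i\<in>UNIV. (s / 2) ^ J i)"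
        unfolding prod_norm[symmetric] norm_power norm_of_real using s by simp
      ultimately show ?thesis by (simp only: f_def norm_mult mult_ac)
    qed
    have t: "\<theta> * (s / 2) < s"
      using mult_right_mono[OF \<theta>(2), of "s / 2"] s by simp
    have lt: "\<forall>i. cmod (p $ i) < s" using p t order.strict_trans1 by blast
    have bM: "((\<lambda>J. \<theta> ^ 3 * cmod (f J)) has_sum \<theta> ^ 3 * M) ?A" by (rule has_sum_cmult_right[OF M])
    have "(\<lambda>J. cmod (?g J)) summable_on ?A"
      by (rule Infinite_Sum.abs_summable_on_comparison_test'[OF has_sum_imp_summable[OF bM] b])
    then have g: "((\<lambda>J. cmod (?g J)) has_sum infsum (\<lambda>J. cmod (?g J)) ?A) ?A" by (rule has_sum_infsum)
    have "cmod (h p) \<le> infsum (\<lambda>J. cmod (?g J)) ?A" by (rule norm_has_sum_bound[OF g h[THEN spec, THEN mp, OF lt]])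
    also have "\<dots> \<le> \<theta> ^ 3 * M" by (rule has_sum_mono[OF g bM b])
    finally show "cmod (h p) \<le> \<theta> ^ 3 * M" .
  qed
qed

text \<open>On the polydomain of radius \<open>u\<close> the function is of size u^3, so the Cauchy
  estimates for first and second derivatives are of order u^2 and u, for every small
  \<open>u\<close>. This avoids differentiating the series. As the function depends on
  \<open>p\<close> alone, it suffices to look at the point with all angles 1 and
  \<open>t = 0\<close>.\<close>

lemma cubic_derivatives_vanish:
  fixes h :: "complex ^ 'n::finite \<Rightarrow> complex"
  defines "f \<equiv> \<lambda>x :: 'n phase. h (fst (snd x))"
  assumes f: "holo_on f (tdom s s)" and r: "0 < r" "r \<le> s" and M: "0 \<le> M"
    and b: "\<And>p \<theta>. 0 \<le> \<theta> \<Longrightarrow> \<theta> \<le> 1 \<Longrightarrow> (\<And>i. cmod (p $ i) \<le> \<theta> * r) \<Longrightarrow> cmod (h p) \<le> \<theta> ^ 3 * M"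
  shows "dp i f (pz x) = 0" "dp i (dp j f) (pz x) = 0"
proof -
  let ?e = "(\<chi> i. 1, 0, 0) :: 'n phase"
  have sh: "fder f v (y + (a, 0, c)) = fder f v y" for v y a c
    by (rule fder_shift_eq) (simp add: f_def)
  have sh2: "fder (fder f w) v (y + (a, 0, c)) = fder (fder f w) v y" for w v y a c
    by (rule fder_shift_eq) (rule sh)
  have e: "pz x = ?e + (fst x - (\<chi> i. 1), 0, snd (snd x))" by (simp add: pz_def)
  have fu: "holo_on f (tdom u u)" if "u < r" for u
    by (rule holo_on_subset[OF f]) (use tdom_mono[of u s u s] that r in auto)
  have fb: "cmod (f y) \<le> (u / r) ^ 3 * M" if "y \<in> tdom u u" "0 < u" "u < r" for y u
    unfolding f_def by (rule b) (use that in \<open>auto simp: tdom_def less_imp_le\<close>)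
  have eu: "?e \<in> tdom u u'" if "0 < u" "0 < u'" for u u' using that by (simp add: tdom_def)
  have "dp i f ?e = 0"
  proof (rule zero_if_le_linear[OF r(1)])
    fix u assume u: "0 < u" "u < r"
    have "cmod (dp i f ?e) \<le> 2 * ((u / r) ^ 3 * M) / (u / 2)"
      by (rule dp_bound[OF fu[OF u(2)] fb[OF _ u]]) (use u eu[of "u / 2" u] in simp_all)
    also have "\<dots> = (4 * M / r ^ 3 * u) * u" using u by (simp add: field_simps power3_eq_cube)
    \<comment> \<open>The bound is weakened from quadratic to linear in \<open>u\<close> to fit the
      criterion for vanishing.\<close>
    also have "\<dots> \<le> (4 * M / r ^ 3 * u) * r" using u M r by (intro mult_left_mono) auto
    finally show "cmod (dp i f ?e) \<le> (4 * M / r ^ 3 * r) * u" by (simp add: mult_ac)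
  qed
  then show "dp i f (pz x) = 0" unfolding e sh .
  have "dp i (dp j f) (pz ?e) = 0"
  proof (rule zero_if_le_linear[OF r(1)])
    fix u assume u: "0 < u" "u < r"
    have "cmod (dp i (dp j f) (pz ?e)) \<le> 16 * ((u / r) ^ 3 * M) / u\<^sup>2"
      by (rule dp_dp_bound_at_pz[OF fu[OF u(2)] fb[OF _ u] u(1) eu[OF u(1) u(1)]])
    also have "\<dots> = (16 * M / r ^ 3) * u" using u by (simp add: field_simps power3_eq_cube power2_eq_square)
    finally show "cmod (dp i (dp j f) (pz ?e)) \<le> (16 * M / r ^ 3) * u" .
  qed
  moreover have "pz ?e = ?e" by (simp add: pz_def)
  ultimately show "dp i (dp j f) (pz x) = 0" unfolding e sh2 by simp
qed

section \<open>The quadratic part of the Hamiltonian and its Hessian\<close>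

definition quad_ham :: "complex ^ 'n \<Rightarrow> complex ^ 'n ^ 'n \<Rightarrow> 'n::finite phase \<Rightarrow> complex" where
  "quad_ham \<omega> a x = (\<Sum>i\<in>UNIV. \<omega> $ i * fst (snd x) $ i) + (\<Sum>i\<in>UNIV. \<Sum>j\<in>UNIV. a $ i $ j * fst (snd x) $ i * fst (snd x) $ j)"

lemma symmetric_nth: "transpose a = a \<Longrightarrow> a $ i $ j = a $ j $ i"
proof -
  assume "transpose a = a"
  then have "a $ i $ j = transpose a $ i $ j" by simp
  then show ?thesis by (simp add: transpose_def)
qed

text \<open>Symmetry of \<open>a\<close> merges the two contributions of the product rule into the
  factor 2.\<close>

lemma quad_ham_derivatives:
  assumes sym: "transpose a = a"
  shows "holo_on (quad_ham \<omega> a) S" "dp j (quad_ham \<omega> a) x = \<omega> $ j + 2 * (\<Sum>k\<in>UNIV. a $ j $ k * fst (snd x) $ k)"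
    "dp i (dp j (quad_ham \<omega> a)) x = 2 * a $ j $ i"
proof -
  note h = holo_on_sum holo_on_mult holo_on_const holo_on_coords holo_on_add
  show "holo_on (quad_ham \<omega> a) S" unfolding quad_ham_def[abs_def] by (intro h)
  note sy = symmetric_nth[OF sym]
  have ax: "(\<Sum>k\<in>UNIV. f k * axis j 1 $ k) = f j" for f :: "'a \<Rightarrow> complex" and j
    by (simp add: axis_def if_distrib[of "\<lambda>z. _ * z"] cong: if_cong)
  have dq1: "dp j (quad_ham \<omega> a) x = \<omega> $ j + 2 * (\<Sum>k\<in>UNIV. a $ j $ k * fst (snd x) $ k)" for x j
  proof -
    have 1: "dp j (\<lambda>x. \<omega> $ i * fst (snd x) $ i) x = \<omega> $ i * axis j 1 $ i" for i
      by (subst fder_mult[where S = UNIV]) (simp_all add: h)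
    have 2: "dp j (\<lambda>x. a $ i $ k * fst (snd x) $ i * fst (snd x) $ k) x =
        (a $ i $ k * fst (snd x) $ i) * axis j 1 $ k + a $ i $ k * fst (snd x) $ k * axis j 1 $ i" for i k
    proof -
      have "dp j (\<lambda>x. a $ i $ k * fst (snd x) $ i) x = a $ i $ k * axis j 1 $ i"
        by (subst fder_mult[where S = UNIV]) (simp_all add: h)
      then show ?thesis by (subst fder_mult[where S = UNIV]) (simp_all add: h mult_ac)
    qed
    have "dp j (quad_ham \<omega> a) x = dp j (\<lambda>x. \<Sum>i\<in>UNIV. \<omega> $ i * fst (snd x) $ i) x +
        dp j (\<lambda>x. \<Sum>i\<in>UNIV. \<Sum>k\<in>UNIV. a $ i $ k * fst (snd x) $ i * fst (snd x) $ k) x"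
      unfolding quad_ham_def[abs_def] by (rule fder_add[where S = UNIV]) (intro h, intro h, simp)
    also have "dp j (\<lambda>x. \<Sum>i\<in>UNIV. \<omega> $ i * fst (snd x) $ i) x = (\<Sum>i\<in>UNIV. \<omega> $ i * axis j 1 $ i)"
      unfolding 1[symmetric] by (rule fder_sum[where S = UNIV]) (intro h, simp)
    also have "dp j (\<lambda>x. \<Sum>i\<in>UNIV. \<Sum>k\<in>UNIV. a $ i $ k * fst (snd x) $ i * fst (snd x) $ k) x =
        (\<Sum>i\<in>UNIV. dp j (\<lambda>x. \<Sum>k\<in>UNIV. a $ i $ k * fst (snd x) $ i * fst (snd x) $ k) x)"
      by (rule fder_sum[where S = UNIV]) (intro h, simp)
    also have "\<dots> = (\<Sum>i\<in>UNIV. \<Sum>k\<in>UNIV. dp j (\<lambda>x. a $ i $ k * fst (snd x) $ i * fst (snd x) $ k) x)"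
      by (intro sum.cong refl fder_sum[where S = UNIV]) (intro h, simp)
    also have "\<dots> = (\<Sum>i\<in>UNIV. a $ i $ j * fst (snd x) $ i) + (\<Sum>i\<in>UNIV. (\<Sum>k\<in>UNIV. a $ i $ k * fst (snd x) $ k) * axis j 1 $ i)"
      unfolding 2 sum.distrib ax sum_distrib_right[symmetric] ..
    also have "(\<Sum>i\<in>UNIV. a $ i $ j * fst (snd x) $ i) = (\<Sum>k\<in>UNIV. a $ j $ k * fst (snd x) $ k)"
      by (simp only: sy[of _ j])
    finally show ?thesis unfolding ax by simp
  qed
  then show "dp j (quad_ham \<omega> a) x = \<omega> $ j + 2 * (\<Sum>k\<in>UNIV. a $ j $ k * fst (snd x) $ k)" .
  have "dp i (dp j (quad_ham \<omega> a)) x = dp i (\<lambda>x. \<omega> $ j + 2 * (\<Sum>k\<in>UNIV. a $ j $ k * fst (snd x) $ k)) x"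
    by (simp only: dq1)
  also have "\<dots> = dp i (\<lambda>x. 2 * (\<Sum>k\<in>UNIV. a $ j $ k * fst (snd x) $ k)) x"
    by (subst fder_add[where S = UNIV]) (simp_all add: h)
  also have "\<dots> = 2 * dp i (\<lambda>x. \<Sum>k\<in>UNIV. a $ j $ k * fst (snd x) $ k) x"
    by (rule fder_cmult[where S = UNIV]) (intro h, simp)
  also have "dp i (\<lambda>x. \<Sum>k\<in>UNIV. a $ j $ k * fst (snd x) $ k) x = (\<Sum>k\<in>UNIV. dp i (\<lambda>x. a $ j $ k * fst (snd x) $ k) x)"
    by (rule fder_sum[where S = UNIV]) (intro h, simp)
  finally have e: "dp i (dp j (quad_ham \<omega> a)) x = 2 * (\<Sum>k\<in>UNIV. dp i (\<lambda>x. a $ j $ k * fst (snd x) $ k) x)" .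
  have "dp i (\<lambda>x. a $ j $ k * fst (snd x) $ k) x = a $ j $ k * axis i 1 $ k" for k
    by (subst fder_mult[where S = UNIV]) (simp_all add: h)
  then show "dp i (dp j (quad_ham \<omega> a)) x = 2 * a $ j $ i" unfolding e by (simp only: ax)
qed

text \<open>The Hessian is twice \<open>a\<close> because the quadratic part is written without the
  factor 1/2; the cubic remainder contributes nothing to derivatives of order at most 2 at
  \<open>p = 0\<close>.\<close>

lemma normal_ham_quad_plus_cubic:
  fixes h :: "complex ^ 'n::finite \<Rightarrow> complex" and a :: "complex ^ 'n ^ 'n"
  assumes sym: "transpose a = a" and f: "holo_on (\<lambda>x :: 'n phase. h (fst (snd x))) (tdom s s)" and r: "0 < r" "r \<le> s" and M: "0 \<le> M"
    and b: "\<And>p \<theta>. 0 \<le> \<theta> \<Longrightarrow> \<theta> \<le> 1 \<Longrightarrow> (\<And>i. cmod (p $ i) \<le> \<theta> * r) \<Longrightarrow> cmod (h p) \<le> \<theta> ^ 3 * M"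
  shows "normal_ham \<omega> (\<chi> i j. 2 * a $ i $ j) (\<lambda>x. quad_ham \<omega> a x + h (fst (snd x))) (tdom s s)"
  unfolding normal_ham_def
proof (intro conjI ballI allI)
  let ?S = "tdom s s :: 'n phase set" and ?f = "\<lambda>x :: 'n phase. h (fst (snd x))"
  note q = quad_ham_derivatives[OF sym, of \<omega>]
  have v: "dp i ?f (pz x) = 0" "dp i (dp j ?f) (pz x) = 0" for i j x
    by (rule cubic_derivatives_vanish[OF f r M b]; assumption)+
  have s: "0 < s" using r by simp
  show "holo_on (\<lambda>x. quad_ham \<omega> a x + ?f x) ?S" by (intro holo_on_add q(1) f)
  fix x :: "'n phase" assume x: "x \<in> ?S"
  have px: "pz x \<in> ?S" by (rule pz_tdom[OF x s])
  show "quad_ham \<omega> a (pz x) + ?f (pz x) = quad_ham \<omega> a (bp x) + ?f (bp x)" by (simp add: quad_ham_def)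
  have d: "dp j (\<lambda>x. quad_ham \<omega> a x + ?f x) y = dp j (quad_ham \<omega> a) y + dp j ?f y" if "y \<in> ?S" for j y
    by (rule fder_add[OF q(1) f that])
  show "dp i (\<lambda>x. quad_ham \<omega> a x + ?f x) (pz x) = \<omega> $ i" for i
    unfolding d[OF px] v(1) q(2) by simp
  show "dp i (dp j (\<lambda>x. quad_ham \<omega> a x + ?f x)) (pz x) = (\<chi> i j. 2 * a $ i $ j) $ i $ j" for i j
  proof -
    have "dp i (dp j (\<lambda>x. quad_ham \<omega> a x + ?f x)) (pz x) = dp i (\<lambda>y. dp j (quad_ham \<omega> a) y + dp j ?f y) (pz x)"
      by (rule fder_cong[OF open_tdom d px])
    also have "\<dots> = dp i (dp j (quad_ham \<omega> a)) (pz x) + dp i (dp j ?f) (pz x)"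
      by (rule fder_add[OF holo_on_dp[OF q(1) open_tdom] holo_on_dp[OF f open_tdom] px])
    also have "\<dots> = 2 * a $ j $ i" unfolding v(2) q(3) by simp
    also have "a $ j $ i = a $ i $ j" by (rule symmetric_nth[OF sym])
    finally show ?thesis by simp
  qed
qed

lemma invertible_double:
  fixes a :: "complex ^ 'n::finite ^ 'n"
  assumes "invertible a" shows "invertible (\<chi> i j. 2 * a $ i $ j)"
proof -
  obtain b where b: "a ** b = mat 1" "b ** a = mat 1" using assms unfolding invertible_def by blast
  have "(\<chi> i j. 2 * a $ i $ j) ** (\<chi> i j. b $ i $ j / 2) = a ** b" "(\<chi> i j. b $ i $ j / 2) ** (\<chi> i j. 2 * a $ i $ j) = b ** a"
    by (simp_all add: matrix_matrix_mult_def)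
  then show ?thesis unfolding invertible_def b by blast
qed

subsection \<open>Germ algebra\<close>

lemma germ_tdom2:
  fixes f g :: "'n::finite phase \<Rightarrow> complex"
  assumes "germ_eq f f" "germ_eq g g"
  obtains s where "0 < s" "s < 1" "holo_on f (tdom s s)" "holo_on g (tdom s s)"
proof -
  obtain s where s: "0 < s" "s < 1" "holo_on f (tdom s s)" using germ_eq_tdom[OF assms(1)] by blast
  obtain s' where s': "0 < s'" "holo_on g (tdom s' s')" using germ_eq_tdom[OF assms(2)] by blast
  let ?m = "min s s'"
  have sub: "tdom ?m ?m \<subseteq> (tdom s s :: 'n phase set)" "tdom ?m ?m \<subseteq> (tdom s' s' :: 'n phase set)"
    by (rule subsetI, rule tdom_mono[of ?m _ ?m]; simp)+
  show thesis
    by (rule that[of ?m, OF _ _ holo_on_subset[OF s(3) sub(1)] holo_on_subset[OF s'(2) sub(2)]]) (use s s' in auto)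
qed

lemma abs_germ_simps:
  "germ_eq f f \<Longrightarrow> germ_eq g g \<Longrightarrow> abs_germ (\<lambda>x. f x + g x) = abs_germ f + abs_germ g"
  "germ_eq f f \<Longrightarrow> germ_eq g g \<Longrightarrow> abs_germ (\<lambda>x. f x - g x) = abs_germ f - abs_germ g"
  "germ_eq f f \<Longrightarrow> germ_eq g g \<Longrightarrow> abs_germ (\<lambda>x. f x * g x) = abs_germ f * abs_germ g"
  "germ_eq f f \<Longrightarrow> abs_germ (\<lambda>x. - f x) = - abs_germ f"
  by (simp_all add: plus_germ.abs_eq minus_germ.abs_eq times_germ.abs_eq uminus_germ.abs_eq)

lemma germ_eq_sum: "(\<And>i. i \<in> I \<Longrightarrow> germ_eq (f i) (f i)) \<Longrightarrow> germ_eq (\<lambda>x. \<Sum>i\<in>I. f i x) (\<lambda>x. \<Sum>i\<in>I. f i x)"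
  by (induction I rule: infinite_finite_induct) (auto intro: germ_eq_closed)

lemma abs_germ_sum: "(\<And>i. i \<in> I \<Longrightarrow> germ_eq (f i) (f i)) \<Longrightarrow> abs_germ (\<lambda>x. \<Sum>i\<in>I. f i x) = (\<Sum>i\<in>I. abs_germ (f i))"
  by (induction I rule: infinite_finite_induct)
    (simp_all add: zero_germ_def[symmetric] abs_germ_simps germ_eq_sum)

lemma coord_germs:
  "const_germ c = abs_germ (\<lambda>_. c)" "pvar i = abs_germ (\<lambda>x. fst (snd x) $ i)" "tvar = abs_germ (\<lambda>x. snd (snd x))"
  by (simp_all add: const_germ_def pvar_def tvar_def case_prod_beta')

lemma germ_eq_coords:
  "germ_eq (\<lambda>_. c) (\<lambda>_. c)" "germ_eq (\<lambda>x. fst (snd x) $ i) (\<lambda>x. fst (snd x) $ i)"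
  "germ_eq (\<lambda>x. snd (snd x)) (\<lambda>x. snd (snd x))"
  by (rule germ_eq_refl holo_on_const holo_on_coords)+

lemma quad_ham_germ:
  "germ_eq (quad_ham \<omega> a) (quad_ham \<omega> a)"
  "abs_germ (quad_ham \<omega> a) = (\<Sum>i\<in>UNIV. const_germ (\<omega> $ i) * pvar i) +
      (\<Sum>i\<in>UNIV. \<Sum>j\<in>UNIV. const_germ (a $ i $ j) * pvar i * pvar j)"
  unfolding quad_ham_def[abs_def] coord_germs
  by (intro germ_eq_closed germ_eq_sum germ_eq_coords)
     (simp only: abs_germ_simps abs_germ_sum germ_eq_closed germ_eq_sum germ_eq_coords)

lemma bracket_antisym: "bracket G F = - bracket F G"
proof -
  obtain f where f: "germ_eq f f" "F = abs_germ f" by (rule germ_cases)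
  obtain g where g: "germ_eq g g" "G = abs_germ g" by (rule germ_cases)
  have "pb g f = (\<lambda>x. - pb f g x)" by (rule ext) (rule pb_antisym)
  then show ?thesis
    by (simp only: f(2) g(2) bracket_abs[OF g(1) f(1)] bracket_abs[OF f(1) g(1)] abs_germ_simps(4)[OF germ_eq_pb[OF f(1) g(1)], symmetric])
qed

lemma
  shows bracket_add_left: "bracket (F + G) K = bracket F K + bracket G K"
    and bracket_mult_left: "bracket (F * G) K = F * bracket G K + G * bracket F K"
proof -
  obtain f where f: "germ_eq f f" "F = abs_germ f" by (rule germ_cases)
  obtain g where g: "germ_eq g g" "G = abs_germ g" by (rule germ_cases)
  obtain k where k: "germ_eq k k" "K = abs_germ k" by (rule germ_cases)
  note c = f(1) g(1) k(1) germ_eq_closed(1)[OF f(1) g(1)] germ_eq_closed(3)[OF f(1) g(1)]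
  obtain s where s: "0 < s" "holo_on f (tdom s s)" "holo_on g (tdom s s)"
    using germ_tdom2[OF f(1) g(1)] by blast
  have "abs_germ (pb (\<lambda>x. f x + g x) k) = abs_germ (\<lambda>x. pb f k x + pb g k x)"
    by (rule abs_germ_eqI[OF germ_eq_pb[OF c(4,3)] s(1)]) (rule pb_add[OF s(2,3)])
  then show "bracket (F + G) K = bracket F K + bracket G K"
    by (simp only: f(2) g(2) k(2) abs_germ_simps[symmetric] bracket_abs germ_eq_pb c)
  have "abs_germ (pb (\<lambda>x. f x * g x) k) = abs_germ (\<lambda>x. f x * pb g k x + g x * pb f k x)"
    by (rule abs_germ_eqI[OF germ_eq_pb[OF c(5,3)] s(1)]) (rule pb_mult[OF s(2,3)])
  also have "\<dots> = abs_germ f * abs_germ (pb g k) + abs_germ g * abs_germ (pb f k)"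
    by (simp only: abs_germ_simps germ_eq_closed germ_eq_pb c)
  finally show "bracket (F * G) K = F * bracket G K + G * bracket F K"
    by (simp only: f(2) g(2) k(2) abs_germ_simps(3)[symmetric] bracket_abs germ_eq_pb c)
qed

lemma bracket_right:
  shows "bracket K (F + G) = bracket K F + bracket K G"
    and "bracket K (F * G) = F * bracket K G + G * bracket K F"
proof -
  have a: "bracket K X = - bracket X K" for X by (rule bracket_antisym)
  show "bracket K (F + G) = bracket K F + bracket K G"
    unfolding a[of "F + G"] a[of F] a[of G] bracket_add_left by simp
  show "bracket K (F * G) = F * bracket K G + G * bracket K F"
    unfolding a[of "F * G"] a[of F] a[of G] bracket_mult_left by simp
qed

lemma bracket_Ct:
  fixes G :: "'n::finite germ"
  assumes "c \<in> Ct" shows "bracket c G = 0"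
proof -
  obtain k where k: "represents (\<lambda>(q :: complex ^ 'n, p :: complex ^ 'n, t). k t) c"
    using assms unfolding Ct_def by blast
  define f where "f = (\<lambda>x :: 'n phase. k (snd (snd x)))"
  have f: "germ_eq f f" "c = abs_germ f" using k by (simp_all add: represents_def f_def case_prod_beta')
  obtain g where g: "germ_eq g g" "G = abs_germ g" by (rule germ_cases)
  obtain s where s: "0 < s" "holo_on f (tdom s s)" using germ_eq_tdom[OF f(1)] by blast
  have "abs_germ (pb f g) = abs_germ (\<lambda>_. 0)"
  proof (rule abs_germ_eqI[OF germ_eq_pb[OF f(1) g(1)] s(1)])
    fix x :: "'n phase" assume x: "x \<in> tdom s s"
    have t: "tonly f" by (simp add: tonly_def f_def)
    show "pb f g x = 0" unfolding pb_def by (simp add: tonly_fder[OF s(2) x t])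
  qed
  then show ?thesis by (simp only: f(2) g(2) bracket_abs[OF f(1) g(1)] zero_germ_def)
qed

lemma bracket_action_pvar:
  fixes h :: "complex ^ 'n::finite \<Rightarrow> complex"
  assumes f: "germ_eq (\<lambda>x :: 'n phase. h (fst (snd x))) (\<lambda>x. h (fst (snd x)))" 
  shows "bracket (abs_germ (\<lambda>x. h (fst (snd x)))) (pvar i) = 0"
proof -
  let ?f = "\<lambda>x :: 'n phase. h (fst (snd x))" and ?p = "\<lambda>x :: 'n phase. fst (snd x) $ i"
  obtain s where s: "0 < s" "holo_on ?f (tdom s s)" using germ_eq_tdom[OF f(1)] by blast
  have "abs_germ (pb ?p ?f) = abs_germ (\<lambda>_. 0)"
  proof (rule abs_germ_eqI[OF germ_eq_pb[OF germ_eq_coords(2) f] s(1)])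
    fix x :: "'n phase" assume x: "x \<in> tdom s s"
    have "dq i ?f x = 0" by (rule fder_zero_line[OF s(2) x]) (simp add: cscale_def)
    then show "pb ?p ?f x = 0" unfolding pb_p by simp
  qed
  then have "bracket (pvar i) (abs_germ ?f) = 0"
    by (simp only: coord_germs bracket_abs[OF germ_eq_coords(2) f] zero_germ_def)
  then show ?thesis by (subst bracket_antisym) simp
qed

subsection \<open>The invariant ideal\<close>

lemma is_ideal_ideal_p: "is_ideal (ideal_p :: 'n::finite germ set)"
proof -
  interpret module "(*) :: 'n germ \<Rightarrow> 'n germ \<Rightarrow> 'n germ" by (rule module_germ)
  show ?thesis unfolding ideal_p_def by (rule subspace_span)
qed

lemma ideal_pD:
  fixes F G c :: "'n::finite germ"
  shows "(0 :: 'n germ) \<in> ideal_p" "F \<in> ideal_p \<Longrightarrow> G \<in> ideal_p \<Longrightarrow> F + G \<in> ideal_p" "F \<in> ideal_p \<Longrightarrow> c * F \<in> ideal_p"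
    "F \<in> ideal_p \<Longrightarrow> F * c \<in> ideal_p" "(pvar i :: 'n germ) \<in> ideal_p"
proof -
  interpret module "(*) :: 'n germ \<Rightarrow> 'n germ \<Rightarrow> 'n germ" by (rule module_germ)
  show "(0 :: 'n germ) \<in> ideal_p" by (rule subspace_0[OF is_ideal_ideal_p])
  show "F + G \<in> ideal_p" if "F \<in> ideal_p" "G \<in> ideal_p" by (rule subspace_add[OF is_ideal_ideal_p that])
  show "c * F \<in> ideal_p" if "F \<in> ideal_p" by (rule subspace_scale[OF is_ideal_ideal_p that])
  then show "F * c \<in> ideal_p" if "F \<in> ideal_p" using that by (simp only: mult.commute[of F c])
  show "(pvar i :: 'n germ) \<in> ideal_p" unfolding ideal_p_def by (rule span_base) simp
qed

text \<open>By the Leibniz rule, the bracket of a product of two elements of the ideal keeps one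
  factor in the ideal in each term.\<close>

lemma ideal_square_bracket:
  fixes x :: "'n::finite germ"
  assumes "x \<in> ideal_square ideal_p"
  shows "x \<in> ideal_p \<and> bracket x K \<in> ideal_p"
proof -
  interpret module "(*) :: 'n germ \<Rightarrow> 'n germ \<Rightarrow> 'n germ" by (rule module_germ)
  let ?T = "{x :: 'n germ. x \<in> ideal_p \<and> bracket x K \<in> ideal_p}"
  have z: "bracket 0 K = 0" using bracket_add_left[of 0 0 K] by simp
  have "ideal_square ideal_p \<subseteq> ?T"
    unfolding ideal_square_def
  proof (rule span_minimal)
    show "{x * y |x y. x \<in> ideal_p \<and> y \<in> ideal_p} \<subseteq> ?T"
      by (auto simp: bracket_mult_left ideal_pD)
    show "subspace ?T"
      by (rule subspaceI) (auto simp: z bracket_add_left bracket_mult_left ideal_pD)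
  qed
  then show ?thesis using assms by blast
qed

text \<open>By the Leibniz rule it is enough to test the generators.\<close>

lemma ideal_p_invariant:
  fixes K :: "'n::finite germ"
  assumes K: "\<And>i. bracket K (pvar i) \<in> ideal_p" and F: "F \<in> ideal_p"
  shows "bracket K F \<in> ideal_p"
proof -
  interpret module "(*) :: 'n germ \<Rightarrow> 'n germ \<Rightarrow> 'n germ" by (rule module_germ)
  let ?T = "{x :: 'n germ. x \<in> ideal_p \<and> bracket K x \<in> ideal_p}"
  have z: "bracket K 0 = 0" using bracket_right(1)[of K 0 0] by simp
  have "ideal_p \<subseteq> ?T"
  proof (subst ideal_p_def, rule span_minimal)
    show "range pvar \<subseteq> ?T" using K by (auto intro: ideal_pD)
    show "subspace ?T"
      by (rule subspaceI) (auto simp: z bracket_right ideal_pD)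
  qed
  then show ?thesis using F by blast
qed

lemma poisson_automorphismD:
  assumes "poisson_automorphism \<phi>"
  shows "bij \<phi>" "\<phi> 1 = 1" "\<phi> (f + g) = \<phi> f + \<phi> g" "\<phi> (f * g) = \<phi> f * \<phi> g" "c \<in> Ct \<Longrightarrow> \<phi> (c * f) = c * \<phi> f"
    "\<phi> (bracket f g) = bracket (\<phi> f) (\<phi> g)"
  using assms unfolding poisson_automorphism_def by blast+

lemma poisson_automorphism_inv:
  assumes "poisson_automorphism \<phi>"
  shows "poisson_automorphism (inv \<phi>)"
proof -
  note p = poisson_automorphismD[OF assms]
  have e: "inv \<phi> y = x" if "\<phi> x = y" for x y using p(1) that by (metis bij_inv_eq_iff)
  have i: "\<phi> (inv \<phi> y) = y" for y using p(1) by (simp add: bij_is_surj surj_f_inv_f)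
  have c: "\<phi> c = c" if "c \<in> Ct" for c using p(5)[OF that, of 1] p(2) by simp
  show ?thesis
    unfolding poisson_automorphism_def
    by (intro conjI allI ballI bij_imp_bij_inv p(1); rule e; simp add: p(2,3,4,6) i c)
qed

text \<open>The ideal is the image of \<open>ideal_p\<close> under the inverse automorphism, which
  carries the bracket with \<open>\<phi> K\<close> back to the bracket with
  \<open>K\<close>.\<close>

lemma invariant_ideal:
  fixes K :: "'n::finite germ"
  assumes \<phi>: "poisson_automorphism \<phi>" and inv: "\<And>f. f \<in> ideal_p \<Longrightarrow> bracket (\<phi> K) f \<in> ideal_p"
  shows "\<exists>J. is_ideal J \<and> (\<exists>\<psi>. poisson_automorphism \<psi> \<and> J = \<psi> ` ideal_p) \<and> (\<forall>f\<in>J. bracket K f \<in> J)"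
proof -
  interpret module "(*) :: 'n germ \<Rightarrow> 'n germ \<Rightarrow> 'n germ" by (rule module_germ)
  define \<psi> where "\<psi> = inv \<phi>"
  have \<psi>: "poisson_automorphism \<psi>" unfolding \<psi>_def by (rule poisson_automorphism_inv[OF \<phi>])
  note p = poisson_automorphismD[OF \<psi>]
  have i: "\<psi> (\<phi> y) = y" for y using poisson_automorphismD(1)[OF \<phi>] by (simp add: \<psi>_def bij_is_inj)
  have z: "\<psi> 0 = 0" using p(3)[of 0 0] by simp
  have "subspace (\<psi> ` ideal_p)"
  proof (rule subspaceI)
    show "0 \<in> \<psi> ` ideal_p" using z ideal_pD(1) by (metis imageI)
    fix x y assume "x \<in> \<psi> ` ideal_p" "y \<in> \<psi> ` ideal_p"
    then show "x + y \<in> \<psi> ` ideal_p" using p(3) ideal_pD(2) by (metis (no_types, opaque_lifting) image_iff)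
  next
    fix c x assume "x \<in> \<psi> ` ideal_p"
    then obtain f where f: "f \<in> ideal_p" "x = \<psi> f" by blast
    have "c * x = \<psi> (\<phi> c * f)" by (simp add: p(4) i f(2))
    then show "c * x \<in> \<psi> ` ideal_p" using ideal_pD(3)[OF f(1)] by blast
  qed
  moreover have "bracket K x \<in> \<psi> ` ideal_p" if "x \<in> \<psi> ` ideal_p" for x
  proof -
    obtain f where f: "f \<in> ideal_p" "x = \<psi> f" using \<open>x \<in> \<psi> ` ideal_p\<close> by blast
    have "bracket K x = \<psi> (bracket (\<phi> K) f)" by (simp add: p(6) i f(2))
    then show ?thesis using inv[OF f(1)] by blast
  qed
  ultimately show ?thesis using \<psi> by blast
qed

text \<open>Dividing twice by the \<open>p\<close> coordinates and then by \<open>t\<close> writes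
  \<open>G\<close> as \<open>t\<close> times a quadratic form in \<open>p\<close> with holomorphic
  coefficients. The divisions by \<open>p\<close> preserve vanishing at \<open>t = 0\<close>, which
  makes the last one possible.\<close>

lemma t_square_germ:
  fixes G :: "'n::finite phase \<Rightarrow> complex"
  assumes G: "holo_on G (tdom s \<tau>)" and s: "0 < s" "0 < \<tau>"
    and z: "\<forall>x\<in>tdom s \<tau>. G (pz x) = 0" "\<forall>i. \<forall>x\<in>tdom s \<tau>. dp i G (pz x) = 0"
      "\<forall>x\<in>tdom s \<tau>. snd (snd x) = 0 \<longrightarrow> G x = 0"
  shows "\<exists>x\<in>ideal_square ideal_p. abs_germ G = tvar * x"
proof -
  interpret module "(*) :: 'n germ \<Rightarrow> 'n germ \<Rightarrow> 'n germ" by (rule module_germ)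
  let ?S = "tdom s \<tau> :: 'n phase set"
  obtain g where g: "\<forall>i. holo_on (g i) ?S" "\<forall>x\<in>?S. G x = (\<Sum>i\<in>UNIV. fst (snd x) $ i * g i x)"
    "\<forall>i x. g i (pz x) = dp i G (pz x)" "(\<forall>x\<in>?S. snd (snd x) = 0 \<longrightarrow> G x = 0) \<longrightarrow> (\<forall>i. \<forall>x\<in>?S. snd (snd x) = 0 \<longrightarrow> g i x = 0)"
    using hadamard_p[OF G s(1) z(1)] by (elim exE conjE)
  have gz: "\<forall>x\<in>?S. snd (snd x) = 0 \<longrightarrow> g i x = 0" for i using mp[OF g(4) z(3)] by (rule spec)
  have "\<exists>k. \<forall>j. holo_on (k j) ?S \<and> (\<forall>x\<in>?S. g i x = snd (snd x) * (\<Sum>j\<in>UNIV. fst (snd x) $ j * k j x))" for i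
  proof -
    have gp: "\<forall>x\<in>?S. g i (pz x) = 0"
      using z(2) by (intro ballI) (simp only: g(3)[THEN spec, THEN spec] z(2)[THEN spec, THEN bspec])
    obtain h where h: "\<forall>j. holo_on (h j) ?S" "\<forall>x\<in>?S. g i x = (\<Sum>j\<in>UNIV. fst (snd x) $ j * h j x)"
      "(\<forall>x\<in>?S. snd (snd x) = 0 \<longrightarrow> g i x = 0) \<longrightarrow> (\<forall>j. \<forall>x\<in>?S. snd (snd x) = 0 \<longrightarrow> h j x = 0)"
      using hadamard_p[OF spec[OF g(1)] s(1) gp] by (elim exE conjE)
    have "\<forall>j. \<exists>k. holo_on k ?S \<and> (\<forall>x\<in>?S. h j x = snd (snd x) * k x)"
      by (intro allI hadamard_t spec[OF h(1)] spec[OF mp[OF h(3) gz]])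
    then obtain k where k: "\<forall>j. holo_on (k j) ?S \<and> (\<forall>x\<in>?S. h j x = snd (snd x) * k j x)" by (rule choice[THEN exE])
    show ?thesis
    proof (intro exI[of _ k] allI conjI ballI)
      show "holo_on (k j) ?S" for j using k by blast
      fix x :: "'n phase" assume x: "x \<in> ?S"
      have "h j x = snd (snd x) * k j x" for j using k x by blast
      then show "g i x = snd (snd x) * (\<Sum>j\<in>UNIV. fst (snd x) $ j * k j x)"
        using bspec[OF h(2) x] by (simp add: sum_distrib_left mult_ac)
    qed
  qed
  then have "\<forall>i. \<exists>k. \<forall>j. holo_on (k j) ?S \<and> (\<forall>x\<in>?S. g i x = snd (snd x) * (\<Sum>j\<in>UNIV. fst (snd x) $ j * k j x))" by (rule allI)
  then obtain k where kk: "\<forall>i j. holo_on (k i j) ?S \<and> (\<forall>x\<in>?S. g i x = snd (snd x) * (\<Sum>j\<in>UNIV. fst (snd x) $ j * k i j x))"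
    by (rule choice[THEN exE])
  have k: "holo_on (k i j) ?S" for i j using kk by blast
  have k2: "g i x = snd (snd x) * (\<Sum>j\<in>UNIV. fst (snd x) $ j * k i j x)" if "x \<in> ?S" for i x using kk that by blast
  define u where "u = min s \<tau>"
  have u: "0 < u" "tdom u u \<subseteq> ?S" using s tdom_mono[of u s u \<tau>] by (auto simp: u_def)
  have kg: "germ_eq (k i j) (k i j)" for i j by (rule germ_eqI[OF holo_on_subset[OF k u(2)] u(1)])
  have Gg: "germ_eq G G" by (rule germ_eqI[OF holo_on_subset[OF G u(2)] u(1)])
  let ?q = "\<lambda>x :: 'n phase. \<Sum>i\<in>UNIV. \<Sum>j\<in>UNIV. k i j x * (fst (snd x) $ i * fst (snd x) $ j)"
  have e: "G x = snd (snd x) * ?q x" if "x \<in> tdom u u" for x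
    using bspec[OF g(2) subsetD[OF u(2) that]] k2[OF subsetD[OF u(2) that]] by (simp add: sum_distrib_left mult_ac)
  have "abs_germ G = abs_germ (\<lambda>x. snd (snd x) * ?q x)" by (rule abs_germ_eqI[OF Gg u(1) e])
  also have "\<dots> = tvar * (\<Sum>i\<in>UNIV. \<Sum>j\<in>UNIV. abs_germ (k i j) * (pvar i * pvar j))"
    unfolding coord_germs
    by (simp only: abs_germ_simps abs_germ_sum germ_eq_closed germ_eq_sum germ_eq_coords kg)
  finally have "abs_germ G = tvar * (\<Sum>i\<in>UNIV. \<Sum>j\<in>UNIV. abs_germ (k i j) * (pvar i * pvar j))" .
  moreover have pp: "pvar i * pvar j \<in> ideal_square ideal_p" for i j :: 'n
    unfolding ideal_square_def using ideal_pD(5)[of i] ideal_pD(5)[of j] by (intro span_base) blast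
  have "(\<Sum>i\<in>UNIV. \<Sum>j\<in>UNIV. abs_germ (k i j) * (pvar i * pvar j)) \<in> ideal_square ideal_p"
    unfolding ideal_square_def
    by (rule span_sum, rule span_sum, rule span_scale, rule pp[unfolded ideal_square_def])
  ultimately show ?thesis by blast
qed

lemma hamiltonian_representative:
  fixes H :: "'n::finite germ" and a :: "complex ^ 'n ^ 'n"
  assumes H: "H - ((\<Sum>i\<in>UNIV. const_germ (\<omega> $ i) * pvar i) +
      (\<Sum>i\<in>UNIV. \<Sum>j\<in>UNIV. const_germ (a $ i $ j) * pvar i * pvar j)) \<in> p_series_ge 3"
    and sym: "transpose a = a"
  obtains h s where "0 < s" "s < 1" "H = abs_germ (\<lambda>x. h (fst (snd x)))"
    "normal_ham \<omega> (\<chi> i j. 2 * a $ i $ j) (\<lambda>x. h (fst (snd x))) (tdom s s)"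
proof -
  obtain h c u where h: "represents (\<lambda>(q :: complex ^ 'n, p :: complex ^ 'n, t). h p) (H - abs_germ (quad_ham \<omega> a))" and u: "0 < u"
    and c: "\<forall>p. (\<forall>i. cmod (p $ i) < u) \<longrightarrow>
       ((\<lambda>J :: 'n \<Rightarrow> nat. c J * (\<Prod>i\<in>UNIV. (p $ i) ^ J i)) has_sum h p) {J. 3 \<le> (\<Sum>i\<in>UNIV. J i)}"
    using H unfolding p_series_ge_def quad_ham_germ(2)[symmetric] by blast
  let ?f = "\<lambda>x :: 'n phase. h (fst (snd x))"
  have f: "germ_eq ?f ?f" "H - abs_germ (quad_ham \<omega> a) = abs_germ ?f"
    using h by (simp_all add: represents_def case_prod_beta')
  obtain M where M: "0 \<le> M" and b: "\<forall>p \<theta>. 0 \<le> \<theta> \<longrightarrow> \<theta> \<le> 1 \<longrightarrow> (\<forall>i. cmod (p $ i) \<le> \<theta> * (u / 2)) \<longrightarrow> cmod (h p) \<le> \<theta> ^ 3 * M"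
    using series_cubic_bound[OF u c] by blast
  obtain s where s: "0 < s" "s < 1" "holo_on ?f (tdom s s)" using germ_eq_tdom[OF f(1)] by blast
  \<comment> \<open>The series bound holds up to u/2, holomorphy up to \<open>s\<close>.\<close>
  define r where "r = min s (u / 2)"
  have r: "0 < r" "r \<le> s" "r \<le> u / 2" using s u by (auto simp: r_def)
  have b': "cmod (h p) \<le> \<theta> ^ 3 * M" if "0 \<le> \<theta>" "\<theta> \<le> 1" "\<And>i. cmod (p $ i) \<le> \<theta> * r" for p \<theta>
    by (rule b[rule_format, OF that(1,2) order_trans[OF that(3) mult_left_mono[OF r(3) that(1)]]])
  \<comment> \<open>\<open>quad_ham\<close> reads only the momenta, so the zeros for
    \<open>q\<close> and \<open>t\<close> are placeholders.\<close>
  define h0 where "h0 p = quad_ham \<omega> a (0, p, 0) + h p" for p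
  have e: "(\<lambda>x :: 'n phase. h0 (fst (snd x))) = (\<lambda>x. quad_ham \<omega> a x + ?f x)"
    by (simp add: h0_def quad_ham_def fun_eq_iff)
  show thesis
  proof (rule that[of s h0, OF s(1,2)])
    show "H = abs_germ (\<lambda>x. h0 (fst (snd x)))"
      unfolding e abs_germ_simps(1)[OF quad_ham_germ(1) f(1)] f(2)[symmetric] by simp
    show "normal_ham \<omega> (\<chi> i j. 2 * a $ i $ j) (\<lambda>x. h0 (fst (snd x))) (tdom s s)"
      unfolding e by (rule normal_ham_quad_plus_cubic[OF sym s(3) r(1,2) M]) (rule b')
  qed
qed

section \<open>From the analytic conjugacy of functions to the statement about germs\<close>

lemma kolmogorov_analytic_ex:
  fixes \<omega> :: "complex ^ 'n::finite" and A :: "complex ^ 'n ^ 'n"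
  assumes D: "kolmogorov_diophantine \<omega>" and A: "invertible A"
    and s0: "0 < s0" "s0 < 1" and h0: "normal_ham \<omega> A h0 (tdom s0 s0)" and r: "holo_on r (tdom s0 s0)"
    and B: "\<forall>x\<in>tdom s0 s0. cmod (h0 x) \<le> B1 \<and> cmod (r x) \<le> B1"
    and P: "\<And>x. P x = h0 x + snd (snd x) * r x"
  shows "\<exists>\<tau> \<rho> \<Theta>. 0 < \<tau> \<and> \<tau> \<le> s0 \<and> 0 < \<rho> \<and> \<rho> < s0 \<and> symp \<Theta> (tdom \<rho> \<tau>) \<and>
    (\<forall>x\<in>tdom \<rho> \<tau>. \<Theta> x \<in> tdom s0 \<tau> \<and> (snd (snd x) = 0 \<longrightarrow> \<Theta> x = x) \<and>
      P (\<Theta> (pz x)) = P (\<Theta> (bp x)) \<and> (\<forall>i. dp i (\<lambda>x. P (\<Theta> x)) (pz x) = \<omega> $ i))"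
  unfolding P
proof (rule kolmogorov_analytic[OF D A s0 h0 r])
  show "cmod (h0 x) \<le> B1 \<and> cmod (r x) \<le> B1" if "x \<in> tdom s0 s0" for x by (rule bspec[OF B that])
qed (intro exI conjI ballI allI impI, assumption+; blast)

theorem theorem16p4:
  fixes H :: "'n::finite germ" and \<omega> :: "complex ^ 'n" and a :: "complex ^ 'n ^ 'n"
    and R :: "'n germ"
  assumes H: "H - ((\<Sum>i\<in>UNIV. const_germ (\<omega> $ i) * pvar i) +
      (\<Sum>i\<in>UNIV. \<Sum>j\<in>UNIV. const_germ (a $ i $ j) * pvar i * pvar j)) \<in> p_series_ge 3"
    and sym: "transpose a = a"
    and D: "kolmogorov_diophantine \<omega>"
    and K: "invertible a"
  shows "(\<exists>\<phi>. poisson_automorphism \<phi> \<and> \<phi> (H + tvar * R) - H \<in> t_square_plus_Ct) \<and>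
    (\<exists>J. is_ideal J \<and> (\<exists>\<psi>. poisson_automorphism \<psi> \<and> J = \<psi> ` ideal_p) \<and>
      (\<forall>f\<in>J. bracket (H + tvar * R) f \<in> J))"
proof -
  obtain h sh where sh: "0 < sh" "sh < 1" and Hh: "H = abs_germ (\<lambda>x. h (fst (snd x)))"
    and nh: "normal_ham \<omega> (\<chi> i j. 2 * a $ i $ j) (\<lambda>x. h (fst (snd x))) (tdom sh sh)"
    using hamiltonian_representative[OF H sym] by blast
  let ?h = "\<lambda>x :: 'n phase. h (fst (snd x))"
  obtain r where r: "germ_eq r r" "R = abs_germ r" by (rule germ_cases)
  obtain sr where sr: "0 < sr" "holo_on r (tdom sr sr)" using germ_eq_tdom[OF r(1)] by blast
  have hh: "holo_on ?h (tdom sh sh)" using nh unfolding normal_ham_def by blast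
  have hg: "germ_eq ?h ?h" by (rule germ_eqI[OF hh sh(1)])
  \<comment> \<open>Staying strictly inside both domains makes the Hamiltonian and \<open>r\<close>
    bounded.\<close>
  define s0 where "s0 = min sh sr / 2"
  have s0: "0 < s0" "s0 < 1" "s0 < sh" "s0 < sr" using sh sr by (auto simp: s0_def)
  let ?S = "tdom s0 s0 :: 'n phase set"
  have Sh: "?S \<subseteq> tdom sh sh" and Sr: "?S \<subseteq> tdom sr sr"
    using tdom_mono[of s0 sh s0 sh] tdom_mono[of s0 sr s0 sr] s0 by auto
  have nh0: "normal_ham \<omega> (\<chi> i j. 2 * a $ i $ j) ?h ?S"
    using nh Sh holo_on_subset[OF hh Sh] unfolding normal_ham_def by blast
  have r0: "holo_on r ?S" by (rule holo_on_subset[OF sr(2) Sr])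
  obtain Bh where Bh: "\<And>x. x \<in> ?S \<Longrightarrow> cmod (?h x) \<le> Bh" using holo_on_tdom_bounded[OF hh s0(3)] by blast
  obtain Br where Br: "\<And>x. x \<in> ?S \<Longrightarrow> cmod (r x) \<le> Br" using holo_on_tdom_bounded[OF sr(2) s0(4)] by blast
  have B': "\<forall>x\<in>?S. cmod (?h x) \<le> max Bh Br \<and> cmod (r x) \<le> max Bh Br"
    using Bh Br by (intro ballI conjI max.coboundedI1 max.coboundedI2)
  define P where "P x = ?h x + snd (snd x) * r x" for x
  have Pe: "P x = ?h x + snd (snd x) * r x" for x by (simp add: P_def)
  obtain \<tau> \<rho> \<Theta> where \<tau>: "0 < \<tau>" "\<tau> \<le> s0" and \<rho>: "0 < \<rho>" "\<rho> < s0" and sy: "symp \<Theta> (tdom \<rho> \<tau>)"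
    and K\<Theta>: "\<forall>x\<in>tdom \<rho> \<tau>. \<Theta> x \<in> tdom s0 \<tau> \<and> (snd (snd x) = 0 \<longrightarrow> \<Theta> x = x) \<and>
      P (\<Theta> (pz x)) = P (\<Theta> (bp x)) \<and> (\<forall>i. dp i (\<lambda>x. P (\<Theta> x)) (pz x) = \<omega> $ i)"
    using kolmogorov_analytic_ex[OF D invertible_double[OF K] s0(1,2) nh0 r0 B' Pe] by (elim exE conjE)
  have dom: "\<Theta> x \<in> tdom s0 \<tau>" and t0: "snd (snd x) = 0 \<Longrightarrow> \<Theta> x = x" and c1: "P (\<Theta> (pz x)) = P (\<Theta> (bp x))"
    and c2: "dp i (\<lambda>x. P (\<Theta> x)) (pz x) = \<omega> $ i" if "x \<in> tdom \<rho> \<tau>" for x i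
    using bspec[OF K\<Theta> that] by blast+
  let ?T = "tdom \<rho> \<tau> :: 'n phase set"
  note hm = sympD(1)[OF sy]
  \<comment> \<open>The \<open>q\<close> and \<open>p\<close> components of \<Theta> minus the
    identity are bounded by 4, and the Schwarz estimate gives 2 * 4/\<tau>.\<close>
  define C where "C = 8 / \<tau>"
  have small: "small (C * cmod (snd (snd x))) (\<Theta> x - x)" if x: "x \<in> ?T" for x
    unfolding small_def
  proof (intro conjI allI)
    fix i
    have bq: "cmod (fst (\<Theta> y) $ i - fst y $ i) \<le> 4" and bp: "cmod (fst (snd (\<Theta> y)) $ i - fst (snd y) $ i) \<le> 4" if y: "y \<in> ?T" for y
    proof -
      have "cmod (fst (\<Theta> y) $ i) \<le> 2" "cmod (fst (snd (\<Theta> y)) $ i) \<le> 2" "cmod (fst y $ i) \<le> 2" "cmod (fst (snd y) $ i) \<le> 2"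
        using dom[OF y] y \<rho> s0(2) unfolding tdom_def mem_Collect_eq by (smt (verit))+
      then show "cmod (fst (\<Theta> y) $ i - fst y $ i) \<le> 4" "cmod (fst (snd (\<Theta> y)) $ i - fst (snd y) $ i) \<le> 4"
        by (intro norm_triangle_le_diff; simp)+
    qed
    have "cmod (fst (\<Theta> x) $ i - fst x $ i) \<le> 2 * 4 / \<tau> * cmod (snd (snd x))"
      by (rule schwarz_t[OF holo_on_diff[OF hmapD(1)[OF hm] holo_on_coords(1)] bq _ _ \<tau>(1) x]) (simp_all add: t0)
    then show "cmod (fst (\<Theta> x - x) $ i) \<le> C * cmod (snd (snd x))" by (simp add: C_def)
    have "cmod (fst (snd (\<Theta> x)) $ i - fst (snd x) $ i) \<le> 2 * 4 / \<tau> * cmod (snd (snd x))"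
      by (rule schwarz_t[OF holo_on_diff[OF hmapD(2)[OF hm] holo_on_coords(2)] bp _ _ \<tau>(1) x]) (simp_all add: t0)
    then show "cmod (fst (snd (\<Theta> x - x)) $ i) \<le> C * cmod (snd (snd x))" by (simp add: C_def)
  next
    show "snd (snd (\<Theta> x - x)) = 0" using sympD(2)[OF sy x] by simp
  qed
  define u where "u = min \<rho> \<tau>"
  have u: "0 < u" "u \<le> \<rho>" "u \<le> \<tau>" using \<rho> \<tau> by (auto simp: u_def)
  have uT: "tdom u u \<subseteq> ?T" using tdom_mono[OF u(2,3)] by blast
  have N: "near_id \<Theta> C u"
    unfolding near_id_def using u(1) \<tau>(1) hmap_subset[OF hm uT] small uT by (auto simp: C_def)
  define \<phi> where "\<phi> = pull \<Theta>"
  have \<phi>: "poisson_automorphism \<phi>"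
    unfolding \<phi>_def by (rule pull_poisson_automorphism[OF N u(1) symp_subset[OF sy uT]])
  have Pg: "germ_eq P P" unfolding P_def[abs_def] by (intro germ_eq_closed germ_eq_coords hg r(1))
  have HR: "H + tvar * R = abs_germ P"
    unfolding P_def[abs_def] Hh r(2) coord_germs by (simp only: abs_germ_simps germ_eq_closed germ_eq_coords hg r(1))
  have PS: "holo_on P ?S" unfolding P_def[abs_def] by (intro holo_on_add holo_on_mult holo_on_coords r0 holo_on_subset[OF hh Sh])
  have dS: "\<Theta> x \<in> ?S" if "x \<in> ?T" for x by (rule tdom_mono[OF _ \<tau>(2) dom[OF that]]) simp
  have TS: "?T \<subseteq> ?S" using tdom_mono[of \<rho> s0 \<tau> s0] \<rho> \<tau> by auto
  define F where "F x = P (\<Theta> x) - ?h x" for x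
  have PT: "holo_on (\<lambda>x. P (\<Theta> x)) ?T" by (rule holo_on_compose[OF PS hm dS])
  have hT: "holo_on ?h ?T" by (rule holo_on_subset[OF hh subset_trans[OF TS Sh]])
  have FT: "holo_on F ?T" unfolding F_def[abs_def] by (rule holo_on_diff[OF PT hT])
  have bT: "bp x \<in> ?T" if "x \<in> ?T" for x by (rule bp_tdom[OF that \<rho>(1)])
  have pT: "pz x \<in> ?T" if "x \<in> ?T" for x by (rule pz_tdom[OF that \<rho>(1)])
  have Fb: "holo_on (\<lambda>x. F (bp x)) ?T" by (rule holo_on_compose[OF FT hmap_bp bT])
  \<comment> \<open>Subtracting the value at the base point splits off a function of
    \<open>t\<close>; the remainder vanishes to second order at \<open>p = 0\<close> and also
    vanishes at \<open>t = 0\<close>.\<close>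
  define G where "G x = F x - F (bp x)" for x
  have GT: "holo_on G ?T" unfolding G_def[abs_def] by (rule holo_on_diff[OF FT Fb])
  have "\<exists>y\<in>ideal_square ideal_p. abs_germ G = tvar * y"
  proof (rule t_square_germ[OF GT \<rho>(1) \<tau>(1)]; intro allI ballI impI)
    fix x :: "'n phase" and i assume x: "x \<in> ?T"
    have "?h (pz x) = ?h (bp x)" by simp
    then show "G (pz x) = 0" using c1[OF x] by (simp add: G_def F_def)
    have "dp i G (pz x) = dp i F (pz x) - dp i (\<lambda>x. F (bp x)) (pz x)"
      unfolding G_def[abs_def] by (rule fder_diff[OF FT Fb pT[OF x]])
    also have "dp i (\<lambda>x. F (bp x)) (pz x) = 0" by (rule tonly_fder[OF Fb pT[OF x] tonly_bp]) simp
    also have "dp i F (pz x) = dp i (\<lambda>x. P (\<Theta> x)) (pz x) - dp i ?h (pz x)"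
      unfolding F_def[abs_def] by (rule fder_diff[OF PT hT pT[OF x]])
    also have "dp i ?h (pz x) = \<omega> $ i" using nh0 subsetD[OF TS x] unfolding normal_ham_def by blast
    finally show "dp i G (pz x) = 0" using c2[OF x] by simp
  next
    fix x :: "'n phase" assume x: "x \<in> ?T" "snd (snd x) = 0"
    have "F y = 0" if "y \<in> ?T" "snd (snd y) = 0" for y using t0[OF that] that(2) by (simp add: F_def P_def)
    from this[OF x] this[OF bT[OF x(1)]] show "G x = 0" using x(2) by (simp add: G_def)
  qed
  then obtain y where y: "y \<in> ideal_square ideal_p" "abs_germ G = tvar * y" by blast
  have gT: "germ_eq f f" if "holo_on f ?T" for f by (rule germ_eqI[OF holo_on_subset[OF that uT] u(1)])
  define c where "c = abs_germ (\<lambda>x :: 'n phase. F (bp x))"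
  have cC: "c \<in> Ct"
  proof -
    have "(\<lambda>(q :: complex ^ 'n, p :: complex ^ 'n, t). F (\<chi> i. 1, 0, t)) = (\<lambda>x. F (bp x))"
      by (simp add: bp_def case_prod_beta')
    then have "represents (\<lambda>(q :: complex ^ 'n, p :: complex ^ 'n, t). F (\<chi> i. 1, 0, t)) c"
      using gT[OF Fb] by (simp only: represents_def c_def)
    then show ?thesis unfolding Ct_def by (intro CollectI exI[of _ "\<lambda>t. F (\<chi> i. 1, 0, t)"])
  qed
  have "abs_germ G = abs_germ F - c"
    unfolding c_def G_def[abs_def] by (rule abs_germ_simps(2)[OF gT[OF FT] gT[OF Fb]])
  moreover have "abs_germ F = \<phi> (H + tvar * R) - H"
    unfolding F_def[abs_def] abs_germ_simps(2)[OF gT[OF PT] hg] Hh[symmetric] HR \<phi>_def pull_abs[OF N Pg] ..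
  ultimately have e: "\<phi> (H + tvar * R) - H = tvar * y + c" using y(2) by (simp add: algebra_simps)
  have tC: "(tvar :: 'n germ) \<in> Ct"
  proof -
    have "represents (\<lambda>(q :: complex ^ 'n, p :: complex ^ 'n, t). t) tvar"
      using germ_eq_coords(3) by (simp add: represents_def coord_germs case_prod_beta')
    then show ?thesis unfolding Ct_def by (intro CollectI exI[of _ "\<lambda>t. t"])
  qed
  \<comment> \<open>\<open>H\<close> depends on \<open>p\<close> only and \<open>c\<close> on
    \<open>t\<close> only, so both commute with \<open>pvar i\<close>; what remains is
    \<open>t\<close> times the bracket of an element of the squared ideal.\<close>
  have inv: "bracket (\<phi> (H + tvar * R)) f \<in> ideal_p" if "f \<in> ideal_p" for f
  proof (rule ideal_p_invariant[OF _ that])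
    fix i
    have "\<phi> (H + tvar * R) = H + (tvar * y + c)" using e by (simp add: algebra_simps)
    then have "bracket (\<phi> (H + tvar * R)) (pvar i) = tvar * bracket y (pvar i)"
      by (simp add: bracket_add_left bracket_mult_left bracket_Ct[OF cC] bracket_Ct[OF tC] Hh bracket_action_pvar[OF hg])
    then show "bracket (\<phi> (H + tvar * R)) (pvar i) \<in> ideal_p"
      by (simp only: ideal_pD(3)[OF conjunct2[OF ideal_square_bracket[OF y(1)]]])
  qed
  have "\<phi> (H + tvar * R) - H \<in> t_square_plus_Ct"
    unfolding e t_square_plus_Ct_def using y(1) cC by blast
  with \<phi> invariant_ideal[OF \<phi> inv] show ?thesis by blast
qed

end
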